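(* Let $S,D,T,M,N,P,Q$ be the finite categories, and $G\colon T\to S$, $H_M\colon M\to D$, $H_N\colon N\to D$, $H\colon P\to Q$ the functors, defined in the context, so that $H$ is the pushout in the arrow category $\mathsf{Cat}^{\rightarrow}$ of the span $H_M\longleftarrow G\longrightarrow H_N$ given by the inclusions $T\hookrightarrow M$, $T\hookrightarrow N$ and $S\hookrightarrow D$ (twice). Let $B=|N(\_)|\colon\mathsf{Cat}\to\mathsf{Top}$ be the classifying space functor. Then applying $B$ to the commutative diagram formed by $G,H_M,H_N,H$ gives a pushout diagram in the arrow category $\mathsf{Top}^{\rightarrow}$, that is, $BH$ is the pushout of $BH_M\longleftarrow BG\longrightarrow BH_N$. Up to homeomorphism the spaces in this diagram are $$BT\cong T^2,\quad BM\cong S^1\times D^2,\quad BN\cong S^1\times D^2,\quad BP\cong S^3,\quad BS\cong S^1,\quad BD\cong D^2,\quad BQ\cong S^2,$$ and hence $BH\colon BP\to BQ$ is, under suitable homeomorphisms $BP\cong S^3$ and $BQ\cong S^2$, the Hopf map $h\colon S^3\to S^2$.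
   Context: Composition is written right to left: $gf$ means first $f$, then $g$. $\mathsf{Cat}$ is the category of small categories, $\mathsf{Top}$ the category of topological spaces; for a category $\mathcal C$, the arrow category $\mathcal C^{\rightarrow}$ has the arrows of $\mathcal C$ as objects and commutative squares as morphisms. The classifying space of a small category $C$ is $BC=|NC|$, the geometric realization of its nerve (the simplicial set whose $n$-simplices are the strings of $n$ composable arrows of $C$). Hopf map: $S^3=\{(z_0,z_1)\in\mathbb C^2: z_0\overline{z_0}+z_1\overline{z_1}=1\}$, with $w\in U(1)$ acting by $(z_0,z_1)\mapsto(wz_0,wz_1)$; the quotient is homeomorphic to $S^2$, and $h\colon S^3\to S^2$ is the quotient map. $T^2$ is the 2-torus, $D^2$ the closed 2-disk. Category $S$: objects $A,B$; it is freely generated by two parallel arrows $f,g\colon A\to B$. Category $D$: objects $A,B,X$; generated by $f,g\colon A\to B$ and $t\colon B\to X$ with the relation $tf=tg$. $S$ is a full subcategory of $D$. Category $T$: objects $A_0,A_1,B_0,B_1,B_2,B_3$; generated by arrows $f_0,g_0\colon A_0\to B_0$; $f_2,g_2\colon A_0\to B_2$; $p_A,q_A\colon A_0\to A_1$; $p_{B_1}\colon B_0\to B_1$; $q_{B_3}\colon B_0\to B_3$; $f_3\colon A_1\to B_3$; $g_1\colon A_1\to B_1$; $q_{B_1}\colon B_2\to B_1$; $p_{B_3}\colon B_2\to B_3$, with the relations $p_{B_1}f_0=q_{B_1}f_2$, $\;p_{B_1}g_0=g_1p_A$, $\;f_3p_A=p_{B_3}f_2$, $\;f_3q_A=q_{B_3}f_0$,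 $\;g_1q_A=q_{B_1}g_2$, $\;q_{B_3}g_0=p_{B_3}g_2$. Functors $F_M,F_N,G\colon T\to S$: - $F_M$: $A_0,B_0\mapsto A$; $A_1,B_1,B_2,B_3\mapsto B$; $f_0,g_0\mapsto \mathrm{id}_A$; $f_3,p_{B_3},q_{B_1},g_1\mapsto\mathrm{id}_B$; $q_A,q_{B_3},g_2\mapsto f$; $p_A,p_{B_1},f_2\mapsto g$. - $F_N$: $A_0,A_1\mapsto A$; $B_0,B_1,B_2,B_3\mapsto B$; all the generators $p_A,q_A,p_{B_1},p_{B_3},q_{B_1},q_{B_3}$ go to identities; $f_0,f_2,f_3\mapsto f$; $g_0,g_1,g_2\mapsto g$. - $G$: $A_0,B_2\mapsto A$; $A_1,B_0,B_1,B_3\mapsto B$; $f_2,g_2\mapsto\mathrm{id}_A$; $f_3,q_{B_3},p_{B_1},g_1\mapsto\mathrm{id}_B$; $q_A,f_0,q_{B_1}\mapsto f$; $p_A,p_{B_3},g_0\mapsto g$. Mapping cylinder: for a functor $F\colon A\to B$ of small categories, $M_F$ is the strict lax pushout: there are functors $i_A\colon A\to M_F$, $i_B\colon B\to M_F$ and a natural transformation $a\colon i_A\Rightarrow i_BF$, universal in the sense that for any functors $H\colon A\to X$, $K\colon B\to X$ and natural transformation $r\colon H\Rightarrow KF$ there is a unique functor $U\colon M_F\to X$ with $Ui_A=H$, $Ui_B=K$, $Ua=r$. Concretely, the objects of $M_F$ are those of $A$ and those of $B$, and its arrows are those of $A$, those of $B$, and those of the form $g\,a_x f$ with $f$ an arrow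 of $A$ with target $x$, $a_x\colon x\to Fx$, and $g$ an arrow of $B$ with source $Fx$, subject to $a_yf=F(f)a_x$ for $f\colon x\to y$ in $A$. $M=M_{F_M}$ and $N=M_{F_N}$; the objects $A,B$ of the copy of $S$ are called $Z_0,Z_1$ in $M$ and $Y_0,Y_1$ in $N$. (The category $N$ is not to be confused with the nerve functor $N(\_)$.) $T$ is included in both via $i_T$. $H_M\colon M\to D$ and $H_N\colon N\to D$ are the unique functors whose restriction to $T$ is the composite $T\xrightarrow{G}S\hookrightarrow D$; they send $Z_0,Z_1$ (respectively $Y_0,Y_1$) to $X$, the arrows of the copy of $S$ to $\mathrm{id}_X$, and each $a_x$ to the unique arrow $Gx\to X$ of $D$. $P$ is the pushout $M\cup_T N$ in $\mathsf{Cat}$ (10 objects), $Q$ is the pushout $D\cup_S D$ in $\mathsf{Cat}$ (4 objects $A,B,Y,Z$, where $Y$ and $Z$ are the two copies of $X$), and $H\colon P\to Q$ is the functor induced by $H_M$, $H_N$ and $G$. *)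

theory Defs
  imports "HOL-Analysis.Analysis" "HOL-Homology.Simplices"
begin

section \<open>Small categories and functors\<close>

record ('o, 'a) category =
  Obj :: "'o set"
  Arr :: "'a set"
  Src :: "'a \<Rightarrow> 'o"
  Tgt :: "'a \<Rightarrow> 'o"
  Ident :: "'o \<Rightarrow> 'a"
  Comp :: "'a \<Rightarrow> 'a \<Rightarrow> 'a"

text \<open>Composition is written right to left: \<open>Comp C g f\<close> is first \<open>f\<close>, then \<open>g\<close>.\<close>

locale small_category =
  fixes C :: "('o, 'a) category"
  assumes Src_in: "f \<in> Arr C \<Longrightarrow> Src C f \<in> Obj C"
    and Tgt_in: "f \<in> Arr C \<Longrightarrow> Tgt C f \<in> Obj C"
    and Ident_in: "x \<in> Obj C \<Longrightarrow> Ident C x \<in> Arr C"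
    and Src_Ident: "x \<in> Obj C \<Longrightarrow> Src C (Ident C x) = x"
    and Tgt_Ident: "x \<in> Obj C \<Longrightarrow> Tgt C (Ident C x) = x"
    and Comp_in: "\<lbrakk>f \<in> Arr C; g \<in> Arr C; Tgt C f = Src C g\<rbrakk> \<Longrightarrow> Comp C g f \<in> Arr C"
    and Src_Comp: "\<lbrakk>f \<in> Arr C; g \<in> Arr C; Tgt C f = Src C g\<rbrakk> \<Longrightarrow> Src C (Comp C g f) = Src C f"
    and Tgt_Comp: "\<lbrakk>f \<in> Arr C; g \<in> Arr C; Tgt C f = Src C g\<rbrakk> \<Longrightarrow> Tgt C (Comp C g f) = Tgt C g"
    and Comp_Ident: "f \<in> Arr C \<Longrightarrow> Comp C f (Ident C (Src C f)) = f"
    and Ident_Comp: "f \<in> Arr C \<Longrightarrow> Comp C (Ident C (Tgt C f)) f = f"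
    and Comp_assoc: "\<lbrakk>f \<in> Arr C; g \<in> Arr C; h \<in> Arr C; Tgt C f = Src C g; Tgt C g = Src C h\<rbrakk>
          \<Longrightarrow> Comp C h (Comp C g f) = Comp C (Comp C h g) f"

record ('o, 'a, 'p, 'b) func =
  onObj :: "'o \<Rightarrow> 'p"
  onArr :: "'a \<Rightarrow> 'b"

locale cat_functor = S: small_category C + T: small_category D
  for C :: "('o, 'a) category" and D :: "('p, 'b) category" +
  fixes F :: "('o, 'a, 'p, 'b) func"
  assumes onObj_in: "x \<in> Obj C \<Longrightarrow> onObj F x \<in> Obj D"
    and onArr_in: "f \<in> Arr C \<Longrightarrow> onArr F f \<in> Arr D"
    and Src_onArr: "f \<in> Arr C \<Longrightarrow> Src D (onArr F f) = onObj F (Src C f)"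
    and Tgt_onArr: "f \<in> Arr C \<Longrightarrow> Tgt D (onArr F f) = onObj F (Tgt C f)"
    and onArr_Ident: "x \<in> Obj C \<Longrightarrow> onArr F (Ident C x) = Ident D (onObj F x)"
    and onArr_Comp: "\<lbrakk>f \<in> Arr C; g \<in> Arr C; Tgt C f = Src C g\<rbrakk>
          \<Longrightarrow> onArr F (Comp C g f) = Comp D (onArr F g) (onArr F f)"

definition func_comp ::
  "('p, 'b, 'q, 'c) func \<Rightarrow> ('o, 'a, 'p, 'b) func \<Rightarrow> ('o, 'a, 'q, 'c) func" (infixl \<open>\<circ>\<^sub>F\<close> 55)
  where "K \<circ>\<^sub>F F = \<lparr>onObj = onObj K \<circ> onObj F, onArr = onArr K \<circ> onArr F\<rparr>"

text \<open>Values of a functor outside the carriers of its source category are irrelevant, so equality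
  of functors means agreement on the carriers.\<close>

definition func_eq ::
  "('o, 'a) category \<Rightarrow> ('o, 'a, 'p, 'b) func \<Rightarrow> ('o, 'a, 'p, 'b) func \<Rightarrow> bool"
  where "func_eq C F F' \<longleftrightarrow>
    (\<forall>x\<in>Obj C. onObj F x = onObj F' x) \<and> (\<forall>f\<in>Arr C. onArr F f = onArr F' f)"

definition const_func :: "('p, 'b) category \<Rightarrow> 'p \<Rightarrow> ('o, 'a, 'p, 'b) func"
  where "const_func D x = \<lparr>onObj = (\<lambda>_. x), onArr = (\<lambda>_. Ident D x)\<rparr>"

definition nat_trans ::
  "('o, 'a) category \<Rightarrow> ('p, 'b) category \<Rightarrow> ('o, 'a, 'p, 'b) func \<Rightarrow> ('o, 'a, 'p, 'b) func
    \<Rightarrow> ('o \<Rightarrow> 'b) \<Rightarrow> bool"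
  where "nat_trans C D F F' r \<longleftrightarrow>
    (\<forall>x\<in>Obj C. r x \<in> Arr D \<and> Src D (r x) = onObj F x \<and> Tgt D (r x) = onObj F' x) \<and>
    (\<forall>f\<in>Arr C. Comp D (r (Tgt C f)) (onArr F f) = Comp D (onArr F' f) (r (Src C f)))"

text \<open>\<open>is_string C x fs\<close>: the list \<open>fs\<close> is a string of composable arrows starting at the object
  \<open>x\<close>, the first arrow of the list being the one that is applied first.\<close>

fun is_string :: "('o, 'a) category \<Rightarrow> 'o \<Rightarrow> 'a list \<Rightarrow> bool" where
  "is_string C x [] \<longleftrightarrow> x \<in> Obj C"
| "is_string C x (f # fs) \<longleftrightarrow> x \<in> Obj C \<and> f \<in> Arr C \<and> Src C f = x \<and> is_string C (Tgt C f) fs"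

fun composite :: "('o, 'a) category \<Rightarrow> 'o \<Rightarrow> 'a list \<Rightarrow> 'a" where
  "composite C x [] = Ident C x"
| "composite C x (f # fs) = Comp C (composite C (Tgt C f) fs) f"


section \<open>Categories given by generators and relations\<close>

text \<open>A relation \<open>(x, p, q)\<close> identifies the two parallel paths \<open>p\<close> and \<open>q\<close> starting at \<open>x\<close>.
  Paths are listed in the order of application, so the relation \<open>b a = d c\<close> is
  \<open>(x, [a, b], [c, d])\<close>.\<close>

record ('o, 'g) presentation =
  Vert :: "'o set"
  Gen :: "'g set"
  Gsrc :: "'g \<Rightarrow> 'o"
  Gtgt :: "'g \<Rightarrow> 'o"
  Rel :: "('o \<times> 'g list \<times> 'g list) set"

fun is_path :: "('o, 'g) presentation \<Rightarrow> 'o \<Rightarrow> 'g list \<Rightarrow> bool" where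
  "is_path R x [] \<longleftrightarrow> x \<in> Vert R"
| "is_path R x (g # p) \<longleftrightarrow> x \<in> Vert R \<and> g \<in> Gen R \<and> Gsrc R g = x \<and> is_path R (Gtgt R g) p"

fun path_tgt :: "('o, 'g) presentation \<Rightarrow> 'o \<Rightarrow> 'g list \<Rightarrow> 'o" where
  "path_tgt R x [] = x"
| "path_tgt R x (g # p) = path_tgt R (Gtgt R g) p"

inductive path_cong :: "('o, 'g) presentation \<Rightarrow> 'o \<Rightarrow> 'g list \<Rightarrow> 'g list \<Rightarrow> bool"
  for R where
  cong_base: "\<lbrakk>(x, p, q) \<in> Rel R; is_path R x p; is_path R x q; path_tgt R x p = path_tgt R x q\<rbrakk>
    \<Longrightarrow> path_cong R x p q"
| cong_refl: "is_path R x p \<Longrightarrow> path_cong R x p p"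
| cong_sym: "path_cong R x p q \<Longrightarrow> path_cong R x q p"
| cong_trans: "\<lbrakk>path_cong R x p q; path_cong R x q r\<rbrakk> \<Longrightarrow> path_cong R x p r"
| cong_append: "\<lbrakk>path_cong R x p q; path_cong R (path_tgt R x p) p' q'\<rbrakk>
    \<Longrightarrow> path_cong R x (p @ p') (q @ q')"

type_synonym ('o, 'g) parr = "'o \<times> 'g list set \<times> 'o"

definition path_arr :: "('o, 'g) presentation \<Rightarrow> 'o \<Rightarrow> 'g list \<Rightarrow> ('o, 'g) parr"
  where "path_arr R x p = (x, {q. path_cong R x p q}, path_tgt R x p)"

definition gen_arr :: "('o, 'g) presentation \<Rightarrow> 'g \<Rightarrow> ('o, 'g) parr"
  where "gen_arr R g = path_arr R (Gsrc R g) [g]"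

definition presented :: "('o, 'g) presentation \<Rightarrow> ('o, ('o, 'g) parr) category"
  where "presented R =
    \<lparr>Obj = Vert R,
     Arr = {path_arr R x p | x p. is_path R x p},
     Src = (\<lambda>(x, c, y). x),
     Tgt = (\<lambda>(x, c, y). y),
     Ident = (\<lambda>x. path_arr R x []),
     Comp = (\<lambda>(y, d, z) (x, c, y'). (x, {r. \<exists>p\<in>c. \<exists>q\<in>d. path_cong R x (p @ q) r}, z))\<rparr>"

text \<open>The functor from a presented category to \<open>C\<close> with given values on objects and generators;
  it is meaningful when these values respect sources, targets and relations, since then all
  representatives of a congruence class of paths have the same value.\<close>

definition pres_functor :: "('p, 'b) category \<Rightarrow> ('o \<Rightarrow> 'p) \<Rightarrow> ('g \<Rightarrow> 'b) \<Rightarrow> ('o, ('o, 'g) parr, 'p, 'b) func"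
  where "pres_functor C ob h =
    \<lparr>onObj = ob,
     onArr = (\<lambda>(x, c, y). the_elem ((\<lambda>p. composite C (ob x) (map h p)) ` c))\<rparr>"


section \<open>Mapping cylinders\<close>

text \<open>Because of \<open>a\<^sub>y f = F(f) a\<^sub>x\<close>, every arrow \<open>g a\<^sub>y f\<close> from the copy of \<open>A\<close> to the copy of \<open>B\<close> has
  exactly one representation \<open>g' a\<^sub>x\<close> with \<open>g'\<close> an arrow of \<open>B\<close> with source \<open>F x\<close>; this arrow is
  encoded as \<open>Mixed x g'\<close>.\<close>

datatype ('o, 'a, 'b) cyl_arr = Left_arr 'a | Right_arr 'b | Mixed 'o 'b

fun cyl_src :: "('o, 'a) category \<Rightarrow> ('p, 'b) category \<Rightarrow> ('o, 'a, 'b) cyl_arr \<Rightarrow> 'o + 'p" where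
  "cyl_src A B (Left_arr f) = Inl (Src A f)"
| "cyl_src A B (Right_arr g) = Inr (Src B g)"
| "cyl_src A B (Mixed x g) = Inl x"

fun cyl_tgt :: "('o, 'a) category \<Rightarrow> ('p, 'b) category \<Rightarrow> ('o, 'a, 'b) cyl_arr \<Rightarrow> 'o + 'p" where
  "cyl_tgt A B (Left_arr f) = Inl (Tgt A f)"
| "cyl_tgt A B (Right_arr g) = Inr (Tgt B g)"
| "cyl_tgt A B (Mixed x g) = Inr (Tgt B g)"

fun cyl_comp :: "('o, 'a) category \<Rightarrow> ('p, 'b) category \<Rightarrow> ('o, 'a, 'p, 'b) func
    \<Rightarrow> ('o, 'a, 'b) cyl_arr \<Rightarrow> ('o, 'a, 'b) cyl_arr \<Rightarrow> ('o, 'a, 'b) cyl_arr" where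
  "cyl_comp A B F (Left_arr f') (Left_arr f) = Left_arr (Comp A f' f)"
| "cyl_comp A B F (Right_arr g') (Right_arr g) = Right_arr (Comp B g' g)"
| "cyl_comp A B F (Mixed y g) (Left_arr f) = Mixed (Src A f) (Comp B g (onArr F f))"
| "cyl_comp A B F (Right_arr g') (Mixed x g) = Mixed x (Comp B g' g)"
| "cyl_comp A B F _ _ = undefined"

definition mapping_cylinder :: "('o, 'a) category \<Rightarrow> ('p, 'b) category \<Rightarrow> ('o, 'a, 'p, 'b) func
    \<Rightarrow> ('o + 'p, ('o, 'a, 'b) cyl_arr) category"
  where "mapping_cylinder A B F =
    \<lparr>Obj = Obj A <+> Obj B,
     Arr = Left_arr ` Arr A \<union> Right_arr ` Arr B \<union>
       {Mixed x g | x g. x \<in> Obj A \<and> g \<in> Arr B \<and> Src B g = onObj F x},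
     Src = cyl_src A B,
     Tgt = cyl_tgt A B,
     Ident = case_sum (Left_arr \<circ> Ident A) (Right_arr \<circ> Ident B),
     Comp = cyl_comp A B F\<rparr>"

definition cyl_left :: "('o, 'a, 'o + 'p, ('o, 'a, 'b) cyl_arr) func"
  where "cyl_left = \<lparr>onObj = Inl, onArr = Left_arr\<rparr>"

definition cyl_right :: "('p, 'b, 'o + 'p, ('o, 'a, 'b) cyl_arr) func"
  where "cyl_right = \<lparr>onObj = Inr, onArr = Right_arr\<rparr>"

definition cyl_nat :: "('p, 'b) category \<Rightarrow> ('o, 'a, 'p, 'b) func \<Rightarrow> 'o \<Rightarrow> ('o, 'a, 'b) cyl_arr"
  where "cyl_nat B F x = Mixed x (Ident B (onObj F x))"

definition cyl_induced :: "('q, 'c) category \<Rightarrow> ('o, 'a, 'q, 'c) func \<Rightarrow> ('p, 'b, 'q, 'c) func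
    \<Rightarrow> ('o \<Rightarrow> 'c) \<Rightarrow> ('o + 'p, ('o, 'a, 'b) cyl_arr, 'q, 'c) func"
  where "cyl_induced X H K r =
    \<lparr>onObj = case_sum (onObj H) (onObj K),
     onArr = case_cyl_arr (onArr H) (onArr K) (\<lambda>x g. Comp X (onArr K g) (r x))\<rparr>"


lemma (in small_category) Comp_Ident': "f \<in> Arr C \<Longrightarrow> Src C f = x \<Longrightarrow> Comp C f (Ident C x) = f"
  using Comp_Ident by blast

lemma (in small_category) Ident_Comp': "f \<in> Arr C \<Longrightarrow> Tgt C f = x \<Longrightarrow> Comp C (Ident C x) f = f"
  using Ident_Comp by blast

lemma mapping_cylinder_category:
  assumes "cat_functor A B F"
  shows "small_category (mapping_cylinder A B F)"
proof -
  interpret F: cat_functor A B F by fact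
  show ?thesis
    by unfold_locales
      (auto simp: mapping_cylinder_def F.S.Src_in F.S.Tgt_in F.S.Ident_in F.S.Src_Ident F.S.Tgt_Ident
        F.S.Comp_in F.S.Src_Comp F.S.Tgt_Comp F.S.Comp_Ident F.S.Ident_Comp F.S.Comp_assoc
        F.T.Src_in F.T.Tgt_in F.T.Ident_in F.T.Src_Ident F.T.Tgt_Ident
        F.T.Comp_in F.T.Src_Comp F.T.Tgt_Comp F.T.Comp_Ident F.T.Ident_Comp F.T.Comp_assoc
        F.onObj_in F.onArr_in F.Src_onArr F.Tgt_onArr F.onArr_Ident F.onArr_Comp
        F.T.Comp_Ident')
qed

lemma mapping_cylinder_cocone:
  assumes "cat_functor A B F"
  shows "cat_functor A (mapping_cylinder A B F) cyl_left"
    and "cat_functor B (mapping_cylinder A B F) cyl_right"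
    and "nat_trans A (mapping_cylinder A B F) cyl_left (cyl_right \<circ>\<^sub>F F) (cyl_nat B F)"
proof -
  interpret F: cat_functor A B F by fact
  interpret M: small_category "mapping_cylinder A B F" by (rule mapping_cylinder_category[OF assms])
  show "cat_functor A (mapping_cylinder A B F) cyl_left"
    by unfold_locales (auto simp: mapping_cylinder_def cyl_left_def)
  show "cat_functor B (mapping_cylinder A B F) cyl_right"
    by unfold_locales (auto simp: mapping_cylinder_def cyl_right_def)
  show "nat_trans A (mapping_cylinder A B F) cyl_left (cyl_right \<circ>\<^sub>F F) (cyl_nat B F)"
    by (auto simp: nat_trans_def mapping_cylinder_def cyl_left_def cyl_right_def cyl_nat_def
        func_comp_def F.S.Src_in F.S.Tgt_in F.onObj_in F.onArr_in F.Src_onArr F.Tgt_onArr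
        F.T.Ident_in F.T.Src_Ident F.T.Tgt_Ident F.T.Comp_Ident' F.T.Ident_Comp')
qed

lemma mapping_cylinder_universal:
  assumes F: "cat_functor A B F" and H: "cat_functor A X H" and K: "cat_functor B X K"
    and r: "nat_trans A X H (K \<circ>\<^sub>F F) r"
  shows "cat_functor (mapping_cylinder A B F) X (cyl_induced X H K r)"
    and "cyl_induced X H K r \<circ>\<^sub>F cyl_left = H"
    and "cyl_induced X H K r \<circ>\<^sub>F cyl_right = K"
    and "x \<in> Obj A \<Longrightarrow> onArr (cyl_induced X H K r) (cyl_nat B F x) = r x"
    and "\<lbrakk>cat_functor (mapping_cylinder A B F) X U; func_eq A (U \<circ>\<^sub>F cyl_left) H;
          func_eq B (U \<circ>\<^sub>F cyl_right) K; \<And>x. x \<in> Obj A \<Longrightarrow> onArr U (cyl_nat B F x) = r x\<rbrakk>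
         \<Longrightarrow> func_eq (mapping_cylinder A B F) U (cyl_induced X H K r)"
proof -
  interpret F: cat_functor A B F by fact
  interpret H: cat_functor A X H by fact
  interpret K: cat_functor B X K by fact
  interpret M: small_category "mapping_cylinder A B F" by (rule mapping_cylinder_category[OF F])
  have r1: "r x \<in> Arr X" "Src X (r x) = onObj H x" "Tgt X (r x) = onObj K (onObj F x)"
    if "x \<in> Obj A" for x using r that by (auto simp: nat_trans_def func_comp_def)
  have r2: "Comp X (r (Tgt A f)) (onArr H f) = Comp X (onArr K (onArr F f)) (r (Src A f))"
    if "f \<in> Arr A" for f using r that by (auto simp: nat_trans_def func_comp_def)
  have r3: "Comp X (Comp X (onArr K g) (r (Tgt A f))) (onArr H f)
      = Comp X (Comp X (onArr K g) (onArr K (onArr F f))) (r (Src A f))"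
    if f: "f \<in> Arr A" and g: "g \<in> Arr B" "Src B g = onObj F (Tgt A f)" for f g
  proof -
    have "Comp X (Comp X (onArr K g) (r (Tgt A f))) (onArr H f) =
        Comp X (onArr K g) (Comp X (r (Tgt A f)) (onArr H f))"
      using f g by (simp add: H.T.Comp_assoc H.onArr_in H.Tgt_onArr r1 F.S.Tgt_in K.onArr_in K.Src_onArr)
    also have "\<dots> = Comp X (onArr K g) (Comp X (onArr K (onArr F f)) (r (Src A f)))"
      using f r2 by simp
    also have "\<dots> = Comp X (Comp X (onArr K g) (onArr K (onArr F f))) (r (Src A f))"
      using f g by (simp add: H.T.Comp_assoc r1 F.S.Src_in K.onArr_in K.Src_onArr K.Tgt_onArr
          F.onArr_in F.Src_onArr F.Tgt_onArr)
    finally show ?thesis .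
  qed
  show "cat_functor (mapping_cylinder A B F) X (cyl_induced X H K r)"
  proof unfold_locales
    fix f g
    assume "f \<in> Arr (mapping_cylinder A B F)" "g \<in> Arr (mapping_cylinder A B F)"
      "Tgt (mapping_cylinder A B F) f = Src (mapping_cylinder A B F) g"
    then show "onArr (cyl_induced X H K r) (Comp (mapping_cylinder A B F) g f) =
        Comp X (onArr (cyl_induced X H K r) g) (onArr (cyl_induced X H K r) f)"
      by (auto simp: mapping_cylinder_def cyl_induced_def H.onArr_Comp K.onArr_Comp r3
          F.onArr_in F.Src_onArr F.Tgt_onArr H.T.Comp_assoc K.onArr_in K.Src_onArr K.Tgt_onArr r1)
  qed (auto simp: mapping_cylinder_def cyl_induced_def H.onObj_in K.onObj_in H.onArr_in K.onArr_in
      H.Src_onArr K.Src_onArr H.Tgt_onArr K.Tgt_onArr H.onArr_Ident K.onArr_Ident r1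
      H.T.Comp_in H.T.Src_Comp H.T.Tgt_Comp)
  show "cyl_induced X H K r \<circ>\<^sub>F cyl_left = H" "cyl_induced X H K r \<circ>\<^sub>F cyl_right = K"
    by (simp_all add: cyl_induced_def cyl_left_def cyl_right_def func_comp_def comp_def)
  show "onArr (cyl_induced X H K r) (cyl_nat B F x) = r x" if "x \<in> Obj A" for x
    using that by (simp add: cyl_induced_def cyl_nat_def K.onArr_Ident F.onObj_in H.T.Ident_Comp' r1)
  show "func_eq (mapping_cylinder A B F) U (cyl_induced X H K r)"
    if U: "cat_functor (mapping_cylinder A B F) X U" and UH: "func_eq A (U \<circ>\<^sub>F cyl_left) H"
      and UK: "func_eq B (U \<circ>\<^sub>F cyl_right) K"
      and Ur: "\<And>x. x \<in> Obj A \<Longrightarrow> onArr U (cyl_nat B F x) = r x" for U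
  proof -
    interpret U: cat_functor "mapping_cylinder A B F" X U by fact
    have "onArr U (Mixed x g) = Comp X (onArr K g) (r x)"
      if "x \<in> Obj A" "g \<in> Arr B" "Src B g = onObj F x" for x g
    proof -
      have "Mixed x g = Comp (mapping_cylinder A B F) (Right_arr g) (cyl_nat B F x)"
        using that by (simp add: mapping_cylinder_def cyl_nat_def F.T.Comp_Ident')
      moreover have "cyl_nat B F x \<in> Arr (mapping_cylinder A B F)"
          "Tgt (mapping_cylinder A B F) (cyl_nat B F x) = Inr (Src B g)"
          "Right_arr g \<in> Arr (mapping_cylinder A B F)"
          "Src (mapping_cylinder A B F) (Right_arr g) = Inr (Src B g)"
        using that by (auto simp: mapping_cylinder_def cyl_nat_def F.onObj_in F.T.Ident_in
            F.T.Src_Ident F.T.Tgt_Ident)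
      ultimately have "onArr U (Mixed x g) = Comp X (onArr U (Right_arr g)) (onArr U (cyl_nat B F x))"
        using U.onArr_Comp by simp
      then show ?thesis using that UK Ur by (simp add: func_eq_def func_comp_def cyl_right_def)
    qed
    then show ?thesis
      using UH UK by (auto simp: func_eq_def func_comp_def cyl_left_def cyl_right_def
          mapping_cylinder_def cyl_induced_def)
  qed
qed


section \<open>Pushouts in the category of small categories\<close>

text \<open>The pushout of \<open>F1 : A \<rightarrow> C1\<close> and \<open>F2 : A \<rightarrow> C2\<close>: its objects are the classes of the
  equivalence relation on the disjoint union of the object sets generated by the identifications
  \<open>F1 a = F2 a\<close>; it is generated by the arrows of \<open>C1\<close> and of \<open>C2\<close>, subject to the identities and
  composites of \<open>C1\<close> and \<open>C2\<close> and to the identifications \<open>F1 a = F2 a\<close> for the arrows of \<open>A\<close>.\<close>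

definition po_class :: "('o, 'a) category \<Rightarrow> ('o, 'a, 'p, 'b) func \<Rightarrow> ('o, 'a, 'q, 'c) func
    \<Rightarrow> 'p + 'q \<Rightarrow> ('p + 'q) set"
  where "po_class A F1 F2 z =
    (let E = {(Inl (onObj F1 a), Inr (onObj F2 a)) | a. a \<in> Obj A} in (E \<union> E\<inverse>)\<^sup>* `` {z})"

definition po_presentation :: "('o, 'a) category \<Rightarrow> ('p, 'b) category \<Rightarrow> ('q, 'c) category
    \<Rightarrow> ('o, 'a, 'p, 'b) func \<Rightarrow> ('o, 'a, 'q, 'c) func \<Rightarrow> (('p + 'q) set, 'b + 'c) presentation"
  where "po_presentation A C1 C2 F1 F2 =
    (let cl = po_class A F1 F2 in
    \<lparr>Vert = cl ` (Obj C1 <+> Obj C2),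
     Gen = Arr C1 <+> Arr C2,
     Gsrc = cl \<circ> map_sum (Src C1) (Src C2),
     Gtgt = cl \<circ> map_sum (Tgt C1) (Tgt C2),
     Rel = {(cl (Inl x), [Inl (Ident C1 x)], []) | x. x \<in> Obj C1}
         \<union> {(cl (Inr x), [Inr (Ident C2 x)], []) | x. x \<in> Obj C2}
         \<union> {(cl (Inl (Src C1 f)), [Inl f, Inl g], [Inl (Comp C1 g f)]) | f g.
              f \<in> Arr C1 \<and> g \<in> Arr C1 \<and> Tgt C1 f = Src C1 g}
         \<union> {(cl (Inr (Src C2 f)), [Inr f, Inr g], [Inr (Comp C2 g f)]) | f g.
              f \<in> Arr C2 \<and> g \<in> Arr C2 \<and> Tgt C2 f = Src C2 g}
         \<union> {(cl (Inl (onObj F1 (Src A a))), [Inl (onArr F1 a)], [Inr (onArr F2 a)]) | a. a \<in> Arr A}\<rparr>)"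

definition cat_pushout :: "('o, 'a) category \<Rightarrow> ('p, 'b) category \<Rightarrow> ('q, 'c) category
    \<Rightarrow> ('o, 'a, 'p, 'b) func \<Rightarrow> ('o, 'a, 'q, 'c) func
    \<Rightarrow> (('p + 'q) set, (('p + 'q) set, 'b + 'c) parr) category"
  where "cat_pushout A C1 C2 F1 F2 = presented (po_presentation A C1 C2 F1 F2)"

definition po_in1 :: "('o, 'a) category \<Rightarrow> ('p, 'b) category \<Rightarrow> ('q, 'c) category
    \<Rightarrow> ('o, 'a, 'p, 'b) func \<Rightarrow> ('o, 'a, 'q, 'c) func
    \<Rightarrow> ('p, 'b, ('p + 'q) set, (('p + 'q) set, 'b + 'c) parr) func"
  where "po_in1 A C1 C2 F1 F2 =
    \<lparr>onObj = po_class A F1 F2 \<circ> Inl, onArr = gen_arr (po_presentation A C1 C2 F1 F2) \<circ> Inl\<rparr>"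

definition po_in2 :: "('o, 'a) category \<Rightarrow> ('p, 'b) category \<Rightarrow> ('q, 'c) category
    \<Rightarrow> ('o, 'a, 'p, 'b) func \<Rightarrow> ('o, 'a, 'q, 'c) func
    \<Rightarrow> ('q, 'c, ('p + 'q) set, (('p + 'q) set, 'b + 'c) parr) func"
  where "po_in2 A C1 C2 F1 F2 =
    \<lparr>onObj = po_class A F1 F2 \<circ> Inr, onArr = gen_arr (po_presentation A C1 C2 F1 F2) \<circ> Inr\<rparr>"

text \<open>The functor on the pushout with restrictions \<open>U\<close> and \<open>V\<close>.\<close>

definition po_induced :: "('r, 'd) category \<Rightarrow> ('p, 'b, 'r, 'd) func \<Rightarrow> ('q, 'c, 'r, 'd) func
    \<Rightarrow> (('p + 'q) set, (('p + 'q) set, 'b + 'c) parr, 'r, 'd) func"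
  where "po_induced X U V =
    pres_functor X (\<lambda>c. the_elem (case_sum (onObj U) (onObj V) ` c)) (case_sum (onArr U) (onArr V))"


section \<open>The categories and functors of the theorem\<close>

datatype S_obj = S_A | S_B
datatype S_gen = S_f | S_g

definition S_pres :: "(S_obj, S_gen) presentation"
  where "S_pres = \<lparr>Vert = UNIV, Gen = UNIV, Gsrc = (\<lambda>_. S_A), Gtgt = (\<lambda>_. S_B), Rel = {}\<rparr>"

definition "S_cat = presented S_pres"

datatype D_obj = D_A | D_B | D_X
datatype D_gen = D_f | D_g | D_t

definition D_pres :: "(D_obj, D_gen) presentation"
  where "D_pres =
    \<lparr>Vert = UNIV, Gen = UNIV,
     Gsrc = case_D_gen D_A D_A D_B,
     Gtgt = case_D_gen D_B D_B D_X,
     Rel = {(D_A, [D_f, D_t], [D_g, D_t])}\<rparr>"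

definition "D_cat = presented D_pres"

definition S_incl :: "(S_obj, (S_obj, S_gen) parr, D_obj, (D_obj, D_gen) parr) func"
  where "S_incl = pres_functor D_cat (case_S_obj D_A D_B) (case_S_gen (gen_arr D_pres D_f) (gen_arr D_pres D_g))"

datatype T_obj = T_A0 | T_A1 | T_B0 | T_B1 | T_B2 | T_B3
datatype T_gen = T_f0 | T_g0 | T_f2 | T_g2 | T_pA | T_qA | T_pB1 | T_qB3 | T_f3 | T_g1 | T_qB1 | T_pB3

fun T_src :: "T_gen \<Rightarrow> T_obj" where
  "T_src T_f0 = T_A0" | "T_src T_g0 = T_A0"
| "T_src T_f2 = T_A0" | "T_src T_g2 = T_A0"
| "T_src T_pA = T_A0" | "T_src T_qA = T_A0"
| "T_src T_pB1 = T_B0" | "T_src T_qB3 = T_B0"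
| "T_src T_f3 = T_A1" | "T_src T_g1 = T_A1"
| "T_src T_qB1 = T_B2" | "T_src T_pB3 = T_B2"

fun T_tgt :: "T_gen \<Rightarrow> T_obj" where
  "T_tgt T_f0 = T_B0" | "T_tgt T_g0 = T_B0"
| "T_tgt T_f2 = T_B2" | "T_tgt T_g2 = T_B2"
| "T_tgt T_pA = T_A1" | "T_tgt T_qA = T_A1"
| "T_tgt T_pB1 = T_B1" | "T_tgt T_qB3 = T_B3"
| "T_tgt T_f3 = T_B3" | "T_tgt T_g1 = T_B1"
| "T_tgt T_qB1 = T_B1" | "T_tgt T_pB3 = T_B3"

definition T_pres :: "(T_obj, T_gen) presentation"
  where "T_pres =
    \<lparr>Vert = UNIV, Gen = UNIV, Gsrc = T_src, Gtgt = T_tgt,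
     Rel = {(T_A0, [T_f0, T_pB1], [T_f2, T_qB1]),
            (T_A0, [T_g0, T_pB1], [T_pA, T_g1]),
            (T_A0, [T_pA, T_f3], [T_f2, T_pB3]),
            (T_A0, [T_qA, T_f3], [T_f0, T_qB3]),
            (T_A0, [T_qA, T_g1], [T_g2, T_qB1]),
            (T_A0, [T_g0, T_qB3], [T_g2, T_pB3])}\<rparr>"

definition "T_cat = presented T_pres"

definition "S_arr_f = gen_arr S_pres S_f"
definition "S_arr_g = gen_arr S_pres S_g"
definition "S_id_A = Ident S_cat S_A"
definition "S_id_B = Ident S_cat S_B"

fun FM_obj :: "T_obj \<Rightarrow> S_obj" where
  "FM_obj T_A0 = S_A" | "FM_obj T_B0 = S_A"
| "FM_obj T_A1 = S_B" | "FM_obj T_B1 = S_B" | "FM_obj T_B2 = S_B" | "FM_obj T_B3 = S_B"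

fun FM_gen :: "T_gen \<Rightarrow> (S_obj, S_gen) parr" where
  "FM_gen T_f0 = S_id_A" | "FM_gen T_g0 = S_id_A"
| "FM_gen T_f3 = S_id_B" | "FM_gen T_pB3 = S_id_B" | "FM_gen T_qB1 = S_id_B" | "FM_gen T_g1 = S_id_B"
| "FM_gen T_qA = S_arr_f" | "FM_gen T_qB3 = S_arr_f" | "FM_gen T_g2 = S_arr_f"
| "FM_gen T_pA = S_arr_g" | "FM_gen T_pB1 = S_arr_g" | "FM_gen T_f2 = S_arr_g"

fun FN_obj :: "T_obj \<Rightarrow> S_obj" where
  "FN_obj T_A0 = S_A" | "FN_obj T_A1 = S_A"
| "FN_obj T_B0 = S_B" | "FN_obj T_B1 = S_B" | "FN_obj T_B2 = S_B" | "FN_obj T_B3 = S_B"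

fun FN_gen :: "T_gen \<Rightarrow> (S_obj, S_gen) parr" where
  "FN_gen T_pA = S_id_A" | "FN_gen T_qA = S_id_A"
| "FN_gen T_pB1 = S_id_B" | "FN_gen T_pB3 = S_id_B" | "FN_gen T_qB1 = S_id_B" | "FN_gen T_qB3 = S_id_B"
| "FN_gen T_f0 = S_arr_f" | "FN_gen T_f2 = S_arr_f" | "FN_gen T_f3 = S_arr_f"
| "FN_gen T_g0 = S_arr_g" | "FN_gen T_g1 = S_arr_g" | "FN_gen T_g2 = S_arr_g"

fun G_obj :: "T_obj \<Rightarrow> S_obj" where
  "G_obj T_A0 = S_A" | "G_obj T_B2 = S_A"
| "G_obj T_A1 = S_B" | "G_obj T_B0 = S_B" | "G_obj T_B1 = S_B" | "G_obj T_B3 = S_B"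

fun G_gen :: "T_gen \<Rightarrow> (S_obj, S_gen) parr" where
  "G_gen T_f2 = S_id_A" | "G_gen T_g2 = S_id_A"
| "G_gen T_f3 = S_id_B" | "G_gen T_qB3 = S_id_B" | "G_gen T_pB1 = S_id_B" | "G_gen T_g1 = S_id_B"
| "G_gen T_qA = S_arr_f" | "G_gen T_f0 = S_arr_f" | "G_gen T_qB1 = S_arr_f"
| "G_gen T_pA = S_arr_g" | "G_gen T_pB3 = S_arr_g" | "G_gen T_g0 = S_arr_g"

type_synonym TS_func = "(T_obj, (T_obj, T_gen) parr, S_obj, (S_obj, S_gen) parr) func"

definition F_M :: TS_func where "F_M = pres_functor S_cat FM_obj FM_gen"
definition F_N :: TS_func where "F_N = pres_functor S_cat FN_obj FN_gen"
definition G_fun :: TS_func where "G_fun = pres_functor S_cat G_obj G_gen"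

definition "M_cat = mapping_cylinder T_cat S_cat F_M"
definition "N_cat = mapping_cylinder T_cat S_cat F_N"

type_synonym TS_cyl_arr = "(T_obj, (T_obj, T_gen) parr, (S_obj, S_gen) parr) cyl_arr"

definition T_incl :: "(T_obj, (T_obj, T_gen) parr, T_obj + S_obj, TS_cyl_arr) func"
  where "T_incl = cyl_left"

text \<open>Both \<open>H\<^sub>M\<close> and \<open>H\<^sub>N\<close> are composed of \<open>T \<rightarrow> S \<rightarrow> D\<close> on the copy of \<open>T\<close>, the constant functor \<open>X\<close>
  on the copy of \<open>S\<close>, and the unique arrows \<open>G x \<rightarrow> X\<close>. Hence they are given by the same
  expression, although the composition laws of their sources \<open>M\<close> and \<open>N\<close> differ.\<close>

definition to_X :: "T_obj \<Rightarrow> (D_obj, D_gen) parr"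
  where "to_X x = (THE u. u \<in> Arr D_cat \<and>
    Src D_cat u = onObj (S_incl \<circ>\<^sub>F G_fun) x \<and> Tgt D_cat u = D_X)"

type_synonym cyl_D_func = "(T_obj + S_obj, TS_cyl_arr, D_obj, (D_obj, D_gen) parr) func"

definition H_M :: cyl_D_func
  where "H_M = cyl_induced D_cat (S_incl \<circ>\<^sub>F G_fun) (const_func D_cat D_X) to_X"
definition H_N :: cyl_D_func
  where "H_N = cyl_induced D_cat (S_incl \<circ>\<^sub>F G_fun) (const_func D_cat D_X) to_X"

definition "P_cat = cat_pushout T_cat M_cat N_cat T_incl T_incl"
definition "M_to_P = po_in1 T_cat M_cat N_cat T_incl T_incl"
definition "N_to_P = po_in2 T_cat M_cat N_cat T_incl T_incl"

definition "Q_cat = cat_pushout S_cat D_cat D_cat S_incl S_incl"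
definition "D_to_Q1 = po_in1 S_cat D_cat D_cat S_incl S_incl"
definition "D_to_Q2 = po_in2 S_cat D_cat D_cat S_incl S_incl"

definition "H_fun = po_induced Q_cat (D_to_Q1 \<circ>\<^sub>F H_M) (D_to_Q2 \<circ>\<^sub>F H_N)"


section \<open>Pushouts in the arrow category of small categories\<close>

type_synonym ('o, 'a, 'p, 'b) cat_arrow =
  "('o, 'a) category \<times> ('p, 'b) category \<times> ('o, 'a, 'p, 'b) func"

type_synonym ('o, 'a, 'p, 'b, 'o1, 'a1, 'p1, 'b1) func_pair =
  "('o, 'a, 'o1, 'a1) func \<times> ('p, 'b, 'p1, 'b1) func"

definition is_cat_arrow :: "('o, 'a, 'p, 'b) cat_arrow \<Rightarrow> bool"
  where "is_cat_arrow = (\<lambda>(C, D, F). cat_functor C D F)"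

definition cat_square :: "('o, 'a, 'p, 'b) cat_arrow \<Rightarrow> ('o1, 'a1, 'p1, 'b1) cat_arrow
    \<Rightarrow> ('o, 'a, 'p, 'b, 'o1, 'a1, 'p1, 'b1) func_pair \<Rightarrow> bool"
  where "cat_square = (\<lambda>(C, D, F) (C', D', F') (U, V).
    cat_functor C C' U \<and> cat_functor D D' V \<and> func_eq C (V \<circ>\<^sub>F F) (F' \<circ>\<^sub>F U))"

definition cat_square_comp :: "('o1, 'a1, 'p1, 'b1, 'o2, 'a2, 'p2, 'b2) func_pair
    \<Rightarrow> ('o, 'a, 'p, 'b, 'o1, 'a1, 'p1, 'b1) func_pair
    \<Rightarrow> ('o, 'a, 'p, 'b, 'o2, 'a2, 'p2, 'b2) func_pair"
  where "cat_square_comp = (\<lambda>(U', V') (U, V). (U' \<circ>\<^sub>F U, V' \<circ>\<^sub>F V))"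

definition cat_square_eq :: "('o, 'a, 'p, 'b) cat_arrow
    \<Rightarrow> ('o, 'a, 'p, 'b, 'o1, 'a1, 'p1, 'b1) func_pair
    \<Rightarrow> ('o, 'a, 'p, 'b, 'o1, 'a1, 'p1, 'b1) func_pair \<Rightarrow> bool"
  where "cat_square_eq = (\<lambda>(C, D, F) (U, V) (U', V'). func_eq C U U' \<and> func_eq D V V')"

text \<open>\<open>L\<close> is the pushout of \<open>K1 \<leftarrow> K \<rightarrow> K2\<close>. The arguments of type \<open>itself\<close> determine the carrier
  types of the test object; the property is meant to be asserted with type variables there.\<close>

definition is_cat_arrow_pushout :: "('x, 'y) category itself \<Rightarrow> ('v, 'w) category itself
    \<Rightarrow> ('o, 'a, 'p, 'b) cat_arrow \<Rightarrow> ('o1, 'a1, 'p1, 'b1) cat_arrow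
    \<Rightarrow> ('o2, 'a2, 'p2, 'b2) cat_arrow \<Rightarrow> ('o3, 'a3, 'p3, 'b3) cat_arrow
    \<Rightarrow> ('o, 'a, 'p, 'b, 'o1, 'a1, 'p1, 'b1) func_pair
    \<Rightarrow> ('o, 'a, 'p, 'b, 'o2, 'a2, 'p2, 'b2) func_pair
    \<Rightarrow> ('o1, 'a1, 'p1, 'b1, 'o3, 'a3, 'p3, 'b3) func_pair
    \<Rightarrow> ('o2, 'a2, 'p2, 'b2, 'o3, 'a3, 'p3, 'b3) func_pair \<Rightarrow> bool"
  where "is_cat_arrow_pushout _ _ K K1 K2 L i1 i2 j1 j2 \<longleftrightarrow>
    is_cat_arrow K \<and> is_cat_arrow K1 \<and> is_cat_arrow K2 \<and> is_cat_arrow L \<and>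
    cat_square K K1 i1 \<and> cat_square K K2 i2 \<and> cat_square K1 L j1 \<and> cat_square K2 L j2 \<and>
    cat_square_eq K (cat_square_comp j1 i1) (cat_square_comp j2 i2) \<and>
    (\<forall>(E :: ('x, 'y, 'v, 'w) cat_arrow) u1 u2.
      is_cat_arrow E \<and> cat_square K1 E u1 \<and> cat_square K2 E u2 \<and>
      cat_square_eq K (cat_square_comp u1 i1) (cat_square_comp u2 i2) \<longrightarrow>
      (\<exists>w. cat_square L E w \<and>
        cat_square_eq K1 (cat_square_comp w j1) u1 \<and> cat_square_eq K2 (cat_square_comp w j2) u2 \<and>
        (\<forall>w'. cat_square L E w' \<and>
          cat_square_eq K1 (cat_square_comp w' j1) u1 \<and> cat_square_eq K2 (cat_square_comp w' j2) u2
          \<longrightarrow> cat_square_eq L w w')))"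


section \<open>Pushouts in the arrow category of topological spaces\<close>

type_synonym ('a, 'b) top_arrow = "'a topology \<times> 'b topology \<times> ('a \<Rightarrow> 'b)"

definition is_top_arrow :: "('a, 'b) top_arrow \<Rightarrow> bool"
  where "is_top_arrow = (\<lambda>(X, Y, \<phi>). continuous_map X Y \<phi>)"

definition top_square :: "('a, 'b) top_arrow \<Rightarrow> ('a1, 'b1) top_arrow \<Rightarrow> ('a \<Rightarrow> 'a1) \<times> ('b \<Rightarrow> 'b1) \<Rightarrow> bool"
  where "top_square = (\<lambda>(X, Y, \<phi>) (X', Y', \<phi>') (u, v).
    continuous_map X X' u \<and> continuous_map Y Y' v \<and> (\<forall>x\<in>topspace X. v (\<phi> x) = \<phi>' (u x)))"

definition top_square_comp :: "('a1 \<Rightarrow> 'a2) \<times> ('b1 \<Rightarrow> 'b2) \<Rightarrow> ('a \<Rightarrow> 'a1) \<times> ('b \<Rightarrow> 'b1)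
    \<Rightarrow> ('a \<Rightarrow> 'a2) \<times> ('b \<Rightarrow> 'b2)"
  where "top_square_comp = (\<lambda>(u', v') (u, v). (u' \<circ> u, v' \<circ> v))"

definition top_square_eq :: "('a, 'b) top_arrow \<Rightarrow> ('a \<Rightarrow> 'a1) \<times> ('b \<Rightarrow> 'b1)
    \<Rightarrow> ('a \<Rightarrow> 'a1) \<times> ('b \<Rightarrow> 'b1) \<Rightarrow> bool"
  where "top_square_eq = (\<lambda>(X, Y, \<phi>) (u, v) (u', v').
    (\<forall>x\<in>topspace X. u x = u' x) \<and> (\<forall>y\<in>topspace Y. v y = v' y))"

definition is_top_arrow_pushout :: "'x itself \<Rightarrow> 'y itself
    \<Rightarrow> ('a, 'b) top_arrow \<Rightarrow> ('a1, 'b1) top_arrow \<Rightarrow> ('a2, 'b2) top_arrow \<Rightarrow> ('a3, 'b3) top_arrow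
    \<Rightarrow> ('a \<Rightarrow> 'a1) \<times> ('b \<Rightarrow> 'b1) \<Rightarrow> ('a \<Rightarrow> 'a2) \<times> ('b \<Rightarrow> 'b2)
    \<Rightarrow> ('a1 \<Rightarrow> 'a3) \<times> ('b1 \<Rightarrow> 'b3) \<Rightarrow> ('a2 \<Rightarrow> 'a3) \<times> ('b2 \<Rightarrow> 'b3) \<Rightarrow> bool"
  where "is_top_arrow_pushout _ _ K K1 K2 L i1 i2 j1 j2 \<longleftrightarrow>
    is_top_arrow K \<and> is_top_arrow K1 \<and> is_top_arrow K2 \<and> is_top_arrow L \<and>
    top_square K K1 i1 \<and> top_square K K2 i2 \<and> top_square K1 L j1 \<and> top_square K2 L j2 \<and>
    top_square_eq K (top_square_comp j1 i1) (top_square_comp j2 i2) \<and>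
    (\<forall>(E :: ('x, 'y) top_arrow) u1 u2.
      is_top_arrow E \<and> top_square K1 E u1 \<and> top_square K2 E u2 \<and>
      top_square_eq K (top_square_comp u1 i1) (top_square_comp u2 i2) \<longrightarrow>
      (\<exists>w. top_square L E w \<and>
        top_square_eq K1 (top_square_comp w j1) u1 \<and> top_square_eq K2 (top_square_comp w j2) u2 \<and>
        (\<forall>w'. top_square L E w' \<and>
          top_square_eq K1 (top_square_comp w' j1) u1 \<and> top_square_eq K2 (top_square_comp w' j2) u2
          \<longrightarrow> top_square_eq L w w')))"


section \<open>Simplicial sets, geometric realization, classifying spaces\<close>

definition quotient_topology :: "'a topology \<Rightarrow> ('a \<times> 'a) set \<Rightarrow> 'a set topology"
  where "quotient_topology X r =
    topology (\<lambda>U. U \<subseteq> topspace X // r \<and> openin X {x \<in> topspace X. r `` {x} \<in> U})"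

lemma openin_quotient_topology:
  "openin (quotient_topology X r) U \<longleftrightarrow>
    U \<subseteq> topspace X // r \<and> openin X {x \<in> topspace X. r `` {x} \<in> U}"
proof -
  have "istopology (\<lambda>U. U \<subseteq> topspace X // r \<and> openin X {x \<in> topspace X. r `` {x} \<in> U})"
    unfolding istopology_def
  proof (intro conjI allI impI)
    fix S T assume S: "S \<subseteq> topspace X // r \<and> openin X {x \<in> topspace X. r `` {x} \<in> S}"
      and T: "T \<subseteq> topspace X // r \<and> openin X {x \<in> topspace X. r `` {x} \<in> T}"
    have "{x \<in> topspace X. r `` {x} \<in> S \<inter> T} =
        {x \<in> topspace X. r `` {x} \<in> S} \<inter> {x \<in> topspace X. r `` {x} \<in> T}" by auto
    then show "openin X {x \<in> topspace X. r `` {x} \<in> S \<inter> T}" using S T by auto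
    show "S \<inter> T \<subseteq> topspace X // r" using S by auto
  next
    fix \<K> assume K: "\<forall>K\<in>\<K>. K \<subseteq> topspace X // r \<and> openin X {x \<in> topspace X. r `` {x} \<in> K}"
    have "{x \<in> topspace X. r `` {x} \<in> \<Union>\<K>} = (\<Union>K\<in>\<K>. {x \<in> topspace X. r `` {x} \<in> K})" by auto
    then show "openin X {x \<in> topspace X. r `` {x} \<in> \<Union>\<K>}" using K by auto
    show "\<Union>\<K> \<subseteq> topspace X // r" using K by auto
  qed
  then show ?thesis by (simp add: quotient_topology_def)
qed

lemma topspace_quotient_topology: "topspace (quotient_topology X r) = topspace X // r"
proof -
  have "{x \<in> topspace X. r `` {x} \<in> topspace X // r} = topspace X"
    by (auto simp: quotient_def)
  then have "openin (quotient_topology X r) (topspace X // r)"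
    by (simp add: openin_quotient_topology)
  then show ?thesis
    by (metis openin_quotient_topology openin_subset openin_topspace subset_antisym)
qed

lemma quotient_map_quotient_topology:
  "quotient_map X (quotient_topology X r) (\<lambda>x. r `` {x})"
  by (auto simp: quotient_map_def topspace_quotient_topology openin_quotient_topology quotient_def)

text \<open>\<open>Act X m n \<theta> : X\<^sub>n \<rightarrow> X\<^sub>m\<close> is the operator of the monotone map \<open>\<theta> : [m] \<rightarrow> [n]\<close>, where
  \<open>[m] = {0, \<dots>, m}\<close>.\<close>

record 's simplicial_set =
  Smp :: "nat \<Rightarrow> 's set"
  Act :: "nat \<Rightarrow> nat \<Rightarrow> (nat \<Rightarrow> nat) \<Rightarrow> 's \<Rightarrow> 's"

definition monotone_maps :: "nat \<Rightarrow> nat \<Rightarrow> (nat \<Rightarrow> nat) set"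
  where "monotone_maps m n = {\<theta>. mono_on {..m} \<theta> \<and> \<theta> ` {..m} \<subseteq> {..n}}"

definition simplex_push :: "nat \<Rightarrow> (nat \<Rightarrow> nat) \<Rightarrow> (nat \<Rightarrow> real) \<Rightarrow> nat \<Rightarrow> real"
  where "simplex_push m \<theta> t = (\<lambda>j. \<Sum>i | i \<le> m \<and> \<theta> i = j. t i)"

definition realization_total :: "'s simplicial_set \<Rightarrow> (nat \<times> 's \<times> (nat \<Rightarrow> real)) topology"
  where "realization_total X = sum_topology
    (\<lambda>n. prod_topology (discrete_topology (Smp X n))
      (subtopology (powertop_real UNIV) (standard_simplex n))) UNIV"

definition realization_rel ::
  "'s simplicial_set \<Rightarrow> ((nat \<times> 's \<times> (nat \<Rightarrow> real)) \<times> (nat \<times> 's \<times> (nat \<Rightarrow> real))) set"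
  where "realization_rel X =
    (let E = {((m, Act X m n \<theta> x, t), (n, x, simplex_push m \<theta> t)) | m n \<theta> x t.
      \<theta> \<in> monotone_maps m n \<and> x \<in> Smp X n \<and> t \<in> standard_simplex m}
    in (E \<union> E\<inverse>)\<^sup>*)"

definition realization :: "'s simplicial_set \<Rightarrow> (nat \<times> 's \<times> (nat \<Rightarrow> real)) set topology"
  where "realization X = quotient_topology (realization_total X) (realization_rel X)"

text \<open>The map of realizations induced by a simplicial map into \<open>Y\<close>: the image of a class is
  contained in a single class, which is then its saturation.\<close>

definition realization_map :: "'s simplicial_set \<Rightarrow> ('r \<Rightarrow> 's)
    \<Rightarrow> (nat \<times> 'r \<times> (nat \<Rightarrow> real)) set \<Rightarrow> (nat \<times> 's \<times> (nat \<Rightarrow> real)) set"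
  where "realization_map Y \<phi> c = realization_rel Y `` ((\<lambda>(n, x, t). (n, \<phi> x, t)) ` c)"

text \<open>The string \<open>(x, [f\<^sub>1, \<dots>, f\<^sub>n])\<close> starts at \<open>x\<close>; an operator composes the arrows between the
  selected vertices.\<close>

fun string_vertex :: "('o, 'a) category \<Rightarrow> 'o \<times> 'a list \<Rightarrow> nat \<Rightarrow> 'o" where
  "string_vertex C (x, fs) 0 = x"
| "string_vertex C (x, fs) (Suc i) = Tgt C (fs ! i)"

definition nerve :: "('o, 'a) category \<Rightarrow> ('o \<times> 'a list) simplicial_set"
  where "nerve C =
    \<lparr>Smp = (\<lambda>n. {(x, fs). is_string C x fs \<and> length fs = n}),
     Act = (\<lambda>m n \<theta> s.
       (string_vertex C s (\<theta> 0),
        map (\<lambda>i. composite C (string_vertex C s (\<theta> i)) (take (\<theta> (Suc i) - \<theta> i) (drop (\<theta> i) (snd s))))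
          [0..<m]))\<rparr>"

definition nerve_map :: "('o, 'a, 'p, 'b) func \<Rightarrow> 'o \<times> 'a list \<Rightarrow> 'p \<times> 'b list"
  where "nerve_map F = map_prod (onObj F) (map (onArr F))"

type_synonym ('o, 'a) cs_point = "(nat \<times> ('o \<times> 'a list) \<times> (nat \<Rightarrow> real)) set"

definition B_space :: "('o, 'a) category \<Rightarrow> ('o, 'a) cs_point topology"
  where "B_space C = realization (nerve C)"

definition B_map :: "('p, 'b) category \<Rightarrow> ('o, 'a, 'p, 'b) func
    \<Rightarrow> ('o, 'a) cs_point \<Rightarrow> ('p, 'b) cs_point"
  where "B_map D F = realization_map (nerve D) (nerve_map F)"

definition B_arrow :: "('o, 'a, 'p, 'b) cat_arrow \<Rightarrow> (('o, 'a) cs_point, ('p, 'b) cs_point) top_arrow"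
  where "B_arrow = (\<lambda>(C, D, F). (B_space C, B_space D, B_map D F))"

definition B_square :: "('o1, 'a1, 'p1, 'b1) cat_arrow
    \<Rightarrow> ('o, 'a, 'p, 'b, 'o1, 'a1, 'p1, 'b1) func_pair
    \<Rightarrow> (('o, 'a) cs_point \<Rightarrow> ('o1, 'a1) cs_point) \<times> (('p, 'b) cs_point \<Rightarrow> ('p1, 'b1) cs_point)"
  where "B_square = (\<lambda>(C', D', F') (U, V). (B_map C' U, B_map D' V))"


section \<open>Spheres, disk, torus and the Hopf map\<close>

definition "S1_space = top_of_set (sphere (0 :: complex) 1)"

definition "D2_space = top_of_set (cball (0 :: complex) 1)"

definition "T2_space = prod_topology S1_space S1_space"

definition "S2_space = top_of_set (sphere (0 :: real ^ 3) 1)"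

definition S3_space :: "(complex \<times> complex) topology"
  where "S3_space = top_of_set {(z0, z1). z0 * cnj z0 + z1 * cnj z1 = 1}"

definition U1_rel :: "((complex \<times> complex) \<times> (complex \<times> complex)) set"
  where "U1_rel = {((z0, z1), (w * z0, w * z1)) | z0 z1 w.
    (z0, z1) \<in> topspace S3_space \<and> w \<in> sphere 0 1}"

definition S3_mod_U1 :: "(complex \<times> complex) set topology"
  where "S3_mod_U1 = quotient_topology S3_space U1_rel"

text \<open>The Hopf map as a map to \<open>S\<^sup>2\<close> depends on an identification \<open>k\<close> of \<open>S\<^sup>3/U(1)\<close> with \<open>S\<^sup>2\<close>.\<close>

definition hopf_map :: "((complex \<times> complex) set \<Rightarrow> real ^ 3) \<Rightarrow> complex \<times> complex \<Rightarrow> real ^ 3"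
  where "hopf_map k z = k (U1_rel `` {z})"

end

theory Submission
  imports Defs
begin

text \<open>All inclusions in the diagram are sieves, so the nerve of each pushout is the union of the nerves,
  and the classifying spaces, being compact, are glued accordingly. A point of the classifying space of
  a category without loops is determined by its barycentric weights at the objects together with the
  arrows occurring between objects of positive weight; hence continuous bijections from these compact
  spaces can be written down in terms of weights and signs.

  \<open>BD\<close> is the cone over the circle \<open>BS\<close>, which gives a disk coordinate \<open>w\<close>. On \<open>BM\<close> a second
  coordinate \<open>v\<close> is the value in the circle of the retraction of the mapping cylinder to \<open>S\<close>, sheared by
  \<open>(b\<^sub>1 - b\<^sub>3)/4\<close> turns, where \<open>b\<^sub>i\<close> is the weight at \<open>B\<^sub>i\<close>; then every fibre of \<open>w\<close> is traversed
  monotonically in eight linear segments, and \<open>(v, w)\<close> is a homeomorphism onto \<open>S\<^sup>1 \<times> D\<^sup>2\<close>. The same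
  formula with \<open>A\<^sub>1\<close> and \<open>B\<^sub>0\<close> exchanged gives \<open>(u, w)\<close> on \<open>BN\<close>. On \<open>BT\<close>, where \<open>|w| = 1\<close>, one has
  \<open>w = v u\<close>. This is the relation between the coordinates of the two solid tori of the 3-sphere over the
  hemispheres, glued along the torus \<open>|z\<^sub>0| = |z\<^sub>1|\<close>, for the Hopf map in the form
  \<open>(z\<^sub>0, z\<^sub>1) \<mapsto> (2 z\<^sub>0 cnj z\<^sub>1, |z\<^sub>0|\<^sup>2 - |z\<^sub>1|\<^sup>2)\<close>.\<close>

section \<open>Strings and functors\<close>

text \<open>The shear is forced by the fibres. Over a point of \<open>BD\<close> with weights
  \<alpha>, \<beta>, s at A, B, X, the retraction of \<open>BM\<close> to the circle stands still
  while weight moves between \<open>A\<^sub>1\<close> and \<open>B\<^sub>1\<close> or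
  \<open>B\<^sub>3\<close>, and advances \<beta>/2 turns while weight moves between
  \<open>B\<^sub>0\<close> and one of these. Adding \<open>(b\<^sub>1 - b\<^sub>3)/4\<close> gives
  each of these four segments the length \<beta>/4. The other four have lengths \<alpha>/2 and s/2,
  twice each, so a fibre is exactly one turn long because the weights sum to 1. The obstacle is the
  signs: they belong to arrows and jump where a weight vanishes. Continuity is therefore tested on
  single simplices, where the string fixes the sign, and injectivity allows signs to differ at the
  vertices of the circle. What the arrows of \<open>T\<close> permit is condensed into finitely many
  linear conditions on weights and signs, which turns the geometry of the fibres into linear real
  arithmetic. The relation \<open>w = v u\<close> does not follow from these conditions for the two
  cylinders separately; it also uses that a single arrow of \<open>T\<close> determines the signs on
  both sides.\<close>

fun string_tgt :: "('o, 'a) category \<Rightarrow> 'o \<Rightarrow> 'a list \<Rightarrow> 'o" where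
  "string_tgt C x [] = x"
| "string_tgt C x (f # fs) = string_tgt C (Tgt C f) fs"

lemma is_string_Obj: "is_string C x fs \<Longrightarrow> x \<in> Obj C"
  by (cases fs) auto

lemma string_tgt_append: "string_tgt C x (fs @ gs) = string_tgt C (string_tgt C x fs) gs"
  by (induction fs arbitrary: x) auto

lemma is_string_append:
  "is_string C x (fs @ gs) \<longleftrightarrow> is_string C x fs \<and> is_string C (string_tgt C x fs) gs"
  by (induction fs arbitrary: x) (auto dest: is_string_Obj)

lemma is_string_Arr: "is_string C x fs \<Longrightarrow> set fs \<subseteq> Arr C"
  by (induction fs arbitrary: x) auto

context small_category
begin

lemma composite_props:
  assumes "is_string C x fs"
  shows "composite C x fs \<in> Arr C" "Src C (composite C x fs) = x"
    "Tgt C (composite C x fs) = string_tgt C x fs"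
proof -
  have "composite C x fs \<in> Arr C \<and> Src C (composite C x fs) = x \<and>
      Tgt C (composite C x fs) = string_tgt C x fs"
    using assms
    by (induction fs arbitrary: x) (auto simp: Ident_in Src_Ident Tgt_Ident Comp_in Src_Comp Tgt_Comp)
  then show "composite C x fs \<in> Arr C" "Src C (composite C x fs) = x"
    "Tgt C (composite C x fs) = string_tgt C x fs" by auto
qed

lemma composite_append:
  assumes "is_string C x fs" "is_string C (string_tgt C x fs) gs"
  shows "composite C x (fs @ gs) = Comp C (composite C (string_tgt C x fs) gs) (composite C x fs)"
  using assms
proof (induction fs arbitrary: x)
  case Nil
  then show ?case using Comp_Ident composite_props by fastforce
next
  case (Cons f fs)
  then show ?case using composite_props by (simp add: Comp_assoc)
qed

lemma composite_single: "f \<in> Arr C \<Longrightarrow> Src C f = x \<Longrightarrow> composite C x [f] = f"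
  by (simp add: Ident_Comp)

end

context cat_functor
begin

lemma map_string:
  assumes "is_string C x fs"
  shows "is_string D (onObj F x) (map (onArr F) fs)"
    "string_tgt D (onObj F x) (map (onArr F) fs) = onObj F (string_tgt C x fs)"
    "composite D (onObj F x) (map (onArr F) fs) = onArr F (composite C x fs)"
proof -
  have "is_string D (onObj F x) (map (onArr F) fs) \<and>
    string_tgt D (onObj F x) (map (onArr F) fs) = onObj F (string_tgt C x fs) \<and>
    composite D (onObj F x) (map (onArr F) fs) = onArr F (composite C x fs)"
    using assms
    by (induction fs arbitrary: x)
      (auto simp: onObj_in onArr_in Src_onArr Tgt_onArr onArr_Ident onArr_Comp S.composite_props)
  then show "is_string D (onObj F x) (map (onArr F) fs)"
    "string_tgt D (onObj F x) (map (onArr F) fs) = onObj F (string_tgt C x fs)"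
    "composite D (onObj F x) (map (onArr F) fs) = onArr F (composite C x fs)" by auto
qed

end

lemma cat_functor_comp:
  assumes "cat_functor A B F" "cat_functor B C K"
  shows "cat_functor A C (K \<circ>\<^sub>F F)"
proof -
  interpret F: cat_functor A B F by fact
  interpret K: cat_functor B C K by fact
  show ?thesis
    by unfold_locales
      (auto simp: func_comp_def F.onObj_in F.onArr_in F.Src_onArr F.Tgt_onArr F.onArr_Ident
        F.onArr_Comp K.onObj_in K.onArr_in K.Src_onArr K.Tgt_onArr K.onArr_Ident K.onArr_Comp)
qed

lemma onObj_func_comp [simp]: "onObj (K \<circ>\<^sub>F F) x = onObj K (onObj F x)"
  and onArr_func_comp [simp]: "onArr (K \<circ>\<^sub>F F) f = onArr K (onArr F f)"
  by (simp_all add: func_comp_def)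

lemma func_eq_refl [simp]: "func_eq C F F"
  by (simp add: func_eq_def)

lemma func_eq_sym: "func_eq C F K \<Longrightarrow> func_eq C K F"
  by (simp add: func_eq_def)

lemma func_eq_trans [trans]: "func_eq C F K \<Longrightarrow> func_eq C K L \<Longrightarrow> func_eq C F L"
  by (simp add: func_eq_def)

lemma func_eq_comp_right: "cat_functor C D F \<Longrightarrow> func_eq D K K' \<Longrightarrow> func_eq C (K \<circ>\<^sub>F F) (K' \<circ>\<^sub>F F)"
  by (simp add: func_eq_def cat_functor.onObj_in cat_functor.onArr_in)

lemma cat_functor_cong:
  assumes "cat_functor C D F" "func_eq C F F'"
  shows "cat_functor C D F'"
proof -
  interpret F: cat_functor C D F by fact
  have o: "\<And>x. x \<in> Obj C \<Longrightarrow> onObj F' x = onObj F x"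
    and a: "\<And>f. f \<in> Arr C \<Longrightarrow> onArr F' f = onArr F f"
    using assms(2) by (auto simp: func_eq_def)
  show ?thesis
    by unfold_locales
      (auto simp: o a F.S.Src_in F.S.Tgt_in F.S.Ident_in F.S.Comp_in F.onObj_in F.onArr_in
        F.Src_onArr F.Tgt_onArr F.onArr_Ident F.onArr_Comp)
qed

definition id_func :: "('o, 'a, 'o, 'a) func"
  where "id_func = \<lparr>onObj = id, onArr = id\<rparr>"

lemma id_func_simps [simp]: "onObj id_func x = x" "onArr id_func f = f"
  by (simp_all add: id_func_def)

lemma id_functor: "small_category C \<Longrightarrow> cat_functor C C id_func"
  by (simp add: cat_functor_def cat_functor_axioms_def small_category.Ident_in)

section \<open>Categories presented by generators and relations\<close>

lemma is_path_Vert: "is_path R x p \<Longrightarrow> x \<in> Vert R"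
  by (cases p) auto

lemma path_tgt_Vert: "is_path R x p \<Longrightarrow> path_tgt R x p \<in> Vert R"
  by (induction p arbitrary: x) auto

lemma path_tgt_append: "path_tgt R x (p @ q) = path_tgt R (path_tgt R x p) q"
  by (induction p arbitrary: x) auto

lemma is_path_append: "is_path R x (p @ q) \<longleftrightarrow> is_path R x p \<and> is_path R (path_tgt R x p) q"
  by (induction p arbitrary: x) (auto dest: is_path_Vert)

lemma path_cong_parallel:
  assumes "path_cong R x p q"
  shows "is_path R x p" "is_path R x q" "path_tgt R x p = path_tgt R x q"
proof -
  have "is_path R x p \<and> is_path R x q \<and> path_tgt R x p = path_tgt R x q"
    using assms by induction (auto simp: is_path_append path_tgt_append)
  then show "is_path R x p" "is_path R x q" "path_tgt R x p = path_tgt R x q" by auto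
qed

lemma path_arr_eq_iff:
  assumes "is_path R x p" "is_path R y q"
  shows "path_arr R x p = path_arr R y q \<longleftrightarrow> x = y \<and> path_cong R x p q"
proof
  assume *: "path_arr R x p = path_arr R y q"
  then have "x = y" "{r. path_cong R x p r} = {r. path_cong R y q r}"
    by (auto simp: path_arr_def)
  then show "x = y \<and> path_cong R x p q"
    using cong_refl[OF assms(2)] by auto
next
  assume "x = y \<and> path_cong R x p q"
  then show "path_arr R x p = path_arr R y q"
    by (auto simp: path_arr_def path_cong_parallel(3) intro: cong_trans cong_sym)
qed

lemma presented_simps [simp]:
  "Obj (presented R) = Vert R"
  "Src (presented R) (path_arr R x p) = x"
  "Tgt (presented R) (path_arr R x p) = path_tgt R x p"
  "Ident (presented R) x = path_arr R x []"
  by (auto simp: presented_def path_arr_def)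

lemma presented_Arr: "Arr (presented R) = {path_arr R x p | x p. is_path R x p}"
  by (simp add: presented_def)

lemma path_arr_Arr [simp]: "is_path R x p \<Longrightarrow> path_arr R x p \<in> Arr (presented R)"
  by (auto simp: presented_Arr)

text \<open>The definition of composition runs over all representatives of both classes; as the
  congruence is closed under concatenation, any one pair already yields the whole class.\<close>

lemma presented_Comp:
  assumes "is_path R x p" "is_path R (path_tgt R x p) q"
  shows "Comp (presented R) (path_arr R (path_tgt R x p) q) (path_arr R x p) = path_arr R x (p @ q)"
proof -
  have "(\<exists>p'. path_cong R x p p' \<and> (\<exists>q'. path_cong R (path_tgt R x p) q q' \<and> path_cong R x (p' @ q') r))
      \<longleftrightarrow> path_cong R x (p @ q) r" for r
    using assms by (meson cong_append cong_refl cong_trans)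
  then show ?thesis
    by (auto simp: presented_def path_arr_def path_tgt_append)
qed

lemma presented_category: "small_category (presented R)"
proof
  fix f g
  assume "f \<in> Arr (presented R)" "g \<in> Arr (presented R)" "Tgt (presented R) f = Src (presented R) g"
  then obtain x p q where fg: "f = path_arr R x p" "g = path_arr R (path_tgt R x p) q"
    "is_path R x p" "is_path R (path_tgt R x p) q"
    by (auto simp: presented_Arr)
  then show "Comp (presented R) g f \<in> Arr (presented R)"
    "Src (presented R) (Comp (presented R) g f) = Src (presented R) f"
    "Tgt (presented R) (Comp (presented R) g f) = Tgt (presented R) g"
    by (auto simp: presented_Comp is_path_append path_tgt_append)
  fix h
  assume "h \<in> Arr (presented R)" "Tgt (presented R) g = Src (presented R) h"
  then obtain r where h: "h = path_arr R (path_tgt R (path_tgt R x p) q) r"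
    "is_path R (path_tgt R (path_tgt R x p) q) r"
    using fg by (auto simp: presented_Arr)
  have "Comp (presented R) h (Comp (presented R) g f) = path_arr R x (p @ q @ r)"
    using presented_Comp[of R x "p @ q" r] fg h
    by (simp add: presented_Comp is_path_append path_tgt_append)
  moreover have "Comp (presented R) (Comp (presented R) h g) f = path_arr R x (p @ q @ r)"
    using fg h by (simp add: presented_Comp is_path_append)
  ultimately show "Comp (presented R) h (Comp (presented R) g f) = Comp (presented R) (Comp (presented R) h g) f"
    by simp
next
  fix f
  assume "f \<in> Arr (presented R)"
  then obtain x p where f: "f = path_arr R x p" "is_path R x p"
    by (auto simp: presented_Arr)
  then show "Src (presented R) f \<in> Obj (presented R)" "Tgt (presented R) f \<in> Obj (presented R)"
    by (auto simp: is_path_Vert path_tgt_Vert)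
  show "Comp (presented R) f (Ident (presented R) (Src (presented R) f)) = f"
    using f presented_Comp[of R x "[]" p] by (simp add: is_path_Vert)
  show "Comp (presented R) (Ident (presented R) (Tgt (presented R) f)) f = f"
    using f presented_Comp[of R x p "[]"] by (simp add: path_tgt_Vert)
qed auto

lemma path_arr_composite:
  assumes "is_path R x p"
  shows "path_arr R x p = composite (presented R) x (map (gen_arr R) p)"
  using assms
proof (induction p arbitrary: x)
  case (Cons g p)
  then have "path_arr R x (g # p) =
      Comp (presented R) (path_arr R (Gtgt R g) p) (path_arr R x [g])"
    using presented_Comp[of R x "[g]" p] is_path_Vert[of R "Gtgt R g" p] by simp
  then show ?case
    using Cons is_path_Vert[of R "Gtgt R g" p] by (auto simp: gen_arr_def)
qed simp

text \<open>Every arrow is a composite of generators. A generator with an endpoint outside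
  \<open>Vert R\<close> occurs in no path, hence the restriction in the last assumption.\<close>

lemma presented_functor_eq:
  assumes F: "cat_functor (presented R) C F" and F': "cat_functor (presented R) C F'"
    and o: "\<And>x. x \<in> Vert R \<Longrightarrow> onObj F x = onObj F' x"
    and g: "\<And>g. g \<in> Gen R \<Longrightarrow> Gsrc R g \<in> Vert R \<Longrightarrow> Gtgt R g \<in> Vert R \<Longrightarrow>
      onArr F (gen_arr R g) = onArr F' (gen_arr R g)"
  shows "func_eq (presented R) F F'"
proof -
  have str: "is_string (presented R) x (map (gen_arr R) p)"
      "map (onArr F) (map (gen_arr R) p) = map (onArr F') (map (gen_arr R) p)" if "is_path R x p" for x p
    using that
    by (induction p arbitrary: x) (auto simp: gen_arr_def path_tgt_Vert dest: is_path_Vert g)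
  have "onArr F (path_arr R x p) = onArr F' (path_arr R x p)" if "is_path R x p" for x p
    using cat_functor.map_string(3)[OF F str(1)[OF that]] cat_functor.map_string(3)[OF F' str(1)[OF that]]
      str(2)[OF that] o is_path_Vert[OF that] path_arr_composite[OF that]
    by (metis (no_types, lifting))
  then show ?thesis
    using o by (auto simp: func_eq_def presented_Arr)
qed

text \<open>An interpretation of the presentation in \<open>C\<close>. Relations are imposed only
  between parallel paths, since these are the ones that enter \<open>path_cong\<close>; all
  representatives of an arrow then have one value, as \<open>pres_functor\<close>
  presupposes.\<close>

locale presentation_model = small_category C
  for C :: "('p, 'b) category" +
  fixes R :: "('o, 'g) presentation" and ob :: "'o \<Rightarrow> 'p" and h :: "'g \<Rightarrow> 'b"
  assumes ob_in: "x \<in> Vert R \<Longrightarrow> ob x \<in> Obj C"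
    and h_in: "g \<in> Gen R \<Longrightarrow> h g \<in> Arr C"
    and h_Src: "g \<in> Gen R \<Longrightarrow> Src C (h g) = ob (Gsrc R g)"
    and h_Tgt: "g \<in> Gen R \<Longrightarrow> Tgt C (h g) = ob (Gtgt R g)"
    and h_Rel: "\<lbrakk>(x, p, q) \<in> Rel R; is_path R x p; is_path R x q; path_tgt R x p = path_tgt R x q\<rbrakk>
      \<Longrightarrow> composite C (ob x) (map h p) = composite C (ob x) (map h q)"
begin

lemma map_path:
  assumes "is_path R x p"
  shows "is_string C (ob x) (map h p)" "string_tgt C (ob x) (map h p) = ob (path_tgt R x p)"
proof -
  have "is_string C (ob x) (map h p) \<and> string_tgt C (ob x) (map h p) = ob (path_tgt R x p)"
    using assms by (induction p arbitrary: x) (auto simp: ob_in h_in h_Src h_Tgt)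
  then show "is_string C (ob x) (map h p)" "string_tgt C (ob x) (map h p) = ob (path_tgt R x p)"
    by auto
qed

lemma composite_cong:
  "path_cong R x p q \<Longrightarrow> composite C (ob x) (map h p) = composite C (ob x) (map h q)"
proof (induction rule: path_cong.induct)
  case (cong_base x p q)
  then show ?case by (rule h_Rel)
next
  case (cong_append x p q p' q')
  note pq = path_cong_parallel[OF cong_append.hyps(1)] path_cong_parallel[OF cong_append.hyps(2)]
  have "composite C (ob x) (map h p @ map h p') = composite C (ob x) (map h q @ map h q')"
    using cong_append.IH pq by (subst (1 2) composite_append) (auto simp: map_path)
  then show ?case by simp
qed auto

lemma onArr_path:
  assumes "is_path R x p"
  shows "onArr (pres_functor C ob h) (path_arr R x p) = composite C (ob x) (map h p)"
proof -
  have "(\<lambda>q. composite C (ob x) (map h q)) ` {q. path_cong R x p q} = {composite C (ob x) (map h p)}"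
  proof (intro equalityI subsetI)
    fix a assume "a \<in> (\<lambda>q. composite C (ob x) (map h q)) ` {q. path_cong R x p q}"
    then show "a \<in> {composite C (ob x) (map h p)}" using composite_cong by fastforce
  next
    fix a assume "a \<in> {composite C (ob x) (map h p)}"
    then show "a \<in> (\<lambda>q. composite C (ob x) (map h q)) ` {q. path_cong R x p q}"
      using cong_refl[OF assms] by blast
  qed
  then show ?thesis by (simp add: pres_functor_def path_arr_def)
qed

lemma onObj_pres [simp]: "onObj (pres_functor C ob h) x = ob x"
  by (simp add: pres_functor_def)

lemma onArr_gen:
  assumes "g \<in> Gen R" "Gsrc R g \<in> Vert R" "Gtgt R g \<in> Vert R"
  shows "onArr (pres_functor C ob h) (gen_arr R g) = h g"
  using assms onArr_path[of "Gsrc R g" "[g]"] composite_single[of "h g"]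
  by (simp add: gen_arr_def h_in h_Src h_Tgt)

lemma is_functor: "cat_functor (presented R) C (pres_functor C ob h)"
proof -
  interpret P: small_category "presented R" by (rule presented_category)
  show ?thesis
  proof
    fix f g
    assume "f \<in> Arr (presented R)" "g \<in> Arr (presented R)" "Tgt (presented R) f = Src (presented R) g"
    then obtain x p q where fg: "f = path_arr R x p" "g = path_arr R (path_tgt R x p) q"
      "is_path R x p" "is_path R (path_tgt R x p) q"
      by (auto simp: presented_Arr)
    then show "onArr (pres_functor C ob h) (Comp (presented R) g f) =
        Comp C (onArr (pres_functor C ob h) g) (onArr (pres_functor C ob h) f)"
      by (simp add: presented_Comp onArr_path is_path_append composite_append map_path)
  qed (auto simp: presented_Arr onArr_path ob_in map_path composite_props is_path_Vert path_tgt_Vert)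
qed

end

lemma sym_trans_Image_eq:
  assumes "sym r" "trans r" "(x, y) \<in> r"
  shows "r `` {x} = r `` {y}"
  using assms by (auto dest: symD transD)

section \<open>The universal property of the pushout of categories\<close>

context
  fixes A :: "('o, 'a) category" and C1 :: "('p, 'b) category" and C2 :: "('q, 'c) category"
    and F1 :: "('o, 'a, 'p, 'b) func" and F2 :: "('o, 'a, 'q, 'c) func"
  assumes F1: "cat_functor A C1 F1" and F2: "cat_functor A C2 F2"
begin

interpretation F1: cat_functor A C1 F1 by (rule F1)
interpretation F2: cat_functor A C2 F2 by (rule F2)

abbreviation (input) "po \<equiv> po_presentation A C1 C2 F1 F2"
abbreviation (input) "cl \<equiv> po_class A F1 F2"

lemma po_class_self: "z \<in> cl z"
  by (simp add: po_class_def Let_def)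

lemma po_class_glue: "a \<in> Obj A \<Longrightarrow> cl (Inl (onObj F1 a)) = cl (Inr (onObj F2 a))"
proof -
  assume a: "a \<in> Obj A"
  let ?E = "{(Inl (onObj F1 a), Inr (onObj F2 a)) | a. a \<in> Obj A}"
  have "sym ((?E \<union> ?E\<inverse>)\<^sup>*)" by (simp add: sym_Un_converse sym_rtrancl)
  moreover have "(Inl (onObj F1 a), Inr (onObj F2 a)) \<in> (?E \<union> ?E\<inverse>)\<^sup>*" using a by blast
  ultimately show ?thesis
    unfolding po_class_def Let_def by (intro sym_trans_Image_eq trans_rtrancl)
qed

lemma po_Vert: "Vert po = cl ` (Obj C1 <+> Obj C2)"
  and po_Gen: "Gen po = Arr C1 <+> Arr C2"
  and po_Gsrc [simp]: "Gsrc po (Inl f) = cl (Inl (Src C1 f))" "Gsrc po (Inr g) = cl (Inr (Src C2 g))"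
  and po_Gtgt [simp]: "Gtgt po (Inl f) = cl (Inl (Tgt C1 f))" "Gtgt po (Inr g) = cl (Inr (Tgt C2 g))"
  by (simp_all add: po_presentation_def Let_def)

lemma po_Vert_in: "x \<in> Obj C1 \<Longrightarrow> cl (Inl x) \<in> Vert po" "y \<in> Obj C2 \<Longrightarrow> cl (Inr y) \<in> Vert po"
  by (auto simp: po_Vert)

lemma po_Rel:
  "x \<in> Obj C1 \<Longrightarrow> (cl (Inl x), [Inl (Ident C1 x)], []) \<in> Rel po"
  "y \<in> Obj C2 \<Longrightarrow> (cl (Inr y), [Inr (Ident C2 y)], []) \<in> Rel po"
  "\<lbrakk>f \<in> Arr C1; g \<in> Arr C1; Tgt C1 f = Src C1 g\<rbrakk>
    \<Longrightarrow> (cl (Inl (Src C1 f)), [Inl f, Inl g], [Inl (Comp C1 g f)]) \<in> Rel po"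
  "\<lbrakk>f' \<in> Arr C2; g' \<in> Arr C2; Tgt C2 f' = Src C2 g'\<rbrakk>
    \<Longrightarrow> (cl (Inr (Src C2 f')), [Inr f', Inr g'], [Inr (Comp C2 g' f')]) \<in> Rel po"
  "a \<in> Arr A \<Longrightarrow> (cl (Inl (onObj F1 (Src A a))), [Inl (onArr F1 a)], [Inr (onArr F2 a)]) \<in> Rel po"
  by (auto simp: po_presentation_def Let_def)

lemma po_gen_path:
  "f \<in> Arr C1 \<Longrightarrow> is_path po (cl (Inl (Src C1 f))) [Inl f]"
  "g \<in> Arr C2 \<Longrightarrow> is_path po (cl (Inr (Src C2 g))) [Inr g]"
  by (auto simp: po_Gen po_Vert_in F1.T.Src_in F1.T.Tgt_in F2.T.Src_in F2.T.Tgt_in)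

lemma po_in1_functor: "cat_functor C1 (cat_pushout A C1 C2 F1 F2) (po_in1 A C1 C2 F1 F2)"
proof -
  interpret P: small_category "cat_pushout A C1 C2 F1 F2"
    unfolding cat_pushout_def by (rule presented_category)
  show ?thesis
  proof
    fix x assume x: "x \<in> Obj C1"
    show "onArr (po_in1 A C1 C2 F1 F2) (Ident C1 x) =
        Ident (cat_pushout A C1 C2 F1 F2) (onObj (po_in1 A C1 C2 F1 F2) x)"
      using x po_gen_path(1)[of "Ident C1 x"] po_Rel(1)[OF x]
      by (auto simp: po_in1_def cat_pushout_def gen_arr_def path_arr_eq_iff po_Vert_in
          F1.T.Ident_in F1.T.Src_Ident F1.T.Tgt_Ident intro!: cong_base)
  next
    fix f g assume fg: "f \<in> Arr C1" "g \<in> Arr C1" "Tgt C1 f = Src C1 g"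
    then have "path_cong po (cl (Inl (Src C1 f))) [Inl f, Inl g] [Inl (Comp C1 g f)]"
      by (auto intro!: cong_base po_Rel simp: po_Gen po_Vert_in F1.T.Src_in F1.T.Tgt_in F1.T.Comp_in
          F1.T.Src_Comp F1.T.Tgt_Comp)
    moreover have "Comp (presented po) (gen_arr po (Inl g)) (gen_arr po (Inl f)) =
        path_arr po (cl (Inl (Src C1 f))) ([Inl f] @ [Inl g])"
      using presented_Comp[OF po_gen_path(1)[OF fg(1)], of "[Inl g]"] po_gen_path(1)[OF fg(2)] fg
      by (simp add: gen_arr_def)
    ultimately show "onArr (po_in1 A C1 C2 F1 F2) (Comp C1 g f) = Comp (cat_pushout A C1 C2 F1 F2)
        (onArr (po_in1 A C1 C2 F1 F2) g) (onArr (po_in1 A C1 C2 F1 F2) f)"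
      using fg by (simp add: po_in1_def cat_pushout_def gen_arr_def F1.T.Src_Comp
          path_arr_eq_iff[OF path_cong_parallel(2,1)] cong_sym)
  qed (auto simp: po_in1_def cat_pushout_def po_Vert gen_arr_def path_arr_Arr[OF po_gen_path(1)])
qed

lemma po_in2_functor: "cat_functor C2 (cat_pushout A C1 C2 F1 F2) (po_in2 A C1 C2 F1 F2)"
proof -
  interpret P: small_category "cat_pushout A C1 C2 F1 F2"
    unfolding cat_pushout_def by (rule presented_category)
  show ?thesis
  proof
    fix x assume x: "x \<in> Obj C2"
    show "onArr (po_in2 A C1 C2 F1 F2) (Ident C2 x) =
        Ident (cat_pushout A C1 C2 F1 F2) (onObj (po_in2 A C1 C2 F1 F2) x)"
      using x po_gen_path(2)[of "Ident C2 x"] po_Rel(2)[OF x]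
      by (auto simp: po_in2_def cat_pushout_def gen_arr_def path_arr_eq_iff po_Vert_in
          F2.T.Ident_in F2.T.Src_Ident F2.T.Tgt_Ident intro!: cong_base)
  next
    fix f g assume fg: "f \<in> Arr C2" "g \<in> Arr C2" "Tgt C2 f = Src C2 g"
    then have "path_cong po (cl (Inr (Src C2 f))) [Inr f, Inr g] [Inr (Comp C2 g f)]"
      by (auto intro!: cong_base po_Rel simp: po_Gen po_Vert_in F2.T.Src_in F2.T.Tgt_in F2.T.Comp_in
          F2.T.Src_Comp F2.T.Tgt_Comp)
    moreover have "Comp (presented po) (gen_arr po (Inr g)) (gen_arr po (Inr f)) =
        path_arr po (cl (Inr (Src C2 f))) ([Inr f] @ [Inr g])"
      using presented_Comp[OF po_gen_path(2)[OF fg(1)], of "[Inr g]"] po_gen_path(2)[OF fg(2)] fg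
      by (simp add: gen_arr_def)
    ultimately show "onArr (po_in2 A C1 C2 F1 F2) (Comp C2 g f) = Comp (cat_pushout A C1 C2 F1 F2)
        (onArr (po_in2 A C1 C2 F1 F2) g) (onArr (po_in2 A C1 C2 F1 F2) f)"
      using fg by (simp add: po_in2_def cat_pushout_def gen_arr_def F2.T.Src_Comp
          path_arr_eq_iff[OF path_cong_parallel(2,1)] cong_sym)
  qed (auto simp: po_in2_def cat_pushout_def po_Vert gen_arr_def path_arr_Arr[OF po_gen_path(2)])
qed

lemma po_commutes: "func_eq A (po_in1 A C1 C2 F1 F2 \<circ>\<^sub>F F1) (po_in2 A C1 C2 F1 F2 \<circ>\<^sub>F F2)"
proof -
  have c: "path_cong po (cl (Inl (onObj F1 (Src A a)))) [Inl (onArr F1 a)] [Inr (onArr F2 a)]"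
    if a: "a \<in> Arr A" for a
    using po_gen_path(1)[OF F1.onArr_in[OF a]] po_gen_path(2)[OF F2.onArr_in[OF a]] a po_Rel(5)[OF a]
    by (intro cong_base)
      (auto simp: F1.Src_onArr F2.Src_onArr F1.Tgt_onArr F2.Tgt_onArr po_class_glue F1.S.Src_in F1.S.Tgt_in)
  have *: "path_arr po (cl (Inl (onObj F1 (Src A a)))) [Inl (onArr F1 a)] =
      path_arr po (cl (Inl (onObj F1 (Src A a)))) [Inr (onArr F2 a)]" if "a \<in> Arr A" for a
    using path_arr_eq_iff[OF path_cong_parallel(1,2)[OF c[OF that]]] c[OF that] by blast
  have "gen_arr po (Inl (onArr F1 a)) = gen_arr po (Inr (onArr F2 a))" if "a \<in> Arr A" for a
    using *[OF that] that
    by (simp add: gen_arr_def F1.Src_onArr F2.Src_onArr F1.S.Src_in po_class_glue)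
  then show ?thesis
    by (simp add: func_eq_def po_in1_def po_in2_def po_class_glue)
qed

context
  fixes X :: "('r, 'd) category" and U :: "('p, 'b, 'r, 'd) func" and V :: "('q, 'c, 'r, 'd) func"
  assumes U: "cat_functor C1 X U" and V: "cat_functor C2 X V"
    and UV: "func_eq A (U \<circ>\<^sub>F F1) (V \<circ>\<^sub>F F2)"
begin

interpretation U: cat_functor C1 X U by (rule U)
interpretation V: cat_functor C2 X V by (rule V)

abbreviation (input) "po_ob \<equiv> \<lambda>c. the_elem (case_sum (onObj U) (onObj V) ` c)"

text \<open>\<open>U\<close> and \<open>V\<close> agree on glued objects, so the value is constant
  along the generated equivalence relation and \<open>the_elem\<close> meets a singleton.\<close>

lemma po_ob_cl: "po_ob (cl z) = case_sum (onObj U) (onObj V) z"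
proof -
  let ?E = "{(Inl (onObj F1 a), Inr (onObj F2 a)) | a. a \<in> Obj A}"
  have "case_sum (onObj U) (onObj V) z = case_sum (onObj U) (onObj V) z'"
    if "(z, z') \<in> (?E \<union> ?E\<inverse>)\<^sup>*" for z'
    using that by induction (use UV in \<open>auto simp: func_eq_def\<close>)
  then have "case_sum (onObj U) (onObj V) ` cl z = {case_sum (onObj U) (onObj V) z}"
    using po_class_self[of z] by (auto simp: po_class_def Let_def image_iff)
  then show ?thesis by simp
qed

lemma po_model: "presentation_model X po po_ob (case_sum (onArr U) (onArr V))"
proof
  fix x p q assume *: "(x, p, q) \<in> Rel po" "is_path po x p" "is_path po x q" "path_tgt po x p = path_tgt po x q"
  show "composite X (po_ob x) (map (case_sum (onArr U) (onArr V)) p) =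
        composite X (po_ob x) (map (case_sum (onArr U) (onArr V)) q)"
    using *(1) UV
    by (auto simp: po_presentation_def Let_def po_ob_cl U.onArr_Ident V.onArr_Ident U.onArr_Comp V.onArr_Comp
        U.onArr_in V.onArr_in U.onObj_in V.onObj_in U.Src_onArr V.Src_onArr U.Tgt_onArr V.Tgt_onArr
        F1.T.Ident_in F2.T.Ident_in F1.T.Src_Ident F2.T.Src_Ident F1.T.Tgt_Ident F2.T.Tgt_Ident
        F1.T.Comp_in F2.T.Comp_in F1.T.Tgt_Comp F2.T.Tgt_Comp F1.T.Tgt_in F2.T.Tgt_in
        U.T.Ident_Comp' U.T.Comp_in U.T.Tgt_Comp U.T.Ident_in U.T.Tgt_Ident F1.onArr_in F2.onArr_in func_eq_def
        F1.Tgt_onArr F2.Tgt_onArr)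
qed (auto simp: po_Vert po_Gen po_ob_cl U.onObj_in V.onObj_in U.onArr_in V.onArr_in U.Src_onArr V.Src_onArr
      U.Tgt_onArr V.Tgt_onArr)

lemma po_induced_functor: "cat_functor (cat_pushout A C1 C2 F1 F2) X (po_induced X U V)"
  unfolding po_induced_def cat_pushout_def by (rule presentation_model.is_functor[OF po_model])

lemma po_induced_in1: "func_eq C1 (po_induced X U V \<circ>\<^sub>F po_in1 A C1 C2 F1 F2) U"
  by (auto simp: func_eq_def po_induced_def po_in1_def po_ob_cl presentation_model.onObj_pres[OF po_model]
      presentation_model.onArr_gen[OF po_model] InlI InrI po_Gen po_Vert_in F1.T.Src_in F1.T.Tgt_in)

lemma po_induced_in2: "func_eq C2 (po_induced X U V \<circ>\<^sub>F po_in2 A C1 C2 F1 F2) V"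
  by (auto simp: func_eq_def po_induced_def po_in2_def po_ob_cl presentation_model.onObj_pres[OF po_model]
      presentation_model.onArr_gen[OF po_model] InlI InrI po_Gen po_Vert_in F2.T.Src_in F2.T.Tgt_in)

end

text \<open>The arrows of the two legs generate the pushout, so the two inclusions are jointly
  epic.\<close>

lemma po_functor_eq:
  assumes "cat_functor (cat_pushout A C1 C2 F1 F2) X W" "cat_functor (cat_pushout A C1 C2 F1 F2) X W'"
    and "func_eq C1 (W \<circ>\<^sub>F po_in1 A C1 C2 F1 F2) (W' \<circ>\<^sub>F po_in1 A C1 C2 F1 F2)"
    and "func_eq C2 (W \<circ>\<^sub>F po_in2 A C1 C2 F1 F2) (W' \<circ>\<^sub>F po_in2 A C1 C2 F1 F2)"
  shows "func_eq (cat_pushout A C1 C2 F1 F2) W W'"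
  unfolding cat_pushout_def
  by (rule presented_functor_eq)
    (use assms in \<open>auto simp: cat_pushout_def[symmetric] po_Vert po_Gen func_eq_def po_in1_def po_in2_def\<close>)

end

text \<open>Pushouts in an arrow category are formed separately on sources and on targets. It
  remains to see that the two mediating functors form a square, and this follows from uniqueness on
  \<open>P\<close>.\<close>

theorem cat_arrow_pushout:
  fixes X :: "('x, 'y) category itself" and Y :: "('v, 'w) category itself"
  assumes F1: "cat_functor A C1 F1" and F2: "cat_functor A C2 F2"
    and F1': "cat_functor A' C1' F1'" and F2': "cat_functor A' C2' F2'"
    and G: "cat_functor A A' G" and H1: "cat_functor C1 C1' H1" and H2: "cat_functor C2 C2' H2"
    and sq1: "func_eq A (F1' \<circ>\<^sub>F G) (H1 \<circ>\<^sub>F F1)" and sq2: "func_eq A (F2' \<circ>\<^sub>F G) (H2 \<circ>\<^sub>F F2)"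
  defines "P \<equiv> cat_pushout A C1 C2 F1 F2" and "Q \<equiv> cat_pushout A' C1' C2' F1' F2'"
  defines "j1 \<equiv> po_in1 A C1 C2 F1 F2" and "j2 \<equiv> po_in2 A C1 C2 F1 F2"
    and "j1' \<equiv> po_in1 A' C1' C2' F1' F2'" and "j2' \<equiv> po_in2 A' C1' C2' F1' F2'"
  defines "H \<equiv> po_induced Q (j1' \<circ>\<^sub>F H1) (j2' \<circ>\<^sub>F H2)"
  shows "cat_functor P Q H" "func_eq C1 (H \<circ>\<^sub>F j1) (j1' \<circ>\<^sub>F H1)" "func_eq C2 (H \<circ>\<^sub>F j2) (j2' \<circ>\<^sub>F H2)"
    "is_cat_arrow_pushout X Y (A, A', G) (C1, C1', H1) (C2, C2', H2) (P, Q, H)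
      (F1, F1') (F2, F2') (j1, j1') (j2, j2')"
proof -
  have j1: "cat_functor C1 P j1" and j2: "cat_functor C2 P j2"
    and j1': "cat_functor C1' Q j1'" and j2': "cat_functor C2' Q j2'"
    and jF: "func_eq A (j1 \<circ>\<^sub>F F1) (j2 \<circ>\<^sub>F F2)" and jF': "func_eq A' (j1' \<circ>\<^sub>F F1') (j2' \<circ>\<^sub>F F2')"
    unfolding P_def Q_def j1_def j2_def j1'_def j2'_def
    using F1 F2 F1' F2' by (simp_all add: po_in1_functor po_in2_functor po_commutes)
  have jH1: "cat_functor C1 Q (j1' \<circ>\<^sub>F H1)" and jH2: "cat_functor C2 Q (j2' \<circ>\<^sub>F H2)"
    using H1 H2 j1' j2' by (auto intro: cat_functor_comp)
  have "func_eq A ((j1' \<circ>\<^sub>F H1) \<circ>\<^sub>F F1) (j1' \<circ>\<^sub>F F1' \<circ>\<^sub>F G)"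
    using sq1 by (simp add: func_eq_def)
  also have "func_eq A (j1' \<circ>\<^sub>F F1' \<circ>\<^sub>F G) (j2' \<circ>\<^sub>F F2' \<circ>\<^sub>F G)"
    by (rule func_eq_comp_right[OF G jF'])
  also have "func_eq A (j2' \<circ>\<^sub>F F2' \<circ>\<^sub>F G) ((j2' \<circ>\<^sub>F H2) \<circ>\<^sub>F F2)"
    using sq2 by (simp add: func_eq_def)
  finally have jH: "func_eq A ((j1' \<circ>\<^sub>F H1) \<circ>\<^sub>F F1) ((j2' \<circ>\<^sub>F H2) \<circ>\<^sub>F F2)" .
  show H: "cat_functor P Q H" "func_eq C1 (H \<circ>\<^sub>F j1) (j1' \<circ>\<^sub>F H1)" "func_eq C2 (H \<circ>\<^sub>F j2) (j2' \<circ>\<^sub>F H2)"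
    unfolding H_def P_def j1_def j2_def
    by (rule po_induced_functor[OF F1 F2 jH1 jH2 jH] po_induced_in1[OF F1 F2 jH1 jH2 jH]
        po_induced_in2[OF F1 F2 jH1 jH2 jH])+
  show "is_cat_arrow_pushout X Y (A, A', G) (C1, C1', H1) (C2, C2', H2) (P, Q, H)
      (F1, F1') (F2, F2') (j1, j1') (j2, j2')"
    unfolding is_cat_arrow_pushout_def
  proof (intro conjI allI impI)
    fix E :: "('x, 'y, 'v, 'w) cat_arrow" and u1 u2
    assume as: "is_cat_arrow E \<and> cat_square (C1, C1', H1) E u1 \<and> cat_square (C2, C2', H2) E u2 \<and>
      cat_square_eq (A, A', G) (cat_square_comp u1 (F1, F1')) (cat_square_comp u2 (F2, F2'))"
    obtain X Y K where E: "E = (X, Y, K)" by (metis prod_cases3)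
    obtain U1 V1 where u1: "u1 = (U1, V1)" by force
    obtain U2 V2 where u2: "u2 = (U2, V2)" by force
    have K: "cat_functor X Y K"
      and U1: "cat_functor C1 X U1" and V1: "cat_functor C1' Y V1"
      and s1: "func_eq C1 (V1 \<circ>\<^sub>F H1) (K \<circ>\<^sub>F U1)"
      and U2: "cat_functor C2 X U2" and V2: "cat_functor C2' Y V2"
      and s2: "func_eq C2 (V2 \<circ>\<^sub>F H2) (K \<circ>\<^sub>F U2)"
      and UU: "func_eq A (U1 \<circ>\<^sub>F F1) (U2 \<circ>\<^sub>F F2)" and VV: "func_eq A' (V1 \<circ>\<^sub>F F1') (V2 \<circ>\<^sub>F F2')"
      using as by (auto simp: E u1 u2 is_cat_arrow_def cat_square_def cat_square_comp_def cat_square_eq_def)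
    define W where "W = po_induced X U1 U2"
    define W' where "W' = po_induced Y V1 V2"
    have W: "cat_functor P X W" "func_eq C1 (W \<circ>\<^sub>F j1) U1" "func_eq C2 (W \<circ>\<^sub>F j2) U2"
      unfolding W_def P_def j1_def j2_def
      by (rule po_induced_functor[OF F1 F2 U1 U2 UU] po_induced_in1[OF F1 F2 U1 U2 UU]
          po_induced_in2[OF F1 F2 U1 U2 UU])+
    have W': "cat_functor Q Y W'" "func_eq C1' (W' \<circ>\<^sub>F j1') V1" "func_eq C2' (W' \<circ>\<^sub>F j2') V2"
      unfolding W'_def Q_def j1'_def j2'_def
      by (rule po_induced_functor[OF F1' F2' V1 V2 VV] po_induced_in1[OF F1' F2' V1 V2 VV]
          po_induced_in2[OF F1' F2' V1 V2 VV])+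
    have "func_eq P (W' \<circ>\<^sub>F H) (K \<circ>\<^sub>F W)"
      unfolding P_def
    proof (rule po_functor_eq[OF F1 F2])
      show "cat_functor (cat_pushout A C1 C2 F1 F2) Y (W' \<circ>\<^sub>F H)"
        "cat_functor (cat_pushout A C1 C2 F1 F2) Y (K \<circ>\<^sub>F W)"
        using H(1) W(1) W'(1) K by (auto intro: cat_functor_comp simp: P_def[symmetric])
      show "func_eq C1 ((W' \<circ>\<^sub>F H) \<circ>\<^sub>F po_in1 A C1 C2 F1 F2) ((K \<circ>\<^sub>F W) \<circ>\<^sub>F po_in1 A C1 C2 F1 F2)"
        using H(2) W(2) func_eq_comp_right[OF H1 W'(2)] s1 by (auto simp: func_eq_def j1_def[symmetric])
      show "func_eq C2 ((W' \<circ>\<^sub>F H) \<circ>\<^sub>F po_in2 A C1 C2 F1 F2) ((K \<circ>\<^sub>F W) \<circ>\<^sub>F po_in2 A C1 C2 F1 F2)"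
        using H(3) W(3) func_eq_comp_right[OF H2 W'(3)] s2 by (auto simp: func_eq_def j2_def[symmetric])
    qed
    then have "cat_square (P, Q, H) E (W, W')"
      using W W' by (simp add: E cat_square_def)
    moreover have "cat_square_eq (P, Q, H) (W, W') w'"
      if w': "cat_square (P, Q, H) E w'" "cat_square_eq (C1, C1', H1) (cat_square_comp w' (j1, j1')) u1"
        "cat_square_eq (C2, C2', H2) (cat_square_comp w' (j2, j2')) u2" for w'
    proof -
      obtain Z Z' where [simp]: "w' = (Z, Z')" by force
      have Z: "cat_functor P X Z" "cat_functor Q Y Z'" "func_eq C1 (Z \<circ>\<^sub>F j1) U1" "func_eq C1' (Z' \<circ>\<^sub>F j1') V1"
        "func_eq C2 (Z \<circ>\<^sub>F j2) U2" "func_eq C2' (Z' \<circ>\<^sub>F j2') V2"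
        using w' by (auto simp: E u1 u2 cat_square_def cat_square_comp_def cat_square_eq_def)
      have "func_eq P W Z"
        unfolding P_def
        by (rule po_functor_eq[OF F1 F2])
          (use Z W in \<open>auto simp: P_def j1_def j2_def intro: func_eq_trans func_eq_sym\<close>)
      moreover have "func_eq Q W' Z'"
        unfolding Q_def
        by (rule po_functor_eq[OF F1' F2'])
          (use Z W' in \<open>auto simp: Q_def j1'_def j2'_def intro: func_eq_trans func_eq_sym\<close>)
      ultimately show ?thesis by (simp add: cat_square_eq_def)
    qed
    ultimately show "\<exists>w. cat_square (P, Q, H) E w \<and>
        cat_square_eq (C1, C1', H1) (cat_square_comp w (j1, j1')) u1 \<and>
        cat_square_eq (C2, C2', H2) (cat_square_comp w (j2, j2')) u2 \<and>
        (\<forall>w'. cat_square (P, Q, H) E w' \<and>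
          cat_square_eq (C1, C1', H1) (cat_square_comp w' (j1, j1')) u1 \<and>
          cat_square_eq (C2, C2', H2) (cat_square_comp w' (j2, j2')) u2
          \<longrightarrow> cat_square_eq (P, Q, H) w w')"
      using W W' by (intro exI[of _ "(W, W')"]) (auto simp: u1 u2 cat_square_comp_def cat_square_eq_def)
  qed (use G H1 H2 H F1 F2 F1' F2' j1 j2 j1' j2' sq1 sq2 jF jF' in
      \<open>auto simp: is_cat_arrow_def cat_square_def cat_square_comp_def cat_square_eq_def intro: func_eq_sym\<close>)
qed

section \<open>Pushouts of sieve inclusions\<close>

text \<open>The last clause says that every arrow into the image comes from \<open>A\<close>.
  Together with injectivity on objects it gives fullness as well as closure under
  precomposition.\<close>

definition sieve_inclusion :: "('o, 'a) category \<Rightarrow> ('p, 'b) category \<Rightarrow> ('o, 'a, 'p, 'b) func \<Rightarrow> bool"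
  where "sieve_inclusion A C F \<longleftrightarrow> cat_functor A C F \<and> inj_on (onObj F) (Obj A) \<and> inj_on (onArr F) (Arr A) \<and>
    (\<forall>f\<in>Arr C. Tgt C f \<in> onObj F ` Obj A \<longrightarrow> f \<in> onArr F ` Arr A)"

definition One_cat :: "(unit, unit) category"
  where "One_cat = \<lparr>Obj = UNIV, Arr = UNIV, Src = id, Tgt = id, Ident = id, Comp = (\<lambda>_ _. ())\<rparr>"

definition to_One :: "('o, 'a, unit, unit) func"
  where "to_One = \<lparr>onObj = (\<lambda>_. ()), onArr = (\<lambda>_. ())\<rparr>"

lemma to_One_functor: "small_category C \<Longrightarrow> cat_functor C One_cat to_One"
  unfolding cat_functor_def cat_functor_axioms_def
  by (auto simp: to_One_def One_cat_def intro!: small_category.intro)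

abbreviation "with_terminal C \<equiv> mapping_cylinder C One_cat to_One"

text \<open>Together with the inclusion of \<open>C1\<close>, this functor induces one on the pushout which separates the
  arrows coming from \<open>C1\<close>; the terminal object absorbs everything outside of the sieve.\<close>

definition collapse :: "('o, 'a) category \<Rightarrow> ('q, 'c) category \<Rightarrow> ('o, 'a, 'q, 'c) func
    \<Rightarrow> ('o, 'a, 'p, 'b) func \<Rightarrow> ('q, 'c, 'p + unit, ('p, 'b, unit) cyl_arr) func"
  where "collapse A C2 F2 F1 =
    (let ob = (\<lambda>y. onObj F1 (inv_into (Obj A) (onObj F2) y));
         im = onObj F2 ` Obj A
     in \<lparr>onObj = (\<lambda>y. if y \<in> im then Inl (ob y) else Inr ()),
         onArr = (\<lambda>g. if Tgt C2 g \<in> im then Left_arr (onArr F1 (inv_into (Arr A) (onArr F2) g))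
                      else if Src C2 g \<in> im then Mixed (ob (Src C2 g)) () else Right_arr ())\<rparr>)"

context
  fixes A :: "('o, 'a) category" and C1 :: "('p, 'b) category" and C2 :: "('q, 'c) category"
    and F1 :: "('o, 'a, 'p, 'b) func" and F2 :: "('o, 'a, 'q, 'c) func"
  assumes F1: "cat_functor A C1 F1" and F2: "sieve_inclusion A C2 F2"
begin

interpretation F1: cat_functor A C1 F1 by (rule F1)
interpretation F2: cat_functor A C2 F2 using F2 by (simp add: sieve_inclusion_def)

lemma collapse_image:
  "a \<in> Obj A \<Longrightarrow> onObj (collapse A C2 F2 F1) (onObj F2 a) = Inl (onObj F1 a)"
  "f \<in> Arr A \<Longrightarrow> onArr (collapse A C2 F2 F1) (onArr F2 f) = Left_arr (onArr F1 f)"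
  using F2 by (auto simp: collapse_def sieve_inclusion_def inv_into_f_f F2.Tgt_onArr F1.S.Tgt_in)

lemma collapse_outside:
  "y \<notin> onObj F2 ` Obj A \<Longrightarrow> onObj (collapse A C2 F2 F1) y = Inr ()"
  "Tgt C2 g \<notin> onObj F2 ` Obj A \<Longrightarrow> Src C2 g \<notin> onObj F2 ` Obj A
    \<Longrightarrow> onArr (collapse A C2 F2 F1) g = Right_arr ()"
  "Tgt C2 g \<notin> onObj F2 ` Obj A \<Longrightarrow> a \<in> Obj A \<Longrightarrow> Src C2 g = onObj F2 a
    \<Longrightarrow> onArr (collapse A C2 F2 F1) g = Mixed (onObj F1 a) ()"
  using F2 by (auto simp: collapse_def sieve_inclusion_def inv_into_f_f)

lemma collapse_cases:
  assumes "g \<in> Arr C2"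
  obtains (inside) b where "b \<in> Arr A" "g = onArr F2 b"
  | (cross) a where "a \<in> Obj A" "Src C2 g = onObj F2 a" "Tgt C2 g \<notin> onObj F2 ` Obj A"
  | (outside) "Src C2 g \<notin> onObj F2 ` Obj A" "Tgt C2 g \<notin> onObj F2 ` Obj A"
  using assms F2 unfolding sieve_inclusion_def by blast

lemma sieve_Src_image: "b \<in> Arr A \<Longrightarrow> Src C2 (onArr F2 b) \<in> onObj F2 ` Obj A"
  by (simp add: F2.Src_onArr F1.S.Src_in)

lemma sieve_Tgt_image: "b \<in> Arr A \<Longrightarrow> Tgt C2 (onArr F2 b) \<in> onObj F2 ` Obj A"
  by (simp add: F2.Tgt_onArr F1.S.Tgt_in)

text \<open>No arrow enters the sieve from outside, so an arrow of \<open>C2\<close> is inside,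
  leaves the sieve, or stays outside. In the last two cases it is sent to the only arrow with the
  required source and the terminal object as target.\<close>

lemma collapse_functor: "cat_functor C2 (with_terminal C1) (collapse A C2 F2 F1)"
proof -
  interpret X: small_category "with_terminal C1"
    by (rule mapping_cylinder_category) (rule to_One_functor, rule F1.T.small_category_axioms)
  have inj: "inj_on (onObj F2) (Obj A)" using F2 by (simp add: sieve_inclusion_def)
  show ?thesis
  proof
    fix y assume "y \<in> Obj C2"
    then show "onObj (collapse A C2 F2 F1) y \<in> Obj (with_terminal C1)"
      by (cases "y \<in> onObj F2 ` Obj A")
        (auto simp: collapse_image collapse_outside mapping_cylinder_def F1.onObj_in One_cat_def)
    show "onArr (collapse A C2 F2 F1) (Ident C2 y) = Ident (with_terminal C1) (onObj (collapse A C2 F2 F1) y)"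
    proof (cases "y \<in> onObj F2 ` Obj A")
      case True
      then obtain a where a: "a \<in> Obj A" "y = onObj F2 a" by auto
      then have "onArr (collapse A C2 F2 F1) (onArr F2 (Ident A a)) = Left_arr (onArr F1 (Ident A a))"
        by (simp add: collapse_image F1.S.Ident_in)
      then show ?thesis
        using a by (simp add: collapse_image F2.onArr_Ident F1.onArr_Ident mapping_cylinder_def)
    next
      case False
      then show ?thesis
        using \<open>y \<in> Obj C2\<close>
        by (simp add: collapse_outside F2.T.Src_Ident F2.T.Tgt_Ident mapping_cylinder_def One_cat_def)
    qed
  next
    fix g assume g: "g \<in> Arr C2"
    show "onArr (collapse A C2 F2 F1) g \<in> Arr (with_terminal C1)"
      "Src (with_terminal C1) (onArr (collapse A C2 F2 F1) g) = onObj (collapse A C2 F2 F1) (Src C2 g)"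
      "Tgt (with_terminal C1) (onArr (collapse A C2 F2 F1) g) = onObj (collapse A C2 F2 F1) (Tgt C2 g)"
      using g
      by (cases rule: collapse_cases;
          auto simp: collapse_image collapse_outside mapping_cylinder_def One_cat_def to_One_def F1.onArr_in
            F1.onObj_in F1.Src_onArr F1.Tgt_onArr F2.Src_onArr F2.Tgt_onArr F1.S.Src_in F1.S.Tgt_in)+
  next
    fix f g assume f: "f \<in> Arr C2" and g: "g \<in> Arr C2" and fg: "Tgt C2 f = Src C2 g"
    show "onArr (collapse A C2 F2 F1) (Comp C2 g f) =
      Comp (with_terminal C1) (onArr (collapse A C2 F2 F1) g) (onArr (collapse A C2 F2 F1) f)"
      using g
    proof (cases rule: collapse_cases)
      case (inside b)
      then obtain a where a: "a \<in> Arr A" "f = onArr F2 a"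
        using f fg sieve_Src_image by (cases rule: collapse_cases[OF f]) auto
      have "Tgt A a = Src A b"
        using fg a inside inj by (simp add: F2.Src_onArr F2.Tgt_onArr inj_on_def F1.S.Src_in F1.S.Tgt_in)
      then have "Comp C2 g f = onArr F2 (Comp A b a)" "Comp A b a \<in> Arr A"
        "onArr F1 (Comp A b a) = Comp C1 (onArr F1 b) (onArr F1 a)"
        using a inside by (auto simp: F2.onArr_Comp F1.S.Comp_in F1.onArr_Comp)
      then show ?thesis
        using a inside by (simp add: collapse_image mapping_cylinder_def)
    next
      case (cross c)
      then obtain a where a: "a \<in> Arr A" "f = onArr F2 a"
        using f fg by (cases rule: collapse_cases[OF f]) auto
      then have 1: "Src C2 (Comp C2 g f) = onObj F2 (Src A a)" "Tgt C2 (Comp C2 g f) = Tgt C2 g"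
        using f g fg by (auto simp: F2.T.Src_Comp F2.T.Tgt_Comp F2.Src_onArr)
      have "onArr (collapse A C2 F2 F1) (Comp C2 g f) = Mixed (onObj F1 (Src A a)) ()"
        using a 1 cross by (intro collapse_outside(3)) (auto simp: F1.S.Src_in)
      then show ?thesis
        using a cross
        by (simp add: collapse_image collapse_outside(3) mapping_cylinder_def One_cat_def F1.Src_onArr)
    next
      case outside
      have 1: "Src C2 (Comp C2 g f) = Src C2 f" "Tgt C2 (Comp C2 g f) = Tgt C2 g"
        using f g fg by (auto simp: F2.T.Src_Comp F2.T.Tgt_Comp)
      show ?thesis
        using f
      proof (cases rule: collapse_cases)
        case (inside b)
        then show ?thesis using outside fg sieve_Tgt_image by force
      next
        case (cross a)
        then show ?thesis
          using outside 1 collapse_outside(2)[of g] collapse_outside(3)[of f a] collapse_outside(3)[of "Comp C2 g f" a]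
          by (simp add: mapping_cylinder_def One_cat_def)
      next
        case outside
        then show ?thesis
          using \<open>Tgt C2 g \<notin> _\<close> fg 1 collapse_outside(2)[of f] collapse_outside(2)[of g] collapse_outside(2)[of "Comp C2 g f"]
          by (simp add: mapping_cylinder_def One_cat_def)
      qed
    qed
  qed
qed

text \<open>A test functor replaces the word problem in the pushout: the functor induced by the
  inclusion of \<open>C1\<close> and by \<open>collapse\<close> is a left inverse on the image of
  \<open>C1\<close>, and it sends an arrow of \<open>C2\<close> into the copy of \<open>C1\<close>
  only if that arrow comes from \<open>A\<close>.\<close>

lemma po_in1_separated:
  "x \<in> Obj C1 \<Longrightarrow> x' \<in> Obj C1 \<Longrightarrow> onObj (po_in1 A C1 C2 F1 F2) x = onObj (po_in1 A C1 C2 F1 F2) x' \<Longrightarrow> x = x'"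
  "f \<in> Arr C1 \<Longrightarrow> f' \<in> Arr C1 \<Longrightarrow> onArr (po_in1 A C1 C2 F1 F2) f = onArr (po_in1 A C1 C2 F1 F2) f' \<Longrightarrow> f = f'"
  "x \<in> Obj C1 \<Longrightarrow> y \<in> Obj C2 \<Longrightarrow> onObj (po_in1 A C1 C2 F1 F2) x = onObj (po_in2 A C1 C2 F1 F2) y
    \<Longrightarrow> \<exists>a\<in>Obj A. x = onObj F1 a \<and> y = onObj F2 a"
  "f \<in> Arr C1 \<Longrightarrow> g \<in> Arr C2 \<Longrightarrow> onArr (po_in1 A C1 C2 F1 F2) f = onArr (po_in2 A C1 C2 F1 F2) g
    \<Longrightarrow> \<exists>a\<in>Arr A. f = onArr F1 a \<and> g = onArr F2 a"
proof -
  have V: "cat_functor C1 (with_terminal C1) cyl_left"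
    by (rule mapping_cylinder_cocone(1), rule to_One_functor, rule F1.T.small_category_axioms)
  have UV: "func_eq A (cyl_left \<circ>\<^sub>F F1) (collapse A C2 F2 F1 \<circ>\<^sub>F F2)"
    by (simp add: func_eq_def collapse_image cyl_left_def)
  define W where "W = po_induced (with_terminal C1) cyl_left (collapse A C2 F2 F1)"
  have W1: "func_eq C1 (W \<circ>\<^sub>F po_in1 A C1 C2 F1 F2) cyl_left"
    and W2: "func_eq C2 (W \<circ>\<^sub>F po_in2 A C1 C2 F1 F2) (collapse A C2 F2 F1)"
    using po_induced_in1[OF F1 F2.cat_functor_axioms V collapse_functor UV]
      po_induced_in2[OF F1 F2.cat_functor_axioms V collapse_functor UV] by (auto simp: W_def)
  then have o1: "onObj W (onObj (po_in1 A C1 C2 F1 F2) x) = Inl x" if "x \<in> Obj C1" for x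
    using that by (auto simp: func_eq_def cyl_left_def)
  have a1: "onArr W (onArr (po_in1 A C1 C2 F1 F2) f) = Left_arr f" if "f \<in> Arr C1" for f
    using that W1 by (auto simp: func_eq_def cyl_left_def)
  have o2: "onObj W (onObj (po_in2 A C1 C2 F1 F2) y) = onObj (collapse A C2 F2 F1) y" if "y \<in> Obj C2" for y
    using that W2 by (auto simp: func_eq_def)
  have a2: "onArr W (onArr (po_in2 A C1 C2 F1 F2) g) = onArr (collapse A C2 F2 F1) g" if "g \<in> Arr C2" for g
    using that W2 by (auto simp: func_eq_def)
  show "x \<in> Obj C1 \<Longrightarrow> x' \<in> Obj C1 \<Longrightarrow> onObj (po_in1 A C1 C2 F1 F2) x = onObj (po_in1 A C1 C2 F1 F2) x' \<Longrightarrow> x = x'"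
    using o1 by (metis Inl_inject)
  show "f \<in> Arr C1 \<Longrightarrow> f' \<in> Arr C1 \<Longrightarrow> onArr (po_in1 A C1 C2 F1 F2) f = onArr (po_in1 A C1 C2 F1 F2) f' \<Longrightarrow> f = f'"
    using a1 by (metis cyl_arr.inject(1))
  show "\<exists>a\<in>Obj A. x = onObj F1 a \<and> y = onObj F2 a"
    if "x \<in> Obj C1" "y \<in> Obj C2" "onObj (po_in1 A C1 C2 F1 F2) x = onObj (po_in2 A C1 C2 F1 F2) y"
  proof -
    have e: "onObj (collapse A C2 F2 F1) y = Inl x" using that o1 o2 by metis
    then obtain a where "a \<in> Obj A" "y = onObj F2 a"
      using collapse_outside(1) by fastforce
    then show ?thesis using e collapse_image(1) by auto
  qed
  show "\<exists>a\<in>Arr A. f = onArr F1 a \<and> g = onArr F2 a"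
    if "f \<in> Arr C1" and g: "g \<in> Arr C2" and "onArr (po_in1 A C1 C2 F1 F2) f = onArr (po_in2 A C1 C2 F1 F2) g"
  proof -
    have e: "onArr (collapse A C2 F2 F1) g = Left_arr f" using that a1 a2 by metis
    show ?thesis
      using g e by (cases rule: collapse_cases) (auto simp: collapse_image collapse_outside)
  qed
qed

end

text \<open>The test functor now retains \<open>C2\<close> and collapses \<open>C1\<close>.\<close>

lemma po_in2_separated:
  assumes F1: "sieve_inclusion A C1 F1" and F2: "cat_functor A C2 F2"
  shows
    "x \<in> Obj C2 \<Longrightarrow> x' \<in> Obj C2 \<Longrightarrow> onObj (po_in2 A C1 C2 F1 F2) x = onObj (po_in2 A C1 C2 F1 F2) x' \<Longrightarrow> x = x'"
    "f \<in> Arr C2 \<Longrightarrow> f' \<in> Arr C2 \<Longrightarrow> onArr (po_in2 A C1 C2 F1 F2) f = onArr (po_in2 A C1 C2 F1 F2) f' \<Longrightarrow> f = f'"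
proof -
  interpret F1: cat_functor A C1 F1 using F1 by (simp add: sieve_inclusion_def)
  interpret F2: cat_functor A C2 F2 by (rule F2)
  have V: "cat_functor C2 (with_terminal C2) cyl_left"
    by (rule mapping_cylinder_cocone(1), rule to_One_functor, rule F2.T.small_category_axioms)
  have UV: "func_eq A (collapse A C1 F1 F2 \<circ>\<^sub>F F1) (cyl_left \<circ>\<^sub>F F2)"
    by (simp add: func_eq_def collapse_image[OF F2 F1] cyl_left_def)
  define W where "W = po_induced (with_terminal C2) (collapse A C1 F1 F2) cyl_left"
  have "func_eq C2 (W \<circ>\<^sub>F po_in2 A C1 C2 F1 F2) cyl_left"
    using po_induced_in2[OF F1.cat_functor_axioms F2 collapse_functor[OF F2 F1] V UV] by (auto simp: W_def)
  then have o1: "\<And>x. x \<in> Obj C2 \<Longrightarrow> onObj W (onObj (po_in2 A C1 C2 F1 F2) x) = Inl x"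
    and a1: "\<And>f. f \<in> Arr C2 \<Longrightarrow> onArr W (onArr (po_in2 A C1 C2 F1 F2) f) = Left_arr f"
    by (auto simp: func_eq_def cyl_left_def)
  show "x \<in> Obj C2 \<Longrightarrow> x' \<in> Obj C2 \<Longrightarrow> onObj (po_in2 A C1 C2 F1 F2) x = onObj (po_in2 A C1 C2 F1 F2) x' \<Longrightarrow> x = x'"
    using o1 by (metis Inl_inject)
  show "f \<in> Arr C2 \<Longrightarrow> f' \<in> Arr C2 \<Longrightarrow> onArr (po_in2 A C1 C2 F1 F2) f = onArr (po_in2 A C1 C2 F1 F2) f' \<Longrightarrow> f = f'"
    using a1 by (metis cyl_arr.inject(1))
qed

text \<open>The properties of a pushout of two sieve inclusions that matter for nerves, in a form
  symmetric in the legs, so that a fact is proved for one leg and transferred to the other.\<close>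

locale sieve_square =
  F1: cat_functor A C1 F1 + F2: cat_functor A C2 F2 + J1: cat_functor C1 P j1 + J2: cat_functor C2 P j2
  for A :: "('o, 'a) category" and C1 :: "('p, 'b) category" and C2 :: "('q, 'c) category"
    and P :: "('r, 'd) category"
    and F1 :: "('o, 'a, 'p, 'b) func" and F2 :: "('o, 'a, 'q, 'c) func"
    and j1 :: "('p, 'b, 'r, 'd) func" and j2 :: "('q, 'c, 'r, 'd) func" +
  assumes sieve1: "sieve_inclusion A C1 F1" and sieve2: "sieve_inclusion A C2 F2"
    and commutes: "func_eq A (j1 \<circ>\<^sub>F F1) (j2 \<circ>\<^sub>F F2)"
    and inj_Obj1: "inj_on (onObj j1) (Obj C1)" and inj_Obj2: "inj_on (onObj j2) (Obj C2)"
    and inj_Arr1: "inj_on (onArr j1) (Arr C1)" and inj_Arr2: "inj_on (onArr j2) (Arr C2)"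
    and meet_Obj: "\<lbrakk>x \<in> Obj C1; y \<in> Obj C2; onObj j1 x = onObj j2 y\<rbrakk>
      \<Longrightarrow> \<exists>a\<in>Obj A. x = onObj F1 a \<and> y = onObj F2 a"
    and meet_Arr: "\<lbrakk>f \<in> Arr C1; g \<in> Arr C2; onArr j1 f = onArr j2 g\<rbrakk>
      \<Longrightarrow> \<exists>a\<in>Arr A. f = onArr F1 a \<and> g = onArr F2 a"
    and cover_Obj: "Obj P \<subseteq> onObj j1 ` Obj C1 \<union> onObj j2 ` Obj C2"
    and cover_Arr: "Arr P \<subseteq> onArr j1 ` Arr C1 \<union> onArr j2 ` Arr C2"

lemma sieve_square_sym:
  assumes "sieve_square A C1 C2 P F1 F2 j1 j2"
  shows "sieve_square A C2 C1 P F2 F1 j2 j1"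
proof -
  interpret sieve_square A C1 C2 P F1 F2 j1 j2 by fact
  show ?thesis
    by unfold_locales
      (fact sieve1 sieve2 func_eq_sym[OF commutes] inj_Obj1 inj_Obj2 inj_Arr1 inj_Arr2
        cover_Obj[unfolded Un_commute[of "onObj j1 ` _"]] cover_Arr[unfolded Un_commute[of "onArr j1 ` _"]]
      | (use meet_Obj meet_Arr in metis))+
qed

context sieve_square
begin

text \<open>If \<open>f\<close> comes from the other leg, its target lies in both legs, hence in
  \<open>A\<close>; as \<open>A\<close> is a sieve there, \<open>f\<close> itself comes from
  \<open>A\<close> and so from \<open>C1\<close>.\<close>

lemma extend_string1:
  assumes "f \<in> Arr P" "is_string C1 y gs" "Tgt P f = onObj j1 y"
  shows "\<exists>g\<in>Arr C1. Tgt C1 g = y \<and> f = onArr j1 g"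
proof -
  have y: "y \<in> Obj C1" using assms(2) by (rule is_string_Obj)
  have "f \<in> onArr j1 ` Arr C1"
  proof (cases "f \<in> onArr j2 ` Arr C2")
    case True
    then obtain g where g: "g \<in> Arr C2" "f = onArr j2 g" by auto
    then have "\<exists>a\<in>Obj A. y = onObj F1 a \<and> Tgt C2 g = onObj F2 a"
      using assms(3) y by (intro meet_Obj) (auto simp: J2.Tgt_onArr F2.T.Tgt_in)
    then have "g \<in> onArr F2 ` Arr A"
      using sieve2 g by (auto simp: sieve_inclusion_def)
    then show ?thesis
      using commutes g by (auto simp: func_eq_def image_iff) (metis F1.onArr_in)
  qed (use cover_Arr assms(1) in auto)
  then show ?thesis
    using assms(3) y inj_Obj1 by (auto simp: J1.Tgt_onArr inj_on_def F1.T.Tgt_in) (metis F1.T.Tgt_in)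
qed

end

lemma (in sieve_square) extend_string2:
  assumes "f \<in> Arr P" "is_string C2 y gs" "Tgt P f = onObj j2 y"
  shows "\<exists>g\<in>Arr C2. Tgt C2 g = y \<and> f = onArr j2 g"
  by (rule sieve_square.extend_string1[OF sieve_square_sym[OF sieve_square_axioms] assms])

context sieve_square
begin

text \<open>Induction from the end of the string: the leg that contains the tail contains every
  arrow into the first object of the tail. In a general pushout a string may pass from one leg to
  the other, and the nerve is then larger than the union.\<close>

lemma string_cover:
  assumes "is_string P x fs"
  shows "(\<exists>y gs. is_string C1 y gs \<and> x = onObj j1 y \<and> fs = map (onArr j1) gs) \<or>
    (\<exists>y gs. is_string C2 y gs \<and> x = onObj j2 y \<and> fs = map (onArr j2) gs)"
  using assms
proof (induction fs arbitrary: x)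
  case Nil
  then have "x \<in> onObj j1 ` Obj C1 \<union> onObj j2 ` Obj C2" using cover_Obj by auto
  then show ?case
    by (metis UnE imageE is_string.simps(1) list.map(1))
next
  case (Cons f fs)
  then have f: "f \<in> Arr P" "Src P f = x" by auto
  have "is_string P (Tgt P f) fs" using Cons.prems by simp
  from Cons.IH[OF this] consider (1) y gs where "is_string C1 y gs" "Tgt P f = onObj j1 y" "fs = map (onArr j1) gs"
    | (2) y gs where "is_string C2 y gs" "Tgt P f = onObj j2 y" "fs = map (onArr j2) gs"
    by metis
  then show ?case
  proof cases
    case 1
    then obtain g where "g \<in> Arr C1" "Tgt C1 g = y" "f = onArr j1 g"
      using extend_string1[OF f(1)] by blast
    then show ?thesis
      using 1 f by (intro disjI1 exI[of _ "Src C1 g"] exI[of _ "g # gs"]) (auto simp: J1.Src_onArr F1.T.Src_in)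
  next
    case 2
    then obtain g where "g \<in> Arr C2" "Tgt C2 g = y" "f = onArr j2 g"
      using extend_string2[OF f(1)] by blast
    then show ?thesis
      using 2 f by (intro disjI2 exI[of _ "Src C2 g"] exI[of _ "g # gs"]) (auto simp: J2.Src_onArr F2.T.Src_in)
  qed
qed

lemma string_meet:
  assumes "is_string C1 y gs" "is_string C2 z hs" "onObj j1 y = onObj j2 z" "map (onArr j1) gs = map (onArr j2) hs"
  shows "\<exists>a as. is_string A a as \<and> y = onObj F1 a \<and> gs = map (onArr F1) as \<and>
    z = onObj F2 a \<and> hs = map (onArr F2) as"
  using assms
proof (induction gs arbitrary: y z hs)
  case Nil
  then show ?case using meet_Obj by fastforce
next
  case (Cons g gs)
  then obtain h hs' where hs: "hs = h # hs'" by auto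
  then have gh: "g \<in> Arr C1" "h \<in> Arr C2" "onArr j1 g = onArr j2 h" using Cons.prems by auto
  then obtain a where a: "a \<in> Arr A" "g = onArr F1 a" "h = onArr F2 a" using meet_Arr by blast
  have "\<exists>b as. is_string A b as \<and> Tgt C1 g = onObj F1 b \<and> gs = map (onArr F1) as \<and>
    Tgt C2 h = onObj F2 b \<and> hs' = map (onArr F2) as"
    using Cons.prems hs gh by (intro Cons.IH) (auto simp: J1.Tgt_onArr[symmetric] J2.Tgt_onArr[symmetric])
  then obtain b as where b: "is_string A b as" "Tgt C1 g = onObj F1 b" "gs = map (onArr F1) as"
    "hs' = map (onArr F2) as" by blast
  have "b = Tgt A a"
    using b a sieve1 is_string_Obj[OF b(1)]
    by (auto simp: F1.Tgt_onArr sieve_inclusion_def inj_on_def F1.S.Tgt_in)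
  then show ?case
    using a b hs Cons.prems
    by (intro exI[of _ "Src A a"] exI[of _ "a # as"]) (auto simp: F1.S.Src_in F1.Src_onArr F2.Src_onArr)
qed

lemma string_inj1:
  assumes "is_string C1 y gs" "is_string C1 z hs" "onObj j1 y = onObj j1 z" "map (onArr j1) gs = map (onArr j1) hs"
  shows "y = z" "gs = hs"
proof -
  show "y = z" using assms inj_Obj1 by (auto simp: inj_on_def dest: is_string_Obj)
  show "gs = hs"
    using assms inj_Arr1 is_string_Arr by (metis inj_on_map_eq_map inj_on_subset le_sup_iff)
qed

end

text \<open>A composite of arrows from different legs passes through an object of \<open>A\<close>.
  By the sieve property the earlier factor comes from \<open>A\<close>, so both factors lie in the
  leg of the later one; hence the arrows of the legs are already closed under composition.\<close>

lemma sieve_square_pushout: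
  assumes F1: "sieve_inclusion A C1 F1" and F2: "sieve_inclusion A C2 F2"
  shows "sieve_square A C1 C2 (cat_pushout A C1 C2 F1 F2) F1 F2 (po_in1 A C1 C2 F1 F2) (po_in2 A C1 C2 F1 F2)"
proof -
  interpret F1: cat_functor A C1 F1 using F1 by (simp add: sieve_inclusion_def)
  interpret F2: cat_functor A C2 F2 using F2 by (simp add: sieve_inclusion_def)
  let ?j1 = "po_in1 A C1 C2 F1 F2" and ?j2 = "po_in2 A C1 C2 F1 F2" and ?P = "cat_pushout A C1 C2 F1 F2"
  let ?po = "po_presentation A C1 C2 F1 F2"
  note Ff = F1.cat_functor_axioms F2.cat_functor_axioms
  interpret J1: cat_functor C1 ?P ?j1 by (rule po_in1_functor[OF Ff])
  interpret J2: cat_functor C2 ?P ?j2 by (rule po_in2_functor[OF Ff])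
  note comm = po_commutes[OF Ff]
  note sep1 = po_in1_separated[OF Ff(1) F2] and sep2 = po_in2_separated[OF F1 Ff(2)]
  have cov: "path_arr ?po x p \<in> onArr ?j1 ` Arr C1 \<union> onArr ?j2 ` Arr C2" if "is_path ?po x p" for x p
    using that
  proof (induction p arbitrary: x)
    case Nil
    then consider y where "y \<in> Obj C1" "x = onObj ?j1 y" | y where "y \<in> Obj C2" "x = onObj ?j2 y"
      by (auto simp: po_Vert[OF Ff] po_in1_def po_in2_def)
    then show ?case
    proof cases
      case (1 y)
      then show ?thesis
        using J1.onArr_Ident[of y] F1.T.Ident_in[of y] by (auto simp: cat_pushout_def intro!: image_eqI)
    next
      case (2 y)
      then show ?thesis
        using J2.onArr_Ident[of y] F2.T.Ident_in[of y] by (auto simp: cat_pushout_def intro!: image_eqI)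
    qed
  next
    case (Cons e p)
    have pe: "path_arr ?po x (e # p) = Comp ?P (path_arr ?po (Gtgt ?po e) p) (gen_arr ?po e)"
      using presented_Comp[of ?po x "[e]" p] Cons.prems is_path_Vert[of ?po "Gtgt ?po e" p]
      by (auto simp: cat_pushout_def gen_arr_def)
    have e: "Src ?P (path_arr ?po (Gtgt ?po e) p) = Tgt ?P (gen_arr ?po e)"
      by (simp add: cat_pushout_def gen_arr_def)
    have tail: "path_arr ?po (Gtgt ?po e) p \<in> onArr ?j1 ` Arr C1 \<union> onArr ?j2 ` Arr C2"
      using Cons by auto
    have "e \<in> Arr C1 <+> Arr C2" using Cons.prems by (auto simp: po_Gen[OF Ff])
    then have head: "gen_arr ?po e \<in> onArr ?j1 ` Arr C1 \<union> onArr ?j2 ` Arr C2"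
      by (auto simp: po_in1_def po_in2_def)
    have same1: "Comp ?P (onArr ?j1 g) (onArr ?j1 f) \<in> onArr ?j1 ` Arr C1"
      if "f \<in> Arr C1" "g \<in> Arr C1" "Src ?P (onArr ?j1 g) = Tgt ?P (onArr ?j1 f)" for f g
    proof -
      have "Tgt C1 f = Src C1 g"
        using that sep1(1)[of "Tgt C1 f" "Src C1 g"] by (simp add: J1.Src_onArr J1.Tgt_onArr F1.T.Src_in F1.T.Tgt_in)
      then show ?thesis
        using that J1.onArr_Comp[of f g] F1.T.Comp_in[of f g] by (metis image_eqI)
    qed
    have same2: "Comp ?P (onArr ?j2 g) (onArr ?j2 f) \<in> onArr ?j2 ` Arr C2"
      if "f \<in> Arr C2" "g \<in> Arr C2" "Src ?P (onArr ?j2 g) = Tgt ?P (onArr ?j2 f)" for f g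
    proof -
      have "Tgt C2 f = Src C2 g"
        using that sep2(1)[of "Tgt C2 f" "Src C2 g"] by (simp add: J2.Src_onArr J2.Tgt_onArr F2.T.Src_in F2.T.Tgt_in)
      then show ?thesis
        using that J2.onArr_Comp[of f g] F2.T.Comp_in[of f g] by (metis image_eqI)
    qed
    have jA: "onArr ?j1 (onArr F1 a) = onArr ?j2 (onArr F2 a)" if "a \<in> Arr A" for a
      using comm that by (simp add: func_eq_def)
    from head tail e show ?case
      unfolding pe
    proof (elim UnE imageE)
      fix f g assume fg: "gen_arr ?po e = onArr ?j1 f" "f \<in> Arr C1"
        "path_arr ?po (Gtgt ?po e) p = onArr ?j2 g" "g \<in> Arr C2"
      then have "\<exists>a\<in>Obj A. Tgt C1 f = onObj F1 a \<and> Src C2 g = onObj F2 a"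
        using e by (intro sep1(3)) (auto simp: J1.Tgt_onArr J2.Src_onArr F1.T.Tgt_in F2.T.Src_in)
      then obtain a where "a \<in> Arr A" "f = onArr F1 a"
        using F1 fg by (auto simp: sieve_inclusion_def)
      then show "Comp ?P (path_arr ?po (Gtgt ?po e) p) (gen_arr ?po e) \<in> onArr ?j1 ` Arr C1 \<union> onArr ?j2 ` Arr C2"
        using fg e same2[of "onArr F2 a" g] jA by (auto simp: F2.onArr_in)
    next
      fix f g assume fg: "gen_arr ?po e = onArr ?j2 f" "f \<in> Arr C2"
        "path_arr ?po (Gtgt ?po e) p = onArr ?j1 g" "g \<in> Arr C1"
      then have "\<exists>a\<in>Obj A. Src C1 g = onObj F1 a \<and> Tgt C2 f = onObj F2 a"
        using e by (intro sep1(3)) (auto simp: J2.Tgt_onArr J1.Src_onArr F2.T.Tgt_in F1.T.Src_in)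
      then obtain a where "a \<in> Arr A" "f = onArr F2 a"
        using F2 fg by (auto simp: sieve_inclusion_def)
      then show "Comp ?P (path_arr ?po (Gtgt ?po e) p) (gen_arr ?po e) \<in> onArr ?j1 ` Arr C1 \<union> onArr ?j2 ` Arr C2"
        using fg e same1[of "onArr F1 a" g] jA by (auto simp: F1.onArr_in)
    qed (use same1 same2 in auto)
  qed
  show ?thesis
  proof
    show "Arr ?P \<subseteq> onArr ?j1 ` Arr C1 \<union> onArr ?j2 ` Arr C2"
      using cov by (fastforce simp: cat_pushout_def presented_Arr)
    show "Obj ?P \<subseteq> onObj ?j1 ` Obj C1 \<union> onObj ?j2 ` Obj C2"
      by (auto simp: cat_pushout_def po_Vert[OF Ff] po_in1_def po_in2_def)
  qed (use F1 F2 comm sep1 sep2 in \<open>auto simp: inj_on_def\<close>)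
qed

section \<open>Geometric realization\<close>

abbreviation simplex_space :: "nat \<Rightarrow> (nat \<Rightarrow> real) topology"
  where "simplex_space n \<equiv> subtopology (powertop_real UNIV) (standard_simplex n)"

definition pt :: "'s simplicial_set \<Rightarrow> nat \<Rightarrow> 's \<Rightarrow> (nat \<Rightarrow> real) \<Rightarrow> (nat \<times> 's \<times> (nat \<Rightarrow> real)) set"
  where "pt X n x t = realization_rel X `` {(n, x, t)}"

definition is_simplicial_map :: "'r simplicial_set \<Rightarrow> 's simplicial_set \<Rightarrow> ('r \<Rightarrow> 's) \<Rightarrow> bool"
  where "is_simplicial_map X Y \<phi> \<longleftrightarrow> (\<forall>n. \<forall>x\<in>Smp X n. \<phi> x \<in> Smp Y n) \<and>
    (\<forall>m n \<theta> x. \<theta> \<in> monotone_maps m n \<longrightarrow> x \<in> Smp X n \<longrightarrow> \<phi> (Act X m n \<theta> x) = Act Y m n \<theta> (\<phi> x))"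

lemma topspace_simplex_space [simp]: "topspace (simplex_space n) = standard_simplex n"
  by simp

text \<open>Summation over the fibres of \<open>\<theta>\<close>. The predicate \<open>P\<close>
  lets one formula serve both the total weight and the weight at a single object.\<close>

lemma sum_simplex_push:
  assumes "\<theta> \<in> monotone_maps m n"
  shows "(\<Sum>j\<le>n. if P j then simplex_push m \<theta> t j else 0) = (\<Sum>i\<le>m. if P (\<theta> i) then t i else 0)"
proof -
  have "(\<Sum>j\<le>n. \<Sum>i\<in>{i \<in> {..m}. \<theta> i = j}. if P (\<theta> i) then t i else 0) =
      (\<Sum>i\<le>m. if P (\<theta> i) then t i else 0)"
    using assms by (intro sum.group) (auto simp: monotone_maps_def)
  moreover have "(\<Sum>i\<in>{i \<in> {..m}. \<theta> i = j}. if P (\<theta> i) then t i else 0) =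
      (if P j then simplex_push m \<theta> t j else 0)" for j
    by (auto simp: simplex_push_def intro!: sum.cong sum.neutral)
  ultimately show ?thesis by simp
qed

lemma simplex_push_pos_iff:
  assumes "t \<in> standard_simplex m"
  shows "simplex_push m \<theta> t j > 0 \<longleftrightarrow> (\<exists>i\<le>m. \<theta> i = j \<and> t i > 0)"
proof -
  let ?I = "{i. i \<le> m \<and> \<theta> i = j}"
  have t: "t i \<ge> 0" for i using assms by (simp add: standard_simplex_def)
  then have z: "sum t ?I = 0 \<longleftrightarrow> (\<forall>i\<in>?I. t i = 0)" and "sum t ?I \<ge> 0"
    by (intro sum_nonneg_eq_0_iff sum_nonneg; simp)+
  then have "sum t ?I > 0 \<longleftrightarrow> \<not> (\<forall>i\<in>?I. t i = 0)" by linarith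
  moreover have "t i = 0 \<longleftrightarrow> \<not> t i > 0" for i using t[of i] by linarith
  ultimately have "sum t ?I > 0 \<longleftrightarrow> (\<exists>i\<in>?I. t i > 0)" by simp
  then have "sum t ?I > 0 \<longleftrightarrow> (\<exists>i\<le>m. \<theta> i = j \<and> t i > 0)" by blast
  then show ?thesis unfolding simplex_push_def .
qed

lemma simplex_push_in:
  assumes t: "t \<in> standard_simplex m" and \<theta>: "\<theta> \<in> monotone_maps m n"
  shows "simplex_push m \<theta> t \<in> standard_simplex n"
proof -
  have pos: "t i \<ge> 0" for i using t by (simp add: standard_simplex_def)
  have sm: "(\<Sum>i\<le>m. t i) = 1" using t by (simp add: standard_simplex_def)
  have "simplex_push m \<theta> t j \<le> (\<Sum>i\<le>m. t i)" for j
    unfolding simplex_push_def by (rule sum_mono2) (auto simp: pos)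
  moreover have "simplex_push m \<theta> t j = 0" if "j > n" for j
  proof -
    have "{i. i \<le> m \<and> \<theta> i = j} = {}" using that \<theta> by (auto simp: monotone_maps_def)
    then show ?thesis unfolding simplex_push_def by (simp only: sum.empty)
  qed
  moreover have "simplex_push m \<theta> t j \<ge> 0" for j
    unfolding simplex_push_def by (rule sum_nonneg) (auto simp: pos)
  moreover have "(\<Sum>j\<le>n. simplex_push m \<theta> t j) = 1"
    using sum_simplex_push[OF \<theta>, of "\<lambda>_. True" t] sm by simp
  ultimately show ?thesis using sm by (simp add: standard_simplex_def)
qed

lemma topspace_realization_total:
  "topspace (realization_total X) = {(n, x, t). x \<in> Smp X n \<and> t \<in> standard_simplex n}"
  by (auto simp: realization_total_def)

lemma realization_rel_sym: "sym (realization_rel X)"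
  and realization_rel_trans: "trans (realization_rel X)"
  by (simp_all add: realization_rel_def Let_def sym_Un_converse sym_rtrancl trans_rtrancl)

lemma realization_rel_self [simp]: "(r, r) \<in> realization_rel X"
  by (simp add: realization_rel_def Let_def)

lemma realization_rel_invariant:
  assumes inv: "\<And>m n \<theta> x t. \<theta> \<in> monotone_maps m n \<Longrightarrow> x \<in> Smp X n \<Longrightarrow> t \<in> standard_simplex m
      \<Longrightarrow> \<phi> (m, Act X m n \<theta> x, t) = \<phi> (n, x, simplex_push m \<theta> t)"
    and "(r, r') \<in> realization_rel X"
  shows "\<phi> r = \<phi> r'"
  using assms(2) unfolding realization_rel_def Let_def
  by (induction rule: rtrancl_induct) (auto simp: inv)

lemma pt_eq_iff: "pt X n x t = pt X m y u \<longleftrightarrow> ((n, x, t), (m, y, u)) \<in> realization_rel X"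
proof
  assume "pt X n x t = pt X m y u"
  then have "(m, y, u) \<in> pt X n x t" by (simp add: pt_def)
  then show "((n, x, t), (m, y, u)) \<in> realization_rel X" by (simp add: pt_def)
qed (simp add: pt_def sym_trans_Image_eq[OF realization_rel_sym realization_rel_trans])

lemma pt_Act:
  assumes "\<theta> \<in> monotone_maps m n" "x \<in> Smp X n" "t \<in> standard_simplex m"
  shows "pt X m (Act X m n \<theta> x) t = pt X n x (simplex_push m \<theta> t)"
  unfolding pt_eq_iff unfolding realization_rel_def Let_def using assms by blast

lemma topspace_realization:
  "topspace (realization X) = {pt X n x t | n x t. x \<in> Smp X n \<and> t \<in> standard_simplex n}"
  unfolding realization_def topspace_quotient_topology topspace_realization_total quotient_def pt_def
  by auto

lemma pt_in: "x \<in> Smp X n \<Longrightarrow> t \<in> standard_simplex n \<Longrightarrow> pt X n x t \<in> topspace (realization X)"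
  by (auto simp: topspace_realization)

lemma continuous_map_sum_topology:
  assumes "\<And>i. i \<in> I \<Longrightarrow> continuous_map (X i) Y (\<lambda>x. f (i, x))"
  shows "continuous_map (sum_topology X I) Y f"
  unfolding continuous_map_def
proof (intro conjI allI impI)
  show "f \<in> topspace (sum_topology X I) \<rightarrow> topspace Y"
    using assms by (fastforce simp: continuous_map_def)
  fix U assume "openin Y U"
  then have "openin (X i) {x \<in> topspace (X i). f (i, x) \<in> U}" if "i \<in> I" for i
    using assms[OF that] by (simp add: continuous_map_def)
  then show "openin (sum_topology X I) {z \<in> topspace (sum_topology X I). f z \<in> U}"
    by (auto simp: openin_sum_topology)
qed

text \<open>The realization is a quotient of a disjoint sum of simplices, so continuity can be
  tested on one closed simplex at a time. This admits functions whose formula changes from simplex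
  to simplex, such as those with signs.\<close>

lemma continuous_map_realization:
  assumes "\<And>n x. x \<in> Smp X n \<Longrightarrow> continuous_map (simplex_space n) Y (\<lambda>t. f (pt X n x t))"
  shows "continuous_map (realization X) Y f"
proof -
  have "continuous_map (realization_total X) Y (f \<circ> (\<lambda>r. realization_rel X `` {r}))"
    unfolding realization_total_def
  proof (rule continuous_map_sum_topology)
    fix n
    let ?Z = "prod_topology (discrete_topology (Smp X n)) (simplex_space n)"
    have "continuous_map ?Z Y (\<lambda>(x, t). f (pt X n x t))"
      unfolding continuous_map_def
    proof (intro conjI allI impI)
      show "(\<lambda>(x, t). f (pt X n x t)) \<in> topspace ?Z \<rightarrow> topspace Y"
        using assms by (fastforce simp: continuous_map_def)
      fix U assume U: "openin Y U"
      have "{z \<in> topspace ?Z. (case z of (x, t) \<Rightarrow> f (pt X n x t)) \<in> U} =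
          (\<Union>x\<in>Smp X n. {x} \<times> {t \<in> standard_simplex n. f (pt X n x t) \<in> U})"
        by auto
      moreover have "openin ?Z ({x} \<times> {t \<in> standard_simplex n. f (pt X n x t) \<in> U})" if "x \<in> Smp X n" for x
        using assms[OF that] U that by (simp add: openin_prod_Times_iff continuous_map_def)
      ultimately show "openin ?Z {z \<in> topspace ?Z. (case z of (x, t) \<Rightarrow> f (pt X n x t)) \<in> U}"
        by auto
    qed
    then show "continuous_map ?Z Y (\<lambda>x. (f \<circ> (\<lambda>r. realization_rel X `` {r})) (n, x))"
      by (simp add: pt_def comp_def case_prod_unfold)
  qed
  then show ?thesis
    unfolding realization_def
    using continuous_compose_quotient_map quotient_map_quotient_topology by blast
qed

lemma continuous_map_pt:
  assumes "x \<in> Smp X n"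
  shows "continuous_map (simplex_space n) (realization X) (pt X n x)"
proof -
  have "continuous_map (simplex_space n) (prod_topology (discrete_topology (Smp X n)) (simplex_space n)) (\<lambda>t. (x, t))"
    using assms by (simp add: continuous_map_pairwise comp_def)
  moreover have "continuous_map (prod_topology (discrete_topology (Smp X n)) (simplex_space n))
      (realization_total X) (\<lambda>z. (n, z))"
    unfolding realization_total_def using continuous_map_component_injection[of n UNIV] by simp
  moreover have "continuous_map (realization_total X) (realization X) (\<lambda>r. realization_rel X `` {r})"
    unfolding realization_def by (rule quotient_imp_continuous_map[OF quotient_map_quotient_topology])
  ultimately have "continuous_map (simplex_space n) (realization X)
      ((\<lambda>r. realization_rel X `` {r}) \<circ> ((\<lambda>z. (n, z)) \<circ> (\<lambda>t. (x, t))))"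
    by (intro continuous_map_compose)
  then show ?thesis by (simp add: comp_def pt_def[abs_def])
qed

text \<open>Equivalent representatives have equivalent images, so the saturated image of a class is
  the class of the image of any representative.\<close>

lemma realization_map_pt:
  assumes \<phi>: "is_simplicial_map X Y \<phi>" and x: "x \<in> Smp X n" "t \<in> standard_simplex n"
  shows "realization_map Y \<phi> (pt X n x t) = pt Y n (\<phi> x) t"
proof -
  let ?f = "\<lambda>(n, x, t). (n, \<phi> x, t)"
  have "realization_rel Y `` {?f r} = realization_rel Y `` {?f r'}" if "(r, r') \<in> realization_rel X" for r r'
    by (rule realization_rel_invariant[OF _ that, of "\<lambda>r. realization_rel Y `` {?f r}"])
      (use \<phi> in \<open>auto simp: is_simplicial_map_def pt_Act[unfolded pt_def]\<close>)
  then have "realization_rel Y `` {?f r} = realization_rel Y `` {?f (n, x, t)}"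
    if "r \<in> realization_rel X `` {(n, x, t)}" for r
    using that by blast
  then have "(\<Union>r\<in>realization_rel X `` {(n, x, t)}. realization_rel Y `` {?f r}) = realization_rel Y `` {?f (n, x, t)}"
    using realization_rel_self[of "(n, x, t)" X] by blast
  moreover have "realization_rel Y `` (?f ` (realization_rel X `` {(n, x, t)})) =
      (\<Union>r\<in>realization_rel X `` {(n, x, t)}. realization_rel Y `` {?f r})"
    by blast
  ultimately have "realization_rel Y `` (?f ` (realization_rel X `` {(n, x, t)})) = realization_rel Y `` {(n, \<phi> x, t)}"
    by simp
  then show ?thesis by (simp add: realization_map_def pt_def)
qed

lemma continuous_realization_map:
  assumes "is_simplicial_map X Y \<phi>"
  shows "continuous_map (realization X) (realization Y) (realization_map Y \<phi>)"
proof (rule continuous_map_realization)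
  fix n x assume x: "x \<in> Smp X n"
  have "continuous_map (simplex_space n) (realization Y) (pt Y n (\<phi> x))"
    using assms x by (intro continuous_map_pt) (auto simp: is_simplicial_map_def)
  then show "continuous_map (simplex_space n) (realization Y) (\<lambda>t. realization_map Y \<phi> (pt X n x t))"
    by (rule continuous_map_eq) (use assms x in \<open>auto simp: realization_map_pt\<close>)
qed

definition class_val :: "('r \<Rightarrow> 'b) \<Rightarrow> 'r set \<Rightarrow> 'b"
  where "class_val \<phi> c = the_elem (\<phi> ` c)"

lemma class_val_pt:
  assumes inv: "\<And>m n \<theta> x t. \<theta> \<in> monotone_maps m n \<Longrightarrow> x \<in> Smp X n \<Longrightarrow> t \<in> standard_simplex m
      \<Longrightarrow> \<phi> (m, Act X m n \<theta> x, t) = \<phi> (n, x, simplex_push m \<theta> t)"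
  shows "class_val \<phi> (pt X n x t) = \<phi> (n, x, t)"
proof -
  have "\<phi> ` pt X n x t = {\<phi> (n, x, t)}"
    using realization_rel_invariant[of X \<phi>, OF inv] by (force simp: pt_def)
  then show ?thesis by (simp add: class_val_def)
qed

section \<open>Nerves\<close>

text \<open>The arrow between the vertices \<open>i\<close> and \<open>j\<close> of a string,
  meaningful for \<open>i \<le> j\<close>. In these terms an operator of the nerve merely
  substitutes indices.\<close>

definition string_arr :: "('o, 'a) category \<Rightarrow> 'o \<times> 'a list \<Rightarrow> nat \<Rightarrow> nat \<Rightarrow> 'a"
  where "string_arr C s i j = composite C (string_vertex C s i) (take (j - i) (drop i (snd s)))"

lemma string_vertex_Cons: "string_vertex C (x, f # fs) (Suc i) = string_vertex C (Tgt C f, fs) i"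
  by (cases i) auto

lemma string_vertex_tgt: "i \<le> length fs \<Longrightarrow> string_vertex C (x, fs) i = string_tgt C x (take i fs)"
proof (induction fs arbitrary: x i)
  case (Cons f fs)
  then show ?case by (cases i) (auto simp: string_vertex_Cons simp del: string_vertex.simps(2))
qed simp

lemma nerve_Smp: "s \<in> Smp (nerve C) n \<longleftrightarrow> is_string C (fst s) (snd s) \<and> length (snd s) = n"
  by (cases s) (simp add: nerve_def)

lemma nerve_map_Pair: "nerve_map F (x, fs) = (onObj F x, map (onArr F) fs)"
  by (simp add: nerve_map_def)

lemma nerve_Act: "Act (nerve C) m n \<theta> s = (string_vertex C s (\<theta> 0),
    map (\<lambda>i. string_arr C s (\<theta> i) (\<theta> (Suc i))) [0..<m])"
  by (simp add: nerve_def string_arr_def)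

context small_category
begin

lemma is_string_iff_nth:
  "is_string C x fs \<longleftrightarrow> x \<in> Obj C \<and>
    (\<forall>i<length fs. fs ! i \<in> Arr C \<and> Src C (fs ! i) = string_vertex C (x, fs) i)"
proof (induction fs arbitrary: x)
  case (Cons f fs)
  show ?case
    by (auto simp: Cons.IH All_less_Suc2 string_vertex_Cons Tgt_in simp del: string_vertex.simps(2))
qed auto

context
  fixes s n assumes s: "s \<in> Smp (nerve C) n"
begin

lemma string_vertex_Obj: "i \<le> n \<Longrightarrow> string_vertex C s i \<in> Obj C"
  using s is_string_iff_nth[of "fst s" "snd s"] Tgt_in by (cases i; cases s) (auto simp: nerve_Smp)

lemma string_drop:
  assumes "i \<le> n"
  shows "is_string C (string_vertex C s i) (drop i (snd s))"
proof -
  have "is_string C (fst s) (take i (snd s) @ drop i (snd s))" using s by (simp add: nerve_Smp)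
  then show ?thesis
    using assms s string_vertex_tgt[of i "snd s" C "fst s"] by (simp only: is_string_append) (simp add: nerve_Smp)
qed

lemma string_arr_string:
  assumes "i \<le> j" "j \<le> n"
  shows "is_string C (string_vertex C s i) (take (j - i) (drop i (snd s)))"
    "string_tgt C (string_vertex C s i) (take (j - i) (drop i (snd s))) = string_vertex C s j"
proof -
  have l: "length (snd s) = n" using s by (simp add: nerve_Smp)
  have "is_string C (string_vertex C s i) (take (j - i) (drop i (snd s)) @ drop (j - i) (drop i (snd s)))"
    using string_drop[of i] assms by (simp only: append_take_drop_id)
  then show "is_string C (string_vertex C s i) (take (j - i) (drop i (snd s)))"
    by (simp only: is_string_append)
  have "take j (snd s) = take i (snd s) @ take (j - i) (drop i (snd s))"
    using assms by (metis le_add_diff_inverse take_add)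
  then show "string_tgt C (string_vertex C s i) (take (j - i) (drop i (snd s))) = string_vertex C s j"
    using assms l string_vertex_tgt[of i "snd s" C "fst s"] string_vertex_tgt[of j "snd s" C "fst s"]
    by (simp add: string_tgt_append)
qed

lemma string_arr_props:
  assumes "i \<le> j" "j \<le> n"
  shows "string_arr C s i j \<in> Arr C" "Src C (string_arr C s i j) = string_vertex C s i"
    "Tgt C (string_arr C s i j) = string_vertex C s j"
  using composite_props[OF string_arr_string(1)[OF assms]] string_arr_string(2)[OF assms]
  by (auto simp: string_arr_def)

lemma string_arr_Comp:
  assumes "i \<le> j" "j \<le> k" "k \<le> n"
  shows "Comp C (string_arr C s j k) (string_arr C s i j) = string_arr C s i k"
proof -
  have "take (k - i) (drop i (snd s)) = take (j - i) (drop i (snd s)) @ take (k - j) (drop j (snd s))"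
    using assms take_add[of "j - i" "k - j" "drop i (snd s)"] by simp
  then show ?thesis
    using composite_append[of "string_vertex C s i" "take (j - i) (drop i (snd s))" "take (k - j) (drop j (snd s))"]
      assms string_arr_string[of i j] string_arr_string[of j k]
    by (simp add: string_arr_def)
qed

end

lemma string_arr_refl [simp]: "string_arr C s i i = Ident C (string_vertex C s i)"
  by (simp add: string_arr_def)

lemma string_arr_Suc:
  assumes "s \<in> Smp (nerve C) n" "i < n"
  shows "string_arr C s i (Suc i) = snd s ! i"
proof -
  have "snd s ! i \<in> Arr C" "Src C (snd s ! i) = string_vertex C s i"
    using assms is_string_iff_nth[of "fst s" "snd s"] by (auto simp: nerve_Smp)
  moreover have "take (Suc i - i) (drop i (snd s)) = [snd s ! i]"
    using assms by (auto simp: nerve_Smp take_Suc hd_drop_conv_nth)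
  ultimately show ?thesis by (simp add: string_arr_def Ident_Comp)
qed

context
  fixes s m n \<theta> assumes s: "s \<in> Smp (nerve C) n" and \<theta>: "\<theta> \<in> monotone_maps m n"
begin

lemma mono_le: "i \<le> j \<Longrightarrow> j \<le> m \<Longrightarrow> \<theta> i \<le> \<theta> j" "i \<le> m \<Longrightarrow> \<theta> i \<le> n"
  using \<theta> by (auto simp: monotone_maps_def mono_on_def)

lemma string_vertex_Act: "i \<le> m \<Longrightarrow> string_vertex C (Act (nerve C) m n \<theta> s) i = string_vertex C s (\<theta> i)"
  by (cases i) (auto simp: nerve_Act string_arr_props[OF s] mono_le)

lemma Act_Smp: "Act (nerve C) m n \<theta> s \<in> Smp (nerve C) m"
  unfolding nerve_Smp
proof
  have "string_vertex C (string_vertex C s (\<theta> 0), map (\<lambda>i. string_arr C s (\<theta> i) (\<theta> (Suc i))) [0..<m]) i =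
      string_vertex C s (\<theta> i)" if "i \<le> m" for i
    using string_vertex_Act[OF that] by (simp add: nerve_Act)
  then show "is_string C (fst (Act (nerve C) m n \<theta> s)) (snd (Act (nerve C) m n \<theta> s))"
    unfolding is_string_iff_nth
    by (simp add: nerve_Act string_vertex_Obj[OF s] mono_le string_arr_props[OF s])
qed (simp add: nerve_Act)

lemma string_arr_Act:
  assumes "i \<le> j" "j \<le> m"
  shows "string_arr C (Act (nerve C) m n \<theta> s) i j = string_arr C s (\<theta> i) (\<theta> j)"
  using assms
proof (induction j rule: dec_induct)
  case base
  then show ?case by (simp add: string_vertex_Act)
next
  case (step j)
  have "string_arr C (Act (nerve C) m n \<theta> s) i (Suc j) =
      Comp C (string_arr C (Act (nerve C) m n \<theta> s) j (Suc j)) (string_arr C (Act (nerve C) m n \<theta> s) i j)"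
    using step string_arr_Comp[OF Act_Smp, of i j "Suc j"] by simp
  also have "string_arr C (Act (nerve C) m n \<theta> s) j (Suc j) = string_arr C s (\<theta> j) (\<theta> (Suc j))"
    using step string_arr_Suc[OF Act_Smp] by (simp add: nerve_Act)
  finally show ?case using step string_arr_Comp[OF s] mono_le by simp
qed

end

end

context cat_functor
begin

lemma nerve_map_vertex:
  assumes "s \<in> Smp (nerve C) n" "i \<le> n"
  shows "string_vertex D (nerve_map F s) i = onObj F (string_vertex C s i)"
proof (cases i)
  case 0
  then show ?thesis by (cases s) (simp add: nerve_map_def)
next
  case (Suc k)
  then have "snd s ! k \<in> Arr C"
    using assms is_string_Arr[of C "fst s" "snd s"] by (auto simp: nerve_Smp)
  then show ?thesis using Suc assms by (cases s) (simp add: nerve_map_def nerve_Smp Tgt_onArr)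
qed

lemma nerve_map_Smp: "s \<in> Smp (nerve C) n \<Longrightarrow> nerve_map F s \<in> Smp (nerve D) n"
  by (simp add: nerve_Smp nerve_map_def map_string)

lemma nerve_map_arr:
  assumes s: "s \<in> Smp (nerve C) n" and ij: "i \<le> j" "j \<le> n"
  shows "string_arr D (nerve_map F s) i j = onArr F (string_arr C s i j)"
proof -
  have "take (j - i) (drop i (snd (nerve_map F s))) = map (onArr F) (take (j - i) (drop i (snd s)))"
    by (simp add: nerve_map_def take_map drop_map)
  then show ?thesis
    using s ij by (simp add: string_arr_def nerve_map_vertex map_string S.string_arr_string)
qed

lemma nerve_map_simplicial: "is_simplicial_map (nerve C) (nerve D) (nerve_map F)"
  unfolding is_simplicial_map_def
proof (intro conjI allI ballI impI)
  fix m n \<theta> s assume *: "\<theta> \<in> monotone_maps m n" "s \<in> Smp (nerve C) n"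
  then show "nerve_map F (Act (nerve C) m n \<theta> s) = Act (nerve D) m n \<theta> (nerve_map F s)"
    using S.mono_le[OF *(2,1)] nerve_map_vertex[OF *(2)] nerve_map_arr[OF *(2)]
    by (simp add: nerve_Act nerve_map_Pair)
qed (rule nerve_map_Smp)

lemma B_map_pt:
  "s \<in> Smp (nerve C) n \<Longrightarrow> t \<in> standard_simplex n \<Longrightarrow>
    B_map D F (pt (nerve C) n s t) = pt (nerve D) n (nerve_map F s) t"
  unfolding B_map_def by (rule realization_map_pt[OF nerve_map_simplicial])

lemma continuous_B_map: "continuous_map (B_space C) (B_space D) (B_map D F)"
  unfolding B_map_def B_space_def by (rule continuous_realization_map[OF nerve_map_simplicial])

end

lemma B_space_cases:
  assumes "p \<in> topspace (B_space C)"
  obtains n s t where "p = pt (nerve C) n s t" "s \<in> Smp (nerve C) n" "t \<in> standard_simplex n"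
  using assms by (auto simp: B_space_def topspace_realization)

lemma B_map_comp:
  assumes F: "cat_functor A C F" and K: "cat_functor C D K" and p: "p \<in> topspace (B_space A)"
  shows "B_map D (K \<circ>\<^sub>F F) p = B_map D K (B_map C F p)"
proof -
  obtain n s t where 1: "p = pt (nerve A) n s t" "s \<in> Smp (nerve A) n" "t \<in> standard_simplex n"
    using p by (rule B_space_cases)
  have "nerve_map (K \<circ>\<^sub>F F) s = nerve_map K (nerve_map F s)"
    by (cases s) (simp add: nerve_map_def)
  then show ?thesis
    using 1 cat_functor.B_map_pt[OF F 1(2,3)] cat_functor.B_map_pt[OF cat_functor_comp[OF F K] 1(2,3)]
      cat_functor.B_map_pt[OF K cat_functor.nerve_map_Smp[OF F 1(2)] 1(3)]
    by simp
qed

lemma B_map_cong: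
  assumes F: "cat_functor A C F" and FK: "func_eq A F K" and p: "p \<in> topspace (B_space A)"
  shows "B_map C F p = B_map C K p"
proof -
  obtain n s t where 1: "p = pt (nerve A) n s t" "s \<in> Smp (nerve A) n" "t \<in> standard_simplex n"
    using p by (rule B_space_cases)
  have "nerve_map F s = nerve_map K s"
    using 1(2) FK is_string_Arr[of A "fst s" "snd s"] is_string_Obj[of A "fst s" "snd s"]
    by (cases s) (auto simp: nerve_map_def nerve_Smp func_eq_def)
  then show ?thesis
    using 1 cat_functor.B_map_pt[OF F 1(2,3)] cat_functor.B_map_pt[OF cat_functor_cong[OF F FK] 1(2,3)]
    by simp
qed

section \<open>Masses and carriers of points of a classifying space\<close>

text \<open>The barycentric weight at an object. Summing over all positions of the object makes it
  independent of the representative, in which vertices may be repeated.\<close>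

definition mass :: "('o, 'a) category \<Rightarrow> 'o \<Rightarrow> ('o, 'a) cs_point \<Rightarrow> real"
  where "mass C v = class_val (\<lambda>(n, s, t). \<Sum>j\<le>n. if string_vertex C s j = v then t j else 0)"

text \<open>Restricting to vertices of positive weight makes this set independent of the
  representative: faces drop only vertices of weight zero, and the identities created by repeated
  vertices are present anyway, since \<open>i = j\<close> is allowed.\<close>

definition carrier_arrs :: "('o, 'a) category \<Rightarrow> ('o, 'a) cs_point \<Rightarrow> 'a set"
  where "carrier_arrs C =
    class_val (\<lambda>(n, s, t). {string_arr C s i j | i j. i \<le> j \<and> j \<le> n \<and> t i > 0 \<and> t j > 0})"

context small_category
begin

lemma mass_pt: "mass C v (pt (nerve C) n s t) = (\<Sum>j\<le>n. if string_vertex C s j = v then t j else 0)"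
  unfolding mass_def
proof (subst class_val_pt, goal_cases)
  case (1 m n \<theta> x t)
  have "(\<Sum>j\<le>m. if string_vertex C (Act (nerve C) m n \<theta> x) j = v then t j else 0) =
      (\<Sum>j\<le>m. if string_vertex C x (\<theta> j) = v then t j else 0)"
    by (rule sum.cong) (auto simp: string_vertex_Act[OF 1(2,1)])
  then show ?case
    using sum_simplex_push[OF 1(1), of "\<lambda>j. string_vertex C x j = v" t] by simp
qed simp

lemma carrier_arrs_pt: "carrier_arrs C (pt (nerve C) n s t) =
    {string_arr C s i j | i j. i \<le> j \<and> j \<le> n \<and> t i > 0 \<and> t j > 0}"
  unfolding carrier_arrs_def
proof (subst class_val_pt, goal_cases)
  case (1 m n \<theta> x t)
  have "{string_arr C (Act (nerve C) m n \<theta> x) i j | i j. i \<le> j \<and> j \<le> m \<and> t i > 0 \<and> t j > 0} =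
      {string_arr C x i j | i j. i \<le> j \<and> j \<le> n \<and> simplex_push m \<theta> t i > 0 \<and> simplex_push m \<theta> t j > 0}"
    (is "?L = ?R")
  proof (intro equalityI subsetI)
    fix f assume "f \<in> ?L"
    then obtain i j where ij: "f = string_arr C (Act (nerve C) m n \<theta> x) i j" "i \<le> j" "j \<le> m" "t i > 0" "t j > 0"
      by auto
    then have "f = string_arr C x (\<theta> i) (\<theta> j)" using string_arr_Act[OF 1(2,1)] by simp
    moreover have "simplex_push m \<theta> t (\<theta> i) > 0" "simplex_push m \<theta> t (\<theta> j) > 0"
      using ij by (auto simp: simplex_push_pos_iff[OF 1(3)] intro: le_trans)
    ultimately show "f \<in> ?R" using ij mono_le[OF 1(2,1)] by blast
  next
    fix f assume "f \<in> ?R"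
    then obtain i j where ij: "f = string_arr C x i j" "i \<le> j" "j \<le> n"
      "simplex_push m \<theta> t i > 0" "simplex_push m \<theta> t j > 0"
      by auto
    then obtain a b where ab: "a \<le> m" "\<theta> a = i" "t a > 0" "b \<le> m" "\<theta> b = j" "t b > 0"
      by (auto simp: simplex_push_pos_iff[OF 1(3)])
    show "f \<in> ?L"
    proof (cases "a \<le> b")
      case True
      then have "f = string_arr C (Act (nerve C) m n \<theta> x) a b"
        using ab ij string_arr_Act[OF 1(2,1)] by simp
      then show ?thesis using ab True by blast
    next
      case False
      \<comment> \<open>The preimages were chosen independently and may be in the wrong order;
        monotonicity then makes the two positions coincide, and the arrow is an identity.\<close>
      then have "i = j" using ab ij mono_le(1)[OF 1(2,1), of b a] by simp
      then have "f = string_arr C (Act (nerve C) m n \<theta> x) a a"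
        using ab ij string_arr_Act[OF 1(2,1), of a a] by simp
      then show ?thesis using ab by blast
    qed
  qed
  then show ?case by simp
qed simp

lemma string_arr_in_carrier:
  assumes "i \<le> j" "j \<le> n" "t i > 0" "t j > 0"
  shows "string_arr C s i j \<in> carrier_arrs C (pt (nerve C) n s t)"
  unfolding carrier_arrs_pt using assms by blast

lemma mass_nonneg:
  assumes "p \<in> topspace (B_space C)"
  shows "mass C v p \<ge> 0"
  using assms by (rule B_space_cases) (auto simp: mass_pt standard_simplex_def intro!: sum_nonneg)

lemma sum_mass:
  assumes "finite (Obj C)" "p \<in> topspace (B_space C)"
  shows "(\<Sum>v\<in>Obj C. mass C v p) = 1"
  using assms(2)
proof (rule B_space_cases)
  fix n s t assume p: "p = pt (nerve C) n s t" "s \<in> Smp (nerve C) n" "t \<in> standard_simplex n"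
  have "(\<Sum>v\<in>Obj C. mass C v p) = (\<Sum>j\<le>n. \<Sum>v\<in>Obj C. if string_vertex C s j = v then t j else 0)"
    unfolding p(1) mass_pt by (rule sum.swap)
  also have "\<dots> = (\<Sum>j\<le>n. t j)"
    using assms(1) string_vertex_Obj[OF p(2)] by (intro sum.cong) auto
  finally show ?thesis using p(3) by (simp add: standard_simplex_def)
qed

lemma continuous_mass: "continuous_map (B_space C) euclideanreal (mass C v)"
  unfolding B_space_def
proof (rule continuous_map_realization)
  fix n s
  have "continuous_map (simplex_space n) euclideanreal
      (\<lambda>t. if string_vertex C s j = v then t j else 0)" for j
    by (cases "string_vertex C s j = v")
      (auto intro: continuous_map_from_subtopology continuous_map_product_projection)
  then show "continuous_map (simplex_space n) euclideanreal (\<lambda>t. mass C v (pt (nerve C) n s t))"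
    unfolding mass_pt by (intro continuous_map_sum) auto
qed

lemma carrier_arrs_props:
  assumes "p \<in> topspace (B_space C)" "f \<in> carrier_arrs C p"
  shows "f \<in> Arr C" "mass C (Src C f) p > 0" "mass C (Tgt C f) p > 0"
proof -
  obtain n s t where p: "p = pt (nerve C) n s t" "s \<in> Smp (nerve C) n" "t \<in> standard_simplex n"
    using assms(1) by (rule B_space_cases)
  obtain i j where ij: "f = string_arr C s i j" "i \<le> j" "j \<le> n" "t i > 0" "t j > 0"
    using assms(2) by (auto simp: p carrier_arrs_pt)
  have "mass C (string_vertex C s k) p > 0" if "k \<le> n" "t k > 0" for k
    unfolding p(1) mass_pt
    using that p(3) by (intro sum_pos2[of _ k]) (auto simp: standard_simplex_def)
  then show "f \<in> Arr C" "mass C (Src C f) p > 0" "mass C (Tgt C f) p > 0"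
    using ij string_arr_props[OF p(2)] by auto
qed

text \<open>The vertices of a simplex form a chain, so the string has an arrow between any two of
  them, in one direction or the other.\<close>

lemma carrier_arrs_between:
  assumes "p \<in> topspace (B_space C)" "mass C x p > 0" "mass C y p > 0"
  shows "\<exists>f\<in>carrier_arrs C p. (Src C f = x \<and> Tgt C f = y) \<or> (Src C f = y \<and> Tgt C f = x)"
proof -
  obtain n s t where p: "p = pt (nerve C) n s t" "s \<in> Smp (nerve C) n" "t \<in> standard_simplex n"
    using assms(1) by (rule B_space_cases)
  have ex: "\<exists>k\<le>n. string_vertex C s k = v \<and> t k > 0" if "mass C v p > 0" for v
  proof (rule ccontr)
    assume *: "\<not> ?thesis"
    have "t k \<ge> 0" for k using p(3) by (simp add: standard_simplex_def)
    then have "mass C v p = 0"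
      unfolding p(1) mass_pt using * by (intro sum.neutral) (auto simp: less_le)
    then show False using that by simp
  qed
  obtain i j where ij: "i \<le> n" "string_vertex C s i = x" "t i > 0" "j \<le> n" "string_vertex C s j = y" "t j > 0"
    using ex[OF assms(2)] ex[OF assms(3)] by auto
  show ?thesis
  proof (cases "i \<le> j")
    case True
    then show ?thesis
      using ij string_arr_props[OF p(2), of i j]
      by (intro bexI[of _ "string_arr C s i j"]) (auto simp: p(1) carrier_arrs_pt)
  next
    case False
    then have "string_arr C s j i \<in> carrier_arrs C p"
      unfolding p(1) using ij False by (intro string_arr_in_carrier) auto
    then show ?thesis
      using False ij string_arr_props[OF p(2), of j i] by (intro bexI[of _ "string_arr C s j i"]) auto
  qed
qed

end

context cat_functor
begin

lemma carrier_arrs_B_map: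
  assumes "p \<in> topspace (B_space C)"
  shows "carrier_arrs D (B_map D F p) = onArr F ` carrier_arrs C p"
proof -
  obtain n s t where p: "p = pt (nerve C) n s t" "s \<in> Smp (nerve C) n" "t \<in> standard_simplex n"
    using assms(1) by (rule B_space_cases)
  have "carrier_arrs D (B_map D F p) =
      {string_arr D (nerve_map F s) i j | i j. i \<le> j \<and> j \<le> n \<and> t i > 0 \<and> t j > 0}"
    unfolding p(1) B_map_pt[OF p(2,3)] T.carrier_arrs_pt by simp
  also have "\<dots> = {onArr F (string_arr C s i j) | i j. i \<le> j \<and> j \<le> n \<and> t i > 0 \<and> t j > 0}"
    using nerve_map_arr[OF p(2)] by (intro Collect_cong) metis
  also have "\<dots> = onArr F ` carrier_arrs C p"
    unfolding p(1) S.carrier_arrs_pt by auto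
  finally show ?thesis .
qed

lemma mass_B_map:
  assumes "finite (Obj C)" "p \<in> topspace (B_space C)"
  shows "mass D y (B_map D F p) = (\<Sum>x\<in>Obj C. if onObj F x = y then mass C x p else 0)"
proof -
  obtain n s t where p: "p = pt (nerve C) n s t" "s \<in> Smp (nerve C) n" "t \<in> standard_simplex n"
    using assms(2) by (rule B_space_cases)
  have "(\<Sum>x\<in>Obj C. if onObj F x = y then mass C x p else 0) =
      (\<Sum>x\<in>Obj C. \<Sum>j\<le>n. if onObj F x = y \<and> string_vertex C s j = x then t j else 0)"
    unfolding p(1) S.mass_pt by (intro sum.cong) auto
  also have "\<dots> = (\<Sum>j\<le>n. \<Sum>x\<in>Obj C. if onObj F x = y \<and> string_vertex C s j = x then t j else 0)"
    by (rule sum.swap)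
  also have "\<dots> = (\<Sum>j\<le>n. if onObj F (string_vertex C s j) = y then t j else 0)"
  proof (rule sum.cong)
    fix j assume "j \<in> {..n}"
    then have v: "string_vertex C s j \<in> Obj C" using S.string_vertex_Obj[OF p(2)] by simp
    have "(\<Sum>x\<in>Obj C. if onObj F x = y \<and> string_vertex C s j = x then t j else 0) =
      (\<Sum>x\<in>Obj C. if string_vertex C s j = x then (if onObj F x = y then t j else 0) else 0)"
      by (rule sum.cong) auto
    also have "\<dots> = (if onObj F (string_vertex C s j) = y then t j else 0)"
      using assms(1) v by (subst sum.delta') auto
    finally show "(\<Sum>x\<in>Obj C. if onObj F x = y \<and> string_vertex C s j = x then t j else 0) =
      (if onObj F (string_vertex C s j) = y then t j else 0)" .
  qed simp
  also have "\<dots> = mass D y (B_map D F p)"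
    unfolding p(1) B_map_pt[OF p(2,3)] T.mass_pt
    by (rule sum.cong) (auto simp: nerve_map_vertex[OF p(2)])
  finally show ?thesis ..
qed

end

section \<open>Nondegenerate representatives\<close>

lemma face_push:
  assumes t: "t \<in> standard_simplex n" and i: "i \<le> n" "t i = 0"
  obtains m u \<theta> where "n = Suc m" "\<theta> \<in> monotone_maps m n" "u \<in> standard_simplex m" "simplex_push m \<theta> u = t"
proof -
  have "n \<noteq> 0"
  proof
    assume "n = 0"
    then show False using t i by (simp add: standard_simplex_def)
  qed
  then obtain m where m: "n = Suc m" by (cases n) auto
  \<comment> \<open>The coface map that omits \<open>i\<close>.\<close>
  define \<theta> where "\<theta> = (\<lambda>k. if k < i then k else Suc k)"
  define u where "u = (\<lambda>k. t (\<theta> k))"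
  have \<theta>: "\<theta> \<in> monotone_maps m n"
    using i m by (auto simp: monotone_maps_def \<theta>_def mono_on_def)
  have inj: "{k. k \<le> m \<and> \<theta> k = \<theta> l} = {l}" if "l \<le> m" for l
    using that by (auto simp: \<theta>_def split: if_splits)
  have sur: "\<exists>l\<le>m. j = \<theta> l" if "j \<le> n" "j \<noteq> i" for j
    using that m i by (intro exI[of _ "if j < i then j else j - 1"]) (auto simp: \<theta>_def)
  have push: "simplex_push m \<theta> u j = t j" for j
  proof (cases "j \<le> n \<and> j \<noteq> i")
    case True
    then obtain l where "l \<le> m" "j = \<theta> l" using sur by auto
    then show ?thesis by (simp add: simplex_push_def inj u_def)
  next
    case False
    then have e: "{k. k \<le> m \<and> \<theta> k = j} = {}" using i m by (auto simp: \<theta>_def split: if_splits)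
    have "t j = 0" using False t i by (auto simp: standard_simplex_def)
    then show ?thesis unfolding simplex_push_def e by simp
  qed
  have "(\<Sum>k\<le>m. u k) = (\<Sum>j\<le>n. t j)"
    using sum_simplex_push[OF \<theta>, of "\<lambda>_. True" u] push by simp
  moreover have "\<theta> k > n" if "k > m" for k using that m i by (auto simp: \<theta>_def)
  ultimately have "u \<in> standard_simplex m"
    using t by (auto simp: standard_simplex_def u_def)
  then show thesis using that m \<theta> push by blast
qed

context small_category
begin

definition nondegenerate :: "nat \<Rightarrow> 'o \<times> 'a list \<Rightarrow> bool"
  where "nondegenerate n s \<longleftrightarrow> s \<in> Smp (nerve C) n \<and> (\<forall>i<n. snd s ! i \<noteq> Ident C (string_vertex C s i))"

lemma pt_reduce:
  assumes s: "s \<in> Smp (nerve C) n" and t: "t \<in> standard_simplex n" and i: "i \<le> n" "t i = 0"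
  obtains m s' u where "m < n" "s' \<in> Smp (nerve C) m" "u \<in> standard_simplex m"
    "pt (nerve C) n s t = pt (nerve C) m s' u"
proof -
  obtain m u \<theta> where "n = Suc m" "\<theta> \<in> monotone_maps m n" "u \<in> standard_simplex m" "simplex_push m \<theta> u = t"
    using t i by (rule face_push)
  then show thesis
    using that[of m "Act (nerve C) m n \<theta> s" u] Act_Smp[OF s] pt_Act[of \<theta> m n s "nerve C" u] s by simp
qed

lemma nondegenerate_rep:
  assumes "p \<in> topspace (B_space C)"
  obtains n s t where "p = pt (nerve C) n s t" "nondegenerate n s" "t \<in> standard_simplex n"
    "\<forall>i\<le>n. t i > 0"
proof -
  obtain n s t where p: "p = pt (nerve C) n s t" "s \<in> Smp (nerve C) n" "t \<in> standard_simplex n"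
    using assms(1) by (rule B_space_cases)
  then have "\<exists>m s' u. p = pt (nerve C) m s' u \<and> nondegenerate m s' \<and> u \<in> standard_simplex m \<and> (\<forall>i\<le>m. u i > 0)"
  proof (induction n arbitrary: s t rule: less_induct)
    case (less n)
    show ?case
    proof (cases "\<exists>i\<le>n. t i = 0")
      case True
      then obtain m s' u where "m < n" "s' \<in> Smp (nerve C) m" "u \<in> standard_simplex m"
        "pt (nerve C) n s t = pt (nerve C) m s' u"
        using pt_reduce less.prems by blast
      then show ?thesis using less.IH[of m s' u] less.prems by simp
    next
      case pos: False
      show ?thesis
      proof (cases "nondegenerate n s")
        case True
        moreover have "\<forall>i\<le>n. t i > 0"
          using pos less.prems(3) by (auto simp: standard_simplex_def less_le)
        ultimately show ?thesis using less.prems by blast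
      next
        case False
        then obtain i where i: "i < n" "snd s ! i = Ident C (string_vertex C s i)"
          using less.prems by (auto simp: nondegenerate_def)
        \<comment> \<open>Sending \<open>Suc i\<close> to \<open>i\<close> leaves a string with an
          identity in place \<open>i\<close> unchanged, but it moves the weight of vertex
          \<open>Suc i\<close> to vertex \<open>i\<close>.\<close>
        define \<psi> where "\<psi> = (\<lambda>k. if k = Suc i then i else k)"
        have \<psi>: "\<psi> \<in> monotone_maps n n"
          using i by (auto simp: monotone_maps_def \<psi>_def mono_on_def)
        note s = less.prems(2)
        have v: "string_vertex C s (Suc i) = string_vertex C s i"
          using string_arr_props(3)[OF s, of i "Suc i"] string_arr_Suc[OF s i(1)] i
          by (simp add: Tgt_Ident string_vertex_Obj[OF s])
        have arr: "string_arr C s (\<psi> k) (\<psi> (Suc k)) = snd s ! k" if k: "k < n" for k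
        proof -
          consider "k = i" | "k = Suc i" | "k \<noteq> i" "k \<noteq> Suc i" by blast
          then show ?thesis
          proof cases
            case 1
            then show ?thesis using i by (simp add: \<psi>_def)
          next
            case 2
            have "string_arr C s i (Suc k) = Comp C (string_arr C s k (Suc k)) (string_arr C s i k)"
              using string_arr_Comp[OF s, of i k "Suc k"] 2 k by simp
            moreover have "string_arr C s i k = Ident C (string_vertex C s k)"
              using 2 i v string_arr_Suc[OF s i(1)] by simp
            ultimately show ?thesis
              using 2 k string_arr_Suc[OF s k] string_arr_props[OF s, of k "Suc k"]
              by (simp add: \<psi>_def Comp_Ident')
          next
            case 3
            then show ?thesis using string_arr_Suc[OF s k] by (simp add: \<psi>_def)
          qed
        qed
        have "Act (nerve C) n n \<psi> s = s"
        proof -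
          have "map (\<lambda>k. string_arr C s (\<psi> k) (\<psi> (Suc k))) [0..<n] = map (\<lambda>k. snd s ! k) [0..<n]"
            using arr by simp
          also have "\<dots> = snd s" using s map_nth[of "snd s"] by (simp add: nerve_Smp)
          finally show ?thesis by (cases s) (simp add: nerve_Act \<psi>_def)
        qed
        then have e: "pt (nerve C) n s t = pt (nerve C) n s (simplex_push n \<psi> t)"
          using pt_Act[OF \<psi> s less.prems(3)] by simp
        have "{k. k \<le> n \<and> \<psi> k = Suc i} = {}" by (auto simp: \<psi>_def split: if_splits)
        then have z: "simplex_push n \<psi> t (Suc i) = 0"
          unfolding simplex_push_def by (simp only: sum.empty)
        obtain m s' u where "m < n" "s' \<in> Smp (nerve C) m" "u \<in> standard_simplex m"
          "pt (nerve C) n s (simplex_push n \<psi> t) = pt (nerve C) m s' u"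
          by (rule pt_reduce[OF s simplex_push_in[OF less.prems(3) \<psi>] _ z]) (use i in auto)
        then show ?thesis using less.IH[of m s' u] less.prems(1) e by simp
      qed
    qed
  qed
  then show thesis using that by blast
qed

end

section \<open>Categories without loops: points determined by weights and arrows\<close>

locale loop_free = small_category C for C :: "('o, 'a) category" +
  assumes endo_Ident: "f \<in> Arr C \<Longrightarrow> Src C f = Tgt C f \<Longrightarrow> f = Ident C (Src C f)"
    and no_cycle: "\<lbrakk>f \<in> Arr C; g \<in> Arr C; Src C g = Tgt C f; Tgt C g = Src C f\<rbrakk> \<Longrightarrow> Src C f = Tgt C f"
begin

text \<open>If an object recurs, the first step away from it and the rest of the way back are
  opposite arrows; without cycles the first step is an endomorphism, hence an identity.\<close>

lemma nondegenerate_distinct: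
  assumes s: "nondegenerate n s" and ij: "i < j" "j \<le> n"
  shows "string_vertex C s i \<noteq> string_vertex C s j"
proof
  assume v: "string_vertex C s i = string_vertex C s j"
  have sm: "s \<in> Smp (nerve C) n" using s by (simp add: nondegenerate_def)
  have "string_vertex C s i = string_vertex C s (Suc i)"
    using no_cycle[of "string_arr C s i (Suc i)" "string_arr C s (Suc i) j"] v ij
    by (simp add: string_arr_props[OF sm])
  then have "snd s ! i = Ident C (string_vertex C s i)"
    using endo_Ident[of "string_arr C s i (Suc i)"] ij string_arr_Suc[OF sm, of i]
      string_arr_props[OF sm, of i "Suc i"] by simp
  then show False using s ij by (simp add: nondegenerate_def)
qed

lemma nondegenerate_inj:
  assumes "nondegenerate n s" "i \<le> n" "j \<le> n" "string_vertex C s i = string_vertex C s j"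
  shows "i = j"
  using nondegenerate_distinct[OF assms(1), of i j] nondegenerate_distinct[OF assms(1), of j i] assms
  by (metis linorder_neqE_nat)

lemma mass_nondegenerate:
  assumes "nondegenerate n s" "i \<le> n"
  shows "mass C (string_vertex C s i) (pt (nerve C) n s t) = t i"
proof -
  have "(\<Sum>j\<le>n. if string_vertex C s j = string_vertex C s i then t j else 0) = (\<Sum>j\<le>n. if j = i then t j else 0)"
    using nondegenerate_inj[OF assms(1)] assms(2) by (intro sum.cong) auto
  then show ?thesis using assms(2) by (simp add: mass_pt)
qed

lemma mass_pos_vertex:
  assumes "mass C v (pt (nerve C) n s t) > 0"
  obtains i where "i \<le> n" "string_vertex C s i = v"
proof -
  have "\<exists>i\<le>n. string_vertex C s i = v"
  proof (rule ccontr)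
    assume "\<not> ?thesis"
    then have "mass C v (pt (nerve C) n s t) = 0"
      unfolding mass_pt by (intro sum.neutral) auto
    then show False using assms by simp
  qed
  then show thesis using that by blast
qed

lemma carrier_arrs_unique:
  assumes p: "p \<in> topspace (B_space C)" and fg: "f \<in> carrier_arrs C p" "g \<in> carrier_arrs C p"
    and par: "Src C f = Src C g" "Tgt C f = Tgt C g"
  shows "f = g"
proof -
  obtain n s t where r: "p = pt (nerve C) n s t" "nondegenerate n s" "t \<in> standard_simplex n" "\<forall>i\<le>n. t i > 0"
    using p by (rule nondegenerate_rep)
  have sm: "s \<in> Smp (nerve C) n" using r by (simp add: nondegenerate_def)
  obtain i j k l where "f = string_arr C s i j" "i \<le> j" "j \<le> n" "g = string_arr C s k l" "k \<le> l" "l \<le> n"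
    using fg by (auto simp: r(1) carrier_arrs_pt)
  then show ?thesis
    using par nondegenerate_inj[OF r(2), of i k] nondegenerate_inj[OF r(2), of j l]
    by (simp add: string_arr_props[OF sm])
qed

text \<open>Two objects in opposite order in the two strings would have arrows in both directions.
  So the positions in \<open>s'\<close> increase strictly with those in \<open>s\<close>, and the
  one that belongs to \<open>i\<close> is at least \<open>i\<close>.\<close>

lemma nondegenerate_order:
  assumes s: "nondegenerate n s" and s': "nondegenerate n' s'"
    and sub: "\<forall>i\<le>n. \<exists>k\<le>n'. string_vertex C s i = string_vertex C s' k"
    and i: "i \<le> n" "k \<le> n'" "string_vertex C s i = string_vertex C s' k"
  shows "i \<le> k"
  using i
proof (induction i arbitrary: k)
  case (Suc i)
  note sm = s[unfolded nondegenerate_def, THEN conjunct1] and sm' = s'[unfolded nondegenerate_def, THEN conjunct1]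
  have "i \<le> n" using Suc.prems by simp
  then obtain l where l: "l \<le> n'" "string_vertex C s i = string_vertex C s' l" using sub by blast
  then have "i \<le> l" using Suc by simp
  moreover have "l < k"
  proof (rule ccontr)
    assume "\<not> l < k"
    then have "string_vertex C s i = string_vertex C s (Suc i)"
      using no_cycle[of "string_arr C s i (Suc i)" "string_arr C s' k l"] l Suc.prems
      by (simp add: string_arr_props[OF sm] string_arr_props[OF sm'])
    then show False using nondegenerate_distinct[OF s, of i "Suc i"] Suc.prems by simp
  qed
  ultimately show ?case by simp
qed simp

text \<open>The vertices of a nondegenerate representative with positive weights are the objects of
  positive mass. Equal masses give the same vertices, by \<open>nondegenerate_order\<close> in both
  directions also the same order, and the same weights; the last assumption supplies the
  arrows.\<close>

theorem point_eqI:
  assumes p: "p \<in> topspace (B_space C)" and q: "q \<in> topspace (B_space C)"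
    and m: "\<And>v. v \<in> Obj C \<Longrightarrow> mass C v p = mass C v q"
    and c: "\<And>f g. \<lbrakk>f \<in> carrier_arrs C p; g \<in> carrier_arrs C q; Src C f = Src C g; Tgt C f = Tgt C g\<rbrakk> \<Longrightarrow> f = g"
  shows "p = q"
proof -
  obtain n s t where r: "p = pt (nerve C) n s t" "nondegenerate n s" "t \<in> standard_simplex n" "\<forall>i\<le>n. t i > 0"
    using p by (rule nondegenerate_rep)
  obtain n' s' t' where r': "q = pt (nerve C) n' s' t'" "nondegenerate n' s'" "t' \<in> standard_simplex n'" "\<forall>i\<le>n'. t' i > 0"
    using q by (rule nondegenerate_rep)
  note sm = r(2)[unfolded nondegenerate_def, THEN conjunct1] and sm' = r'(2)[unfolded nondegenerate_def, THEN conjunct1]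
  have sub: "\<exists>k\<le>n'. string_vertex C s i = string_vertex C s' k" if "i \<le> n" for i
  proof -
    have "mass C (string_vertex C s i) q = t i"
      using m[of "string_vertex C s i"] mass_nondegenerate[OF r(2) that, of t] r(1) string_vertex_Obj[OF sm that]
      by simp
    then have "mass C (string_vertex C s i) q > 0" using r(4) that by simp
    then show ?thesis unfolding r'(1) by (metis mass_pos_vertex)
  qed
  have sub': "\<exists>k\<le>n. string_vertex C s' i = string_vertex C s k" if "i \<le> n'" for i
  proof -
    have "mass C (string_vertex C s' i) p = t' i"
      using m[of "string_vertex C s' i"] mass_nondegenerate[OF r'(2) that, of t'] r'(1) string_vertex_Obj[OF sm' that]
      by simp
    then have "mass C (string_vertex C s' i) p > 0" using r'(4) that by simp
    then show ?thesis unfolding r(1) by (metis mass_pos_vertex)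
  qed
  have eq: "i = k" if "i \<le> n" "k \<le> n'" "string_vertex C s i = string_vertex C s' k" for i k
    using nondegenerate_order[OF r(2) r'(2)] nondegenerate_order[OF r'(2) r(2)] sub sub' that
    by (metis le_antisym)
  have "n \<le> n'" using sub[of n] eq by force
  moreover have "n' \<le> n" using sub'[of n'] eq by force
  ultimately have n: "n' = n" by simp
  have v: "string_vertex C s i = string_vertex C s' i" if "i \<le> n" for i
    using sub[OF that] eq that by auto
  have "t i = t' i" for i
  proof (cases "i \<le> n")
    case True
    then show ?thesis
      using m[of "string_vertex C s i"] mass_nondegenerate[OF r(2) True, of t]
        mass_nondegenerate[OF r'(2), of i t'] n v[OF True] r(1) r'(1) string_vertex_Obj[OF sm True]
      by simp
  next
    case False
    then show ?thesis using r(3) r'(3) n by (simp add: standard_simplex_def)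
  qed
  moreover have "snd s ! i = snd s' ! i" if i: "i < n" for i
  proof -
    have "string_arr C s i (Suc i) \<in> carrier_arrs C p" "string_arr C s' i (Suc i) \<in> carrier_arrs C q"
      using i r r' n by (auto intro!: string_arr_in_carrier)
    then have "string_arr C s i (Suc i) = string_arr C s' i (Suc i)"
      using c i v[of i] v[of "Suc i"] n by (simp add: string_arr_props[OF sm] string_arr_props[OF sm'])
    then show ?thesis using string_arr_Suc[OF sm i] string_arr_Suc[OF sm'] i n by simp
  qed
  then have "snd s = snd s'" using sm sm' n by (auto simp: nerve_Smp intro: nth_equalityI)
  moreover have "fst s = fst s'" using v[of 0] by (cases s; cases s') simp
  ultimately have "t = t'" "s = s'" by (auto simp: prod_eq_iff)
  then show ?thesis using r(1) r'(1) n by simp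
qed

text \<open>A nondegenerate string repeats no object, so its length is bounded by the number of
  objects, and finitely many closed simplices cover the space.\<close>

lemma compact_B_space:
  assumes "finite (Obj C)" "finite (Arr C)"
  shows "compact_space (B_space C)"
proof -
  define S where "S = {(n, s). nondegenerate n s}"
  have "S \<subseteq> {..card (Obj C)} \<times> (Obj C \<times> {fs. set fs \<subseteq> Arr C \<and> length fs \<le> card (Obj C)})"
  proof (clarsimp simp: S_def)
    fix n x fs assume nd: "nondegenerate n (x, fs)"
    then have sm: "(x, fs) \<in> Smp (nerve C) n" by (simp add: nondegenerate_def)
    have "inj_on (string_vertex C (x, fs)) {..n}"
      using nondegenerate_inj[OF nd] by (auto simp: inj_on_def)
    then have "card {..n} \<le> card (Obj C)"
      using string_vertex_Obj[OF sm] assms(1) by (intro card_inj_on_le) auto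
    then show "n \<le> card (Obj C) \<and> x \<in> Obj C \<and> set fs \<subseteq> Arr C \<and> length fs \<le> card (Obj C)"
      using sm is_string_Obj is_string_Arr by (fastforce simp: nerve_Smp)
  qed
  then have fin: "finite S"
    by (rule finite_subset) (simp add: assms finite_lists_length_le)
  have "topspace (B_space C) = (\<Union>(n, s)\<in>S. pt (nerve C) n s ` standard_simplex n)"
  proof (intro equalityI subsetI)
    fix p assume "p \<in> topspace (B_space C)"
    then show "p \<in> (\<Union>(n, s)\<in>S. pt (nerve C) n s ` standard_simplex n)"
      by (rule nondegenerate_rep) (auto simp: S_def)
  next
    fix p assume "p \<in> (\<Union>(n, s)\<in>S. pt (nerve C) n s ` standard_simplex n)"
    then show "p \<in> topspace (B_space C)"
      by (auto simp: S_def B_space_def nondegenerate_def intro: pt_in)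
  qed
  moreover have "compactin (B_space C) (pt (nerve C) n s ` standard_simplex n)" if "(n, s) \<in> S" for n s
  proof (rule image_compactin)
    show "compactin (simplex_space n) (standard_simplex n)"
      using compactin_standard_simplex[of n] by (simp add: compactin_subtopology)
    show "continuous_map (simplex_space n) (B_space C) (pt (nerve C) n s)"
      unfolding B_space_def using that by (intro continuous_map_pt) (simp add: S_def nondegenerate_def)
  qed
  ultimately show ?thesis
    unfolding compact_space_def using fin by (auto intro!: compactin_Union)
qed

end

text \<open>Equality of carriers is obtained from the images under two jointly faithful functors: in
  the carrier of an image point parallel arrows coincide, so equal image points force equal
  arrows.\<close>

lemma point_eq_via_functors:
  assumes C: "loop_free C"
    and F: "cat_functor C D F" and D: "loop_free D" and K: "cat_functor C E K" and E: "loop_free E"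
    and faithful: "\<And>f g. \<lbrakk>f \<in> Arr C; g \<in> Arr C; Src C f = Src C g; Tgt C f = Tgt C g; onArr F f = onArr F g;
      onArr K f = onArr K g\<rbrakk> \<Longrightarrow> f = g"
    and p: "p \<in> topspace (B_space C)" and q: "q \<in> topspace (B_space C)"
    and m: "\<And>v. v \<in> Obj C \<Longrightarrow> mass C v p = mass C v q"
    and BF: "B_map D F p = B_map D F q" and BK: "B_map E K p = B_map E K q"
  shows "p = q"
proof -
  interpret C: loop_free C by fact
  interpret D: loop_free D by fact
  interpret E: loop_free E by fact
  interpret F: cat_functor C D F by fact
  interpret K: cat_functor C E K by fact
  show ?thesis
  proof (rule C.point_eqI[OF p q m])
    fix f g assume fg: "f \<in> carrier_arrs C p" "g \<in> carrier_arrs C q" "Src C f = Src C g" "Tgt C f = Tgt C g"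
    have A: "f \<in> Arr C" "g \<in> Arr C" using fg C.carrier_arrs_props p q by auto
    have Bp: "B_map D F p \<in> topspace (B_space D)" "B_map E K p \<in> topspace (B_space E)"
      using p F.continuous_B_map K.continuous_B_map by (auto simp: continuous_map_def)
    have "onArr F f \<in> carrier_arrs D (B_map D F p)" "onArr F g \<in> carrier_arrs D (B_map D F p)"
      using fg BF F.carrier_arrs_B_map[OF p] F.carrier_arrs_B_map[OF q] by force+
    then have "onArr F f = onArr F g"
      using D.carrier_arrs_unique[OF Bp(1)] fg A by (simp add: F.Src_onArr F.Tgt_onArr)
    moreover have "onArr K f \<in> carrier_arrs E (B_map E K p)" "onArr K g \<in> carrier_arrs E (B_map E K p)"
      using fg BK K.carrier_arrs_B_map[OF p] K.carrier_arrs_B_map[OF q] by force+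
    then have "onArr K f = onArr K g"
      using E.carrier_arrs_unique[OF Bp(2)] fg A by (simp add: K.Src_onArr K.Tgt_onArr)
    ultimately show "f = g" using faithful fg A by blast
  qed
qed

lemma mapping_cylinder_loop_free:
  assumes "cat_functor A B F" "loop_free A" "loop_free B"
  shows "loop_free (mapping_cylinder A B F)"
proof -
  interpret M: small_category "mapping_cylinder A B F" by (rule mapping_cylinder_category[OF assms(1)])
  interpret A: loop_free A by fact
  interpret B: loop_free B by fact
  show ?thesis
  proof
    fix f assume "f \<in> Arr (mapping_cylinder A B F)" "Src (mapping_cylinder A B F) f = Tgt (mapping_cylinder A B F) f"
    then show "f = Ident (mapping_cylinder A B F) (Src (mapping_cylinder A B F) f)"
      using A.endo_Ident B.endo_Ident by (auto simp: mapping_cylinder_def)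
  next
    fix f g assume "f \<in> Arr (mapping_cylinder A B F)" "g \<in> Arr (mapping_cylinder A B F)"
      "Src (mapping_cylinder A B F) g = Tgt (mapping_cylinder A B F) f"
      "Tgt (mapping_cylinder A B F) g = Src (mapping_cylinder A B F) f"
    then show "Src (mapping_cylinder A B F) f = Tgt (mapping_cylinder A B F) f"
      using A.no_cycle B.no_cycle by (auto simp: mapping_cylinder_def)
  qed
qed

section \<open>Classifying spaces of pushouts of sieve inclusions\<close>

context sieve_square
begin

lemma simplex_cover:
  assumes "s \<in> Smp (nerve P) n"
  shows "(\<exists>s1\<in>Smp (nerve C1) n. s = nerve_map j1 s1) \<or> (\<exists>s2\<in>Smp (nerve C2) n. s = nerve_map j2 s2)"
proof -
  have "is_string P (fst s) (snd s)" using assms by (simp add: nerve_Smp)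
  from string_cover[OF this] show ?thesis
  proof (elim disjE exE conjE)
    fix y gs assume "is_string C1 y gs" "fst s = onObj j1 y" "snd s = map (onArr j1) gs"
    then show ?thesis
      using assms by (intro disjI1 bexI[of _ "(y, gs)"]) (auto simp: nerve_Smp nerve_map_Pair prod_eq_iff)
  next
    fix y gs assume "is_string C2 y gs" "fst s = onObj j2 y" "snd s = map (onArr j2) gs"
    then show ?thesis
      using assms by (intro disjI2 bexI[of _ "(y, gs)"]) (auto simp: nerve_Smp nerve_map_Pair prod_eq_iff)
  qed
qed

lemma simplex_meet:
  assumes "s1 \<in> Smp (nerve C1) n" "s2 \<in> Smp (nerve C2) n" "nerve_map j1 s1 = nerve_map j2 s2"
  shows "\<exists>s\<in>Smp (nerve A) n. s1 = nerve_map F1 s \<and> s2 = nerve_map F2 s"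
proof -
  obtain a as where "is_string A a as" "s1 = nerve_map F1 (a, as)" "s2 = nerve_map F2 (a, as)"
    using assms string_meet[of "fst s1" "snd s1" "fst s2" "snd s2"]
    by (cases s1; cases s2) (auto simp: nerve_Smp nerve_map_Pair)
  then show ?thesis using assms(1) by (intro bexI[of _ "(a, as)"]) (auto simp: nerve_Smp nerve_map_Pair)
qed

lemma simplex_inj1:
  assumes "s \<in> Smp (nerve C1) n" "s' \<in> Smp (nerve C1) n" "nerve_map j1 s = nerve_map j1 s'"
  shows "s = s'"
  using string_inj1[of "fst s" "snd s" "fst s'" "snd s'"] assms
  by (cases s; cases s') (auto simp: nerve_Smp nerve_map_Pair)

end

lemma (in sieve_square) simplex_inj2:
  assumes "s \<in> Smp (nerve C2) n" "s' \<in> Smp (nerve C2) n" "nerve_map j2 s = nerve_map j2 s'"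
  shows "s = s'"
  by (rule sieve_square.simplex_inj1[OF sieve_square_sym[OF sieve_square_axioms] assms])

context sieve_square
begin

lemma B_cover:
  "topspace (B_space P) = B_map P j1 ` topspace (B_space C1) \<union> B_map P j2 ` topspace (B_space C2)"
proof (intro equalityI subsetI)
  fix p assume "p \<in> topspace (B_space P)"
  then obtain n s t where p: "p = pt (nerve P) n s t" "s \<in> Smp (nerve P) n" "t \<in> standard_simplex n"
    by (rule B_space_cases)
  from simplex_cover[OF p(2)] show "p \<in> B_map P j1 ` topspace (B_space C1) \<union> B_map P j2 ` topspace (B_space C2)"
  proof (elim disjE bexE)
    fix s1 assume "s1 \<in> Smp (nerve C1) n" "s = nerve_map j1 s1"
    then have "p = B_map P j1 (pt (nerve C1) n s1 t)" "pt (nerve C1) n s1 t \<in> topspace (B_space C1)"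
      using p by (auto simp: J1.B_map_pt B_space_def intro: pt_in)
    then show ?thesis by blast
  next
    fix s1 assume "s1 \<in> Smp (nerve C2) n" "s = nerve_map j2 s1"
    then have "p = B_map P j2 (pt (nerve C2) n s1 t)" "pt (nerve C2) n s1 t \<in> topspace (B_space C2)"
      using p by (auto simp: J2.B_map_pt B_space_def intro: pt_in)
    then show ?thesis by blast
  qed
qed (use J1.continuous_B_map J2.continuous_B_map in \<open>auto simp: continuous_map_def\<close>)

lemma compact_B_pushout:
  assumes "compact_space (B_space C1)" "compact_space (B_space C2)"
  shows "compact_space (B_space P)"
  unfolding compact_space_def B_cover
  using assms J1.continuous_B_map J2.continuous_B_map
  by (intro compactin_Un) (auto simp: compact_space_def intro: image_compactin)

lemma B_commutes: "p \<in> topspace (B_space A) \<Longrightarrow> B_map P j1 (B_map C1 F1 p) = B_map P j2 (B_map C2 F2 p)"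
  using B_map_comp[OF F1.cat_functor_axioms J1.cat_functor_axioms, of p]
    B_map_comp[OF F2.cat_functor_axioms J2.cat_functor_axioms, of p]
    B_map_cong[OF cat_functor_comp[OF F1.cat_functor_axioms J1.cat_functor_axioms] commutes, of p]
  by simp

text \<open>The map is defined on representatives by the leg to which the simplex lifts. Lifts to a
  leg are unique, and a simplex that lifts to both legs lifts to \<open>A\<close>, where the two
  maps agree.\<close>

theorem B_pushout:
  assumes u1: "continuous_map (B_space C1) E u1" and u2: "continuous_map (B_space C2) E u2"
    and u: "\<And>p. p \<in> topspace (B_space A) \<Longrightarrow> u1 (B_map C1 F1 p) = u2 (B_map C2 F2 p)"
  obtains w where "continuous_map (B_space P) E w"
    "\<And>p. p \<in> topspace (B_space C1) \<Longrightarrow> w (B_map P j1 p) = u1 p"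
    "\<And>p. p \<in> topspace (B_space C2) \<Longrightarrow> w (B_map P j2 p) = u2 p"
proof -
  define \<phi> where "\<phi> = (\<lambda>(n, s, t). if \<exists>s1\<in>Smp (nerve C1) n. s = nerve_map j1 s1
    then u1 (pt (nerve C1) n (SOME s1. s1 \<in> Smp (nerve C1) n \<and> s = nerve_map j1 s1) t)
    else u2 (pt (nerve C2) n (SOME s2. s2 \<in> Smp (nerve C2) n \<and> s = nerve_map j2 s2) t))"
  have \<phi>1: "\<phi> (n, nerve_map j1 s1, t) = u1 (pt (nerve C1) n s1 t)" if "s1 \<in> Smp (nerve C1) n" for n s1 t
  proof -
    have "(SOME s. s \<in> Smp (nerve C1) n \<and> nerve_map j1 s1 = nerve_map j1 s) = s1"
      by (rule some_equality) (use that simplex_inj1 in metis)+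
    then show ?thesis using that by (auto simp: \<phi>_def)
  qed
  have \<phi>2: "\<phi> (n, nerve_map j2 s2, t) = u2 (pt (nerve C2) n s2 t)"
    if s2: "s2 \<in> Smp (nerve C2) n" and t: "t \<in> standard_simplex n" for n s2 t
  proof (cases "\<exists>s1\<in>Smp (nerve C1) n. nerve_map j2 s2 = nerve_map j1 s1")
    case True
    then obtain s1 where s1: "s1 \<in> Smp (nerve C1) n" "nerve_map j2 s2 = nerve_map j1 s1" by blast
    then obtain s where s: "s \<in> Smp (nerve A) n" "s1 = nerve_map F1 s" "s2 = nerve_map F2 s"
      using simplex_meet s2 by metis
    have "u1 (pt (nerve C1) n s1 t) = u2 (pt (nerve C2) n s2 t)"
      using u[of "pt (nerve A) n s t"] s t
      by (simp add: F1.B_map_pt F2.B_map_pt pt_in B_space_def)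
    then show ?thesis using \<phi>1[OF s1(1)] s1(2) by simp
  next
    case False
    have "(SOME s. s \<in> Smp (nerve C2) n \<and> nerve_map j2 s2 = nerve_map j2 s) = s2"
      by (rule some_equality) (use s2 simplex_inj2 in metis)+
    then show ?thesis using False s2 by (simp add: \<phi>_def)
  qed
  have inv: "\<phi> (m, Act (nerve P) m n \<theta> s, t) = \<phi> (n, s, simplex_push m \<theta> t)"
    if *: "\<theta> \<in> monotone_maps m n" "s \<in> Smp (nerve P) n" "t \<in> standard_simplex m" for m n \<theta> s t
    using simplex_cover[OF *(2)]
  proof (elim disjE bexE)
    fix s1 assume s1: "s1 \<in> Smp (nerve C1) n" "s = nerve_map j1 s1"
    have "Act (nerve P) m n \<theta> s = nerve_map j1 (Act (nerve C1) m n \<theta> s1)"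
      using J1.nerve_map_simplicial s1 *(1) unfolding is_simplicial_map_def by metis
    then show ?thesis
      using s1 * by (simp add: \<phi>1 F1.T.Act_Smp pt_Act)
  next
    fix s2 assume s2: "s2 \<in> Smp (nerve C2) n" "s = nerve_map j2 s2"
    have "Act (nerve P) m n \<theta> s = nerve_map j2 (Act (nerve C2) m n \<theta> s2)"
      using J2.nerve_map_simplicial s2 *(1) unfolding is_simplicial_map_def by metis
    then show ?thesis
      using s2 * by (simp add: \<phi>2 F2.T.Act_Smp pt_Act simplex_push_in)
  qed
  define w where "w = class_val \<phi>"
  have w: "w (pt (nerve P) n s t) = \<phi> (n, s, t)" for n s t
    unfolding w_def by (rule class_val_pt[OF inv])
  show thesis
  proof
    show "continuous_map (B_space P) E w"
      unfolding B_space_def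
    proof (rule continuous_map_realization)
      fix n s assume "s \<in> Smp (nerve P) n"
      from simplex_cover[OF this] show "continuous_map (simplex_space n) E (\<lambda>t. w (pt (nerve P) n s t))"
        unfolding w
      proof (elim disjE bexE)
        fix s1 assume s1: "s1 \<in> Smp (nerve C1) n" "s = nerve_map j1 s1"
        have "continuous_map (simplex_space n) E (u1 \<circ> pt (nerve C1) n s1)"
          using continuous_map_pt[OF s1(1)] u1 unfolding B_space_def by (rule continuous_map_compose)
        then show "continuous_map (simplex_space n) E (\<lambda>t. \<phi> (n, s, t))"
          by (rule continuous_map_eq) (simp add: s1 \<phi>1)
      next
        fix s2 assume s2: "s2 \<in> Smp (nerve C2) n" "s = nerve_map j2 s2"
        have "continuous_map (simplex_space n) E (u2 \<circ> pt (nerve C2) n s2)"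
          using continuous_map_pt[OF s2(1)] u2 unfolding B_space_def by (rule continuous_map_compose)
        then show "continuous_map (simplex_space n) E (\<lambda>t. \<phi> (n, s, t))"
          by (rule continuous_map_eq) (simp add: s2 \<phi>2)
      qed
    qed
    show "w (B_map P j1 p) = u1 p" if "p \<in> topspace (B_space C1)" for p
      using that by (rule B_space_cases) (auto simp: J1.B_map_pt w \<phi>1)
    show "w (B_map P j2 p) = u2 p" if "p \<in> topspace (B_space C2)" for p
      using that by (rule B_space_cases) (auto simp: J2.B_map_pt w \<phi>2)
  qed
qed

end

text \<open>The mediating maps exist separately on sources and on targets. That they form a square
  and are unique follows because the images of the two legs cover the classifying space.\<close>

theorem B_arrow_pushout:
  fixes X :: "'x itself" and Y :: "'y itself"
  assumes sq: "sieve_square A C1 C2 P F1 F2 j1 j2" and sq': "sieve_square A' C1' C2' P' F1' F2' j1' j2'"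
    and G: "cat_functor A A' G" and H1: "cat_functor C1 C1' H1" and H2: "cat_functor C2 C2' H2" and H: "cat_functor P P' H"
    and c1: "func_eq A (F1' \<circ>\<^sub>F G) (H1 \<circ>\<^sub>F F1)" and c2: "func_eq A (F2' \<circ>\<^sub>F G) (H2 \<circ>\<^sub>F F2)"
    and d1: "func_eq C1 (H \<circ>\<^sub>F j1) (j1' \<circ>\<^sub>F H1)" and d2: "func_eq C2 (H \<circ>\<^sub>F j2) (j2' \<circ>\<^sub>F H2)"
  shows "is_top_arrow_pushout X Y (B_arrow (A, A', G)) (B_arrow (C1, C1', H1)) (B_arrow (C2, C2', H2)) (B_arrow (P, P', H))
    (B_square (C1, C1', H1) (F1, F1')) (B_square (C2, C2', H2) (F2, F2'))
    (B_square (P, P', H) (j1, j1')) (B_square (P, P', H) (j2, j2'))"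
proof -
  interpret S: sieve_square A C1 C2 P F1 F2 j1 j2 by fact
  interpret S': sieve_square A' C1' C2' P' F1' F2' j1' j2' by fact
  interpret G: cat_functor A A' G by fact
  interpret H1: cat_functor C1 C1' H1 by fact
  interpret H2: cat_functor C2 C2' H2 by fact
  interpret H: cat_functor P P' H by fact
  have sqB: "B_map D K (B_map B F p) = B_map D K' (B_map B' F' p)"
    if "cat_functor A B F" "cat_functor B D K" "cat_functor A B' F'" "cat_functor B' D K'"
      "func_eq A (K \<circ>\<^sub>F F) (K' \<circ>\<^sub>F F')" "p \<in> topspace (B_space A)"
    for A :: "('e1, 'e2) category" and B :: "('e3, 'e4) category" and B' :: "('e5, 'e6) category"
      and D :: "('e7, 'e8) category" and F F' K K' p
    using B_map_comp[OF that(1,2,6)] B_map_comp[OF that(3,4,6)]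
      B_map_cong[OF cat_functor_comp[OF that(1,2)] that(5,6)] by simp
  show ?thesis
    unfolding is_top_arrow_pushout_def
  proof (intro conjI allI impI)
    fix E :: "('x, 'y) top_arrow" and u1 u2
    assume as: "is_top_arrow E \<and> top_square (B_arrow (C1, C1', H1)) E u1 \<and> top_square (B_arrow (C2, C2', H2)) E u2 \<and>
      top_square_eq (B_arrow (A, A', G)) (top_square_comp u1 (B_square (C1, C1', H1) (F1, F1')))
        (top_square_comp u2 (B_square (C2, C2', H2) (F2, F2')))"
    obtain V W k where E: "E = (V, W, k)" by (metis prod_cases3)
    obtain a1 b1 where u1: "u1 = (a1, b1)" by force
    obtain a2 b2 where u2: "u2 = (a2, b2)" by force
    have k: "continuous_map V W k" and a1: "continuous_map (B_space C1) V a1" and b1: "continuous_map (B_space C1') W b1"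
      and s1: "\<And>p. p \<in> topspace (B_space C1) \<Longrightarrow> b1 (B_map C1' H1 p) = k (a1 p)"
      and a2: "continuous_map (B_space C2) V a2" and b2: "continuous_map (B_space C2') W b2"
      and s2: "\<And>p. p \<in> topspace (B_space C2) \<Longrightarrow> b2 (B_map C2' H2 p) = k (a2 p)"
      and a: "\<And>p. p \<in> topspace (B_space A) \<Longrightarrow> a1 (B_map C1 F1 p) = a2 (B_map C2 F2 p)"
      and b: "\<And>p. p \<in> topspace (B_space A') \<Longrightarrow> b1 (B_map C1' F1' p) = b2 (B_map C2' F2' p)"
      using as by (auto simp: E u1 u2 is_top_arrow_def top_square_def top_square_comp_def top_square_eq_def
          B_arrow_def B_square_def)
    obtain w where w: "continuous_map (B_space P) V w"
      "\<And>p. p \<in> topspace (B_space C1) \<Longrightarrow> w (B_map P j1 p) = a1 p"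
      "\<And>p. p \<in> topspace (B_space C2) \<Longrightarrow> w (B_map P j2 p) = a2 p"
      using S.B_pushout[OF a1 a2 a] by blast
    obtain w' where w': "continuous_map (B_space P') W w'"
      "\<And>p. p \<in> topspace (B_space C1') \<Longrightarrow> w' (B_map P' j1' p) = b1 p"
      "\<And>p. p \<in> topspace (B_space C2') \<Longrightarrow> w' (B_map P' j2' p) = b2 p"
      using S'.B_pushout[OF b1 b2 b] by blast
    have Hin: "B_map C1' H1 p \<in> topspace (B_space C1')" if "p \<in> topspace (B_space C1)" for p
      using that H1.continuous_B_map by (auto simp: continuous_map_def)
    have Hin2: "B_map C2' H2 p \<in> topspace (B_space C2')" if "p \<in> topspace (B_space C2)" for p
      using that H2.continuous_B_map by (auto simp: continuous_map_def)
    have comm: "w' (B_map P' H p) = k (w p)" if p: "p \<in> topspace (B_space P)" for p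
    proof -
      from p[unfolded S.B_cover] show ?thesis
      proof (elim UnE imageE)
        fix q assume q: "p = B_map P j1 q" "q \<in> topspace (B_space C1)"
        have "B_map P' H p = B_map P' j1' (B_map C1' H1 q)"
          unfolding q(1)
          by (rule sqB[OF S.J1.cat_functor_axioms H H1 S'.J1.cat_functor_axioms d1 q(2)])
        then show ?thesis using w(2)[OF q(2)] w'(2)[OF Hin[OF q(2)]] s1[OF q(2)] q by simp
      next
        fix q assume q: "p = B_map P j2 q" "q \<in> topspace (B_space C2)"
        have "B_map P' H p = B_map P' j2' (B_map C2' H2 q)"
          unfolding q(1)
          by (rule sqB[OF S.J2.cat_functor_axioms H H2 S'.J2.cat_functor_axioms d2 q(2)])
        then show ?thesis using w(3)[OF q(2)] w'(3)[OF Hin2[OF q(2)]] s2[OF q(2)] q by simp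
      qed
    qed
    have "top_square (B_arrow (P, P', H)) E (w, w')"
      using w(1) w'(1) comm by (auto simp: E top_square_def B_arrow_def)
    moreover have "top_square_eq (B_arrow (P, P', H)) (w, w') z"
      if "top_square_eq (B_arrow (C1, C1', H1)) (top_square_comp z (B_square (P, P', H) (j1, j1'))) u1"
        "top_square_eq (B_arrow (C2, C2', H2)) (top_square_comp z (B_square (P, P', H) (j2, j2'))) u2" for z
    proof -
      obtain z1 z2 where z: "z = (z1, z2)" by force
      show ?thesis
        using that w(2,3) w'(2,3)
        by (auto simp: z u1 u2 top_square_eq_def top_square_comp_def B_arrow_def B_square_def S.B_cover S'.B_cover)
    qed
    ultimately show "\<exists>z. top_square (B_arrow (P, P', H)) E z \<and>
        top_square_eq (B_arrow (C1, C1', H1)) (top_square_comp z (B_square (P, P', H) (j1, j1'))) u1 \<and>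
        top_square_eq (B_arrow (C2, C2', H2)) (top_square_comp z (B_square (P, P', H) (j2, j2'))) u2 \<and>
        (\<forall>z'. top_square (B_arrow (P, P', H)) E z' \<and>
          top_square_eq (B_arrow (C1, C1', H1)) (top_square_comp z' (B_square (P, P', H) (j1, j1'))) u1 \<and>
          top_square_eq (B_arrow (C2, C2', H2)) (top_square_comp z' (B_square (P, P', H) (j2, j2'))) u2
          \<longrightarrow> top_square_eq (B_arrow (P, P', H)) z z')"
      using w w' by (intro exI[of _ "(w, w')"])
        (auto simp: u1 u2 top_square_eq_def top_square_comp_def B_arrow_def B_square_def)
  qed (use G.continuous_B_map H1.continuous_B_map H2.continuous_B_map H.continuous_B_map
      S.F1.continuous_B_map S.F2.continuous_B_map S.J1.continuous_B_map S.J2.continuous_B_map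
      S'.F1.continuous_B_map S'.F2.continuous_B_map S'.J1.continuous_B_map S'.J2.continuous_B_map
      S.B_commutes S'.B_commutes
      sqB[OF G S'.F1.cat_functor_axioms S.F1.cat_functor_axioms H1 c1]
      sqB[OF G S'.F2.cat_functor_axioms S.F2.cat_functor_axioms H2 c2]
      sqB[OF H1 S'.J1.cat_functor_axioms S.J1.cat_functor_axioms H func_eq_sym[OF d1]]
      sqB[OF H2 S'.J2.cat_functor_axioms S.J2.cat_functor_axioms H func_eq_sym[OF d2]]
      in \<open>auto simp: is_top_arrow_def top_square_def top_square_comp_def top_square_eq_def B_arrow_def B_square_def\<close>)
qed

section \<open>The categories S, D and T\<close>

lemma presented_Comp':
  assumes "y = path_tgt R x p" "is_path R x p" "is_path R y q"
  shows "Comp (presented R) (path_arr R y q) (path_arr R x p) = path_arr R x (p @ q)"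
  using assms(2,3) unfolding assms(1) by (rule presented_Comp)

text \<open>Two opposite arrows concatenate to a closed path, so only closed paths have to be
  inspected.\<close>

lemma presented_loop_free:
  assumes endo: "\<And>x p. is_path R x p \<Longrightarrow> path_tgt R x p = x \<Longrightarrow> p = []"
  shows "loop_free (presented R)"
proof -
  interpret small_category "presented R" by (rule presented_category)
  show ?thesis
  proof
    fix f assume "f \<in> Arr (presented R)" "Src (presented R) f = Tgt (presented R) f"
    then obtain x p where "f = path_arr R x p" "is_path R x p" "path_tgt R x p = x"
      unfolding presented_Arr by force
    moreover from this have "p = []" using endo by blast
    ultimately show "f = Ident (presented R) (Src (presented R) f)" by simp
  next
    fix f g assume "f \<in> Arr (presented R)" "g \<in> Arr (presented R)" "Src (presented R) g = Tgt (presented R) f"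
      "Tgt (presented R) g = Src (presented R) f"
    then obtain x p q where pq: "f = path_arr R x p" "g = path_arr R (path_tgt R x p) q" "is_path R x p"
      "is_path R (path_tgt R x p) q" "path_tgt R (path_tgt R x p) q = x"
      by (auto simp: presented_Arr)
    then have "p @ q = []"
      by (intro endo[of x]) (auto simp: is_path_append path_tgt_append)
    then show "Src (presented R) f = Tgt (presented R) f" using pq by simp
  qed
qed

lemma S_obj_UNIV: "UNIV = {S_A, S_B}" using S_obj.exhaust by auto
lemma D_obj_UNIV: "UNIV = {D_A, D_B, D_X}" using D_obj.exhaust by auto
lemma T_obj_UNIV: "UNIV = {T_A0, T_A1, T_B0, T_B1, T_B2, T_B3}" using T_obj.exhaust by auto
lemma T_gen_UNIV: "UNIV = {T_f0, T_g0, T_f2, T_g2, T_pA, T_qA, T_pB1, T_qB3, T_f3, T_g1, T_qB1, T_pB3}"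
  using T_gen.exhaust by auto

lemma S_pres_simps [simp]: "Vert S_pres = UNIV" "Gen S_pres = UNIV" "Gsrc S_pres g = S_A" "Gtgt S_pres g = S_B"
    "Rel S_pres = {}"
  and D_pres_simps [simp]: "Vert D_pres = UNIV" "Gen D_pres = UNIV" "Gsrc D_pres = case_D_gen D_A D_A D_B"
    "Gtgt D_pres = case_D_gen D_B D_B D_X" "Rel D_pres = {(D_A, [D_f, D_t], [D_g, D_t])}"
  and T_pres_simps [simp]: "Vert T_pres = UNIV" "Gen T_pres = UNIV" "Gsrc T_pres = T_src" "Gtgt T_pres = T_tgt"
  by (simp_all add: S_pres_def D_pres_def T_pres_def)

lemma S_path_iff: "is_path S_pres x p \<longleftrightarrow> p = [] \<or> x = S_A \<and> (p = [S_f] \<or> p = [S_g])"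
proof -
  have "is_path S_pres S_B p \<longleftrightarrow> p = []" for p by (cases p) auto
  then show ?thesis
  proof (cases p)
    case (Cons g r)
    then show ?thesis using \<open>\<And>p. is_path S_pres S_B p \<longleftrightarrow> p = []\<close> by (cases g) auto
  qed simp
qed

lemma S_cong_eq: "path_cong S_pres x p q \<Longrightarrow> p = q"
  by (induction rule: path_cong.induct) auto

lemma S_arr_eq_iff [simp]:
  "is_path S_pres x p \<Longrightarrow> is_path S_pres y q \<Longrightarrow> path_arr S_pres x p = path_arr S_pres y q \<longleftrightarrow> x = y \<and> p = q"
  using path_arr_eq_iff S_cong_eq cong_refl by metis

lemma D_path_iff: "is_path D_pres x p \<longleftrightarrow> p = [] \<or> x = D_B \<and> p = [D_t] \<or>
    x = D_A \<and> (p = [D_f] \<or> p = [D_g] \<or> p = [D_f, D_t] \<or> p = [D_g, D_t])"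
proof -
  have X: "is_path D_pres D_X p \<longleftrightarrow> p = []" for p
    by (cases p) (auto split: D_gen.splits)
  have B: "is_path D_pres D_B p \<longleftrightarrow> p = [] \<or> p = [D_t]" for p
  proof (cases p)
    case (Cons g r)
    then show ?thesis using X by (cases g) auto
  qed simp
  show ?thesis
  proof (cases p)
    case (Cons g r)
    then show ?thesis using X B by (cases g; cases x) auto
  qed simp
qed

text \<open>The only relation is between paths that end at X, and only the empty path starts at X;
  hence congruent paths that end elsewhere are equal.\<close>

lemma D_cong_cases: "path_cong D_pres x p q \<Longrightarrow> path_tgt D_pres x p = D_X \<or> p = q"
proof (induction rule: path_cong.induct)
  case (cong_append x p q p' q')
  note par = path_cong_parallel[OF cong_append.hyps(1)] path_cong_parallel[OF cong_append.hyps(2)]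
  show ?case
  proof (cases "path_tgt D_pres x p = D_X")
    case True
    then have "p' = []" using par(4) by (simp add: D_path_iff)
    then show ?thesis using True by simp
  next
    case False
    then show ?thesis using cong_append.IH by (auto simp: path_tgt_append)
  qed
qed (auto simp: path_cong_parallel(3))

lemma D_arr_eq_iff [simp]:
  assumes p: "is_path D_pres x p" and q: "is_path D_pres y q"
  shows "path_arr D_pres x p = path_arr D_pres y q \<longleftrightarrow>
    x = y \<and> path_tgt D_pres x p = path_tgt D_pres y q \<and> (path_tgt D_pres x p = D_X \<or> p = q)"
proof -
  have "path_cong D_pres D_A [D_f, D_t] [D_g, D_t]" by (rule cong_base) auto
  then have "path_cong D_pres x p q" if "is_path D_pres x q" "path_tgt D_pres x p = path_tgt D_pres x q"
      "path_tgt D_pres x p = D_X \<or> p = q"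
    using that p cong_sym[of D_pres] cong_refl[of D_pres] by (auto simp: D_path_iff)
  then show ?thesis
    using path_arr_eq_iff[OF p q] path_cong_parallel[of D_pres x p q] D_cong_cases[of x p q] q by blast
qed

lemma T_path_iff: "is_path T_pres x p \<longleftrightarrow> p = [] \<or> (\<exists>g. p = [g] \<and> x = T_src g) \<or>
    (\<exists>g h. p = [g, h] \<and> x = T_src g \<and> T_tgt g = T_src h)"
proof -
  have no: "T_src k \<noteq> T_B1" "T_src k \<noteq> T_B3" for k by (cases k; simp)+
  have "T_tgt h \<in> {T_B1, T_B3}" if "T_tgt g = T_src h" for g h
    using that by (cases g; cases h) auto
  then have B: "is_path T_pres (T_tgt h) r \<longleftrightarrow> r = []" if "T_tgt g = T_src h" for g h r
    using that no by (cases r) force+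
  have C: "is_path T_pres (T_tgt g) r \<longleftrightarrow> r = [] \<or> (\<exists>h. r = [h] \<and> T_tgt g = T_src h)" for g r
    using B[of g] by (cases r) auto
  show ?thesis using C by (cases p) auto
qed

lemma T_composable: "T_tgt g = T_src h \<longleftrightarrow> (g, h) \<in>
    {(T_f0, T_pB1), (T_f0, T_qB3), (T_g0, T_pB1), (T_g0, T_qB3), (T_f2, T_qB1), (T_f2, T_pB3),
     (T_g2, T_qB1), (T_g2, T_pB3), (T_pA, T_f3), (T_pA, T_g1), (T_qA, T_f3), (T_qA, T_g1)}"
  by (cases g; cases h) auto

abbreviation "sI x \<equiv> path_arr S_pres x []"
abbreviation "sf \<equiv> path_arr S_pres S_A [S_f]"
abbreviation "sg \<equiv> path_arr S_pres S_A [S_g]"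
abbreviation "dI x \<equiv> path_arr D_pres x []"
abbreviation "df \<equiv> path_arr D_pres D_A [D_f]"
abbreviation "dg \<equiv> path_arr D_pres D_A [D_g]"
abbreviation "dt \<equiv> path_arr D_pres D_B [D_t]"
abbreviation "du \<equiv> path_arr D_pres D_A [D_f, D_t]"

lemma S_arr_simps [simp]: "S_arr_f = sf" "S_arr_g = sg" "S_id_A = sI S_A" "S_id_B = sI S_B"
    "gen_arr S_pres g = path_arr S_pres S_A [g]"
  and D_gen_arr_simps [simp]: "gen_arr D_pres D_f = df" "gen_arr D_pres D_g = dg" "gen_arr D_pres D_t = dt"
  by (simp_all add: S_arr_f_def S_arr_g_def S_id_A_def S_id_B_def S_cat_def gen_arr_def)

lemma S_Arr: "Arr S_cat = {sI S_A, sI S_B, sf, sg}"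
  by (auto simp: S_cat_def presented_Arr S_path_iff) (metis S_obj.exhaust)

lemma D_Arr: "Arr D_cat = {dI D_A, dI D_B, dI D_X, df, dg, dt, du}"
proof -
  have "path_arr D_pres D_A [D_g, D_t] = du" by simp
  then show ?thesis by (auto simp: D_cat_def presented_Arr D_path_iff) (metis D_obj.exhaust)
qed

lemma S_cat_simps [simp]:
  "Obj S_cat = UNIV" "Ident S_cat x = sI x" "Src S_cat (path_arr S_pres x p) = x"
  "Tgt S_cat (path_arr S_pres x p) = path_tgt S_pres x p"
  "y = path_tgt S_pres x p \<Longrightarrow> is_path S_pres x p \<Longrightarrow> is_path S_pres y q \<Longrightarrow>
    Comp S_cat (path_arr S_pres y q) (path_arr S_pres x p) = path_arr S_pres x (p @ q)"
  by (simp_all add: S_cat_def presented_Comp')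

lemma D_cat_simps [simp]:
  "Obj D_cat = UNIV" "Ident D_cat x = dI x" "Src D_cat (path_arr D_pres x p) = x"
  "Tgt D_cat (path_arr D_pres x p) = path_tgt D_pres x p"
  "y = path_tgt D_pres x p \<Longrightarrow> is_path D_pres x p \<Longrightarrow> is_path D_pres y q \<Longrightarrow>
    Comp D_cat (path_arr D_pres y q) (path_arr D_pres x p) = path_arr D_pres x (p @ q)"
  by (simp_all add: D_cat_def presented_Comp')

lemma T_cat_simps [simp]:
  "Obj T_cat = UNIV" "Ident T_cat x = path_arr T_pres x []" "Src T_cat (path_arr T_pres x p) = x"
  "Tgt T_cat (path_arr T_pres x p) = path_tgt T_pres x p"
  "is_path T_pres x p \<Longrightarrow> path_arr T_pres x p \<in> Arr T_cat"
  by (simp_all add: T_cat_def)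

lemma T_Arr: "Arr T_cat = {path_arr T_pres x p | x p. is_path T_pres x p}"
  by (simp add: T_cat_def presented_Arr)

lemma S_loop_free: "loop_free S_cat"
  unfolding S_cat_def by (rule presented_loop_free) (auto simp: S_path_iff)

lemma D_loop_free: "loop_free D_cat"
  unfolding D_cat_def by (rule presented_loop_free) (auto simp: D_path_iff)

lemma T_endo:
  assumes "is_path T_pres x p" "path_tgt T_pres x p = x"
  shows "p = []"
  using assms(1) unfolding T_path_iff
proof (elim disjE exE conjE)
  fix g assume "p = [g]" "x = T_src g"
  then show ?thesis using assms(2) by (cases g) simp_all
next
  fix g h assume p: "p = [g, h]" "x = T_src g" "T_tgt g = T_src h"
  show ?thesis using p(3) assms(2) unfolding p(1,2) T_composable by (elim insertE emptyE; simp)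
qed

lemma T_loop_free: "loop_free T_cat"
  unfolding T_cat_def by (rule presented_loop_free) (rule T_endo)

interpretation S: loop_free S_cat by (rule S_loop_free)
interpretation D: loop_free D_cat by (rule D_loop_free)
interpretation T: loop_free T_cat by (rule T_loop_free)

lemma finite_T: "finite (Obj T_cat)" "finite (Arr T_cat)"
proof -
  show "finite (Obj T_cat)" by (simp add: T_obj_UNIV)
  have "Arr T_cat \<subseteq> (\<lambda>(x, p). path_arr T_pres x p) ` (UNIV \<times> {p. set p \<subseteq> UNIV \<and> length p \<le> 2})"
  proof
    fix e assume "e \<in> Arr T_cat"
    then obtain x p where "e = path_arr T_pres x p" "is_path T_pres x p" by (auto simp: T_Arr)
    then show "e \<in> (\<lambda>(x, p). path_arr T_pres x p) ` (UNIV \<times> {p. set p \<subseteq> UNIV \<and> length p \<le> 2})"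
      unfolding T_path_iff by (intro image_eqI[of _ _ "(x, p)"]) auto
  qed
  moreover have "finite (UNIV :: T_gen set)" "finite (UNIV :: T_obj set)"
    by (simp_all only: T_gen_UNIV T_obj_UNIV finite_insert finite.emptyI)
  ultimately show "finite (Arr T_cat)"
    by (elim finite_subset) (intro finite_imageI finite_cartesian_product finite_lists_length_le)
qed

lemma finite_S: "finite (Obj S_cat)" "finite (Arr S_cat)"
  and finite_D: "finite (Obj D_cat)" "finite (Arr D_cat)"
  by (simp_all add: S_obj_UNIV D_obj_UNIV S_Arr D_Arr)

section \<open>The functors between them\<close>

definition sgn_S :: "(S_obj, S_gen) parr \<Rightarrow> int"
  where "sgn_S a = (if a = sf then 1 else if a = sg then -1 else 0)"

lemma sgn_S_simps [simp]: "sgn_S (sI x) = 0" "sgn_S sf = 1" "sgn_S sg = -1"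
  by (simp_all add: sgn_S_def)

lemma T_Rel: "(x, p, q) \<in> Rel T_pres \<longleftrightarrow> (x, p, q) \<in> {(T_A0, [T_f0, T_pB1], [T_f2, T_qB1]),
            (T_A0, [T_g0, T_pB1], [T_pA, T_g1]), (T_A0, [T_pA, T_f3], [T_f2, T_pB3]),
            (T_A0, [T_qA, T_f3], [T_f0, T_qB3]), (T_A0, [T_qA, T_g1], [T_g2, T_qB1]),
            (T_A0, [T_g0, T_qB3], [T_g2, T_pB3])}"
  by (simp add: T_pres_def)

interpretation FM: presentation_model S_cat T_pres FM_obj FM_gen
proof
  show "FM_gen g \<in> Arr S_cat" "Src S_cat (FM_gen g) = FM_obj (Gsrc T_pres g)"
    "Tgt S_cat (FM_gen g) = FM_obj (Gtgt T_pres g)" for g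
    by (cases g; simp add: S_Arr)+
qed (auto simp: T_Rel)

interpretation FN: presentation_model S_cat T_pres FN_obj FN_gen
proof
  show "FN_gen g \<in> Arr S_cat" "Src S_cat (FN_gen g) = FN_obj (Gsrc T_pres g)"
    "Tgt S_cat (FN_gen g) = FN_obj (Gtgt T_pres g)" for g
    by (cases g; simp add: S_Arr)+
qed (auto simp: T_Rel)

interpretation GG: presentation_model S_cat T_pres G_obj G_gen
proof
  show "G_gen g \<in> Arr S_cat" "Src S_cat (G_gen g) = G_obj (Gsrc T_pres g)"
    "Tgt S_cat (G_gen g) = G_obj (Gtgt T_pres g)" for g
    by (cases g; simp add: S_Arr)+
qed (auto simp: T_Rel)

interpretation SD: presentation_model D_cat S_pres "case_S_obj D_A D_B" "case_S_gen df dg"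
proof
  show "case_S_gen df dg g \<in> Arr D_cat" "Src D_cat (case_S_gen df dg g) = case_S_obj D_A D_B (Gsrc S_pres g)"
    "Tgt D_cat (case_S_gen df dg g) = case_S_obj D_A D_B (Gtgt S_pres g)" for g
    by (cases g; simp add: D_Arr)+
qed auto

lemma F_M_functor: "cat_functor T_cat S_cat F_M"
  and F_N_functor: "cat_functor T_cat S_cat F_N"
  and G_functor: "cat_functor T_cat S_cat G_fun"
  and S_incl_functor: "cat_functor S_cat D_cat S_incl"
  unfolding F_M_def F_N_def G_fun_def S_incl_def
  using FM.is_functor FN.is_functor GG.is_functor SD.is_functor by (simp_all add: T_cat_def S_cat_def)

lemma onObj_simps [simp]: "onObj F_M x = FM_obj x" "onObj F_N x = FN_obj x" "onObj G_fun x = G_obj x"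
  "onObj S_incl y = case_S_obj D_A D_B y"
  by (simp_all add: F_M_def F_N_def G_fun_def S_incl_def)

lemma onArr_path_simps [simp]:
  "is_path T_pres x p \<Longrightarrow> onArr F_M (path_arr T_pres x p) = composite S_cat (FM_obj x) (map FM_gen p)"
  "is_path T_pres x p \<Longrightarrow> onArr F_N (path_arr T_pres x p) = composite S_cat (FN_obj x) (map FN_gen p)"
  "is_path T_pres x p \<Longrightarrow> onArr G_fun (path_arr T_pres x p) = composite S_cat (G_obj x) (map G_gen p)"
  by (simp_all add: F_M_def F_N_def G_fun_def FM.onArr_path FN.onArr_path GG.onArr_path)

lemma onArr_S_incl [simp]: "onArr S_incl (sI x) = dI (case_S_obj D_A D_B x)" "onArr S_incl sf = df" "onArr S_incl sg = dg"
  by (simp_all add: S_incl_def SD.onArr_path)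

lemma S_incl_sieve: "sieve_inclusion S_cat D_cat S_incl"
  unfolding sieve_inclusion_def
proof (intro conjI ballI impI)
  show "inj_on (onObj S_incl) (Obj S_cat)" by (auto simp: inj_on_def split: S_obj.splits)
  show "inj_on (onArr S_incl) (Arr S_cat)" by (auto simp: inj_on_def S_Arr)
  fix f assume "f \<in> Arr D_cat" "Tgt D_cat f \<in> onObj S_incl ` Obj S_cat"
  then show "f \<in> onArr S_incl ` Arr S_cat"
    by (auto simp: D_Arr S_Arr split: S_obj.splits)
qed (rule S_incl_functor)

text \<open>The arrows of \<open>T\<close> with their images under \<open>F\<^sub>M\<close>, \<open>F\<^sub>N\<close> and \<open>G\<close>, where 1, -1 and 0 stand for \<open>f\<close>, \<open>g\<close>
  and identities.\<close>

definition T_signs :: "(T_obj \<times> T_obj \<times> int \<times> int \<times> int) set"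
  where "T_signs =
    {(T_A0, T_A0, 0, 0, 0), (T_A1, T_A1, 0, 0, 0), (T_B0, T_B0, 0, 0, 0), (T_B1, T_B1, 0, 0, 0),
     (T_B2, T_B2, 0, 0, 0), (T_B3, T_B3, 0, 0, 0),
     (T_A0, T_B0, 0, 1, 1), (T_A0, T_B0, 0, -1, -1), (T_A0, T_B2, -1, 1, 0), (T_A0, T_B2, 1, -1, 0),
     (T_A0, T_A1, -1, 0, -1), (T_A0, T_A1, 1, 0, 1), (T_B0, T_B1, -1, 0, 0), (T_B0, T_B3, 1, 0, 0),
     (T_A1, T_B3, 0, 1, 0), (T_A1, T_B1, 0, -1, 0), (T_B2, T_B1, 0, 0, 1), (T_B2, T_B3, 0, 0, -1),
     (T_A0, T_B1, -1, 1, 1), (T_A0, T_B1, -1, -1, -1), (T_A0, T_B1, 1, -1, 1),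
     (T_A0, T_B3, -1, 1, -1), (T_A0, T_B3, 1, 1, 1), (T_A0, T_B3, 1, -1, -1)}"

lemma T_arrow_signs:
  assumes "e \<in> Arr T_cat"
  shows "(Src T_cat e, Tgt T_cat e, sgn_S (onArr F_M e), sgn_S (onArr F_N e), sgn_S (onArr G_fun e)) \<in> T_signs"
proof -
  obtain x p where e: "e = path_arr T_pres x p" "is_path T_pres x p"
    using assms by (auto simp: T_Arr)
  from e(2)[unfolded T_path_iff] show ?thesis
  proof (elim disjE exE conjE)
    assume "p = []"
    then show ?thesis using e by (cases x) (simp_all add: T_signs_def)
  next
    fix g assume "p = [g]" "x = T_src g"
    then show ?thesis using e by (cases g) (simp_all add: T_signs_def)
  next
    fix g h assume p: "p = [g, h]" "x = T_src g" "T_tgt g = T_src h"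
    show ?thesis
      using p(3) e(2) unfolding e(1) p(1,2) T_composable by (elim insertE emptyE; simp add: T_signs_def)
  qed
qed

text \<open>On each hom-set of \<open>T\<close> the sign under \<open>G_fun\<close> together with
  the sign under \<open>F_M\<close>, or under \<open>F_N\<close>, separates the arrows. Two
  composites that agree in these signs are the same path or the two sides of a defining
  relation.\<close>

lemma T_faithful:
  assumes "e \<in> Arr T_cat" "e' \<in> Arr T_cat" "Src T_cat e = Src T_cat e'" "Tgt T_cat e = Tgt T_cat e'"
    and F: "onArr F_M e = onArr F_M e' \<or> onArr F_N e = onArr F_N e'" and G: "onArr G_fun e = onArr G_fun e'"
  shows "e = e'"
proof -
  obtain x p where e: "e = path_arr T_pres x p" "is_path T_pres x p" using assms by (auto simp: T_Arr)
  obtain q where e': "e' = path_arr T_pres x q" "is_path T_pres x q" "path_tgt T_pres x p = path_tgt T_pres x q"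
    using assms e by (auto simp: T_Arr)
  have "p = q \<or> (x, p, q) \<in> Rel T_pres \<or> (x, q, p) \<in> Rel T_pres"
  proof -
    have F': "sgn_S (onArr F_M e) = sgn_S (onArr F_M e') \<or> sgn_S (onArr F_N e) = sgn_S (onArr F_N e')"
      and G': "sgn_S (onArr G_fun e) = sgn_S (onArr G_fun e')" using F G by auto
    from e(2)[unfolded T_path_iff] show ?thesis
    proof (elim disjE exE conjE)
      assume "p = []"
      then show ?thesis using T_endo[OF e'(2)] e'(3) by simp
    next
      fix g assume g: "p = [g]" "x = T_src g"
      from e'(2)[unfolded T_path_iff] show ?thesis
      proof (elim disjE exE conjE)
        assume "q = []" then show ?thesis using g e'(3) by (cases g) auto
      next
        fix h assume h: "q = [h]" "x = T_src h"
        then show ?thesis using g e e' F' G' by (cases g; cases h) simp_all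
      next
        fix h k assume "q = [h, k]" "x = T_src h" "T_tgt h = T_src k"
        then show ?thesis using g e'(3) unfolding T_composable by (cases g) auto
      qed
    next
      fix g h assume gh: "p = [g, h]" "x = T_src g" "T_tgt g = T_src h"
      from e'(2)[unfolded T_path_iff] show ?thesis
      proof (elim disjE exE conjE)
        assume "q = []" then show ?thesis using gh e'(3) unfolding T_composable by auto
      next
        fix k assume "q = [k]" "x = T_src k"
        then show ?thesis using gh e'(3) unfolding T_composable by (cases k) auto
      next
        fix k l assume kl: "q = [k, l]" "x = T_src k" "T_tgt k = T_src l"
        show ?thesis
          using gh(3)[unfolded T_composable] kl(3)[unfolded T_composable] F' G' e'(3) unfolding e(1) e'(1) gh(1,2) kl(1)
          by (elim insertE emptyE; simp add: T_Rel T_path_iff)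
      qed
    qed
  qed
  then have "path_cong T_pres x p q"
  proof (elim disjE)
    assume "p = q" then show ?thesis using e by (simp add: cong_refl)
  next
    assume "(x, p, q) \<in> Rel T_pres" then show ?thesis using e(2) e'(2,3) by (rule cong_base)
  next
    assume "(x, q, p) \<in> Rel T_pres" then show ?thesis using e'(2) e(2) e'(3)[symmetric] by (rule cong_sym[OF cong_base])
  qed
  then show ?thesis unfolding e(1) e'(1) path_arr_eq_iff[OF e(2) e'(2)] by simp
qed

lemma D_X_terminal: "u \<in> Arr D_cat \<Longrightarrow> v \<in> Arr D_cat \<Longrightarrow> Src D_cat u = Src D_cat v \<Longrightarrow> Tgt D_cat u = D_X \<Longrightarrow>
    Tgt D_cat v = D_X \<Longrightarrow> u = v"
  by (auto simp: D_Arr)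

lemma to_X_props: "to_X x \<in> Arr D_cat" "Src D_cat (to_X x) = onObj S_incl (onObj G_fun x)" "Tgt D_cat (to_X x) = D_X"
proof -
  have "\<exists>!u. u \<in> Arr D_cat \<and> Src D_cat u = onObj (S_incl \<circ>\<^sub>F G_fun) x \<and> Tgt D_cat u = D_X"
  proof (rule ex_ex1I)
    show "\<exists>u. u \<in> Arr D_cat \<and> Src D_cat u = onObj (S_incl \<circ>\<^sub>F G_fun) x \<and> Tgt D_cat u = D_X"
      by (rule exI[of _ "case_S_obj du dt (G_obj x)"]) (cases "G_obj x"; simp add: D_Arr)
  qed (metis D_X_terminal)
  from theI'[OF this] show "to_X x \<in> Arr D_cat" "Src D_cat (to_X x) = onObj S_incl (onObj G_fun x)"
    "Tgt D_cat (to_X x) = D_X" by (auto simp: to_X_def)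
qed

lemma const_functor:
  assumes "small_category C" "small_category D" "x \<in> Obj D"
  shows "cat_functor C D (const_func D x)"
proof -
  interpret C: small_category C by fact
  interpret D: small_category D by fact
  show ?thesis
    using assms(3) by unfold_locales
      (auto simp: const_func_def D.Ident_in D.Src_Ident D.Tgt_Ident D.Comp_Ident' )
qed

lemma SG_functor: "cat_functor T_cat D_cat (S_incl \<circ>\<^sub>F G_fun)"
  by (rule cat_functor_comp[OF G_functor S_incl_functor])

text \<open>X is terminal in \<open>D\<close>, so every square of this kind commutes.\<close>

lemma to_X_nat:
  assumes "cat_functor T_cat S_cat F"
  shows "nat_trans T_cat D_cat (S_incl \<circ>\<^sub>F G_fun) (const_func D_cat D_X \<circ>\<^sub>F F) to_X"
  unfolding nat_trans_def
proof (intro conjI ballI)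
  interpret SG: cat_functor T_cat D_cat "S_incl \<circ>\<^sub>F G_fun" by (rule SG_functor)
  fix f assume f: "f \<in> Arr T_cat"
  show "Comp D_cat (to_X (Tgt T_cat f)) (onArr (S_incl \<circ>\<^sub>F G_fun) f) =
      Comp D_cat (onArr (const_func D_cat D_X \<circ>\<^sub>F F) f) (to_X (Src T_cat f))"
  proof (rule D_X_terminal)
    have 1: "Tgt D_cat (onArr (S_incl \<circ>\<^sub>F G_fun) f) = Src D_cat (to_X (Tgt T_cat f))"
      "onArr (S_incl \<circ>\<^sub>F G_fun) f \<in> Arr D_cat"
      "Src D_cat (onArr (S_incl \<circ>\<^sub>F G_fun) f) = Src D_cat (to_X (Src T_cat f))"
      using f by (auto simp only: SG.Tgt_onArr SG.onArr_in SG.Src_onArr to_X_props onObj_func_comp)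
    have 2: "onArr (const_func D_cat D_X \<circ>\<^sub>F F) f = Ident D_cat D_X" by (simp add: const_func_def)
    show "Comp D_cat (to_X (Tgt T_cat f)) (onArr (S_incl \<circ>\<^sub>F G_fun) f) \<in> Arr D_cat"
      using 1 by (intro D.Comp_in) (auto simp: to_X_props)
    have 3: "Comp D_cat (onArr (const_func D_cat D_X \<circ>\<^sub>F F) f) (to_X (Src T_cat f)) = to_X (Src T_cat f)"
      unfolding 2 by (rule D.Ident_Comp') (auto simp: to_X_props)
    show "Comp D_cat (onArr (const_func D_cat D_X \<circ>\<^sub>F F) f) (to_X (Src T_cat f)) \<in> Arr D_cat"
      "Tgt D_cat (Comp D_cat (onArr (const_func D_cat D_X \<circ>\<^sub>F F) f) (to_X (Src T_cat f))) = D_X"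
      unfolding 3 by (auto simp: to_X_props)
    show "Src D_cat (Comp D_cat (to_X (Tgt T_cat f)) (onArr (S_incl \<circ>\<^sub>F G_fun) f)) =
      Src D_cat (Comp D_cat (onArr (const_func D_cat D_X \<circ>\<^sub>F F) f) (to_X (Src T_cat f)))"
      unfolding 3 using 1 D.Src_Comp[OF 1(2) to_X_props(1) 1(1)] by simp
    show "Tgt D_cat (Comp D_cat (to_X (Tgt T_cat f)) (onArr (S_incl \<circ>\<^sub>F G_fun) f)) = D_X"
      using D.Tgt_Comp[OF 1(2) to_X_props(1) 1(1)] to_X_props by simp
  qed
qed (auto simp: to_X_props const_func_def)

lemma H_functor:
  assumes "cat_functor T_cat S_cat F"
  shows "cat_functor (mapping_cylinder T_cat S_cat F) D_cat (cyl_induced D_cat (S_incl \<circ>\<^sub>F G_fun) (const_func D_cat D_X) to_X)"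
  using assms SG_functor const_functor[OF S.small_category_axioms D.small_category_axioms] to_X_nat
  by (intro mapping_cylinder_universal(1)) auto

lemma H_M_functor: "cat_functor M_cat D_cat H_M"
  and H_N_functor: "cat_functor N_cat D_cat H_N"
  unfolding M_cat_def N_cat_def H_M_def H_N_def using H_functor F_M_functor F_N_functor by auto

lemma cyl_left_sieve:
  assumes "cat_functor A B F"
  shows "sieve_inclusion A (mapping_cylinder A B F) cyl_left"
  using mapping_cylinder_cocone(1)[OF assms]
  by (auto simp: sieve_inclusion_def cyl_left_def mapping_cylinder_def inj_on_def)

text \<open>The retraction of the cylinder onto its target end. For the cylinders over
  \<open>S\<close> its value in \<open>BS\<close> is the angle before the shear.\<close>

definition cyl_retract :: "('p, 'b) category \<Rightarrow> ('o, 'a, 'p, 'b) func \<Rightarrow> ('o + 'p, ('o, 'a, 'b) cyl_arr, 'p, 'b) func"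
  where "cyl_retract B F = cyl_induced B F id_func (\<lambda>x. Ident B (onObj F x))"

lemma cyl_retract_functor:
  assumes "cat_functor A B F"
  shows "cat_functor (mapping_cylinder A B F) B (cyl_retract B F)"
proof -
  interpret cat_functor A B F by fact
  have "nat_trans A B F (id_func \<circ>\<^sub>F F) (\<lambda>x. Ident B (onObj F x))"
    by (auto simp: nat_trans_def T.Ident_in T.Src_Ident T.Tgt_Ident onObj_in onArr_in T.Comp_Ident'
        T.Ident_Comp' Src_onArr Tgt_onArr)
  then show ?thesis
    unfolding cyl_retract_def
    by (intro mapping_cylinder_universal(1) assms id_functor T.small_category_axioms)
qed

lemma cyl_retract_simps [simp]:
  "onObj (cyl_retract B F) (Inl x) = onObj F x" "onObj (cyl_retract B F) (Inr y) = y"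
  "onArr (cyl_retract B F) (Left_arr f) = onArr F f" "onArr (cyl_retract B F) (Right_arr g) = g"
  "onArr (cyl_retract B F) (Mixed x g) = Comp B g (Ident B (onObj F x))"
  by (simp_all add: cyl_retract_def cyl_induced_def)

section \<open>Injectivity and gluing for classifying spaces\<close>

lemma B_map_in:
  "cat_functor C D F \<Longrightarrow> p \<in> topspace (B_space C) \<Longrightarrow> B_map D F p \<in> topspace (B_space D)"
  using cat_functor.continuous_B_map by (fastforce simp: continuous_map_def)

text \<open>Injectivity on objects transports the weights unchanged. Arrows are recovered because
  parallel arrows in one carrier of \<open>D\<close> coincide.\<close>

lemma B_map_inj:
  assumes F: "cat_functor C D F" and C: "loop_free C" "finite (Obj C)" and D: "loop_free D"
    and inj: "inj_on (onObj F) (Obj C)" "inj_on (onArr F) (Arr C)"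
  shows "inj_on (B_map D F) (topspace (B_space C))"
proof (rule inj_onI)
  interpret C: loop_free C by fact
  interpret D: loop_free D by fact
  interpret cat_functor C D F by fact
  fix p q assume p: "p \<in> topspace (B_space C)" and q: "q \<in> topspace (B_space C)" and pq: "B_map D F p = B_map D F q"
  have m: "mass D (onObj F v) (B_map D F r) = mass C v r" if "v \<in> Obj C" "r \<in> topspace (B_space C)" for v r
  proof -
    have "mass D (onObj F v) (B_map D F r) = (\<Sum>x\<in>Obj C. if x = v then mass C x r else 0)"
      unfolding mass_B_map[OF C(2) that(2)] using inj(1) that by (intro sum.cong) (auto simp: inj_on_def)
    then show ?thesis using C(2) that by simp
  qed
  show "p = q"
  proof (rule C.point_eqI[OF p q])
    show "mass C v p = mass C v q" if "v \<in> Obj C" for v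
      using m[OF that p] m[OF that q] pq by simp
    fix f g assume fg: "f \<in> carrier_arrs C p" "g \<in> carrier_arrs C q" "Src C f = Src C g" "Tgt C f = Tgt C g"
    then have A: "f \<in> Arr C" "g \<in> Arr C" using C.carrier_arrs_props p q by auto
    have "onArr F f \<in> carrier_arrs D (B_map D F p)" "onArr F g \<in> carrier_arrs D (B_map D F p)"
      using fg pq carrier_arrs_B_map[OF p] carrier_arrs_B_map[OF q] by auto
    then have "onArr F f = onArr F g"
      using D.carrier_arrs_unique[OF B_map_in[OF F p]] fg A by (simp add: Src_onArr Tgt_onArr)
    then show "f = g" using inj A by (auto simp: inj_on_def)
  qed
qed

text \<open>All vertices of a nondegenerate representative with positive weights lie in the image;
  as arrows into the image lift, so does the whole string.\<close>

lemma sieve_point: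
  assumes F: "sieve_inclusion C D F" and D: "loop_free D" and p: "p \<in> topspace (B_space D)"
    and m: "\<And>v. v \<in> Obj D \<Longrightarrow> v \<notin> onObj F ` Obj C \<Longrightarrow> mass D v p = 0"
  shows "p \<in> B_map D F ` topspace (B_space C)"
proof -
  interpret D: loop_free D by fact
  interpret cat_functor C D F using F by (simp add: sieve_inclusion_def)
  have lift: "\<exists>x gs. is_string C x gs \<and> y = onObj F x \<and> fs = map (onArr F) gs"
    if "is_string D y fs" "y \<in> onObj F ` Obj C" "set fs \<subseteq> onArr F ` Arr C" for y fs
    using that
  proof (induction fs arbitrary: y)
    case Nil
    then show ?case by (auto intro!: exI[of _ "[]"])
  next
    case (Cons f fs)
    then obtain g where g: "g \<in> Arr C" "f = onArr F g" by auto
    have "\<exists>x gs. is_string C x gs \<and> Tgt D f = onObj F x \<and> fs = map (onArr F) gs"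
      using Cons g by (intro Cons.IH) (auto simp: Tgt_onArr S.Tgt_in)
    then obtain x gs where x: "is_string C x gs" "Tgt D f = onObj F x" "fs = map (onArr F) gs" by blast
    have "x = Tgt C g"
      using x g F is_string_Obj[OF x(1)] by (auto simp: Tgt_onArr sieve_inclusion_def inj_on_def S.Tgt_in)
    then show ?case
      using x g Cons.prems by (intro exI[of _ "Src C g"] exI[of _ "g # gs"]) (auto simp: S.Src_in Src_onArr)
  qed
  obtain n s t where r: "p = pt (nerve D) n s t" "D.nondegenerate n s" "t \<in> standard_simplex n" "\<forall>i\<le>n. t i > 0"
    using p by (rule D.nondegenerate_rep)
  have sm: "s \<in> Smp (nerve D) n" using r by (simp add: D.nondegenerate_def)
  have v: "string_vertex D s i \<in> onObj F ` Obj C" if "i \<le> n" for i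
  proof (rule ccontr)
    assume *: "string_vertex D s i \<notin> onObj F ` Obj C"
    have "t i = 0"
      using m[OF D.string_vertex_Obj[OF sm that] *] D.mass_nondegenerate[OF r(2) that, of t] r(1) by simp
    then show False using r(4) that by force
  qed
  have "snd s ! i \<in> onArr F ` Arr C" if i: "i < n" for i
  proof -
    have "snd s ! i \<in> Arr D" "Tgt D (snd s ! i) = string_vertex D s (Suc i)"
      using D.string_arr_props[OF sm, of i "Suc i"] D.string_arr_Suc[OF sm i] i by auto
    then show ?thesis using v[of "Suc i"] i F by (auto simp: sieve_inclusion_def)
  qed
  then have "set (snd s) \<subseteq> onArr F ` Arr C"
    using sm by (auto simp: in_set_conv_nth nerve_Smp)
  then obtain x gs where x: "is_string C x gs" "fst s = onObj F x" "snd s = map (onArr F) gs"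
    using lift[of "fst s" "snd s"] v[of 0] sm by (cases s) (auto simp: nerve_Smp)
  have 1: "(x, gs) \<in> Smp (nerve C) n" using x sm by (simp add: nerve_Smp)
  moreover have "nerve_map F (x, gs) = s" using x by (simp add: nerve_map_Pair prod_eq_iff)
  ultimately have "p = B_map D F (pt (nerve C) n (x, gs) t)"
    using r B_map_pt by simp
  moreover have "pt (nerve C) n (x, gs) t \<in> topspace (B_space C)"
    using 1 r by (simp add: B_space_def pt_in)
  ultimately show ?thesis by blast
qed

text \<open>A continuous bijection from a compact space to a Hausdorff space. For points of
  different legs with a common value, \<open>meet\<close> places the first one in \<open>BA\<close>,
  and injectivity of \<open>u2\<close> then identifies its partner, so that the two are
  glued.\<close>

lemma (in sieve_square) B_glue_homeomorphic_map:
  assumes c: "compact_space (B_space C1)" "compact_space (B_space C2)" and E: "Hausdorff_space E"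
    and u1: "continuous_map (B_space C1) E u1" and u2: "continuous_map (B_space C2) E u2"
    and u: "\<And>p. p \<in> topspace (B_space A) \<Longrightarrow> u1 (B_map C1 F1 p) = u2 (B_map C2 F2 p)"
    and inj: "inj_on u1 (topspace (B_space C1))" "inj_on u2 (topspace (B_space C2))"
    and meet: "\<And>p q. \<lbrakk>p \<in> topspace (B_space C1); q \<in> topspace (B_space C2); u1 p = u2 q\<rbrakk>
      \<Longrightarrow> p \<in> B_map C1 F1 ` topspace (B_space A)"
    and surj: "topspace E \<subseteq> u1 ` topspace (B_space C1) \<union> u2 ` topspace (B_space C2)"
  obtains w where "homeomorphic_map (B_space P) E w"
    "\<And>p. p \<in> topspace (B_space C1) \<Longrightarrow> w (B_map P j1 p) = u1 p"
    "\<And>p. p \<in> topspace (B_space C2) \<Longrightarrow> w (B_map P j2 p) = u2 p"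
proof -
  obtain w where w: "continuous_map (B_space P) E w"
    "\<And>p. p \<in> topspace (B_space C1) \<Longrightarrow> w (B_map P j1 p) = u1 p"
    "\<And>p. p \<in> topspace (B_space C2) \<Longrightarrow> w (B_map P j2 p) = u2 p"
    using B_pushout[OF u1 u2 u] by blast
  have glue: "B_map P j1 p = B_map P j2 q"
    if pq: "p \<in> topspace (B_space C1)" "q \<in> topspace (B_space C2)" "u1 p = u2 q" for p q
  proof -
    obtain a where a: "a \<in> topspace (B_space A)" "p = B_map C1 F1 a" using meet pq by blast
    have "B_map C2 F2 a = q"
      using inj(2) u[OF a(1)] a pq B_map_in[OF F2.cat_functor_axioms a(1)] by (auto simp: inj_on_def)
    then show ?thesis using a B_commutes by auto
  qed
  have "homeomorphic_map (B_space P) E w"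
  proof (rule continuous_imp_homeomorphic_map[OF w(1) compact_B_pushout[OF c] E])
    show "inj_on w (topspace (B_space P))"
    proof (rule inj_onI)
      fix p q assume "p \<in> topspace (B_space P)" "q \<in> topspace (B_space P)" and e: "w p = w q"
      then show "p = q"
        unfolding B_cover
      proof (elim UnE imageE)
        fix p1 q1 assume "p = B_map P j1 p1" "p1 \<in> topspace (B_space C1)" "q = B_map P j1 q1" "q1 \<in> topspace (B_space C1)"
        then show ?thesis using e w(2) inj(1) by (auto simp: inj_on_def)
      next
        fix p1 q1 assume "p = B_map P j2 p1" "p1 \<in> topspace (B_space C2)" "q = B_map P j2 q1" "q1 \<in> topspace (B_space C2)"
        then show ?thesis using e w(3) inj(2) by (auto simp: inj_on_def)
      next
        fix p1 q1 assume "p = B_map P j1 p1" "p1 \<in> topspace (B_space C1)" "q = B_map P j2 q1" "q1 \<in> topspace (B_space C2)"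
        then show ?thesis using e w(2,3) glue by auto
      next
        fix p1 q1 assume "p = B_map P j2 p1" "p1 \<in> topspace (B_space C2)" "q = B_map P j1 q1" "q1 \<in> topspace (B_space C1)"
        then show ?thesis using e w(2,3) glue[of q1 p1] by auto
      qed
    qed
    show "w ` topspace (B_space P) = topspace E"
    proof
      show "w ` topspace (B_space P) \<subseteq> topspace E" using w(1) by (auto simp: continuous_map_def)
      show "topspace E \<subseteq> w ` topspace (B_space P)"
      proof
        fix e assume "e \<in> topspace E"
        then consider p where "p \<in> topspace (B_space C1)" "e = u1 p" | p where "p \<in> topspace (B_space C2)" "e = u2 p"
          using surj by blast
        then show "e \<in> w ` topspace (B_space P)"
        proof cases
          case (1 p)
          then have "e = w (B_map P j1 p)" by (simp add: w(2))
          then show ?thesis using B_map_in[OF J1.cat_functor_axioms 1(1)] by blast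
        next
          case (2 p)
          then have "e = w (B_map P j2 p)" by (simp add: w(3))
          then show ?thesis using B_map_in[OF J2.cat_functor_axioms 2(1)] by blast
        qed
      qed
    qed
  qed
  then show thesis using that w by blast
qed

section \<open>The classifying spaces of D and S\<close>

text \<open>Polar coordinates: the radius is a + b, and the angle runs from 0, where b vanishes, to
  \<sigma> times pi, where a vanishes. At the centre the quotient has the default value 0, and the
  factor a + b makes the result 0.\<close>

definition disk_fun :: "real \<Rightarrow> real \<Rightarrow> real \<Rightarrow> complex"
  where "disk_fun \<sigma> a b = complex_of_real (a + b) * cis (\<sigma> * pi * (b / (a + b)))"

text \<open>If neither \<open>df\<close> nor \<open>dg\<close> is in the carrier, one of the weights
  at A and B vanishes, and both signs give the same value of \<open>disk_fun\<close>; so the default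
  1 does no harm.\<close>

definition sign_D :: "(D_obj, (D_obj, D_gen) parr) cs_point \<Rightarrow> real"
  where "sign_D p = (if dg \<in> carrier_arrs D_cat p then -1 else 1)"

text \<open>The disk is the cone over the circle; on an edge of the circle the angle is proportional to the
  relative weight of B, with the sign depending on the edge.\<close>

definition disk :: "(D_obj, (D_obj, D_gen) parr) cs_point \<Rightarrow> complex"
  where "disk p = disk_fun (sign_D p) (mass D_cat D_A p) (mass D_cat D_B p)"

text \<open>The only critical point is the centre. The angle has no limit there, but the modulus a +
  b tends to 0.\<close>

lemma continuous_map_disk_fun:
  assumes a: "continuous_map X euclideanreal a" and b: "continuous_map X euclideanreal b"
    and pos: "\<And>x. x \<in> topspace X \<Longrightarrow> a x \<ge> 0 \<and> b x \<ge> 0"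
  shows "continuous_map X euclidean (\<lambda>x. disk_fun \<sigma> (a x) (b x))"
proof -
  let ?S = "{z :: real \<times> real. fst z \<ge> 0 \<and> snd z \<ge> 0}"
  have "continuous_on ?S (\<lambda>z. disk_fun \<sigma> (fst z) (snd z))"
    unfolding continuous_on_eq_continuous_within
  proof
    fix z :: "real \<times> real" assume z: "z \<in> ?S"
    show "continuous (at z within ?S) (\<lambda>z. disk_fun \<sigma> (fst z) (snd z))"
    proof (cases "fst z + snd z = 0")
      case True
      have "((\<lambda>z. disk_fun \<sigma> (fst z) (snd z)) \<longlongrightarrow> 0) (at z within ?S)"
      proof (rule Lim_null_comparison)
        show "\<forall>\<^sub>F x in at z within ?S. norm (disk_fun \<sigma> (fst x) (snd x)) \<le> fst x + snd x"
          unfolding eventually_at_filter by (auto simp: disk_fun_def norm_mult simp flip: of_real_add)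
        have "((\<lambda>x. fst x + snd x) \<longlongrightarrow> fst z + snd z) (at z within ?S)"
          by (intro tendsto_intros)
        then show "((\<lambda>x. fst x + snd x) \<longlongrightarrow> 0) (at z within ?S)" using True by simp
      qed
      then show ?thesis using True by (simp add: continuous_within disk_fun_def flip: of_real_add)
    next
      case False
      then show ?thesis unfolding disk_fun_def cis_conv_exp by (intro continuous_intros) auto
    qed
  qed
  then have "continuous_map (top_of_set ?S) euclidean (\<lambda>z. disk_fun \<sigma> (fst z) (snd z))"
    by simp
  moreover have "continuous_map X (top_of_set ?S) (\<lambda>x. (a x, b x))"
    using continuous_map_pairedI[OF a b] pos
    by (auto simp: continuous_map_in_subtopology euclidean_product_topology)
  ultimately have "continuous_map X euclidean ((\<lambda>z. disk_fun \<sigma> (fst z) (snd z)) \<circ> (\<lambda>x. (a x, b x)))"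
    by (rule continuous_map_compose[rotated])
  then show ?thesis by (simp add: comp_def)
qed

lemma norm_disk_fun: "a \<ge> 0 \<Longrightarrow> b \<ge> 0 \<Longrightarrow> norm (disk_fun \<sigma> a b) = a + b"
  by (simp add: disk_fun_def norm_mult flip: of_real_add)

lemma disk_fun_circle: "a + b = 1 \<Longrightarrow> disk_fun \<sigma> a b = cis (\<sigma> * pi * b)"
  by (simp add: disk_fun_def flip: of_real_add)

lemma disk_fun_sign:
  assumes "a = 0 \<or> b = 0"
  shows "disk_fun (-1) a b = disk_fun 1 a b"
  using assms by (cases "a = 0"; cases "b = 0") (auto simp: disk_fun_def complex_eq_iff)

text \<open>The modulus gives a + b; the cosine, injective on [0, pi], gives the relative weight
  b/(a + b); the sign of the sine gives \<sigma> in the interior of the half circle.\<close>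

lemma disk_fun_inj:
  assumes ab: "a \<ge> 0" "b \<ge> 0" and ab': "a' \<ge> 0" "b' \<ge> 0" and \<sigma>: "\<sigma> \<in> {-1, 1}" "\<sigma>' \<in> {-1, 1}"
    and eq: "disk_fun \<sigma> a b = disk_fun \<sigma>' a' b'"
  shows "a = a' \<and> b = b' \<and> (a = 0 \<or> b = 0 \<or> \<sigma> = \<sigma>')"
proof -
  have r: "a + b = a' + b'" using arg_cong[OF eq, of norm] ab ab' by (simp add: norm_disk_fun)
  show ?thesis
  proof (cases "a + b = 0")
    case True
    then show ?thesis using r ab ab' by auto
  next
    case False
    define x where "x = pi * (b / (a + b))"
    define x' where "x' = pi * (b' / (a + b))"
    have "0 \<le> b / (a + b)" "b / (a + b) \<le> 1" "0 \<le> b' / (a + b)" "b' / (a + b) \<le> 1"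
      using ab ab' r False by (auto simp: divide_simps)
    then have x: "0 \<le> x" "x \<le> pi" "0 \<le> x'" "x' \<le> pi"
      unfolding x_def x'_def by (auto simp del: times_divide_eq_right intro!: mult_left_le mult_nonneg_nonneg)
    have "complex_of_real (a + b) * cis (\<sigma> * x) = complex_of_real (a + b) * cis (\<sigma>' * x')"
      using eq unfolding disk_fun_def x_def x'_def r[symmetric] by (simp only: mult.assoc)
    moreover have "complex_of_real (a + b) \<noteq> 0" using False by (simp only: of_real_eq_0_iff not_False_eq_True)
    ultimately have "cis (\<sigma> * x) = cis (\<sigma>' * x')" by (metis mult_left_cancel)
    then have cs: "cos (\<sigma> * x) = cos (\<sigma>' * x')" "sin (\<sigma> * x) = sin (\<sigma>' * x')"
      by (auto simp: complex_eq_iff)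
    have "cos x = cos x'" using cs(1) \<sigma> by auto
    then have xx: "x = x'" using x cos_inj_pi by blast
    then have b: "b = b'" using False by (simp add: x_def x'_def)
    have "\<sigma> = \<sigma>'" if "a \<noteq> 0" "b \<noteq> 0"
    proof -
      have "0 < x" "x < pi" using that ab False by (auto simp: x_def field_simps)
      then have "sin x > 0" by (rule sin_gt_zero)
      then show ?thesis using cs(2) \<sigma> xx by auto
    qed
    then show ?thesis using r b by auto
  qed
qed

lemma disk_fun_surj:
  assumes "norm w \<le> 1"
  obtains \<sigma> a b where "\<sigma> \<in> {-1, 1}" "a \<ge> 0" "b \<ge> 0" "a + b = norm w" "w = disk_fun \<sigma> a b"
proof -
  define \<sigma> where "\<sigma> = (if Arg w < 0 then -1 else 1 :: real)"
  \<comment> \<open>The relative weight of B has to be the absolute argument as a fraction of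
    pi.\<close>
  define b where "b = norm w * \<bar>Arg w\<bar> / pi"
  have A: "\<bar>Arg w\<bar> \<le> pi" using Arg_bounded[of w] by linarith
  have "b \<ge> 0" by (simp add: b_def)
  moreover have "norm w - b \<ge> 0"
    using mult_left_mono[OF A, of "norm w"] by (simp add: b_def field_simps)
  moreover have "w = disk_fun \<sigma> (norm w - b) b"
  proof (cases "w = 0")
    case False
    then have "\<sigma> * pi * (b / norm w) = Arg w" by (simp add: b_def \<sigma>_def)
    then show ?thesis
      using rcis_cmod_Arg[of w] by (simp add: disk_fun_def rcis_def)
  qed (simp add: disk_fun_def b_def)
  ultimately show thesis using that[of \<sigma> "norm w - b" b] by (auto simp: \<sigma>_def)
qed

section \<open>Signs of strings and of points in D\<close>

lemma D_string_no_sign: "is_string D_cat y fs \<Longrightarrow> y \<noteq> D_A \<Longrightarrow> df \<notin> set fs \<and> dg \<notin> set fs"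
proof (induction fs arbitrary: y)
  case (Cons f fs)
  then have f: "f \<in> Arr D_cat" "Src D_cat f \<noteq> D_A" by auto
  then have "Tgt D_cat f \<noteq> D_A" "f \<noteq> df" "f \<noteq> dg" by (auto simp: D_Arr)
  then show ?case using Cons by auto
qed simp

lemma D_string_one_sign: "is_string D_cat y fs \<Longrightarrow> df \<notin> set fs \<or> dg \<notin> set fs"
proof (induction fs arbitrary: y)
  case (Cons f fs)
  have "is_string D_cat (Tgt D_cat f) fs" using Cons.prems by simp
  then show ?case using Cons.IH D_string_no_sign[of "Tgt D_cat f" fs] by auto
qed simp

lemma D_sign_irreducible:
  assumes "a \<in> Arr D_cat" "b \<in> Arr D_cat" "Tgt D_cat a = Src D_cat b" "c \<in> {df, dg}" "Comp D_cat b a = c"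
  shows "a = c \<or> b = c"
  using assms by (auto simp: D_Arr)

lemma D_composite_sign:
  "is_string D_cat y fs \<Longrightarrow> c \<in> {df, dg} \<Longrightarrow> composite D_cat y fs = c \<Longrightarrow> c \<in> set fs"
proof (induction fs arbitrary: y)
  case (Cons f fs)
  then show ?case
    using D_sign_irreducible[of f "composite D_cat (Tgt D_cat f) fs" c] D.composite_props[of "Tgt D_cat f" fs] by auto
qed auto

lemma D_carrier_sign:
  assumes s: "s \<in> Smp (nerve D_cat) n" and c: "c \<in> {df, dg}" "c \<in> carrier_arrs D_cat (pt (nerve D_cat) n s t)"
  shows "c \<in> set (snd s)"
proof -
  obtain i j where ij: "c = string_arr D_cat s i j" "i \<le> j" "j \<le> n"
    using c(2) by (auto simp: D.carrier_arrs_pt)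
  have "c \<in> set (take (j - i) (drop i (snd s)))"
    using D_composite_sign[OF D.string_arr_string(1)[OF s ij(2,3)] c(1)] ij(1) by (simp add: string_arr_def)
  then show ?thesis using in_set_takeD in_set_dropD by fast
qed

lemma D_carrier_AB:
  assumes "p \<in> topspace (B_space D_cat)" "mass D_cat D_A p > 0" "mass D_cat D_B p > 0"
  shows "df \<in> carrier_arrs D_cat p \<or> dg \<in> carrier_arrs D_cat p"
proof -
  obtain f where f: "f \<in> carrier_arrs D_cat p"
    "(Src D_cat f = D_A \<and> Tgt D_cat f = D_B) \<or> (Src D_cat f = D_B \<and> Tgt D_cat f = D_A)"
    using D.carrier_arrs_between[OF assms] by blast
  have "f \<in> Arr D_cat" using D.carrier_arrs_props(1)[OF assms(1) f(1)] .
  then have "f = df \<or> f = dg" using f(2) by (auto simp: D_Arr)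
  then show ?thesis using f(1) by auto
qed

text \<open>Where the sign of the string and the sign of the point disagree, one of the weights vanishes.\<close>

lemma disk_pt:
  assumes s: "s \<in> Smp (nerve D_cat) n" and t: "t \<in> standard_simplex n"
  shows "disk (pt (nerve D_cat) n s t) = disk_fun (if dg \<in> set (snd s) then -1 else 1)
    (mass D_cat D_A (pt (nerve D_cat) n s t)) (mass D_cat D_B (pt (nerve D_cat) n s t))"
proof -
  let ?p = "pt (nerve D_cat) n s t"
  have p: "?p \<in> topspace (B_space D_cat)" using s t by (simp add: B_space_def pt_in)
  show ?thesis
  proof (cases "dg \<in> set (snd s)")
    case True
    then have "df \<notin> set (snd s)" using D_string_one_sign s by (auto simp: nerve_Smp)
    then have "df \<notin> carrier_arrs D_cat ?p" using D_carrier_sign[OF s, of df t] by auto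
    then have "dg \<in> carrier_arrs D_cat ?p \<or> mass D_cat D_A ?p = 0 \<or> mass D_cat D_B ?p = 0"
      using D_carrier_AB[OF p] D.mass_nonneg[OF p] by (metis less_eq_real_def)
    then show ?thesis using True disk_fun_sign by (auto simp: disk_def sign_D_def)
  next
    case False
    then have "dg \<notin> carrier_arrs D_cat ?p" using D_carrier_sign[OF s, of dg t] by auto
    then show ?thesis using False by (simp add: disk_def sign_D_def)
  qed
qed

lemma continuous_disk: "continuous_map (B_space D_cat) euclidean disk"
  unfolding B_space_def
proof (rule continuous_map_realization)
  fix n s assume s: "s \<in> Smp (nerve D_cat) n"
  have m: "continuous_map (simplex_space n) euclideanreal (\<lambda>t. mass D_cat v (pt (nerve D_cat) n s t))" for v
    using continuous_map_compose[OF continuous_map_pt[OF s] D.continuous_mass[unfolded B_space_def]]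
    by (simp add: comp_def)
  have "continuous_map (simplex_space n) euclidean (\<lambda>t. disk_fun (if dg \<in> set (snd s) then -1 else 1)
    (mass D_cat D_A (pt (nerve D_cat) n s t)) (mass D_cat D_B (pt (nerve D_cat) n s t)))"
    by (intro continuous_map_disk_fun m) (use s D.mass_nonneg in \<open>simp add: B_space_def pt_in\<close>)
  then show "continuous_map (simplex_space n) euclidean (\<lambda>t. disk (pt (nerve D_cat) n s t))"
    by (rule continuous_map_eq) (use s in \<open>simp add: disk_pt\<close>)
qed

lemma D_sum_mass:
  "p \<in> topspace (B_space D_cat) \<Longrightarrow> mass D_cat D_A p + mass D_cat D_B p + mass D_cat D_X p = 1"
  using D.sum_mass[OF finite_D(1)] by (simp add: D_obj_UNIV add.assoc)

lemma disk_eq_cis: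
  assumes "q \<in> topspace (B_space D_cat)" "mass D_cat D_X q = 0"
  shows "disk q = cis (2 * pi * (sign_D q * mass D_cat D_B q / 2))"
  using D_sum_mass[OF assms(1)] assms(2) disk_fun_circle[of "mass D_cat D_A q" "mass D_cat D_B q" "sign_D q"]
  by (simp add: disk_def mult_ac)

lemma norm_disk:
  assumes "p \<in> topspace (B_space D_cat)"
  shows "norm (disk p) = 1 - mass D_cat D_X p"
  using D_sum_mass[OF assms] D.mass_nonneg[OF assms] by (simp add: disk_def norm_disk_fun)

lemma inj_disk: "inj_on disk (topspace (B_space D_cat))"
proof (rule inj_onI)
  fix p q assume p: "p \<in> topspace (B_space D_cat)" and q: "q \<in> topspace (B_space D_cat)" and eq: "disk p = disk q"
  have *: "mass D_cat D_A p = mass D_cat D_A q \<and> mass D_cat D_B p = mass D_cat D_B q \<and>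
      (mass D_cat D_A p = 0 \<or> mass D_cat D_B p = 0 \<or> sign_D p = sign_D q)"
    using eq unfolding disk_def
    by (intro disk_fun_inj) (auto simp: D.mass_nonneg p q sign_D_def)
  show "p = q"
  proof (rule D.point_eqI[OF p q])
    show "mass D_cat v p = mass D_cat v q" for v
      using * D_sum_mass[OF p] D_sum_mass[OF q] by (cases v) auto
    fix f g assume fg: "f \<in> carrier_arrs D_cat p" "g \<in> carrier_arrs D_cat q" "Src D_cat f = Src D_cat g" "Tgt D_cat f = Tgt D_cat g"
    note fp = D.carrier_arrs_props[OF p fg(1)] and gp = D.carrier_arrs_props[OF q fg(2)]
    show "f = g"
    proof (rule ccontr)
      assume ne: "f \<noteq> g"
      \<comment> \<open>Distinct parallel arrows of \<open>D\<close> are \<open>df\<close> and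
        \<open>dg\<close>. Their presence makes the weights at A and B positive, and there the signs
        of \<open>p\<close> and \<open>q\<close> agree.\<close>
      then have c: "(f = df \<and> g = dg) \<or> (f = dg \<and> g = df)"
        using fg(3,4) fp(1) gp(1) by (auto simp: D_Arr)
      have "sign_D p = sign_D q" using * c fp by auto
      then have "(dg \<in> carrier_arrs D_cat p) = (dg \<in> carrier_arrs D_cat q)"
        by (auto simp: sign_D_def split: if_splits)
      then have "df = dg"
        using c fg D.carrier_arrs_unique[OF p, of df dg] D.carrier_arrs_unique[OF q, of df dg] by auto
      then show False by simp
    qed
  qed
qed

definition tuple3 :: "real \<Rightarrow> real \<Rightarrow> real \<Rightarrow> nat \<Rightarrow> real"
  where "tuple3 a b c i = (if i = 0 then a else if i = 1 then b else if i = 2 then c else 0)"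

lemma tuple3_simplex: "a \<ge> 0 \<Longrightarrow> b \<ge> 0 \<Longrightarrow> c \<ge> 0 \<Longrightarrow> a + b + c = 1 \<Longrightarrow> tuple3 a b c \<in> standard_simplex 2"
  by (auto simp: standard_simplex_def tuple3_def numeral_2_eq_2)

lemma image_disk: "disk ` topspace (B_space D_cat) = cball 0 1"
proof (intro equalityI subsetI)
  fix w assume "w \<in> disk ` topspace (B_space D_cat)"
  then show "w \<in> cball 0 1" using norm_disk D.mass_nonneg by auto
next
  fix w :: complex assume "w \<in> cball 0 1"
  then have "norm w \<le> 1" by simp
  then obtain \<sigma> a b where w: "\<sigma> \<in> {-1, 1}" "a \<ge> 0" "b \<ge> 0" "a + b = norm w" "w = disk_fun \<sigma> a b"
    by (rule disk_fun_surj)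
  define s where "s = (D_A, [if \<sigma> = 1 then df else dg, dt])"
  have s: "s \<in> Smp (nerve D_cat) 2" by (auto simp: s_def nerve_Smp D_Arr)
  have t: "tuple3 a b (1 - norm w) \<in> standard_simplex 2"
    using w \<open>norm w \<le> 1\<close> by (intro tuple3_simplex) auto
  have m: "mass D_cat D_A (pt (nerve D_cat) 2 s (tuple3 a b (1 - norm w))) = a"
    "mass D_cat D_B (pt (nerve D_cat) 2 s (tuple3 a b (1 - norm w))) = b"
    by (auto simp: D.mass_pt s_def tuple3_def numeral_2_eq_2)
  have "disk (pt (nerve D_cat) 2 s (tuple3 a b (1 - norm w))) = w"
    unfolding disk_pt[OF s t] m using w by (auto simp: s_def)
  then show "w \<in> disk ` topspace (B_space D_cat)"
    using s t by (metis B_space_def image_eqI pt_in)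
qed

lemma D_compact: "compact_space (B_space D_cat)"
  by (rule D.compact_B_space[OF finite_D])

lemma disk_homeomorphic: "homeomorphic_map (B_space D_cat) D2_space disk"
  unfolding D2_space_def
proof (rule continuous_imp_homeomorphic_map[OF _ D_compact])
  show "continuous_map (B_space D_cat) (top_of_set (cball 0 1)) disk"
    using continuous_disk image_disk by (auto simp: continuous_map_in_subtopology)
qed (simp_all add: Hausdorff_space_subtopology inj_disk image_disk)

section \<open>The circle BS as the boundary of the disk BD\<close>

definition circ :: "(S_obj, (S_obj, S_gen) parr) cs_point \<Rightarrow> complex"
  where "circ p = disk (B_map D_cat S_incl p)"

definition sign_S :: "(S_obj, (S_obj, S_gen) parr) cs_point \<Rightarrow> real"
  where "sign_S p = (if sg \<in> carrier_arrs S_cat p then -1 else 1)"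

lemma S_incl_inj: "inj_on (onObj S_incl) (Obj S_cat)" "inj_on (onArr S_incl) (Arr S_cat)"
  using S_incl_sieve by (auto simp: sieve_inclusion_def)

lemma S_incl_B_inj: "inj_on (B_map D_cat S_incl) (topspace (B_space S_cat))"
  by (rule B_map_inj[OF S_incl_functor S_loop_free finite_S(1) D_loop_free S_incl_inj])

lemma mass_S_incl:
  assumes "p \<in> topspace (B_space S_cat)"
  shows "mass D_cat D_A (B_map D_cat S_incl p) = mass S_cat S_A p"
    "mass D_cat D_B (B_map D_cat S_incl p) = mass S_cat S_B p"
    "mass D_cat D_X (B_map D_cat S_incl p) = 0"
  unfolding cat_functor.mass_B_map[OF S_incl_functor finite_S(1) assms] by (auto simp: S_obj_UNIV)

lemma S_sum_mass: "p \<in> topspace (B_space S_cat) \<Longrightarrow> mass S_cat S_A p + mass S_cat S_B p = 1"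
  using S.sum_mass[OF finite_S(1)] by (simp add: S_obj_UNIV)

lemma circ_eq:
  assumes p: "p \<in> topspace (B_space S_cat)"
  shows "circ p = cis (sign_S p * pi * mass S_cat S_B p)"
proof -
  have "dg \<in> onArr S_incl ` carrier_arrs S_cat p \<longleftrightarrow> sg \<in> carrier_arrs S_cat p"
  proof
    assume "dg \<in> onArr S_incl ` carrier_arrs S_cat p"
    then obtain f where f: "f \<in> carrier_arrs S_cat p" "onArr S_incl f = dg" by auto
    then have "f \<in> Arr S_cat" using S.carrier_arrs_props(1)[OF p] by simp
    then have "f = sg" using f(2) by (auto simp: S_Arr)
    then show "sg \<in> carrier_arrs S_cat p" using f by simp
  next
    assume "sg \<in> carrier_arrs S_cat p"
    then show "dg \<in> onArr S_incl ` carrier_arrs S_cat p" by (intro image_eqI[of _ _ sg]) simp_all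
  qed
  then have "sign_D (B_map D_cat S_incl p) = sign_S p"
    by (simp add: sign_D_def sign_S_def cat_functor.carrier_arrs_B_map[OF S_incl_functor p])
  then show ?thesis
    using S_sum_mass[OF p] by (simp add: circ_def disk_def mass_S_incl[OF p] disk_fun_def)
qed

lemma continuous_circ: "continuous_map (B_space S_cat) S1_space circ"
  unfolding S1_space_def continuous_map_in_subtopology
proof
  have "continuous_map (B_space S_cat) euclidean (disk \<circ> B_map D_cat S_incl)"
    by (rule continuous_map_compose[OF cat_functor.continuous_B_map[OF S_incl_functor] continuous_disk])
  then show "continuous_map (B_space S_cat) euclidean circ" by (simp add: circ_def[abs_def] comp_def)
qed (auto simp: circ_eq)

lemma S_point_of_disk:
  assumes "p \<in> topspace (B_space D_cat)" "norm (disk p) = 1"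
  shows "p \<in> B_map D_cat S_incl ` topspace (B_space S_cat)"
proof (rule sieve_point[OF S_incl_sieve D_loop_free assms(1)])
  fix v assume "v \<notin> onObj S_incl ` Obj S_cat"
  then have "v = D_X" using rangeI[of "case_S_obj D_A D_B" S_A] rangeI[of "case_S_obj D_A D_B" S_B]
    by (cases v) (auto simp: image_iff)
  then show "mass D_cat v p = 0" using norm_disk[OF assms(1)] assms(2) by simp
qed

lemma S_compact: "compact_space (B_space S_cat)"
  by (rule S.compact_B_space[OF finite_S])

lemma circ_homeomorphic: "homeomorphic_map (B_space S_cat) S1_space circ"
proof (rule continuous_imp_homeomorphic_map[OF continuous_circ S_compact])
  show "inj_on circ (topspace (B_space S_cat))"
    unfolding circ_def[abs_def]
    using comp_inj_on[OF S_incl_B_inj inj_on_subset[OF inj_disk]] B_map_in[OF S_incl_functor]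
    by (auto simp: comp_def)
  show "circ ` topspace (B_space S_cat) = topspace S1_space"
  proof
    show "circ ` topspace (B_space S_cat) \<subseteq> topspace S1_space"
      using continuous_circ by (auto simp: continuous_map_def)
    show "topspace S1_space \<subseteq> circ ` topspace (B_space S_cat)"
    proof
      fix w :: complex assume "w \<in> topspace S1_space"
      then have w: "norm w = 1" by (simp add: S1_space_def)
      then have "w \<in> disk ` topspace (B_space D_cat)" unfolding image_disk by simp
      then obtain p where p: "p \<in> topspace (B_space D_cat)" "w = disk p" by auto
      then show "w \<in> circ ` topspace (B_space S_cat)"
        using S_point_of_disk[OF p(1)] w by (auto simp: circ_def)
    qed
  qed
qed (simp add: S1_space_def Hausdorff_space_subtopology)

section \<open>The fibres over the disk\<close>

text \<open>The weights and signs of a point of a mapping cylinder: \<open>a0\<close>, \<open>b1\<close>, \<open>b2\<close>, \<open>b3\<close> belong to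
  \<open>A\<^sub>0\<close>, \<open>B\<^sub>1\<close>, \<open>B\<^sub>2\<close>, \<open>B\<^sub>3\<close>, while \<open>e1\<close> and \<open>e2\<close> belong to \<open>A\<^sub>1\<close> and \<open>B\<^sub>0\<close> for \<open>M\<close>, and to \<open>B\<^sub>0\<close>
  and \<open>A\<^sub>1\<close> for \<open>N\<close>; \<open>z0\<close>, \<open>z1\<close> belong to the copy of \<open>S\<close>. The sign \<open>r\<close> is that of the image under
  the retraction to \<open>S\<close>, the sign \<open>g\<close> that of the image in \<open>D\<close>.\<close>

definition valid :: "real \<Rightarrow> real \<Rightarrow> real \<Rightarrow> real \<Rightarrow> real \<Rightarrow> real \<Rightarrow> real \<Rightarrow> real \<Rightarrow> real \<Rightarrow> real \<Rightarrow> bool"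
  where "valid a0 e1 e2 b1 b2 b3 z0 z1 r g \<longleftrightarrow>
    a0 \<ge> 0 \<and> e1 \<ge> 0 \<and> e2 \<ge> 0 \<and> b1 \<ge> 0 \<and> b2 \<ge> 0 \<and> b3 \<ge> 0 \<and> z0 \<ge> 0 \<and> z1 \<ge> 0 \<and>
    a0 + e1 + e2 + b1 + b2 + b3 + z0 + z1 = 1 \<and> (r = 1 \<or> r = -1) \<and> (g = 1 \<or> g = -1) \<and>
    (e1 = 0 \<or> e2 = 0) \<and> (e1 = 0 \<or> b2 = 0) \<and> (e2 = 0 \<or> b2 = 0) \<and> (b1 = 0 \<or> b3 = 0) \<and>
    (z0 = 0 \<or> e1 = 0 \<and> b1 = 0 \<and> b2 = 0 \<and> b3 = 0) \<and>
    (a0 = 0 \<or> e1 = 0 \<or> r = g) \<and> (e2 = 0 \<or> b1 = 0 \<or> r = -1) \<and> (e2 = 0 \<or> b3 = 0 \<or> r = 1) \<and>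
    (b2 = 0 \<or> b1 = 0 \<or> g = 1) \<and> (b2 = 0 \<or> b3 = 0 \<or> g = -1) \<and>
    (a0 = 0 \<or> b1 = 0 \<or> r = -1 \<or> g = 1) \<and> (a0 = 0 \<or> b3 = 0 \<or> r = 1 \<or> g = -1)"

text \<open>The position of a point on its fibre, measured in turns.\<close>

definition turns :: "real \<Rightarrow> real \<Rightarrow> real \<Rightarrow> real \<Rightarrow> real \<Rightarrow> real \<Rightarrow> real"
  where "turns e1 b1 b2 b3 z1 r = r * (e1 + b1 + b2 + b3 + z1) / 2 + (b1 - b3) / 4"

text \<open>A fibre with \<open>g = -1\<close> is a circle composed of eight segments, each of which lies in one of
  the following cells; \<open>x\<close> is the position.\<close>

definition segment :: "real \<Rightarrow> real \<Rightarrow> real \<Rightarrow> real \<Rightarrow> real \<Rightarrow> real \<Rightarrow> real \<Rightarrow> real \<Rightarrow> real \<Rightarrow> bool"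
  where "segment e1 e2 b1 b2 b3 z0 z1 r x \<longleftrightarrow>
    r = -1 \<and> x = - (e1 + b1 + b2 + b3 + z1) / 2 + (b1 - b3) / 4 \<and>
      (e1 = 0 \<and> e2 = 0 \<and> b1 = 0 \<and> z0 = 0 \<or> e2 = 0 \<and> b1 = 0 \<and> b2 = 0 \<and> z0 = 0 \<or>
       e2 = 0 \<and> b3 = 0 \<and> b2 = 0 \<and> z0 = 0 \<or> e1 = 0 \<and> b2 = 0 \<and> b3 = 0 \<and> z0 = 0 \<or>
       e1 = 0 \<and> b1 = 0 \<and> b2 = 0 \<and> b3 = 0) \<or>
    r = 1 \<and> x = (e1 + b1 + b2 + b3 + z1) / 2 + (b1 - b3) / 4 \<and>
      (e1 = 0 \<and> b1 = 0 \<and> b2 = 0 \<and> b3 = 0 \<or> e1 = 0 \<and> b1 = 0 \<and> b2 = 0 \<and> z0 = 0 \<or>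
       e1 = 0 \<and> e2 = 0 \<and> b1 = 0 \<and> z0 = 0)"

text \<open>Exchanging \<open>B\<^sub>1\<close> with \<open>B\<^sub>3\<close> and reversing both
  signs is a symmetry that reflects positions; it reduces fibres with g = 1 to those with g =
  -1.\<close>

lemma valid_mirror:
  assumes "valid a0 e1 e2 b1 b2 b3 z0 z1 r g"
  shows "valid a0 e1 e2 b3 b2 b1 z0 z1 (- r) (- g)"
  using assms unfolding valid_def by argo

lemma turns_mirror: "turns e1 b3 b2 b1 z1 (- r) = - turns e1 b1 b2 b3 z1 r"
  by (simp add: turns_def algebra_simps add_divide_distrib diff_divide_distrib)

text \<open>The recorded sign may differ from that of the segment. If a0 + e2 + z0 = 0, the
  retraction sends the point to the vertex B of the circle; the recorded sign can then be 1 on a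
  segment described with -1, and the position is one full turn too large.\<close>

lemma valid_segment:
  assumes "valid a0 e1 e2 b1 b2 b3 z0 z1 r (-1)"
  shows "\<exists>r' x. segment e1 e2 b1 b2 b3 z0 z1 r' x \<and>
    (r' = r \<and> x = turns e1 b1 b2 b3 z1 r \<or> r = 1 \<and> a0 + e2 + z0 = 0 \<and> x = turns e1 b1 b2 b3 z1 r - 1)"
proof -
  note V = assms[unfolded valid_def]
  let ?x = "(e1 + b1 + b2 + b3 + z1) / 2 + (b1 - b3) / 4"
  have "r = -1 \<and> segment e1 e2 b1 b2 b3 z0 z1 (-1) (- (e1 + b1 + b2 + b3 + z1) / 2 + (b1 - b3) / 4) \<or>
    r = 1 \<and> segment e1 e2 b1 b2 b3 z0 z1 1 ?x \<or>
    r = 1 \<and> a0 + e2 + z0 = 0 \<and> segment e1 e2 b1 b2 b3 z0 z1 (-1) (?x - 1)"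
    using V unfolding segment_def by argo
  then show ?thesis
  proof (elim disjE conjE)
    assume "r = -1" "segment e1 e2 b1 b2 b3 z0 z1 (-1) (- (e1 + b1 + b2 + b3 + z1) / 2 + (b1 - b3) / 4)"
    then show ?thesis
      by (intro exI[of _ "-1"] exI[of _ "- (e1 + b1 + b2 + b3 + z1) / 2 + (b1 - b3) / 4"])
        (simp add: turns_def)
  next
    assume "r = 1" "segment e1 e2 b1 b2 b3 z0 z1 1 ?x"
    then show ?thesis by (intro exI[of _ 1] exI[of _ ?x]) (simp add: turns_def)
  next
    assume "r = 1" "a0 + e2 + z0 = 0" "segment e1 e2 b1 b2 b3 z0 z1 (-1) (?x - 1)"
    then show ?thesis by (intro exI[of _ "-1"] exI[of _ "?x - 1"]) (simp add: turns_def)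
  qed
qed

context
  fixes a0 e1 e2 b1 b2 b3 z0 z1 :: real
  assumes nn: "a0 \<ge> 0" "e1 \<ge> 0" "e2 \<ge> 0" "b1 \<ge> 0" "b2 \<ge> 0" "b3 \<ge> 0" "z0 \<ge> 0" "z1 \<ge> 0"
    "a0 + e1 + e2 + b1 + b2 + b3 + z0 + z1 = 1"
begin

text \<open>An interval of length one: with \<alpha>, \<beta>, s the weights at A, B, X, the lengths
  of the segments from left to right are \<alpha>/2, \<beta>/4, \<beta>/4, \<beta>/4, s/2, s/2,
  \<beta>/4, \<alpha>/2.\<close>

lemma segment_range:
  assumes "segment e1 e2 b1 b2 b3 z0 z1 r x"
  shows "- 1 / 2 - (e1 + e2 + b1 + b3) / 4 \<le> x" "x \<le> 1 / 2 - (e1 + e2 + b1 + b3) / 4"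
  using assms nn unfolding segment_def by argo+

text \<open>The fibre closes up here: both ends of the interval are the point whose weights are
  concentrated in b2, b3 and z1.\<close>

lemma segment_end:
  assumes "segment e1 e2 b1 b2 b3 z0 z1 r x"
    and "x = - 1 / 2 - (e1 + e2 + b1 + b3) / 4 \<or> x = 1 / 2 - (e1 + e2 + b1 + b3) / 4"
  shows "a0 = 0" "e1 = 0" "e2 = 0" "b1 = 0" "z0 = 0"
  using assms nn unfolding segment_def by argo+

context
  fixes a0' e1' e2' b1' b2' b3' z0' z1' :: real
  assumes nn': "a0' \<ge> 0" "e1' \<ge> 0" "e2' \<ge> 0" "b1' \<ge> 0" "b2' \<ge> 0" "b3' \<ge> 0" "z0' \<ge> 0" "z1' \<ge> 0"
    and eq: "a0 + b2 = a0' + b2'" "e1 + e2 + b1 + b3 = e1' + e2' + b1' + b3'" "z0 + z1 = z0' + z1'"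
begin

text \<open>Within a segment the position is strictly monotone in the weight that moves, and
  consecutive segments share an end. The two exceptions for the signs are the points that the
  retraction sends to a vertex of the circle.\<close>

lemma segment_unique:
  assumes "segment e1 e2 b1 b2 b3 z0 z1 r x" "segment e1' e2' b1' b2' b3' z0' z1' r' x"
  shows "a0 = a0'" "e1 = e1'" "e2 = e2'" "b1 = b1'" "b2 = b2'" "b3 = b3'" "z0 = z0'" "z1 = z1'"
    "r = r' \<or> a0 + e2 + z0 = 0 \<or> e1 + b1 + b2 + b3 + z1 = 0"
  using assms nn nn' eq unfolding segment_def by argo+

end

end

text \<open>Both positions lie in the same closed interval of length one and differ by an integer,
  so they are equal or are ends of the interval, which represent one point.\<close>

lemma fibre_inj_negative:
  assumes V: "valid a0 e1 e2 b1 b2 b3 z0 z1 r (-1)" and V': "valid a0' e1' e2' b1' b2' b3' z0' z1' r' (-1)"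
    and eq: "a0 + b2 = a0' + b2'" "e1 + e2 + b1 + b3 = e1' + e2' + b1' + b3'" "z0 + z1 = z0' + z1'"
    and t: "turns e1' b1' b2' b3' z1' r' = turns e1 b1 b2 b3 z1 r + of_int k"
  shows "a0 = a0' \<and> e1 = e1' \<and> e2 = e2' \<and> b1 = b1' \<and> b2 = b2' \<and> b3 = b3' \<and> z0 = z0' \<and> z1 = z1' \<and>
    (r = r' \<or> a0 + e2 + z0 = 0 \<or> e1 + b1 + b2 + b3 + z1 = 0)"
proof -
  have nn: "a0 \<ge> 0" "e1 \<ge> 0" "e2 \<ge> 0" "b1 \<ge> 0" "b2 \<ge> 0" "b3 \<ge> 0" "z0 \<ge> 0" "z1 \<ge> 0"
    "a0 + e1 + e2 + b1 + b2 + b3 + z0 + z1 = 1" using V by (simp_all add: valid_def)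
  have nn': "a0' \<ge> 0" "e1' \<ge> 0" "e2' \<ge> 0" "b1' \<ge> 0" "b2' \<ge> 0" "b3' \<ge> 0" "z0' \<ge> 0" "z1' \<ge> 0"
    "a0' + e1' + e2' + b1' + b2' + b3' + z0' + z1' = 1" using V' by (simp_all add: valid_def)
  obtain s x where x: "segment e1 e2 b1 b2 b3 z0 z1 s x" "s = r \<or> a0 + e2 + z0 = 0"
    "x = turns e1 b1 b2 b3 z1 r \<or> x = turns e1 b1 b2 b3 z1 r - 1"
    using valid_segment[OF V] by blast
  obtain s' x' where x': "segment e1' e2' b1' b2' b3' z0' z1' s' x'" "s' = r' \<or> a0' + e2' + z0' = 0"
    "x' = turns e1' b1' b2' b3' z1' r' \<or> x' = turns e1' b1' b2' b3' z1' r' - 1"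
    using valid_segment[OF V'] by blast
  have "\<exists>m::int. x' = x + of_int m"
    using x(3) x'(3) t by (elim disjE) (auto intro: exI[of _ k] exI[of _ "k + 1"] exI[of _ "k - 1"])
  then obtain m :: int where m: "x' = x + of_int m" by blast
  note range = segment_range[OF nn x(1)] segment_range[OF nn' x'(1)]
  show ?thesis
  proof (cases "m = 0")
    case True
    then have "segment e1' e2' b1' b2' b3' z0' z1' s' x" using x' m by simp
    from segment_unique[OF nn nn'(1-8) eq x(1) this] show ?thesis
      using x(2) x'(2) by auto
  next
    case False
    then consider "m \<ge> 1" | "m \<le> -1" by linarith
    then have ends: "(x = - 1 / 2 - (e1 + e2 + b1 + b3) / 4 \<or> x = 1 / 2 - (e1 + e2 + b1 + b3) / 4) \<and>
      (x' = - 1 / 2 - (e1' + e2' + b1' + b3') / 4 \<or> x' = 1 / 2 - (e1' + e2' + b1' + b3') / 4)"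
    proof cases
      case 1
      then have "of_int m \<ge> (1 :: real)" by simp
      then show ?thesis using range m eq(2) by argo
    next
      case 2
      then have "of_int m \<le> (-1 :: real)" by (metis of_int_le_iff of_int_minus of_int_1)
      then show ?thesis using range m eq(2) by argo
    qed
    from segment_end[OF nn x(1) ends[THEN conjunct1]] segment_end[OF nn' x'(1) ends[THEN conjunct2]] show ?thesis
      using eq by simp
  qed
qed

lemma fibre_inj:
  assumes V: "valid a0 e1 e2 b1 b2 b3 z0 z1 r g" and V': "valid a0' e1' e2' b1' b2' b3' z0' z1' r' g"
    and eq: "a0 + b2 = a0' + b2'" "e1 + e2 + b1 + b3 = e1' + e2' + b1' + b3'" "z0 + z1 = z0' + z1'"
    and t: "turns e1' b1' b2' b3' z1' r' = turns e1 b1 b2 b3 z1 r + of_int k"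
  shows "a0 = a0' \<and> e1 = e1' \<and> e2 = e2' \<and> b1 = b1' \<and> b2 = b2' \<and> b3 = b3' \<and> z0 = z0' \<and> z1 = z1' \<and>
    (r = r' \<or> a0 + e2 + z0 = 0 \<or> e1 + b1 + b2 + b3 + z1 = 0)"
proof -
  have "g = 1 \<or> g = -1" using V by (simp add: valid_def)
  then show ?thesis
  proof
    assume "g = -1"
    then show ?thesis using fibre_inj_negative[OF V[unfolded \<open>g = -1\<close>] V'[unfolded \<open>g = -1\<close>] eq t] by blast
  next
    assume "g = 1"
    then have "valid a0 e1 e2 b3 b2 b1 z0 z1 (- r) (-1)" "valid a0' e1' e2' b3' b2' b1' z0' z1' (- r') (-1)"
      using valid_mirror[OF V] valid_mirror[OF V'] by simp_all
    moreover have "turns e1' b3' b2' b1' z1' (- r') = turns e1 b3 b2 b1 z1 (- r) + of_int (- k)"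
      using t by (simp add: turns_mirror)
    ultimately show ?thesis
      using fibre_inj_negative[of a0 e1 e2 b3 b2 b1 z0 z1 "- r" a0' e1' e2' b3' b2' b1' z0' z1' "- r'" "- k"] eq
      by (auto simp: algebra_simps)
  qed
qed

lemma fibre_surj:
  assumes nn: "\<alpha> \<ge> 0" "\<beta> \<ge> 0" "s \<ge> 0" "\<alpha> + \<beta> + s = 1"
  shows "\<exists>a0 e1 e2 b1 b2 b3 z0 z1 r k. a0 \<ge> 0 \<and> e1 \<ge> 0 \<and> e2 \<ge> 0 \<and> b1 \<ge> 0 \<and> b2 \<ge> 0 \<and> b3 \<ge> 0 \<and> z0 \<ge> 0 \<and> z1 \<ge> 0 \<and>
    a0 + b2 = \<alpha> \<and> e1 + e2 + b1 + b3 = \<beta> \<and> z0 + z1 = s \<and> segment e1 e2 b1 b2 b3 z0 z1 r (l + of_int k)"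
proof -
  \<comment> \<open>The integer that moves \<open>l\<close> into the interval of
    \<open>segment_range\<close>.\<close>
  define k where "k = - \<lfloor>l + 1 / 2 + \<beta> / 4\<rfloor>"
  define x where "x = l + of_int k"
  have "- 1 / 2 - \<beta> / 4 \<le> x" "x \<le> 1 / 2 - \<beta> / 4"
    unfolding x_def k_def using floor_correct[of "l + 1 / 2 + \<beta> / 4"] by linarith+
  \<comment> \<open>The breakpoints are the partial sums of the eight lengths. In each case one pair
    of weights exchanges its mass linearly in \<open>x\<close>, with slope 4 for the parts of
    \<beta> and 2 for those of \<alpha> and \<open>s\<close>; this gives the witnesses.\<close>
  then consider (8) "- 1 / 2 - \<beta> / 4 \<le> x" "x \<le> - (\<beta> + s) / 2 - \<beta> / 4"
    | (1) "- (\<beta> + s) / 2 - \<beta> / 4 \<le> x" "x \<le> - (\<beta> + s) / 2"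
    | (2) "- (\<beta> + s) / 2 \<le> x" "x \<le> - s / 2 - \<beta> / 4"
    | (3) "- s / 2 - \<beta> / 4 \<le> x" "x \<le> - s / 2"
    | (4) "- s / 2 \<le> x" "x \<le> 0" | (5) "0 \<le> x" "x \<le> s / 2"
    | (6) "s / 2 \<le> x" "x \<le> s / 2 + \<beta> / 4" | (7) "s / 2 + \<beta> / 4 \<le> x" "x \<le> 1 / 2 - \<beta> / 4"
    by linarith
  then show ?thesis
    unfolding x_def[symmetric]
  proof cases
    case 8
    show ?thesis
      by (rule exI[of _ "1 + 2 * x + \<beta> / 2"], rule exI[of _ 0], rule exI[of _ 0], rule exI[of _ 0],
          rule exI[of _ "\<alpha> - (1 + 2 * x + \<beta> / 2)"], rule exI[of _ \<beta>], rule exI[of _ 0], rule exI[of _ s],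
          rule exI[of _ "-1"], rule exI[of _ k], unfold segment_def x_def[symmetric]) (use 8 nn in argo)
  next
    case 1
    show ?thesis
      by (rule exI[of _ \<alpha>], rule exI[of _ "\<beta> + 4 * (x + (\<beta> + s) / 2)"], rule exI[of _ 0], rule exI[of _ 0],
          rule exI[of _ 0], rule exI[of _ "- 4 * (x + (\<beta> + s) / 2)"], rule exI[of _ 0], rule exI[of _ s],
          rule exI[of _ "-1"], rule exI[of _ k], unfold segment_def x_def[symmetric]) (use 1 nn in argo)
  next
    case 2
    show ?thesis
      by (rule exI[of _ \<alpha>], rule exI[of _ "\<beta> - 4 * (x + (\<beta> + s) / 2)"], rule exI[of _ 0],
          rule exI[of _ "4 * (x + (\<beta> + s) / 2)"], rule exI[of _ 0], rule exI[of _ 0], rule exI[of _ 0], rule exI[of _ s],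
          rule exI[of _ "-1"], rule exI[of _ k], unfold segment_def x_def[symmetric]) (use 2 nn in argo)
  next
    case 3
    show ?thesis
      by (rule exI[of _ \<alpha>], rule exI[of _ 0], rule exI[of _ "\<beta> + 4 * (x + s / 2)"],
          rule exI[of _ "- 4 * (x + s / 2)"], rule exI[of _ 0], rule exI[of _ 0], rule exI[of _ 0], rule exI[of _ s],
          rule exI[of _ "-1"], rule exI[of _ k], unfold segment_def x_def[symmetric]) (use 3 nn in argo)
  next
    case 4
    show ?thesis
      by (rule exI[of _ \<alpha>], rule exI[of _ 0], rule exI[of _ \<beta>], rule exI[of _ 0], rule exI[of _ 0], rule exI[of _ 0],
          rule exI[of _ "s + 2 * x"], rule exI[of _ "- 2 * x"],
          rule exI[of _ "-1"], rule exI[of _ k], unfold segment_def x_def[symmetric]) (use 4 nn in auto)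
  next
    case 5
    show ?thesis
      by (rule exI[of _ \<alpha>], rule exI[of _ 0], rule exI[of _ \<beta>], rule exI[of _ 0], rule exI[of _ 0], rule exI[of _ 0],
          rule exI[of _ "s - 2 * x"], rule exI[of _ "2 * x"],
          rule exI[of _ 1], rule exI[of _ k], unfold segment_def x_def[symmetric]) (use 5 nn in auto)
  next
    case 6
    show ?thesis
      by (rule exI[of _ \<alpha>], rule exI[of _ 0], rule exI[of _ "\<beta> - 4 * (x - s / 2)"], rule exI[of _ 0], rule exI[of _ 0],
          rule exI[of _ "4 * (x - s / 2)"], rule exI[of _ 0], rule exI[of _ s],
          rule exI[of _ 1], rule exI[of _ k], unfold segment_def x_def[symmetric]) (use 6 nn in argo)
  next
    case 7
    show ?thesis
      by (rule exI[of _ "1 - 2 * x - \<beta> / 2"], rule exI[of _ 0], rule exI[of _ 0], rule exI[of _ 0],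
          rule exI[of _ "\<alpha> - (1 - 2 * x - \<beta> / 2)"], rule exI[of _ \<beta>], rule exI[of _ 0], rule exI[of _ s],
          rule exI[of _ 1], rule exI[of _ k], unfold segment_def x_def[symmetric]) (use 7 nn in argo)
  qed
qed

section \<open>The classifying spaces of the mapping cylinders\<close>

lemma sign_S_carrier:
  assumes "q \<in> topspace (B_space S_cat)" "a \<in> carrier_arrs S_cat q" "sgn_S a \<noteq> 0"
  shows "sign_S q = of_int (sgn_S a)"
proof -
  have a: "a = sf \<or> a = sg" using assms(3) by (auto simp: sgn_S_def split: if_splits)
  show ?thesis
  proof (cases "a = sg")
    case True
    then show ?thesis using assms(2) by (simp add: sign_S_def)
  next
    case False
    then have "a = sf" using a by simp
    then have "sg \<notin> carrier_arrs S_cat q" using S.carrier_arrs_unique[OF assms(1,2), of sg] by auto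
    then show ?thesis using \<open>a = sf\<close> by (simp add: sign_S_def)
  qed
qed

lemma sign_D_carrier:
  assumes "q \<in> topspace (B_space D_cat)" "a \<in> Arr S_cat" "onArr S_incl a \<in> carrier_arrs D_cat q" "sgn_S a \<noteq> 0"
  shows "sign_D q = of_int (sgn_S a)"
proof -
  have a: "a = sf \<or> a = sg" using assms(4) by (auto simp: sgn_S_def split: if_splits)
  show ?thesis
  proof (cases "a = sg")
    case True
    then show ?thesis using assms(3) by (simp add: sign_D_def)
  next
    case False
    then have "a = sf" using a by simp
    then have "dg \<notin> carrier_arrs D_cat q" using D.carrier_arrs_unique[OF assms(1,3), of dg] by auto
    then show ?thesis using \<open>a = sf\<close> by (simp add: sign_D_def)
  qed
qed

text \<open>At the vertices of the circle both signs give the same point, since the angle is 0 or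
  half a turn.\<close>

lemma S_point_eqI:
  assumes p: "p \<in> topspace (B_space S_cat)" and q: "q \<in> topspace (B_space S_cat)"
    and m: "mass S_cat S_B p = mass S_cat S_B q"
    and s: "sign_S p = sign_S q \<or> mass S_cat S_A p = 0 \<or> mass S_cat S_B p = 0"
  shows "p = q"
proof (rule inj_onD[OF homeomorphic_imp_injective_map[OF circ_homeomorphic] _ p q])
  have b: "mass S_cat S_B p = 1 \<or> mass S_cat S_B p = 0" if "sign_S p \<noteq> sign_S q"
    using s that S_sum_mass[OF p] by auto
  show "circ p = circ q"
  proof (cases "sign_S p = sign_S q")
    case False
    then have "sign_S p * pi = pi \<or> sign_S p * pi = - pi" "sign_S q * pi = pi \<or> sign_S q * pi = - pi"
      by (auto simp: sign_S_def)
    then show ?thesis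
      using b[OF False] m by (auto simp: circ_eq[OF p] circ_eq[OF q] complex_eq_iff)
  qed (simp add: circ_eq p q m)
qed

definition tuple4 :: "real \<Rightarrow> real \<Rightarrow> real \<Rightarrow> real \<Rightarrow> nat \<Rightarrow> real"
  where "tuple4 a b c d i = (if i = 0 then a else if i = 1 then b else if i = 2 then c else if i = 3 then d else 0)"

lemma tuple4_simplex:
  assumes "a \<ge> 0" "b \<ge> 0" "c \<ge> 0" "d \<ge> 0" "a + b + c + d = 1"
  shows "tuple4 a b c d \<in> standard_simplex 3"
  using assms by (auto simp: standard_simplex_def tuple4_def numeral_3_eq_3)

text \<open>On objects \<open>F_M\<close> and \<open>F_N\<close> differ by the exchange of
  \<open>A\<^sub>1\<close> and \<open>B\<^sub>0\<close>: in either case \<open>E1\<close> is sent to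
  B and \<open>E2\<close> to A. Both solid tori are treated at once through this common
  pattern.\<close>

locale torus_cylinder =
  fixes F :: TS_func and E1 E2 :: T_obj
  assumes FE: "F = F_M \<and> E1 = T_A1 \<and> E2 = T_B0 \<or> F = F_N \<and> E1 = T_B0 \<and> E2 = T_A1"
begin

abbreviation "C \<equiv> mapping_cylinder T_cat S_cat F"
abbreviation "R \<equiv> cyl_retract S_cat F"
abbreviation H :: cyl_D_func
  where "H \<equiv> cyl_induced D_cat (S_incl \<circ>\<^sub>F G_fun) (const_func D_cat D_X) to_X"
abbreviation "\<mu> \<equiv> mass C"

lemma F_functor: "cat_functor T_cat S_cat F"
  using FE F_M_functor F_N_functor by auto

sublocale F: cat_functor T_cat S_cat F by (rule F_functor)
sublocale C: loop_free C by (rule mapping_cylinder_loop_free[OF F_functor T_loop_free S_loop_free])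
sublocale R: cat_functor C S_cat R by (rule cyl_retract_functor[OF F_functor])
sublocale H: cat_functor C D_cat H by (rule H_functor[OF F_functor])

lemma C_Obj: "Obj C = UNIV"
  by (simp add: mapping_cylinder_def UNIV_Plus_UNIV)

lemma finite_C: "finite (Obj C)" "finite (Arr C)"
proof -
  show "finite (Obj C)" using finite_T finite_S by (simp add: mapping_cylinder_def)
  have "Arr C \<subseteq> Left_arr ` Arr T_cat \<union> Right_arr ` Arr S_cat \<union> (\<lambda>(x, g). Mixed x g) ` (Obj T_cat \<times> Arr S_cat)"
    by (auto simp: mapping_cylinder_def)
  then show "finite (Arr C)"
    by (rule finite_subset) (use finite_T finite_S in simp)
qed

lemma C_Arr [simp]:
  "Left_arr a \<in> Arr C \<longleftrightarrow> a \<in> Arr T_cat" "Right_arr b \<in> Arr C \<longleftrightarrow> b \<in> Arr S_cat"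
  "Mixed x b \<in> Arr C \<longleftrightarrow> b \<in> Arr S_cat \<and> Src S_cat b = onObj F x"
  by (simp_all add: mapping_cylinder_def image_iff del: split_paired_Ex split_paired_All)

lemma C_Src_Tgt [simp]:
  "Src C (Left_arr a) = Inl (Src T_cat a)" "Src C (Right_arr b) = Inr (Src S_cat b)" "Src C (Mixed x b) = Inl x"
  "Tgt C (Left_arr a) = Inl (Tgt T_cat a)" "Tgt C (Right_arr b) = Inr (Tgt S_cat b)" "Tgt C (Mixed x b) = Inr (Tgt S_cat b)"
  by (simp_all add: mapping_cylinder_def)

lemma compact_C: "compact_space (B_space C)"
  by (rule C.compact_B_space[OF finite_C])

lemma onObj_H: "onObj H (Inl x) = case_S_obj D_A D_B (G_obj x)" "onObj H (Inr y) = D_X"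
  by (simp_all add: cyl_induced_def const_func_def)

lemma onArr_H: "onArr H (Left_arr e) = onArr S_incl (onArr G_fun e)"
  by (simp add: cyl_induced_def)

lemma H_no_sign: "Mixed x g \<in> Arr C \<Longrightarrow> onArr H (Mixed x g) \<noteq> dg" "onArr H (Right_arr g) \<noteq> dg"
proof -
  assume "Mixed x g \<in> Arr C"
  then have "Tgt D_cat (onArr H (Mixed x g)) = D_X"
    using H.Tgt_onArr[of "Mixed x g"] by (simp add: onObj_H)
  then show "onArr H (Mixed x g) \<noteq> dg" by auto
qed (simp add: cyl_induced_def const_func_def)

lemma F_obj [simp]: "onObj F T_A0 = S_A" "onObj F E1 = S_B" "onObj F E2 = S_A" "onObj F T_B1 = S_B"
    "onObj F T_B2 = S_B" "onObj F T_B3 = S_B"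
  and G_obj_E [simp]: "G_obj E1 = S_B" "G_obj E2 = S_B"
  using FE by auto

lemma sum_C: "(\<Sum>v\<in>Obj C. f v) = f (Inl T_A0) + f (Inl E1) + f (Inl E2) + f (Inl T_B1) + f (Inl T_B2) +
    f (Inl T_B3) + f (Inr S_A) + (f (Inr S_B) :: real)"
proof -
  have "(\<Sum>v\<in>Obj C. f v) = (\<Sum>x\<in>UNIV. f (Inl x)) + (\<Sum>y\<in>UNIV. f (Inr y))"
    using sum.Plus[of "UNIV :: T_obj set" "UNIV :: S_obj set" f] finite_T(1) finite_S(1)
    by (simp add: mapping_cylinder_def)
  moreover have "(\<Sum>x\<in>UNIV. f (Inl x)) = f (Inl T_A0) + f (Inl E1) + f (Inl E2) + f (Inl T_B1) + f (Inl T_B2) + f (Inl T_B3)"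
    using FE by (auto simp: T_obj_UNIV)
  ultimately show ?thesis by (simp add: S_obj_UNIV)
qed

context
  fixes p assumes p: "p \<in> topspace (B_space C)"
begin

lemma sum_mass_C: "\<mu> (Inl T_A0) p + \<mu> (Inl E1) p + \<mu> (Inl E2) p + \<mu> (Inl T_B1) p + \<mu> (Inl T_B2) p +
    \<mu> (Inl T_B3) p + \<mu> (Inr S_A) p + \<mu> (Inr S_B) p = 1"
  using C.sum_mass[OF finite_C(1) p] unfolding sum_C .

lemma mass_H:
  "mass D_cat D_A (B_map D_cat H p) = \<mu> (Inl T_A0) p + \<mu> (Inl T_B2) p"
  "mass D_cat D_B (B_map D_cat H p) = \<mu> (Inl E1) p + \<mu> (Inl E2) p + \<mu> (Inl T_B1) p + \<mu> (Inl T_B3) p"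
  "mass D_cat D_X (B_map D_cat H p) = \<mu> (Inr S_A) p + \<mu> (Inr S_B) p"
  unfolding H.mass_B_map[OF finite_C(1) p] sum_C by (simp_all add: onObj_H)

lemma mass_R:
  "mass S_cat S_A (B_map S_cat R p) = \<mu> (Inl T_A0) p + \<mu> (Inl E2) p + \<mu> (Inr S_A) p"
  "mass S_cat S_B (B_map S_cat R p) = \<mu> (Inl E1) p + \<mu> (Inl T_B1) p + \<mu> (Inl T_B2) p + \<mu> (Inl T_B3) p + \<mu> (Inr S_B) p"
  unfolding R.mass_B_map[OF finite_C(1) p] sum_C by simp_all

lemma BR_in: "B_map S_cat R p \<in> topspace (B_space S_cat)"
  and BH_in: "B_map D_cat H p \<in> topspace (B_space D_cat)"
  using B_map_in[OF R.cat_functor_axioms p] B_map_in[OF H.cat_functor_axioms p] .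

text \<open>One arrow \<open>e\<close> of \<open>T\<close> accounts for both signs: its images under
  the retraction and under \<open>H\<close> lie in the carriers of the image points, and these
  contain no second parallel arrow.\<close>

lemma carrier_pair:
  assumes xy: "x \<noteq> y" "\<mu> (Inl x) p \<noteq> 0" "\<mu> (Inl y) p \<noteq> 0"
  shows "\<exists>e\<in>Arr T_cat. (Src T_cat e = x \<and> Tgt T_cat e = y \<or> Src T_cat e = y \<and> Tgt T_cat e = x) \<and>
    (sgn_S (onArr F e) \<noteq> 0 \<longrightarrow> sign_S (B_map S_cat R p) = of_int (sgn_S (onArr F e))) \<and>
    (sgn_S (onArr G_fun e) \<noteq> 0 \<longrightarrow> sign_D (B_map D_cat H p) = of_int (sgn_S (onArr G_fun e)))"
proof -
  have "\<mu> (Inl x) p > 0" "\<mu> (Inl y) p > 0" using xy C.mass_nonneg[OF p] by (auto simp: less_le)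
  then obtain e' where e': "e' \<in> carrier_arrs C p"
    "(Src C e' = Inl x \<and> Tgt C e' = Inl y) \<or> (Src C e' = Inl y \<and> Tgt C e' = Inl x)"
    using C.carrier_arrs_between[OF p] by blast
  then obtain e where e: "e \<in> Arr T_cat" "e' = Left_arr e"
    using C.carrier_arrs_props(1)[OF p e'(1)] by (auto simp: mapping_cylinder_def)
  have "onArr F e \<in> carrier_arrs S_cat (B_map S_cat R p)"
    unfolding R.carrier_arrs_B_map[OF p] using e e' by (intro image_eqI[of _ _ "Left_arr e"]) auto
  moreover have "onArr S_incl (onArr G_fun e) \<in> carrier_arrs D_cat (B_map D_cat H p)"
    unfolding H.carrier_arrs_B_map[OF p] using e e' by (intro image_eqI[of _ _ "Left_arr e"]) (auto simp: onArr_H)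
  ultimately show ?thesis
    using e e'(2) sign_S_carrier[OF BR_in] sign_D_carrier[OF BH_in] cat_functor.onArr_in[OF G_functor e(1)]
    by (intro bexI[of _ e]) auto
qed

text \<open>\<open>S\<close> has no arrow from B to A, so no arrow of the cylinder leads from
  \<open>x\<close> to the copy of A; and none leads from the copy of \<open>S\<close> back to
  \<open>T\<close>.\<close>

lemma carrier_Z0:
  assumes "onObj F x = S_B"
  shows "\<mu> (Inr S_A) p = 0 \<or> \<mu> (Inl x) p = 0"
proof (rule ccontr)
  assume "\<not> ?thesis"
  then have "\<mu> (Inr S_A) p > 0" "\<mu> (Inl x) p > 0" using C.mass_nonneg[OF p] by (auto simp: less_le)
  then obtain e where e: "e \<in> carrier_arrs C p"
    "(Src C e = Inr S_A \<and> Tgt C e = Inl x) \<or> (Src C e = Inl x \<and> Tgt C e = Inr S_A)"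
    using C.carrier_arrs_between[OF p] by blast
  then show False
    using C.carrier_arrs_props(1)[OF p e(1)] assms by (auto simp: mapping_cylinder_def S_Arr)
qed

text \<open>Each sign condition is read off from the arrows of \<open>T\<close> between one pair of
  objects, as listed in \<open>T_signs\<close>; for a pair without arrows one of the two weights
  vanishes.\<close>

lemma valid_point:
  "valid (\<mu> (Inl T_A0) p) (\<mu> (Inl E1) p) (\<mu> (Inl E2) p) (\<mu> (Inl T_B1) p) (\<mu> (Inl T_B2) p) (\<mu> (Inl T_B3) p)
    (\<mu> (Inr S_A) p) (\<mu> (Inr S_B) p) (sign_S (B_map S_cat R p)) (sign_D (B_map D_cat H p))"
  unfolding valid_def
proof (intro conjI)
  \<comment> \<open>The test \<open>E1 = T_A1\<close> selects the column of \<open>F_M\<close> or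
    that of \<open>F_N\<close> in \<open>T_signs\<close>.\<close>
  have ex: "\<mu> (Inl x) p = 0 \<or> \<mu> (Inl y) p = 0 \<or> (\<exists>m n g. ((x, y, m, n, g) \<in> T_signs \<or> (y, x, m, n, g) \<in> T_signs) \<and>
    ((if E1 = T_A1 then m else n) \<noteq> 0 \<longrightarrow> sign_S (B_map S_cat R p) = of_int (if E1 = T_A1 then m else n)) \<and>
    (g \<noteq> 0 \<longrightarrow> sign_D (B_map D_cat H p) = of_int g))"
    if "x \<noteq> y" for x y
  proof (cases "\<mu> (Inl x) p = 0 \<or> \<mu> (Inl y) p = 0")
    case False
    then have "\<mu> (Inl x) p \<noteq> 0" "\<mu> (Inl y) p \<noteq> 0" by auto
    from carrier_pair[OF \<open>x \<noteq> y\<close> this] obtain e where e: "e \<in> Arr T_cat" "Src T_cat e = x \<and> Tgt T_cat e = y \<or> Src T_cat e = y \<and> Tgt T_cat e = x"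
      "sgn_S (onArr F e) \<noteq> 0 \<longrightarrow> sign_S (B_map S_cat R p) = of_int (sgn_S (onArr F e))"
      "sgn_S (onArr G_fun e) \<noteq> 0 \<longrightarrow> sign_D (B_map D_cat H p) = of_int (sgn_S (onArr G_fun e))"
      by blast
    have "sgn_S (onArr F e) = (if E1 = T_A1 then sgn_S (onArr F_M e) else sgn_S (onArr F_N e))" using FE by auto
    then show ?thesis
      using e T_arrow_signs[OF e(1)]
      by (intro disjI2 exI[of _ "sgn_S (onArr F_M e)"] exI[of _ "sgn_S (onArr F_N e)"] exI[of _ "sgn_S (onArr G_fun e)"])
        auto
  qed blast
  show "\<mu> (Inl E1) p = 0 \<or> \<mu> (Inl E2) p = 0" using ex[of E1 E2] FE by (auto simp: T_signs_def)
  show "\<mu> (Inl E1) p = 0 \<or> \<mu> (Inl T_B2) p = 0" using ex[of E1 T_B2] FE by (auto simp: T_signs_def)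
  show "\<mu> (Inl E2) p = 0 \<or> \<mu> (Inl T_B2) p = 0" using ex[of E2 T_B2] FE by (auto simp: T_signs_def)
  show "\<mu> (Inl T_B1) p = 0 \<or> \<mu> (Inl T_B3) p = 0" using ex[of T_B1 T_B3] FE by (auto simp: T_signs_def)
  show "\<mu> (Inl T_A0) p = 0 \<or> \<mu> (Inl E1) p = 0 \<or> sign_S (B_map S_cat R p) = sign_D (B_map D_cat H p)"
    using ex[of T_A0 E1] FE by (auto simp: T_signs_def)
  show "\<mu> (Inl E2) p = 0 \<or> \<mu> (Inl T_B1) p = 0 \<or> sign_S (B_map S_cat R p) = - 1"
    using ex[of E2 T_B1] FE by (auto simp: T_signs_def)
  show "\<mu> (Inl E2) p = 0 \<or> \<mu> (Inl T_B3) p = 0 \<or> sign_S (B_map S_cat R p) = 1"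
    using ex[of E2 T_B3] FE by (auto simp: T_signs_def)
  show "\<mu> (Inl T_B2) p = 0 \<or> \<mu> (Inl T_B1) p = 0 \<or> sign_D (B_map D_cat H p) = 1"
    using ex[of T_B2 T_B1] FE by (auto simp: T_signs_def)
  show "\<mu> (Inl T_B2) p = 0 \<or> \<mu> (Inl T_B3) p = 0 \<or> sign_D (B_map D_cat H p) = - 1"
    using ex[of T_B2 T_B3] FE by (auto simp: T_signs_def)
  show "\<mu> (Inl T_A0) p = 0 \<or> \<mu> (Inl T_B1) p = 0 \<or> sign_S (B_map S_cat R p) = - 1 \<or> sign_D (B_map D_cat H p) = 1"
    using ex[of T_A0 T_B1] FE by (auto simp: T_signs_def)
  show "\<mu> (Inl T_A0) p = 0 \<or> \<mu> (Inl T_B3) p = 0 \<or> sign_S (B_map S_cat R p) = 1 \<or> sign_D (B_map D_cat H p) = - 1"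
    using ex[of T_A0 T_B3] FE by (auto simp: T_signs_def)
  show "\<mu> (Inr S_A) p = 0 \<or> \<mu> (Inl E1) p = 0 \<and> \<mu> (Inl T_B1) p = 0 \<and> \<mu> (Inl T_B2) p = 0 \<and> \<mu> (Inl T_B3) p = 0"
    using carrier_Z0 F_obj by blast
qed (use C.mass_nonneg[OF p] sum_mass_C in \<open>auto simp: sign_S_def sign_D_def\<close>)

end

text \<open>The angle of the retraction to the circle, sheared so as to become
  strictly monotone along the fibres.\<close>

definition twist :: "(T_obj + S_obj, TS_cyl_arr) cs_point \<Rightarrow> complex"
  where "twist p = circ (B_map S_cat R p) * cis (pi / 2 * (\<mu> (Inl T_B1) p - \<mu> (Inl T_B3) p))"

definition twist_turns :: "(T_obj + S_obj, TS_cyl_arr) cs_point \<Rightarrow> real"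
  where "twist_turns p = turns (\<mu> (Inl E1) p) (\<mu> (Inl T_B1) p) (\<mu> (Inl T_B2) p) (\<mu> (Inl T_B3) p) (\<mu> (Inr S_B) p)
    (sign_S (B_map S_cat R p))"

lemma twist_eq:
  assumes "p \<in> topspace (B_space C)"
  shows "twist p = cis (2 * pi * twist_turns p)"
  unfolding twist_def circ_eq[OF BR_in[OF assms]] mass_R[OF assms] cis_mult twist_turns_def turns_def
  by (rule arg_cong[of _ _ cis]) (simp add: field_simps)

lemma continuous_twist: "continuous_map (B_space C) S1_space twist"
  unfolding S1_space_def continuous_map_in_subtopology
proof
  have "continuous_map (B_space C) euclidean (circ \<circ> B_map S_cat R)"
    using continuous_map_compose[OF R.continuous_B_map continuous_circ]
    by (simp add: S1_space_def continuous_map_in_subtopology)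
  moreover have "continuous_map (B_space C) euclideanreal (\<lambda>p. pi / 2 * (\<mu> (Inl T_B1) p - \<mu> (Inl T_B3) p))"
    by (intro continuous_map_real_mult continuous_map_diff C.continuous_mass) simp
  then have "continuous_map (B_space C) euclidean (cis \<circ> (\<lambda>p. pi / 2 * (\<mu> (Inl T_B1) p - \<mu> (Inl T_B3) p)))"
    by (rule continuous_map_compose) (simp add: cis_conv_exp[abs_def] continuous_intros)
  ultimately have "continuous_map (B_space C) (prod_topology euclidean euclidean)
      (\<lambda>p. ((circ \<circ> B_map S_cat R) p, (cis \<circ> (\<lambda>p. pi / 2 * (\<mu> (Inl T_B1) p - \<mu> (Inl T_B3) p))) p))"
    by (rule continuous_map_pairedI)
  then have "continuous_map (B_space C) euclidean ((\<lambda>z. fst z * snd z) \<circ>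
      (\<lambda>p. ((circ \<circ> B_map S_cat R) p, (cis \<circ> (\<lambda>p. pi / 2 * (\<mu> (Inl T_B1) p - \<mu> (Inl T_B3) p))) p)))"
    by (rule continuous_map_compose) (simp add: continuous_intros)
  then show "continuous_map (B_space C) euclidean twist"
    by (simp add: comp_def twist_def[abs_def])
qed (auto simp: twist_eq)

definition solid :: "(T_obj + S_obj, TS_cyl_arr) cs_point \<Rightarrow> complex \<times> complex"
  where "solid p = (twist p, disk (B_map D_cat H p))"

lemma continuous_disk_H: "continuous_map (B_space C) D2_space (\<lambda>p. disk (B_map D_cat H p))"
  using continuous_map_compose[OF H.continuous_B_map homeomorphic_imp_continuous_map[OF disk_homeomorphic]]
  by (simp add: comp_def)

lemma continuous_solid: "continuous_map (B_space C) (prod_topology S1_space D2_space) solid"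
  unfolding solid_def[abs_def] by (intro continuous_map_pairedI continuous_twist continuous_disk_H)

lemma norm_disk_H:
  "p \<in> topspace (B_space C) \<Longrightarrow> norm (disk (B_map D_cat H p)) = 1 - \<mu> (Inr S_A) p - \<mu> (Inr S_B) p"
  by (simp add: norm_disk BH_in mass_H)

lemma cis_eq_imp: "cis a = cis b \<Longrightarrow> \<exists>k::int. a = b + 2 * pi * of_int k"
  using sin_cos_eq_iff[of a b] by (auto simp: complex_eq_iff)

text \<open>Arrows of \<open>T\<close> are separated by \<open>T_faithful\<close>; for the other
  arrows the retraction itself remembers the component in \<open>S\<close>.\<close>

lemma faithful:
  assumes "f \<in> Arr C" "g \<in> Arr C" "Src C f = Src C g" "Tgt C f = Tgt C g" "onArr R f = onArr R g" "onArr H f = onArr H g"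
  shows "f = g"
proof -
  have L: "a = b" if "a \<in> Arr T_cat" "b \<in> Arr T_cat" "Src T_cat a = Src T_cat b" "Tgt T_cat a = Tgt T_cat b"
    "onArr F a = onArr F b" "onArr S_incl (onArr G_fun a) = onArr S_incl (onArr G_fun b)" for a b
  proof -
    have "onArr G_fun a = onArr G_fun b"
      using inj_onD[OF S_incl_inj(2) that(6)] that cat_functor.onArr_in[OF G_functor] by blast
    then show ?thesis using T_faithful that FE by blast
  qed
  show ?thesis
  proof (cases f)
    case (Left_arr a)
    then obtain b where "g = Left_arr b" using assms by (cases g) simp_all
    then show ?thesis using L[of a b] assms Left_arr by (simp add: onArr_H)
  next
    case (Right_arr a)
    then obtain b where "g = Right_arr b" using assms by (cases g) simp_all
    then show ?thesis using assms Right_arr by simp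
  next
    case (Mixed x a)
    then obtain b where "g = Mixed x b" using assms by (cases g) simp_all
    then show ?thesis using assms Mixed by (simp add: S.Comp_Ident' del: S_cat_simps(2))
  qed
qed

text \<open>The disk coordinate determines the image under \<open>H\<close>, hence the fibre and the
  sign g. Positions that differ by an integer then give equal weights and, up to vertices of the
  circle, equal signs, so the images under the retraction coincide too; these two functors are
  jointly faithful.\<close>

lemma inj_solid: "inj_on solid (topspace (B_space C))"
proof (rule inj_onI)
  fix p q assume p: "p \<in> topspace (B_space C)" and q: "q \<in> topspace (B_space C)" and eq: "solid p = solid q"
  have H: "B_map D_cat H p = B_map D_cat H q"
    using eq by (intro inj_onD[OF inj_disk]) (auto simp: solid_def BH_in p q)
  have "cis (2 * pi * twist_turns q) = cis (2 * pi * twist_turns p)"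
    using eq by (simp add: solid_def twist_eq p q)
  then obtain k :: int where "2 * pi * twist_turns q = 2 * pi * twist_turns p + 2 * pi * of_int k"
    using cis_eq_imp by blast
  then have "2 * pi * twist_turns q = 2 * pi * (twist_turns p + of_int k)" by (simp add: ring_distribs)
  then have k: "twist_turns q = twist_turns p + of_int k" by simp
  have inj: "\<mu> (Inl T_A0) p = \<mu> (Inl T_A0) q \<and> \<mu> (Inl E1) p = \<mu> (Inl E1) q \<and> \<mu> (Inl E2) p = \<mu> (Inl E2) q \<and>
    \<mu> (Inl T_B1) p = \<mu> (Inl T_B1) q \<and> \<mu> (Inl T_B2) p = \<mu> (Inl T_B2) q \<and> \<mu> (Inl T_B3) p = \<mu> (Inl T_B3) q \<and>
    \<mu> (Inr S_A) p = \<mu> (Inr S_A) q \<and> \<mu> (Inr S_B) p = \<mu> (Inr S_B) q \<and>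
    (sign_S (B_map S_cat R p) = sign_S (B_map S_cat R q) \<or> \<mu> (Inl T_A0) p + \<mu> (Inl E2) p + \<mu> (Inr S_A) p = 0 \<or>
     \<mu> (Inl E1) p + \<mu> (Inl T_B1) p + \<mu> (Inl T_B2) p + \<mu> (Inl T_B3) p + \<mu> (Inr S_B) p = 0)"
  proof (rule fibre_inj[OF valid_point[OF p] valid_point[OF q, folded H]])
    show "\<mu> (Inl T_A0) p + \<mu> (Inl T_B2) p = \<mu> (Inl T_A0) q + \<mu> (Inl T_B2) q"
      "\<mu> (Inl E1) p + \<mu> (Inl E2) p + \<mu> (Inl T_B1) p + \<mu> (Inl T_B3) p =
       \<mu> (Inl E1) q + \<mu> (Inl E2) q + \<mu> (Inl T_B1) q + \<mu> (Inl T_B3) q"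
      "\<mu> (Inr S_A) p + \<mu> (Inr S_B) p = \<mu> (Inr S_A) q + \<mu> (Inr S_B) q"
      using mass_H[OF p] mass_H[OF q] H by simp_all
  qed (use k in \<open>simp add: twist_turns_def\<close>)
  have "B_map S_cat R p = B_map S_cat R q"
    using inj by (intro S_point_eqI BR_in p q) (auto simp: mass_R p q)
  moreover have "\<mu> v p = \<mu> v q" for v
  proof (cases v)
    case (Inl x)
    then show ?thesis using inj FE by (cases x) auto
  next
    case (Inr y)
    then show ?thesis using inj by (cases y) auto
  qed
  ultimately show "p = q"
    using point_eq_via_functors[OF C.loop_free_axioms R.cat_functor_axioms S_loop_free H.cat_functor_axioms D_loop_free
        faithful p q] H by blast
qed

text \<open>Coordinates of a point on an explicit simplex. The signs are read off from the string,
  which spares computing carriers on the faces.\<close>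

lemma simplex_values:
  assumes s: "s \<in> Smp (nerve C) n" and t: "t \<in> standard_simplex n"
  defines "p \<equiv> pt (nerve C) n s t"
  shows "p \<in> topspace (B_space C)"
    "disk (B_map D_cat H p) = disk_fun (if dg \<in> onArr H ` set (snd s) then -1 else 1)
      (\<Sum>j\<le>n. if onObj H (string_vertex C s j) = D_A then t j else 0)
      (\<Sum>j\<le>n. if onObj H (string_vertex C s j) = D_B then t j else 0)"
    "circ (B_map S_cat R p) = disk_fun (if sg \<in> onArr R ` set (snd s) then -1 else 1)
      (\<Sum>j\<le>n. if onObj R (string_vertex C s j) = S_A then t j else 0)
      (\<Sum>j\<le>n. if onObj R (string_vertex C s j) = S_B then t j else 0)"
proof -
  show p: "p \<in> topspace (B_space C)" using s t by (simp add: p_def B_space_def pt_in)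
  have snd: "set (snd (nerve_map K s)) = onArr K ` set (snd s)" for K :: "(T_obj + S_obj, TS_cyl_arr, 'x, 'y) func"
    by (simp add: nerve_map_def)
  show "disk (B_map D_cat H p) = disk_fun (if dg \<in> onArr H ` set (snd s) then -1 else 1)
      (\<Sum>j\<le>n. if onObj H (string_vertex C s j) = D_A then t j else 0)
      (\<Sum>j\<le>n. if onObj H (string_vertex C s j) = D_B then t j else 0)"
  proof -
    have "(\<Sum>j\<le>n. if string_vertex D_cat (nerve_map H s) j = y then t j else 0) =
      (\<Sum>j\<le>n. if onObj H (string_vertex C s j) = y then t j else 0)" for y
      by (rule sum.cong) (auto simp: H.nerve_map_vertex[OF s])
    then show ?thesis
      unfolding p_def H.B_map_pt[OF s t] disk_pt[OF H.nerve_map_Smp[OF s] t] snd D.mass_pt by simp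
  qed
  interpret I: cat_functor S_cat D_cat S_incl by (rule S_incl_functor)
  have Rs: "onArr R ` set (snd s) \<subseteq> Arr S_cat"
    using R.onArr_in is_string_Arr[of C "fst s" "snd s"] s by (auto simp: nerve_Smp)
  have "dg \<in> onArr S_incl ` onArr R ` set (snd s) \<longleftrightarrow> sg \<in> onArr R ` set (snd s)"
  proof
    assume "dg \<in> onArr S_incl ` onArr R ` set (snd s)"
    then obtain a where a: "dg = onArr S_incl a" "a \<in> onArr R ` set (snd s)" by (rule imageE)
    then have "onArr S_incl a = onArr S_incl sg" by simp
    then have "a = sg" using Rs a(2) by (elim inj_onD[OF S_incl_inj(2)]) (auto simp: S_Arr)
    then show "sg \<in> onArr R ` set (snd s)" using a by simp
  next
    assume "sg \<in> onArr R ` set (snd s)"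
    then show "dg \<in> onArr S_incl ` onArr R ` set (snd s)" by (intro image_eqI[of _ _ sg]) simp_all
  qed
  moreover have "set (snd (nerve_map S_incl (nerve_map R s))) = onArr S_incl ` onArr R ` set (snd s)"
    by (simp add: nerve_map_def image_image)
  moreover have "onObj S_incl y = D_A \<longleftrightarrow> y = S_A" "onObj S_incl y = D_B \<longleftrightarrow> y = S_B" for y
    by (cases y; simp)+
  moreover have "(\<Sum>j\<le>n. if string_vertex D_cat (nerve_map S_incl (nerve_map R s)) j = y then t j else 0) =
      (\<Sum>j\<le>n. if onObj S_incl (onObj R (string_vertex C s j)) = y then t j else 0)" for y
    by (rule sum.cong) (auto simp: R.nerve_map_vertex[OF s] I.nerve_map_vertex[OF R.nerve_map_Smp[OF s]])
  ultimately show "circ (B_map S_cat R p) = disk_fun (if sg \<in> onArr R ` set (snd s) then -1 else 1)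
      (\<Sum>j\<le>n. if onObj R (string_vertex C s j) = S_A then t j else 0)
      (\<Sum>j\<le>n. if onObj R (string_vertex C s j) = S_B then t j else 0)"
    unfolding p_def circ_def R.B_map_pt[OF s t] I.B_map_pt[OF R.nerve_map_Smp[OF s] t]
      disk_pt[OF I.nerve_map_Smp[OF R.nerve_map_Smp[OF s]] t] D.mass_pt
    by (simp cong: if_cong)
qed

end

section \<open>Explicit simplices and surjectivity onto the solid torus\<close>

context torus_cylinder
begin

lemma E_cases: "E1 = T_A1 \<and> E2 = T_B0 \<or> E1 = T_B0 \<and> E2 = T_A1"
  using FE by auto

lemma F_cases:
  "E1 = T_A1 \<Longrightarrow> onObj F x = FM_obj x" "E1 = T_B0 \<Longrightarrow> onObj F x = FN_obj x"
  "E1 = T_A1 \<Longrightarrow> onArr F (path_arr T_pres x p) = onArr F_M (path_arr T_pres x p)"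
  "E1 = T_B0 \<Longrightarrow> onArr F (path_arr T_pres x p) = onArr F_N (path_arr T_pres x p)"
  using FE by auto

lemma S_Arr_mem [simp]: "sI x \<in> Arr S_cat" "sf \<in> Arr S_cat" "sg \<in> Arr S_cat"
  by (cases x; simp add: S_Arr)+

text \<open>The common evaluation for the families of 3-simplices below: \<open>w P\<close> is the
  total weight of the vertices with property \<open>P\<close>, and the assumptions on \<sigma>,
  \<open>r\<close>, \<alpha>, \<beta>, \<open>x\<close> are finite computations for a concrete
  string.\<close>

lemma cell:
  fixes \<sigma> r a b c d :: real
  assumes s: "(v0, [f1, f2, f3]) \<in> Smp (nerve C) 3" and v: "Tgt C f1 = v1" "Tgt C f2 = v2" "Tgt C f3 = v3"
    and t: "a \<ge> 0" "b \<ge> 0" "c \<ge> 0" "d \<ge> 0" "a + b + c + d = 1"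
    and \<sigma>: "(if dg \<in> {onArr H f1, onArr H f2, onArr H f3} then -1 else 1) = \<sigma>"
    and r: "(if sg \<in> {onArr R f1, onArr R f2, onArr R f3} then -1 else 1) = r"
  defines "w \<equiv> \<lambda>P. (if P v0 then a else 0) + (if P v1 then b else 0) + (if P v2 then c else 0) + (if P v3 then d else 0)"
  assumes \<alpha>: "w (\<lambda>v. onObj H v = D_A) = \<alpha>" and \<beta>: "w (\<lambda>v. onObj H v = D_B) = \<beta>"
    and x: "r * w (\<lambda>v. onObj R v = S_B) / 2 + (w (\<lambda>v. v = Inl T_B1) - w (\<lambda>v. v = Inl T_B3)) / 4 = x"
  shows "\<exists>p\<in>topspace (B_space C). twist p = cis (2 * pi * x) \<and> disk (B_map D_cat H p) = disk_fun \<sigma> \<alpha> \<beta>"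
proof -
  let ?s = "(v0, [f1, f2, f3])"
  have t3: "tuple4 a b c d \<in> standard_simplex 3" using t by (rule tuple4_simplex)
  have w: "(\<Sum>j\<le>3. if P (string_vertex C ?s j) then tuple4 a b c d j else 0) = w P" for P
    by (simp add: numeral_3_eq_3 w_def v tuple4_def)
  note vals = simplex_values[OF s t3]
  let ?p = "pt (nerve C) 3 ?s (tuple4 a b c d)"
  have m: "\<mu> u ?p = w (\<lambda>v. v = u)" for u
    unfolding C.mass_pt by (rule w)
  have "w (\<lambda>v. onObj R v = S_A) + w (\<lambda>v. onObj R v = S_B) = 1"
  proof -
    have "onObj R v = S_A \<or> onObj R v = S_B" for v by (cases "onObj R v") auto
    then show ?thesis using t unfolding w_def by (auto simp: algebra_simps)
  qed
  then have circ: "circ (B_map S_cat R ?p) = cis (r * pi * w (\<lambda>v. onObj R v = S_B))"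
    using vals(3) r disk_fun_circle w[of "\<lambda>v. onObj R v = S_A"] w[of "\<lambda>v. onObj R v = S_B"] by simp
  have "twist ?p = cis (2 * pi * x)"
    unfolding twist_def m x[symmetric] circ cis_mult by (rule arg_cong[of _ _ cis]) (simp add: field_simps)
  moreover have "disk (B_map D_cat H ?p) = disk_fun \<sigma> \<alpha> \<beta>"
    using vals(2) \<sigma> \<alpha> \<beta> w[of "\<lambda>v. onObj H v = D_A"] w[of "\<lambda>v. onObj H v = D_B"] by simp
  ultimately show ?thesis using vals(1) by blast
qed

abbreviation (input) "edge x g \<equiv> Left_arr (path_arr T_pres x [g])"

lemma onArr_H_no_dg [simp]: "dg \<noteq> onArr H (Mixed T_B1 (sI S_B))" "dg \<noteq> onArr H (Mixed T_B3 (sI S_B))"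
  "E1 = T_A1 \<Longrightarrow> dg \<noteq> onArr H (Mixed T_B0 (sI S_A))" "E1 = T_B0 \<Longrightarrow> dg \<noteq> onArr H (Mixed T_A1 (sI S_A))"
  "dg \<noteq> onArr H (Right_arr g)"
  using H_no_sign(1)[of T_B1 "sI S_B"] H_no_sign(1)[of T_B3 "sI S_B"] H_no_sign(1)[of E2 "sI S_A"] H_no_sign(2)[of g]
    E_cases by auto

text \<open>Each arrow from \<open>A\<^sub>0\<close> to \<open>E1\<close> has equal signs under the
  retraction and under \<open>H\<close>, and the later arrows have none, so \<sigma> is the sign for
  both coordinates.\<close>

lemma cell_E1:
  fixes a0 e1 b z \<sigma> :: real
  assumes "a0 \<ge> 0" "e1 \<ge> 0" "b \<ge> 0" "z \<ge> 0" "a0 + e1 + b + z = 1" and "\<sigma> = -1 \<or> \<sigma> = 1"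
  shows "\<exists>p\<in>topspace (B_space C). twist p = cis (2 * pi * (\<sigma> * (e1 + b + z) / 2 + b / 4)) \<and>
      disk (B_map D_cat H p) = disk_fun \<sigma> a0 (e1 + b)"
    "\<exists>p\<in>topspace (B_space C). twist p = cis (2 * pi * (\<sigma> * (e1 + b + z) / 2 - b / 4)) \<and>
      disk (B_map D_cat H p) = disk_fun \<sigma> a0 (e1 + b)"
proof -
  let ?g = "if E1 = T_A1 then if \<sigma> = -1 then T_pA else T_qA else if \<sigma> = -1 then T_g0 else T_f0"
  let ?h1 = "if E1 = T_A1 then T_g1 else T_pB1" and ?h3 = "if E1 = T_A1 then T_f3 else T_qB3"
  show "\<exists>p\<in>topspace (B_space C). twist p = cis (2 * pi * (\<sigma> * (e1 + b + z) / 2 + b / 4)) \<and>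
      disk (B_map D_cat H p) = disk_fun \<sigma> a0 (e1 + b)"
    by (rule cell[of "Inl T_A0" "edge T_A0 ?g" "edge E1 ?h1" "Mixed T_B1 (sI S_B)"
        "Inl E1" "Inl T_B1" "Inr S_B" a0 e1 b z \<sigma> \<sigma>];
      use E_cases assms in \<open>elim disjE conjE\<close>; simp add: nerve_Smp C_Obj onObj_H onArr_H F_cases)
  show "\<exists>p\<in>topspace (B_space C). twist p = cis (2 * pi * (\<sigma> * (e1 + b + z) / 2 - b / 4)) \<and>
      disk (B_map D_cat H p) = disk_fun \<sigma> a0 (e1 + b)"
    by (rule cell[of "Inl T_A0" "edge T_A0 ?g" "edge E1 ?h3" "Mixed T_B3 (sI S_B)"
        "Inl E1" "Inl T_B3" "Inr S_B" a0 e1 b z \<sigma> \<sigma>];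
      use E_cases assms in \<open>elim disjE conjE\<close>; simp add: nerve_Smp C_Obj onObj_H onArr_H F_cases)
qed

text \<open>The arrow from \<open>A\<^sub>0\<close> to \<open>E2\<close> fixes the sign \<sigma> in
  \<open>D\<close>; the arrow from \<open>E2\<close> to \<open>B\<^sub>1\<close> or
  \<open>B\<^sub>3\<close> fixes the sign in \<open>S\<close>, which is -1 or 1
  respectively.\<close>

lemma cell_E2:
  fixes a0 e2 b z \<sigma> :: real
  assumes "a0 \<ge> 0" "e2 \<ge> 0" "b \<ge> 0" "z \<ge> 0" "a0 + e2 + b + z = 1" and "\<sigma> = -1 \<or> \<sigma> = 1"
  shows "\<exists>p\<in>topspace (B_space C). twist p = cis (2 * pi * (- (b + z) / 2 + b / 4)) \<and>
      disk (B_map D_cat H p) = disk_fun \<sigma> a0 (e2 + b)"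
    "\<exists>p\<in>topspace (B_space C). twist p = cis (2 * pi * ((b + z) / 2 - b / 4)) \<and>
      disk (B_map D_cat H p) = disk_fun \<sigma> a0 (e2 + b)"
proof -
  let ?g = "if E1 = T_A1 then if \<sigma> = -1 then T_g0 else T_f0 else if \<sigma> = -1 then T_pA else T_qA"
  let ?h1 = "if E1 = T_A1 then T_pB1 else T_g1" and ?h3 = "if E1 = T_A1 then T_qB3 else T_f3"
  show "\<exists>p\<in>topspace (B_space C). twist p = cis (2 * pi * (- (b + z) / 2 + b / 4)) \<and>
      disk (B_map D_cat H p) = disk_fun \<sigma> a0 (e2 + b)"
    by (rule cell[of "Inl T_A0" "edge T_A0 ?g" "edge E2 ?h1" "Mixed T_B1 (sI S_B)"
        "Inl E2" "Inl T_B1" "Inr S_B" a0 e2 b z \<sigma> "-1"];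
      use E_cases assms in \<open>elim disjE conjE\<close>; simp add: nerve_Smp C_Obj onObj_H onArr_H F_cases)
  show "\<exists>p\<in>topspace (B_space C). twist p = cis (2 * pi * ((b + z) / 2 - b / 4)) \<and>
      disk (B_map D_cat H p) = disk_fun \<sigma> a0 (e2 + b)"
    by (rule cell[of "Inl T_A0" "edge T_A0 ?g" "edge E2 ?h3" "Mixed T_B3 (sI S_B)"
        "Inl E2" "Inl T_B3" "Inr S_B" a0 e2 b z \<sigma> 1];
      use E_cases assms in \<open>elim disjE conjE\<close>; simp add: nerve_Smp C_Obj onObj_H onArr_H F_cases)
qed

text \<open>The arrow from \<open>A\<^sub>0\<close> to \<open>B\<^sub>2\<close> fixes the sign
  \<rho> in \<open>S\<close>; the arrow from \<open>B\<^sub>2\<close> to \<open>B\<^sub>1\<close> or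
  \<open>B\<^sub>3\<close> fixes the sign in \<open>D\<close>, which is 1 or -1
  respectively.\<close>

lemma cell_B2:
  fixes a0 b2 b z \<rho> :: real
  assumes "a0 \<ge> 0" "b2 \<ge> 0" "b \<ge> 0" "z \<ge> 0" "a0 + b2 + b + z = 1" and "\<rho> = -1 \<or> \<rho> = 1"
  shows "\<exists>p\<in>topspace (B_space C). twist p = cis (2 * pi * (\<rho> * (b2 + b + z) / 2 + b / 4)) \<and>
      disk (B_map D_cat H p) = disk_fun 1 (a0 + b2) b"
    "\<exists>p\<in>topspace (B_space C). twist p = cis (2 * pi * (\<rho> * (b2 + b + z) / 2 - b / 4)) \<and>
      disk (B_map D_cat H p) = disk_fun (-1) (a0 + b2) b"
proof -
  let ?g = "if E1 = T_A1 then if \<rho> = -1 then T_f2 else T_g2 else if \<rho> = -1 then T_g2 else T_f2"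
  show "\<exists>p\<in>topspace (B_space C). twist p = cis (2 * pi * (\<rho> * (b2 + b + z) / 2 + b / 4)) \<and>
      disk (B_map D_cat H p) = disk_fun 1 (a0 + b2) b"
    by (rule cell[of "Inl T_A0" "edge T_A0 ?g" "edge T_B2 T_qB1" "Mixed T_B1 (sI S_B)"
        "Inl T_B2" "Inl T_B1" "Inr S_B" a0 b2 b z 1 \<rho>];
      use E_cases assms in \<open>elim disjE conjE\<close>; simp add: nerve_Smp C_Obj onObj_H onArr_H F_cases)
  show "\<exists>p\<in>topspace (B_space C). twist p = cis (2 * pi * (\<rho> * (b2 + b + z) / 2 - b / 4)) \<and>
      disk (B_map D_cat H p) = disk_fun (-1) (a0 + b2) b"
    by (rule cell[of "Inl T_A0" "edge T_A0 ?g" "edge T_B2 T_pB3" "Mixed T_B3 (sI S_B)"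
        "Inl T_B2" "Inl T_B3" "Inr S_B" a0 b2 b z "-1" \<rho>];
      use E_cases assms in \<open>elim disjE conjE\<close>; simp add: nerve_Smp C_Obj onObj_H onArr_H F_cases)
qed

text \<open>These simplices contain an edge of the copy of \<open>S\<close>, and that edge fixes the
  sign of the retraction.\<close>

lemma cell_Z:
  fixes a0 e2 z0 z1 \<sigma> :: real
  assumes "a0 \<ge> 0" "e2 \<ge> 0" "z0 \<ge> 0" "z1 \<ge> 0" "a0 + e2 + z0 + z1 = 1" and "\<sigma> = -1 \<or> \<sigma> = 1"
  shows "\<exists>p\<in>topspace (B_space C). twist p = cis (2 * pi * (- z1 / 2)) \<and>
      disk (B_map D_cat H p) = disk_fun \<sigma> a0 e2"
    "\<exists>p\<in>topspace (B_space C). twist p = cis (2 * pi * (z1 / 2)) \<and>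
      disk (B_map D_cat H p) = disk_fun \<sigma> a0 e2"
proof -
  let ?g = "if E1 = T_A1 then if \<sigma> = -1 then T_g0 else T_f0 else if \<sigma> = -1 then T_pA else T_qA"
  show "\<exists>p\<in>topspace (B_space C). twist p = cis (2 * pi * (- z1 / 2)) \<and>
      disk (B_map D_cat H p) = disk_fun \<sigma> a0 e2"
    by (rule cell[of "Inl T_A0" "edge T_A0 ?g" "Mixed E2 (sI S_A)" "Right_arr sg"
        "Inl E2" "Inr S_A" "Inr S_B" a0 e2 z0 z1 \<sigma> "-1"];
      use E_cases assms in \<open>elim disjE conjE\<close>; simp add: nerve_Smp C_Obj onObj_H onArr_H F_cases)
  show "\<exists>p\<in>topspace (B_space C). twist p = cis (2 * pi * (z1 / 2)) \<and>
      disk (B_map D_cat H p) = disk_fun \<sigma> a0 e2"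
    by (rule cell[of "Inl T_A0" "edge T_A0 ?g" "Mixed E2 (sI S_A)" "Right_arr sf"
        "Inl E2" "Inr S_A" "Inr S_B" a0 e2 z0 z1 \<sigma> 1];
      use E_cases assms in \<open>elim disjE conjE\<close>; simp add: nerve_Smp C_Obj onObj_H onArr_H F_cases)
qed

lemma point_cong:
  assumes "\<exists>p\<in>topspace (B_space C). twist p = cis (2 * pi * x') \<and> disk (B_map D_cat H p) = disk_fun \<sigma> a' b'"
    and "x' = x" "a' = a" "b' = b"
  shows "\<exists>p\<in>topspace (B_space C). twist p = cis (2 * pi * x) \<and> disk (B_map D_cat H p) = disk_fun \<sigma> a b"
  using assms by simp

text \<open>The alternatives of \<open>segment\<close> are realized one by one by the families of
  simplices. The second claim uses the mirror images, with \<open>B\<^sub>1\<close> and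
  \<open>B\<^sub>3\<close> exchanged and the signs reversed.\<close>

lemma segment_point:
  assumes seg: "segment e1 e2 b1 b2 b3 z0 z1 r x"
    and nn: "a0 \<ge> 0" "e1 \<ge> 0" "e2 \<ge> 0" "b1 \<ge> 0" "b2 \<ge> 0" "b3 \<ge> 0" "z0 \<ge> 0" "z1 \<ge> 0"
      "a0 + e1 + e2 + b1 + b2 + b3 + z0 + z1 = 1"
  shows "\<exists>p\<in>topspace (B_space C). twist p = cis (2 * pi * x) \<and>
      disk (B_map D_cat H p) = disk_fun (-1) (a0 + b2) (e1 + e2 + b1 + b3)"
    "\<exists>p\<in>topspace (B_space C). twist p = cis (2 * pi * (- x)) \<and>
      disk (B_map D_cat H p) = disk_fun 1 (a0 + b2) (e1 + e2 + b1 + b3)"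
proof -
  have "(\<exists>p\<in>topspace (B_space C). twist p = cis (2 * pi * x) \<and>
      disk (B_map D_cat H p) = disk_fun (-1) (a0 + b2) (e1 + e2 + b1 + b3)) \<and>
    (\<exists>p\<in>topspace (B_space C). twist p = cis (2 * pi * (- x)) \<and>
      disk (B_map D_cat H p) = disk_fun 1 (a0 + b2) (e1 + e2 + b1 + b3))"
    using seg unfolding segment_def
  proof (elim disjE conjE)
    assume "x = - (e1 + b1 + b2 + b3 + z1) / 2 + (b1 - b3) / 4" "e1 = 0" "e2 = 0" "b1 = 0" "z0 = 0"
    with nn show ?thesis
      by (intro conjI point_cong[OF cell_B2(2)[of a0 b2 b3 z1 "-1"]] point_cong[OF cell_B2(1)[of a0 b2 b3 z1 1]]) (auto simp: field_simps)
  next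
    assume "x = - (e1 + b1 + b2 + b3 + z1) / 2 + (b1 - b3) / 4" "e2 = 0" "b1 = 0" "b2 = 0" "z0 = 0"
    with nn show ?thesis
      by (intro conjI point_cong[OF cell_E1(2)[of a0 e1 b3 z1 "-1"]] point_cong[OF cell_E1(1)[of a0 e1 b3 z1 1]]) (auto simp: field_simps)
  next
    assume "x = - (e1 + b1 + b2 + b3 + z1) / 2 + (b1 - b3) / 4" "e2 = 0" "b3 = 0" "b2 = 0" "z0 = 0"
    with nn show ?thesis
      by (intro conjI point_cong[OF cell_E1(1)[of a0 e1 b1 z1 "-1"]] point_cong[OF cell_E1(2)[of a0 e1 b1 z1 1]]) (auto simp: field_simps)
  next
    assume "x = - (e1 + b1 + b2 + b3 + z1) / 2 + (b1 - b3) / 4" "e1 = 0" "b2 = 0" "b3 = 0" "z0 = 0"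
    with nn show ?thesis
      by (intro conjI point_cong[OF cell_E2(1)[of a0 e2 b1 z1 "-1"]] point_cong[OF cell_E2(2)[of a0 e2 b1 z1 1]]) (auto simp: field_simps)
  next
    assume "x = - (e1 + b1 + b2 + b3 + z1) / 2 + (b1 - b3) / 4" "e1 = 0" "b1 = 0" "b2 = 0" "b3 = 0"
    with nn show ?thesis
      by (intro conjI point_cong[OF cell_Z(1)[of a0 e2 z0 z1 "-1"]] point_cong[OF cell_Z(2)[of a0 e2 z0 z1 1]]) (auto simp: field_simps)
  next
    assume "x = (e1 + b1 + b2 + b3 + z1) / 2 + (b1 - b3) / 4" "e1 = 0" "b1 = 0" "b2 = 0" "b3 = 0"
    with nn show ?thesis
      by (intro conjI point_cong[OF cell_Z(2)[of a0 e2 z0 z1 "-1"]] point_cong[OF cell_Z(1)[of a0 e2 z0 z1 1]]) (auto simp: field_simps)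
  next
    assume "x = (e1 + b1 + b2 + b3 + z1) / 2 + (b1 - b3) / 4" "e1 = 0" "b1 = 0" "b2 = 0" "z0 = 0"
    with nn show ?thesis
      by (intro conjI point_cong[OF cell_E2(2)[of a0 e2 b3 z1 "-1"]] point_cong[OF cell_E2(1)[of a0 e2 b3 z1 1]]) (auto simp: field_simps)
  next
    assume "x = (e1 + b1 + b2 + b3 + z1) / 2 + (b1 - b3) / 4" "e1 = 0" "e2 = 0" "b1 = 0" "z0 = 0"
    with nn show ?thesis
      by (intro conjI point_cong[OF cell_B2(2)[of a0 b2 b3 z1 1]] point_cong[OF cell_B2(1)[of a0 b2 b3 z1 "-1"]]) (auto simp: field_simps)
  qed
  then show "\<exists>p\<in>topspace (B_space C). twist p = cis (2 * pi * x) \<and>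
      disk (B_map D_cat H p) = disk_fun (-1) (a0 + b2) (e1 + e2 + b1 + b3)"
    "\<exists>p\<in>topspace (B_space C). twist p = cis (2 * pi * (- x)) \<and>
      disk (B_map D_cat H p) = disk_fun 1 (a0 + b2) (e1 + e2 + b1 + b3)" by blast+
qed

lemma image_solid: "solid ` topspace (B_space C) = sphere 0 1 \<times> cball 0 1"
proof (intro equalityI subsetI)
  fix z assume "z \<in> solid ` topspace (B_space C)"
  then show "z \<in> sphere 0 1 \<times> cball 0 1"
    using continuous_solid by (auto simp: continuous_map_def S1_space_def D2_space_def)
next
  fix z :: "complex \<times> complex" assume "z \<in> sphere 0 1 \<times> cball 0 1"
  then obtain v w where z: "z = (v, w)" "norm v = 1" "norm w \<le> 1" by auto
  obtain \<sigma> \<alpha> \<beta> where w: "\<sigma> \<in> {-1, 1}" "\<alpha> \<ge> 0" "\<beta> \<ge> 0" "\<alpha> + \<beta> = norm w" "w = disk_fun \<sigma> \<alpha> \<beta>"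
    using z(3) by (rule disk_fun_surj)
  \<comment> \<open>Segments describe fibres with \<sigma> = -1; for \<sigma> = 1 the fibre is
    reflected and the angle enters with the opposite sign.\<close>
  define l where "l = - \<sigma> * (Arg v / (2 * pi))"
  obtain a0 e1 e2 b1 b2 b3 z0 z1 r k where
    nn: "a0 \<ge> 0" "e1 \<ge> 0" "e2 \<ge> 0" "b1 \<ge> 0" "b2 \<ge> 0" "b3 \<ge> 0" "z0 \<ge> 0" "z1 \<ge> 0"
    and eq: "a0 + b2 = \<alpha>" "e1 + e2 + b1 + b3 = \<beta>" "z0 + z1 = 1 - norm w"
    and seg: "segment e1 e2 b1 b2 b3 z0 z1 r (l + of_int k)"
  proof -
    have "1 - norm w \<ge> 0" "\<alpha> + \<beta> + (1 - norm w) = 1" using z(3) w(4) by simp_all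
    from fibre_surj[OF w(2,3) this, of l] show thesis using that by metis
  qed
  have "a0 + e1 + e2 + b1 + b2 + b3 + z0 + z1 = 1" using eq w(4) by linarith
  note pts = segment_point[OF seg nn this, unfolded eq(1,2)]
  have turn: "cis (2 * pi * (- \<sigma> * (l + of_int k))) = v"
  proof -
    have ss: "\<sigma> * \<sigma> = 1" using w(1) by auto
    have "2 * pi * (- \<sigma> * (l + of_int k)) = (\<sigma> * \<sigma>) * Arg v + 2 * pi * (- \<sigma> * of_int k)"
      by (simp add: l_def field_simps)
    also have "\<dots> = Arg v + 2 * pi * (- \<sigma> * of_int k)" by (simp add: ss)
    finally have "cis (2 * pi * (- \<sigma> * (l + of_int k))) = cis (Arg v) * cis (2 * pi * (- \<sigma> * of_int k))"
      by (simp only: cis_mult)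
    also have "- \<sigma> * of_int k \<in> \<int>" using w(1) by auto
    then have "cis (2 * pi * (- \<sigma> * of_int k)) = 1" by (rule cis_multiple_2pi)
    also have "cis (Arg v) * 1 = v"
      using rcis_cmod_Arg[of v] z(2) by (simp add: rcis_def)
    finally show ?thesis .
  qed
  have "\<exists>p\<in>topspace (B_space C). twist p = v \<and> disk (B_map D_cat H p) = w"
  proof (cases "\<sigma> = -1")
    case True
    have "cis (2 * pi * (l + of_int k)) = v" using turn unfolding True by (simp only: minus_minus mult_1_left)
    then show ?thesis using pts(1) True w(5) by metis
  next
    case False
    then have s: "\<sigma> = 1" using w(1) by simp
    have "cis (2 * pi * (- (l + of_int k))) = v" using turn unfolding s by (simp only: mult_minus1)
    then show ?thesis using pts(2) s w(5) by metis
  qed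
  then show "z \<in> solid ` topspace (B_space C)"
    by (auto simp: z solid_def image_iff)
qed

lemma solid_homeomorphic: "homeomorphic_map (B_space C) (prod_topology S1_space D2_space) solid"
  by (rule continuous_imp_homeomorphic_map[OF continuous_solid compact_C])
    (simp_all add: Hausdorff_space_prod_topology S1_space_def D2_space_def Hausdorff_space_subtopology image_solid inj_solid)

text \<open>Modulus one means that the copy of \<open>S\<close> carries no weight, and
  \<open>T\<close> is a sieve in the cylinder.\<close>

lemma boundary_point:
  assumes p: "p \<in> topspace (B_space C)" and d: "norm (disk (B_map D_cat H p)) = 1"
  shows "p \<in> B_map C cyl_left ` topspace (B_space T_cat)"
proof (rule sieve_point[OF cyl_left_sieve[OF F_functor] C.loop_free_axioms p])
  fix v :: "T_obj + S_obj" assume "v \<notin> onObj cyl_left ` Obj T_cat"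
  then obtain y where v: "v = Inr y" by (cases v) (auto simp: cyl_left_def)
  have "\<mu> (Inr S_A) p = 0 \<and> \<mu> (Inr S_B) p = 0"
    using norm_disk_H[OF p] d C.mass_nonneg[OF p, of "Inr S_A"] C.mass_nonneg[OF p, of "Inr S_B"] by auto
  then show "\<mu> v p = 0" by (cases y) (auto simp: v)
qed

end

section \<open>The Hopf map\<close>

definition vec3 :: "complex \<Rightarrow> real \<Rightarrow> real ^ 3"
  where "vec3 w h = Re w *\<^sub>R axis 1 1 + Im w *\<^sub>R axis 2 1 + h *\<^sub>R axis 3 1"

lemma vec3_nth [simp]: "vec3 w h $ 1 = Re w" "vec3 w h $ 2 = Im w" "vec3 w h $ 3 = h"
  by (simp_all add: vec3_def axis_def)

lemma vec3_eq_iff [simp]: "vec3 w h = vec3 w' h' \<longleftrightarrow> w = w' \<and> h = h'"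
  by (auto simp: vec_eq_iff forall_3 complex_eq_iff)

lemma vec3_cases: obtains w h where "x = vec3 w h"
proof
  show "x = vec3 (Complex (x $ 1) (x $ 2)) (x $ 3)" by (simp add: vec_eq_iff forall_3)
qed

lemma norm_vec3: "norm (vec3 w h) = 1 \<longleftrightarrow> (norm w)\<^sup>2 + h\<^sup>2 = 1"
  by (simp add: norm_vec_def L2_set_def sum_3 cmod_power2 real_sqrt_eq_1_iff)

definition hopf_formula :: "complex \<times> complex \<Rightarrow> real ^ 3"
  where "hopf_formula = (\<lambda>(z0, z1). vec3 (2 * z0 * cnj z1) ((norm z0)\<^sup>2 - (norm z1)\<^sup>2))"

lemma S3_iff: "(z0, z1) \<in> topspace S3_space \<longleftrightarrow> (norm z0)\<^sup>2 + (norm z1)\<^sup>2 = 1"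
proof -
  have "z0 * cnj z0 + z1 * cnj z1 = complex_of_real ((norm z0)\<^sup>2 + (norm z1)\<^sup>2)"
    by (simp only: complex_norm_square of_real_add)
  then have "z0 * cnj z0 + z1 * cnj z1 = 1 \<longleftrightarrow> (norm z0)\<^sup>2 + (norm z1)\<^sup>2 = 1"
    by (simp only: of_real_eq_1_iff)
  then show ?thesis by (simp add: S3_space_def)
qed

lemma S3_space_eq: "S3_space = top_of_set {z. (norm (fst z))\<^sup>2 + (norm (snd z))\<^sup>2 = 1}"
proof -
  have "{(z0, z1). z0 * cnj z0 + z1 * cnj z1 = 1} = {z. (norm (fst z))\<^sup>2 + (norm (snd z))\<^sup>2 = 1}"
    using S3_iff by (auto simp: S3_space_def)
  then show ?thesis by (simp add: S3_space_def)
qed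

lemma S3_compact: "compact_space S3_space"
proof -
  have "closed {z :: complex \<times> complex. (norm (fst z))\<^sup>2 + (norm (snd z))\<^sup>2 = 1}"
    by (intro closed_Collect_eq continuous_intros)
  moreover have "norm z = 1" if "(norm (fst z))\<^sup>2 + (norm (snd z))\<^sup>2 = 1" for z :: "complex \<times> complex"
    using that by (simp add: norm_prod_def)
  then have "bounded {z :: complex \<times> complex. (norm (fst z))\<^sup>2 + (norm (snd z))\<^sup>2 = 1}"
    by (intro boundedI[of _ 1]) simp
  ultimately show ?thesis
    by (simp add: S3_space_eq compact_space_subtopology compact_eq_bounded_closed)
qed

lemma S3_Hausdorff: "Hausdorff_space S3_space"
  by (simp add: S3_space_def Hausdorff_space_subtopology)

lemma S2_Hausdorff: "Hausdorff_space S2_space"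
  by (simp add: S2_space_def Hausdorff_space_subtopology)

lemma hopf_formula_sphere:
  assumes "z \<in> topspace S3_space"
  shows "hopf_formula z \<in> topspace S2_space"
proof -
  obtain z0 z1 where z: "z = (z0, z1)" by force
  then have "(norm z0)\<^sup>2 + (norm z1)\<^sup>2 = 1" using assms S3_iff by blast
  then have "((norm z0)\<^sup>2 + (norm z1)\<^sup>2)\<^sup>2 = 1" by simp
  then have "(norm (2 * z0 * cnj z1))\<^sup>2 + ((norm z0)\<^sup>2 - (norm z1)\<^sup>2)\<^sup>2 = 1"
    by (simp add: norm_mult power_mult_distrib power2_diff power2_sum algebra_simps)
  then show ?thesis by (simp add: z hopf_formula_def S2_space_def norm_vec3)
qed

lemma continuous_hopf_formula: "continuous_map S3_space S2_space hopf_formula"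
proof -
  have "continuous_map S3_space euclidean hopf_formula"
    unfolding S3_space_def hopf_formula_def case_prod_unfold vec3_def
    by (simp, intro continuous_intros)
  then show ?thesis
    using hopf_formula_sphere by (auto simp: S2_space_def continuous_map_in_subtopology)
qed

text \<open>The solid tori \<open>|z\<^sub>0| \<le> |z\<^sub>1|\<close> and \<open>|z\<^sub>1| \<le> |z\<^sub>0|\<close>, parametrized by the argument of the larger
  coordinate (conjugated in the first case) and by \<open>w = 2 z\<^sub>0 cnj z\<^sub>1\<close>; \<open>radius w\<close> is the absolute value
  of the larger coordinate.\<close>

definition radius :: "complex \<Rightarrow> real"
  where "radius w = sqrt ((1 + sqrt (1 - (norm w)\<^sup>2)) / 2)"

definition torus1 :: "complex \<times> complex \<Rightarrow> complex \<times> complex"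
  where "torus1 = (\<lambda>(v, w). (cnj v * w / of_real (2 * radius w), cnj v * of_real (radius w)))"

definition torus2 :: "complex \<times> complex \<Rightarrow> complex \<times> complex"
  where "torus2 = (\<lambda>(v, w). (v * of_real (radius w), v * cnj w / of_real (2 * radius w)))"

definition hemi :: "real \<Rightarrow> complex \<Rightarrow> real ^ 3"
  where "hemi \<epsilon> w = vec3 w (\<epsilon> * sqrt (1 - (norm w)\<^sup>2))"

context
  fixes w :: complex assumes w: "norm w \<le> 1"
begin

lemma sqrt_nonneg: "0 \<le> 1 - (norm w)\<^sup>2"
  using w power_le_one[of "norm w" 2] by simp

lemma radius_pos: "radius w > 0"
  using sqrt_nonneg by (auto simp: radius_def intro!: add_pos_nonneg)

lemma radius_square: "(radius w)\<^sup>2 = (1 + sqrt (1 - (norm w)\<^sup>2)) / 2"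
  using sqrt_nonneg by (simp add: radius_def)

text \<open>The squared moduli of z0 and z1 have sum 1 and product (|w|/2)^2, so they are (1 + k)/2
  and (1 - k)/2 with k = sqrt (1 - |w|^2); this is the smaller one.\<close>

lemma radius_other: "(norm w / (2 * radius w))\<^sup>2 = (1 - sqrt (1 - (norm w)\<^sup>2)) / 2"
proof -
  define k where "k = sqrt (1 - (norm w)\<^sup>2)"
  have k: "k \<ge> 0" "(norm w)\<^sup>2 = (1 + k) * (1 - k)"
    using sqrt_nonneg by (auto simp: k_def algebra_simps simp flip: power2_eq_square)
  have rs: "(radius w)\<^sup>2 = (1 + k) / 2" using radius_square by (simp add: k_def)
  have "(norm w / (2 * radius w))\<^sup>2 = (norm w)\<^sup>2 / (4 * (radius w)\<^sup>2)"
    by (simp add: power_divide power_mult_distrib)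
  also have "\<dots> = (1 - k) / 2"
    unfolding rs k(2) using k(1) by (simp add: divide_simps)
  finally show ?thesis by (simp add: k_def)
qed

lemma torus_props:
  assumes v: "norm v = 1"
  shows "torus1 (v, w) \<in> topspace S3_space" "hopf_formula (torus1 (v, w)) = hemi (-1) w"
    "torus2 (v, w) \<in> topspace S3_space" "hopf_formula (torus2 (v, w)) = hemi 1 w"
proof -
  have n1: "norm (cnj v * w / of_real (2 * radius w)) = norm w / (2 * radius w)"
    "norm (cnj v * of_real (radius w)) = radius w"
    "norm (v * cnj w / of_real (2 * radius w)) = norm w / (2 * radius w)"
    "norm (v * of_real (radius w)) = radius w"
    using v radius_pos by (simp_all add: norm_mult norm_divide)
  show "torus1 (v, w) \<in> topspace S3_space" "torus2 (v, w) \<in> topspace S3_space"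
    unfolding torus1_def torus2_def prod.case S3_iff n1 radius_other radius_square by (simp_all add: field_simps)
  have vv: "v * cnj v = 1" using complex_norm_square[of v] v by simp
  have "2 * (cnj v * w / of_real (2 * radius w)) * cnj (cnj v * of_real (radius w)) = (v * cnj v) * w"
    "2 * (v * of_real (radius w)) * cnj (v * cnj w / of_real (2 * radius w)) = (v * cnj v) * w"
    using radius_pos by (simp_all add: field_simps)
  then have "2 * (cnj v * w / of_real (2 * radius w)) * cnj (cnj v * of_real (radius w)) = w"
    "2 * (v * of_real (radius w)) * cnj (v * cnj w / of_real (2 * radius w)) = w"
    unfolding vv by simp_all
  then show "hopf_formula (torus1 (v, w)) = hemi (-1) w" "hopf_formula (torus2 (v, w)) = hemi 1 w"
    unfolding torus1_def torus2_def hopf_formula_def prod.case hemi_def n1 radius_other radius_square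
    by (simp_all add: field_simps)
qed

lemma hemi_sphere: "\<epsilon>\<^sup>2 = 1 \<Longrightarrow> hemi \<epsilon> w \<in> topspace S2_space"
  using sqrt_nonneg by (simp add: hemi_def S2_space_def norm_vec3 power_mult_distrib)

end

lemma torus1_inj: "norm w \<le> 1 \<Longrightarrow> torus1 (v, w) = torus1 (v', w) \<Longrightarrow> v = v'"
  and torus2_inj: "norm w \<le> 1 \<Longrightarrow> torus2 (v, w) = torus2 (v', w) \<Longrightarrow> v = v'"
  using radius_pos[of w] by (auto simp: torus1_def torus2_def)

text \<open>On the common torus both coordinates have modulus 1/sqrt 2. With v the conjugate phase
  of z1 and u the phase of z0, 2 z0 cnj z1 becomes v u; this is the reason for the conjugation in
  \<open>torus1\<close>.\<close>

lemma torus_overlap: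
  assumes "norm v = 1" "norm u = 1" "w = v * u"
  shows "torus1 (v, w) = torus2 (u, w)"
proof -
  have w: "norm w = 1" using assms by (simp add: norm_mult)
  then have r: "2 * (radius w)\<^sup>2 = 1" using radius_square[of w] by simp
  then have r': "2 * of_real (radius w) * of_real (radius w) = (1 :: complex)"
    by (metis mult.assoc of_real_1 of_real_mult of_real_numeral power2_eq_square)
  have "of_real (radius w) \<noteq> (0 :: complex)" using radius_pos[of w] w by simp
  then have d: "x / of_real (2 * radius w) = x * of_real (radius w)" for x :: complex
    using r' by (simp add: field_simps)
  have "v * cnj v = 1" "u * cnj u = 1" using complex_norm_square[of v] complex_norm_square[of u] assms by simp_all
  then have "cnj v * w = u" "u * cnj w = cnj v"
    unfolding assms(3) by (simp_all add: algebra_simps)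
  then show ?thesis unfolding torus1_def torus2_def prod.case d by simp
qed

text \<open>The coordinate w is forced, and 1 - |w|^2 = (|z1|^2 - |z0|^2)^2 shows that
  \<open>radius w\<close> is the larger modulus. As it is positive, the phase of that coordinate
  exists and yields v.\<close>

lemma torus_cover:
  assumes "(z0, z1) \<in> topspace S3_space"
  shows "\<exists>v w. norm v = 1 \<and> norm w \<le> 1 \<and> ((z0, z1) = torus1 (v, w) \<or> (z0, z1) = torus2 (v, w))"
proof -
  have s: "(norm z0)\<^sup>2 + (norm z1)\<^sup>2 = 1" using assms S3_iff by blast
  define w where "w = 2 * z0 * cnj z1"
  have nw: "(norm w)\<^sup>2 = 4 * (norm z0)\<^sup>2 * (norm z1)\<^sup>2"
    by (simp add: w_def norm_mult power_mult_distrib)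
  have "((norm z0)\<^sup>2 + (norm z1)\<^sup>2)\<^sup>2 = 1" using s by simp
  then have d: "1 - (norm w)\<^sup>2 = ((norm z1)\<^sup>2 - (norm z0)\<^sup>2)\<^sup>2"
    unfolding nw by (simp add: power2_diff power2_sum algebra_simps)
  have "(norm w)\<^sup>2 \<le> 1" using d zero_le_power2[of "(norm z1)\<^sup>2 - (norm z0)\<^sup>2"] by linarith
  then have w1: "norm w \<le> 1" by (simp add: abs_square_le_1)
  show ?thesis
  proof (cases "norm z0 \<le> norm z1")
    case True
    then have "(norm z0)\<^sup>2 \<le> (norm z1)\<^sup>2" by simp
    then have "sqrt (1 - (norm w)\<^sup>2) = (norm z1)\<^sup>2 - (norm z0)\<^sup>2" unfolding d by simp
    then have r: "radius w = norm z1" using s by (simp add: radius_def real_sqrt_unique)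
    then have nz: "z1 \<noteq> 0" using radius_pos[OF w1] by auto
    have "cnj z1 * z1 = of_real (norm z1) * of_real (norm z1)"
      using complex_norm_square[of z1] by (simp add: power2_eq_square mult.commute)
    then have "(z0, z1) = torus1 (cnj z1 / of_real (norm z1), w)"
      unfolding torus1_def prod.case r using nz by (simp add: w_def field_simps)
    then show ?thesis using nz w1 by (intro exI[of _ "cnj z1 / of_real (norm z1)"] exI[of _ w]) (simp add: norm_divide)
  next
    case False
    then have "(norm z1)\<^sup>2 \<le> (norm z0)\<^sup>2" by simp
    then have "sqrt (1 - (norm w)\<^sup>2) = (norm z0)\<^sup>2 - (norm z1)\<^sup>2" unfolding d by simp
    then have r: "radius w = norm z0" using s by (simp add: radius_def real_sqrt_unique)
    then have nz: "z0 \<noteq> 0" using radius_pos[OF w1] by auto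
    have "cnj z0 * z0 = of_real (norm z0) * of_real (norm z0)"
      using complex_norm_square[of z0] by (simp add: power2_eq_square mult.commute)
    then have "(z0, z1) = torus2 (z0 / of_real (norm z0), w)"
      unfolding torus2_def prod.case r using nz by (simp add: w_def field_simps)
    then show ?thesis using nz w1 by (intro exI[of _ "z0 / of_real (norm z0)"] exI[of _ w]) (simp add: norm_divide)
  qed
qed

lemma hemi_cover:
  assumes "x \<in> topspace S2_space"
  shows "\<exists>w. norm w \<le> 1 \<and> (x = hemi (-1) w \<or> x = hemi 1 w)"
proof -
  obtain w h where x: "x = vec3 w h" by (rule vec3_cases)
  then have s: "(norm w)\<^sup>2 + h\<^sup>2 = 1" using assms by (simp add: S2_space_def norm_vec3)
  then have "(norm w)\<^sup>2 \<le> 1" using zero_le_power2[of h] by linarith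
  then have "norm w \<le> 1" by (simp add: abs_square_le_1)
  moreover have "1 - (norm w)\<^sup>2 = h\<^sup>2" using s by simp
  then have "sqrt (1 - (norm w)\<^sup>2) = \<bar>h\<bar>" by simp
  then have "h = - sqrt (1 - (norm w)\<^sup>2) \<or> h = sqrt (1 - (norm w)\<^sup>2)" by linarith
  ultimately show ?thesis by (auto simp: x hemi_def)
qed

lemma solid_space_eq: "prod_topology S1_space D2_space = top_of_set (sphere 0 1 \<times> cball 0 1)"
  by (simp add: S1_space_def D2_space_def prod_topology_subtopology_eu)

lemma continuous_torus:
  "continuous_map (prod_topology S1_space D2_space) S3_space torus1"
  "continuous_map (prod_topology S1_space D2_space) S3_space torus2"
proof -
  let ?S = "sphere 0 1 \<times> cball 0 1 :: (complex \<times> complex) set"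
  have nz: "radius (snd z) \<noteq> 0" if "z \<in> ?S" for z using that radius_pos[of "snd z"] by (auto simp: mem_Times_iff)
  have r: "continuous_on ?S (\<lambda>z. radius (snd z))"
    unfolding radius_def by (intro continuous_intros) simp
  have d: "continuous_on ?S (\<lambda>z. complex_of_real (2 * radius (snd z)))"
    and d': "continuous_on ?S (\<lambda>z. complex_of_real (radius (snd z)))"
    by (intro continuous_intros r)+
  have nz': "complex_of_real (2 * radius (snd z)) \<noteq> 0" if "z \<in> ?S" for z using nz[OF that] by simp
  have c: "continuous_on ?S (\<lambda>z. x z / complex_of_real (2 * radius (snd z)))" if "continuous_on ?S x" for x
    using that d nz' by (intro continuous_on_divide) auto
  have "continuous_on ?S (\<lambda>z. (cnj (fst z) * snd z / complex_of_real (2 * radius (snd z)),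
      cnj (fst z) * complex_of_real (radius (snd z))))"
    "continuous_on ?S (\<lambda>z. (fst z * complex_of_real (radius (snd z)),
      fst z * cnj (snd z) / complex_of_real (2 * radius (snd z))))"
    by (intro continuous_on_Pair c continuous_on_mult d' continuous_intros)+
  then have "continuous_on ?S torus1" "continuous_on ?S torus2"
    by (simp_all add: torus1_def torus2_def case_prod_unfold)
  moreover have "torus1 ` ?S \<subseteq> topspace S3_space" "torus2 ` ?S \<subseteq> topspace S3_space"
    using torus_props by auto
  ultimately show "continuous_map (prod_topology S1_space D2_space) S3_space torus1"
    "continuous_map (prod_topology S1_space D2_space) S3_space torus2"
    unfolding solid_space_eq S3_space_def by (simp_all add: continuous_map_in_subtopology image_subset_iff_funcset)
qed

lemma continuous_hemi:
  assumes "\<epsilon>\<^sup>2 = 1"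
  shows "continuous_map D2_space S2_space (hemi \<epsilon>)"
proof -
  have "continuous_on (cball 0 1) (hemi \<epsilon>)"
    unfolding hemi_def[abs_def] vec3_def by (intro continuous_intros)
  then show ?thesis
    using hemi_sphere assms by (auto simp: D2_space_def S2_space_def continuous_map_in_subtopology)
qed

section \<open>Orbits of U(1) and the quotient of the 3-sphere\<close>

lemma U1_rel_class:
  assumes "z \<in> topspace S3_space"
  shows "U1_rel `` {z} = {(c * fst z, c * snd z) | c. norm c = 1}"
  using assms by (cases z) (auto simp: U1_rel_def)

text \<open>Equal values give equal moduli, from the sum and the difference of the squares. The
  quotient of nonvanishing corresponding coordinates is then the required element of U(1); it fits
  the other coordinate because z0 cnj z1 = y0 cnj y1.\<close>

lemma hopf_formula_fibre:
  assumes z: "z \<in> topspace S3_space" and y: "y \<in> topspace S3_space"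
  shows "hopf_formula z = hopf_formula y \<longleftrightarrow> U1_rel `` {z} = U1_rel `` {y}"
proof
  obtain z0 z1 where zz: "z = (z0, z1)" by force
  obtain y0 y1 where yy: "y = (y0, y1)" by force
  have s: "(norm z0)\<^sup>2 + (norm z1)\<^sup>2 = 1" "(norm y0)\<^sup>2 + (norm y1)\<^sup>2 = 1"
    using z y S3_iff by (auto simp: zz yy)
  assume "hopf_formula z = hopf_formula y"
  then have h: "z0 * cnj z1 = y0 * cnj y1" "(norm z0)\<^sup>2 - (norm z1)\<^sup>2 = (norm y0)\<^sup>2 - (norm y1)\<^sup>2"
    by (auto simp: hopf_formula_def zz yy)
  have "(norm z0)\<^sup>2 = (norm y0)\<^sup>2" "(norm z1)\<^sup>2 = (norm y1)\<^sup>2" using s h(2) by linarith+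
  then have n: "norm z0 = norm y0" "norm z1 = norm y1" by (simp_all add: power2_eq_iff_nonneg)
  have "\<exists>c. norm c = 1 \<and> y0 = c * z0 \<and> y1 = c * z1"
  proof (cases "z1 = 0")
    case True
    then have "z0 \<noteq> 0" "y1 = 0" using s n by auto
    then show ?thesis using n True by (intro exI[of _ "y0 / z0"]) (auto simp: norm_divide)
  next
    case False
    define c where "c = y1 / z1"
    have c: "norm c = 1" "y1 = c * z1" using False n by (auto simp: c_def norm_divide)
    then have cc: "c * cnj c = 1" using complex_norm_square[of c] by simp
    have "z0 * cnj z1 = (y0 * cnj c) * cnj z1" using h(1) c(2) by simp
    then have "z0 = y0 * cnj c" using False by simp
    then have "c * z0 = y0 * (c * cnj c)" by (simp only: mult_ac)
    then have "y0 = c * z0" by (simp add: cc)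
    then show ?thesis using c by blast
  qed
  then obtain c where c: "norm c = 1" "y = (c * z0, c * z1)" using yy by auto
  have nc: "c \<noteq> 0" using c(1) by auto
  show "U1_rel `` {z} = U1_rel `` {y}"
    unfolding U1_rel_class[OF z] U1_rel_class[OF y] unfolding c zz
  proof (intro equalityI subsetI)
    fix x assume "x \<in> {(d * fst (z0, z1), d * snd (z0, z1)) | d. norm d = 1}"
    then obtain d where "norm d = 1" "x = (d * z0, d * z1)" by auto
    then show "x \<in> {(d * fst (c * z0, c * z1), d * snd (c * z0, c * z1)) | d. norm d = 1}"
      using c(1) nc by (auto intro!: exI[of _ "d / c"] simp: norm_divide)
  next
    fix x assume "x \<in> {(d * fst (c * z0, c * z1), d * snd (c * z0, c * z1)) | d. norm d = 1}"
    then obtain d where "norm d = 1" "x = (d * (c * z0), d * (c * z1))" by auto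
    then show "x \<in> {(d * fst (z0, z1), d * snd (z0, z1)) | d. norm d = 1}"
      using c(1) by (auto intro!: exI[of _ "d * c"] simp: norm_mult)
  qed
next
  assume e: "U1_rel `` {z} = U1_rel `` {y}"
  have "y \<in> U1_rel `` {y}" unfolding U1_rel_class[OF y] by (auto intro!: exI[of _ 1])
  then obtain c where c: "norm c = 1" "y = (c * fst z, c * snd z)" unfolding e[symmetric] U1_rel_class[OF z] by blast
  then have cc: "c * cnj c = 1" using complex_norm_square[of c] by simp
  have "2 * (c * fst z) * cnj (c * snd z) = (c * cnj c) * (2 * fst z * cnj (snd z))" by (simp add: mult_ac)
  then show "hopf_formula z = hopf_formula y"
    unfolding cc c(2) hopf_formula_def by (simp add: case_prod_unfold c(1) norm_mult)
qed

text \<open>The formula is constant on orbits and separates them, so it descends to a continuous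
  bijection from the compact quotient. This is one identification with the sphere, against which any
  other can be compared.\<close>

lemma orbit_space_homeomorphism:
  obtains k where "homeomorphic_map S3_mod_U1 S2_space k" "\<And>z. z \<in> topspace S3_space \<Longrightarrow> k (U1_rel `` {z}) = hopf_formula z"
proof -
  let ?q = "\<lambda>z. U1_rel `` {z}"
  define k where "k c = the_elem (hopf_formula ` (c \<inter> topspace S3_space))" for c
  have q: "quotient_map S3_space S3_mod_U1 ?q"
    unfolding S3_mod_U1_def by (rule quotient_map_quotient_topology)
  have top: "topspace S3_mod_U1 = ?q ` topspace S3_space"
    using q by (simp add: quotient_map_def)
  have k: "k (?q z) = hopf_formula z" if z: "z \<in> topspace S3_space" for z
  proof -
    have "y \<in> topspace S3_space \<and> hopf_formula y = hopf_formula z" if y: "y \<in> ?q z" for y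
    proof -
      obtain c where c: "norm c = 1" "y = (c * fst z, c * snd z)"
        using y unfolding U1_rel_class[OF z] by blast
      have S: "y \<in> topspace S3_space"
        using z S3_iff[of "fst z" "snd z"] unfolding c(2) S3_iff prod.collapse by (simp add: norm_mult c(1))
      have cc: "c * cnj c = 1" using complex_norm_square[of c] c(1) by simp
      have "2 * (c * fst z) * cnj (c * snd z) = (c * cnj c) * (2 * fst z * cnj (snd z))" by (simp add: mult_ac)
      then show ?thesis
        using S unfolding cc c(2) hopf_formula_def by (simp add: case_prod_unfold c(1) norm_mult)
    qed
    moreover have "z \<in> ?q z" unfolding U1_rel_class[OF z] by (auto intro!: exI[of _ 1])
    ultimately have "hopf_formula ` (?q z \<inter> topspace S3_space) = {hopf_formula z}" using z by blast
    then show ?thesis by (simp add: k_def)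
  qed
  have "homeomorphic_map S3_mod_U1 S2_space k"
  proof (rule continuous_imp_homeomorphic_map[OF _ _ S2_Hausdorff])
    have "continuous_map S3_space S2_space (k \<circ> ?q)"
      by (rule continuous_map_eq[OF continuous_hopf_formula]) (simp add: k)
    then show "continuous_map S3_mod_U1 S2_space k"
      using continuous_compose_quotient_map[OF q] by blast
    show "compact_space S3_mod_U1"
      using q S3_compact unfolding compact_space_def
      by (metis image_compactin quotient_imp_continuous_map quotient_imp_surjective_map)
    show "k ` topspace S3_mod_U1 = topspace S2_space"
    proof (intro equalityI subsetI)
      fix x assume "x \<in> k ` topspace S3_mod_U1"
      then show "x \<in> topspace S2_space" using k hopf_formula_sphere by (auto simp: top)
    next
      fix x assume "x \<in> topspace S2_space"
      then obtain w where w: "norm w \<le> 1" "x = hemi (-1) w \<or> x = hemi 1 w" using hemi_cover by blast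
      have "\<exists>z\<in>topspace S3_space. x = hopf_formula z"
        using w(2) torus_props[OF w(1), of 1] by (metis norm_one)
      then show "x \<in> k ` topspace S3_mod_U1" using k by (auto simp: top image_iff)
    qed
    show "inj_on k (topspace S3_mod_U1)"
      unfolding top by (auto intro!: inj_onI simp: k hopf_formula_fibre)
  qed
  then show thesis using that k by blast
qed

section \<open>The gluing\<close>

text \<open>Modulo 1, the positions of a point of \<open>BT\<close> in the two solid tori add up to its angle in \<open>BS\<close>.
  The last assumption excludes the sign patterns that no arrow of \<open>T\<close> with source \<open>A\<^sub>0\<close> has.\<close>

lemma torus_turns:
  assumes "valid a0 e1 e2 b1 b2 b3 0 0 r g" "valid a0 e2 e1 b1 b2 b3 0 0 r' g"
    and "a0 > 0 \<Longrightarrow> r = r' \<Longrightarrow> b2 = 0 \<and> (b1 = 0 \<or> r = -1 \<and> g = -1) \<and> (b3 = 0 \<or> r = 1 \<and> g = 1)"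
  shows "\<exists>k::int. turns e1 b1 b2 b3 0 r + turns e2 b1 b2 b3 0 r' = g * (e1 + e2 + b1 + b3) / 2 + of_int k"
proof -
  let ?d = "turns e1 b1 b2 b3 0 r + turns e2 b1 b2 b3 0 r' - g * (e1 + e2 + b1 + b3) / 2"
  have signs: "r = 1 \<or> r = -1" "r' = 1 \<or> r' = -1" "g = 1 \<or> g = -1"
    using assms by (simp_all add: valid_def)
  have "a0 \<ge> 0" using assms(1) by (simp add: valid_def)
  then have "a0 = 0 \<or> a0 > 0" by linarith
  then have J: "a0 = 0 \<or> r \<noteq> r' \<or> b2 = 0 \<and> (b1 = 0 \<or> r = -1 \<and> g = -1) \<and> (b3 = 0 \<or> r = 1 \<and> g = 1)"
    using assms(3) by blast
  have "?d = 0 \<or> ?d = 1 \<or> ?d = -1 \<or> ?d = 2 \<or> ?d = -2"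
  proof (cases "r = r'")
    case False
    then have "r = 1 \<and> r' = -1 \<or> r = -1 \<and> r' = 1" using signs by auto
    \<comment> \<open>With opposite signs \<open>?d\<close> is, up to sign, the sum of one of e1, e2
      and one of b1, b3; validity in both cylinders forces this sum to be 0 or the full weight
      1.\<close>
    then have "?d = 0 \<or> ?d = 1 \<or> ?d = -1"
      using signs(3) assms(1,2) by (elim disjE conjE; simp add: valid_def turns_def; argo)
    then show ?thesis by blast
  next
    case True
    have V: "a0 + e1 + e2 + b1 + b2 + b3 = 1" "e1 = 0 \<or> e2 = 0" "e1 = 0 \<or> b2 = 0" "e2 = 0 \<or> b2 = 0" "b1 = 0 \<or> b3 = 0"
      "a0 = 0 \<or> e1 = 0 \<or> r = g" "a0 = 0 \<or> e2 = 0 \<or> r = g" "b2 = 0 \<or> b1 = 0 \<or> g = 1" "b2 = 0 \<or> b3 = 0 \<or> g = -1"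
      "e1 = 0 \<or> b1 = 0 \<or> r = -1" "e2 = 0 \<or> b1 = 0 \<or> r = -1" "e1 = 0 \<or> b3 = 0 \<or> r = 1" "e2 = 0 \<or> b3 = 0 \<or> r = 1"
      using assms(1,2) True by (simp_all add: valid_def)
    \<comment> \<open>With equal signs and a0 > 0 the condition \<open>J\<close> makes the defect
      vanish; with a0 = 0 its absolute value is 0 or the full weight 1, taken once or twice.\<close>
    have d: "r = 1 \<Longrightarrow> g = 1 \<Longrightarrow> ?d = b1 + b2" "r = -1 \<Longrightarrow> g = -1 \<Longrightarrow> - ?d = b2 + b3"
      "r = 1 \<Longrightarrow> g = -1 \<Longrightarrow> ?d = e1 + e2 + 2 * b1 + b2 + b3"
      "r = -1 \<Longrightarrow> g = 1 \<Longrightarrow> - ?d = e1 + e2 + b1 + b2 + 2 * b3"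
      using True by (simp_all add: turns_def field_simps)
    consider "r = 1" "g = 1" | "r = -1" "g = -1" | "r = 1" "g = -1" | "r = -1" "g = 1"
      using signs(1,3) by blast
    then show ?thesis
    proof cases
      case 1
      then have "?d = 0 \<or> ?d = 1" unfolding d(1)[OF 1] using V J True by (cases "b1 = 0"; cases "b2 = 0") auto
      then show ?thesis by blast
    next
      case 2
      then have "- ?d = 0 \<or> - ?d = 1" unfolding d(2)[OF 2] using V J True by (cases "b3 = 0"; cases "b2 = 0") auto
      then show ?thesis by linarith
    next
      case 3
      then have "?d = 0 \<or> ?d = 1 \<or> ?d = 2" unfolding d(3)[OF 3] using V J True by (cases "b1 = 0"; cases "a0 = 0") simp_all
      then show ?thesis by blast
    next
      case 4
      then have "- ?d = 0 \<or> - ?d = 1 \<or> - ?d = 2" unfolding d(4)[OF 4] using V J True by (cases "b3 = 0"; cases "a0 = 0") simp_all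
      then show ?thesis by linarith
    qed
  qed
  then consider "?d = of_int 0" | "?d = of_int 1" | "?d = of_int (-1)" | "?d = of_int 2" | "?d = of_int (-2)" by force
  then obtain k :: int where "?d = of_int k" by cases blast+
  then show ?thesis by (intro exI[of _ k]) (simp add: algebra_simps)
qed

section \<open>Restriction of the coordinates to the torus BT\<close>

context torus_cylinder
begin

lemma cyl_left_functor: "cat_functor T_cat C cyl_left"
  by (rule mapping_cylinder_cocone(1)[OF F_functor])

lemma H_cyl_left: "H \<circ>\<^sub>F cyl_left = S_incl \<circ>\<^sub>F G_fun"
  by (rule mapping_cylinder_universal(2)[OF F_functor SG_functor _ to_X_nat[OF F_functor]])
    (rule const_functor; simp add: S.small_category_axioms D.small_category_axioms)

context
  fixes p assumes p: "p \<in> topspace (B_space T_cat)"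
begin

lemma mass_cyl_left:
  "\<mu> (Inl x) (B_map C cyl_left p) = mass T_cat x p" "\<mu> (Inr y) (B_map C cyl_left p) = 0"
  using cat_functor.mass_B_map[OF cyl_left_functor _ p] finite_T(1)
  by (simp_all add: cyl_left_def)

lemma B_H_cyl_left: "B_map D_cat H (B_map C cyl_left p) = B_map D_cat S_incl (B_map S_cat G_fun p)"
  using B_map_comp[OF cyl_left_functor H.cat_functor_axioms p] B_map_comp[OF G_functor S_incl_functor p]
  by (simp add: H_cyl_left)

lemma disk_cyl_left: "disk (B_map D_cat H (B_map C cyl_left p)) = circ (B_map S_cat G_fun p)"
  by (simp add: B_H_cyl_left circ_def)

lemma carrier_R_cyl_left:
  assumes "e \<in> carrier_arrs T_cat p"
  shows "onArr F e \<in> carrier_arrs S_cat (B_map S_cat R (B_map C cyl_left p))"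
proof -
  interpret L: cat_functor T_cat C cyl_left by (rule cyl_left_functor)
  have "Left_arr e \<in> carrier_arrs C (B_map C cyl_left p)"
    using L.carrier_arrs_B_map[OF p] assms by (simp add: cyl_left_def)
  then have "onArr R (Left_arr e) \<in> carrier_arrs S_cat (B_map S_cat R (B_map C cyl_left p))"
    using R.carrier_arrs_B_map[OF B_map_in[OF cyl_left_functor p]] by blast
  then show ?thesis by simp
qed

lemma cyl_left_in: "B_map C cyl_left p \<in> topspace (B_space C)"
  by (rule B_map_in[OF cyl_left_functor p])

end

end

interpretation MC: torus_cylinder F_M T_A1 T_B0 by unfold_locales simp
interpretation NC: torus_cylinder F_N T_B0 T_A1 by unfold_locales simp

abbreviation "to_M \<equiv> B_map MC.C (cyl_left :: (T_obj, _, _, TS_cyl_arr) func)"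
abbreviation "to_N \<equiv> B_map NC.C (cyl_left :: (T_obj, _, _, TS_cyl_arr) func)"

text \<open>One arrow of the carrier supplies the signs for both retractions and for
  \<open>D\<close> at once; validity in the two cylinders separately does not relate the two
  retraction signs.\<close>

lemma torus_signs:
  assumes p: "p \<in> topspace (B_space T_cat)" and x: "mass T_cat T_A0 p > 0" "mass T_cat x p > 0" "x \<noteq> T_A0"
  obtains e where "e \<in> Arr T_cat" "Src T_cat e = T_A0" "Tgt T_cat e = x"
    "sgn_S (onArr F_M e) \<noteq> 0 \<Longrightarrow> sign_S (B_map S_cat MC.R (to_M p)) = of_int (sgn_S (onArr F_M e))"
    "sgn_S (onArr F_N e) \<noteq> 0 \<Longrightarrow> sign_S (B_map S_cat NC.R (to_N p)) = of_int (sgn_S (onArr F_N e))"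
    "sgn_S (onArr G_fun e) \<noteq> 0 \<Longrightarrow> sign_D (B_map D_cat S_incl (B_map S_cat G_fun p)) = of_int (sgn_S (onArr G_fun e))"
proof -
  interpret G: cat_functor T_cat S_cat G_fun by (rule G_functor)
  interpret I: cat_functor S_cat D_cat S_incl by (rule S_incl_functor)
  obtain e where e: "e \<in> carrier_arrs T_cat p" "Src T_cat e = T_A0 \<and> Tgt T_cat e = x \<or> Src T_cat e = x \<and> Tgt T_cat e = T_A0"
    using T.carrier_arrs_between[OF p x(1,2)] by blast
  have e': "e \<in> Arr T_cat" using T.carrier_arrs_props(1)[OF p e(1)] .
  have "Tgt T_cat e \<noteq> T_A0 \<or> Src T_cat e = T_A0"
    using T_arrow_signs[OF e'] by (auto simp: T_signs_def)
  then have st: "Src T_cat e = T_A0" "Tgt T_cat e = x" using e(2) x(3) by auto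
  have G: "onArr G_fun e \<in> carrier_arrs S_cat (B_map S_cat G_fun p)"
    using G.carrier_arrs_B_map[OF p] e(1) by simp
  have Gp: "B_map S_cat G_fun p \<in> topspace (B_space S_cat)" by (rule B_map_in[OF G_functor p])
  show thesis
  proof (rule that[OF e' st])
    show "sign_S (B_map S_cat MC.R (to_M p)) = of_int (sgn_S (onArr F_M e))" if "sgn_S (onArr F_M e) \<noteq> 0"
      using MC.carrier_R_cyl_left[OF p e(1)] sign_S_carrier[OF MC.BR_in[OF MC.cyl_left_in[OF p]]] that by blast
    show "sign_S (B_map S_cat NC.R (to_N p)) = of_int (sgn_S (onArr F_N e))" if "sgn_S (onArr F_N e) \<noteq> 0"
      using NC.carrier_R_cyl_left[OF p e(1)] sign_S_carrier[OF NC.BR_in[OF NC.cyl_left_in[OF p]]] that by blast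
    show "sign_D (B_map D_cat S_incl (B_map S_cat G_fun p)) = of_int (sgn_S (onArr G_fun e))" if "sgn_S (onArr G_fun e) \<noteq> 0"
      using sign_D_carrier[OF B_map_in[OF S_incl_functor Gp] G.onArr_in[OF e'] _ that] I.carrier_arrs_B_map[OF Gp] G by simp
  qed
qed

text \<open>In \<open>T_signs\<close> the arrows from \<open>A\<^sub>0\<close> to
  \<open>B\<^sub>2\<close> have opposite signs under \<open>F_M\<close> and \<open>F_N\<close>. The
  only arrow from \<open>A\<^sub>0\<close> to \<open>B\<^sub>1\<close> with equal ones has -1 in all
  three columns, and the only such arrow to \<open>B\<^sub>3\<close> has 1.\<close>

lemma torus_joint_signs:
  fixes r r' g :: real
  assumes p: "p \<in> topspace (B_space T_cat)" and a: "mass T_cat T_A0 p > 0"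
  defines "r \<equiv> sign_S (B_map S_cat MC.R (to_M p))" and "r' \<equiv> sign_S (B_map S_cat NC.R (to_N p))"
    and "g \<equiv> sign_D (B_map D_cat S_incl (B_map S_cat G_fun p))"
  assumes rr: "r = r'"
  shows "mass T_cat T_B2 p = 0 \<and> (mass T_cat T_B1 p = 0 \<or> r = -1 \<and> g = -1) \<and> (mass T_cat T_B3 p = 0 \<or> r = 1 \<and> g = 1)"
proof (intro conjI)
  have pos: "mass T_cat x p = 0 \<or> mass T_cat x p > 0" for x using T.mass_nonneg[OF p, of x] by linarith
  have signs: "\<exists>e\<in>Arr T_cat. Src T_cat e = T_A0 \<and> Tgt T_cat e = x \<and> (sgn_S (onArr F_M e) \<noteq> 0 \<longrightarrow> r = of_int (sgn_S (onArr F_M e))) \<and>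
      (sgn_S (onArr F_N e) \<noteq> 0 \<longrightarrow> r = of_int (sgn_S (onArr F_N e))) \<and> (sgn_S (onArr G_fun e) \<noteq> 0 \<longrightarrow> g = of_int (sgn_S (onArr G_fun e)))"
    if "mass T_cat x p \<noteq> 0" "x \<noteq> T_A0" for x
    using torus_signs[OF p a, of x] pos[of x] that unfolding rr unfolding r'_def g_def by (metis rr r_def r'_def)
  show "mass T_cat T_B2 p = 0"
  proof (rule ccontr)
    assume "mass T_cat T_B2 p \<noteq> 0"
    with signs[of T_B2] show False by (auto dest!: T_arrow_signs simp: T_signs_def)
  qed
  show "mass T_cat T_B1 p = 0 \<or> r = -1 \<and> g = -1"
  proof (cases "mass T_cat T_B1 p = 0")
    case False
    with signs[of T_B1] show ?thesis by (auto dest!: T_arrow_signs simp: T_signs_def)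
  qed simp
  show "mass T_cat T_B3 p = 0 \<or> r = 1 \<and> g = 1"
  proof (cases "mass T_cat T_B3 p = 0")
    case False
    with signs[of T_B3] show ?thesis by (auto dest!: T_arrow_signs simp: T_signs_def)
  qed simp
qed

lemma torus_relation:
  assumes p: "p \<in> topspace (B_space T_cat)"
  shows "MC.twist (to_M p) * NC.twist (to_N p) = circ (B_map S_cat G_fun p)"
proof -
  let ?q = "B_map D_cat S_incl (B_map S_cat G_fun p)"
  have q: "?q \<in> topspace (B_space D_cat)" using MC.BH_in[OF MC.cyl_left_in[OF p]] by (simp only: MC.B_H_cyl_left[OF p])
  have m: "mass D_cat D_X ?q = 0"
    "mass D_cat D_B ?q = mass T_cat T_A1 p + mass T_cat T_B0 p + mass T_cat T_B1 p + mass T_cat T_B3 p"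
    using MC.mass_H[OF MC.cyl_left_in[OF p]] by (simp_all only: MC.B_H_cyl_left[OF p] MC.mass_cyl_left[OF p] add_0)
  obtain k :: int where "MC.twist_turns (to_M p) + NC.twist_turns (to_N p) = sign_D ?q * mass D_cat D_B ?q / 2 + of_int k"
    using torus_turns[OF MC.valid_point[OF MC.cyl_left_in[OF p], unfolded MC.mass_cyl_left[OF p] MC.B_H_cyl_left[OF p]]
      NC.valid_point[OF NC.cyl_left_in[OF p], unfolded NC.mass_cyl_left[OF p] NC.B_H_cyl_left[OF p]]
      torus_joint_signs[OF p]]
    unfolding m MC.twist_turns_def NC.twist_turns_def MC.mass_cyl_left[OF p] NC.mass_cyl_left[OF p] by blast
  then have "MC.twist (to_M p) * NC.twist (to_N p) = cis (2 * pi * (sign_D ?q * mass D_cat D_B ?q / 2 + of_int k))"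
    by (simp add: MC.twist_eq[OF MC.cyl_left_in[OF p]] NC.twist_eq[OF NC.cyl_left_in[OF p]] cis_mult
        flip: distrib_left)
  also have "\<dots> = disk ?q"
    unfolding disk_eq_cis[OF q m(1)] distrib_left by (simp add: cis_multiple_2pi flip: cis_mult)
  finally show ?thesis by (simp add: circ_def)
qed

lemma M_cat_cylinder: "M_cat = MC.C" "H_M = MC.H" "T_incl = cyl_left"
  and N_cat_cylinder: "N_cat = NC.C" "H_N = NC.H"
  by (simp_all add: M_cat_def N_cat_def H_M_def H_N_def T_incl_def)

text \<open>\<open>BT\<close> is the part of \<open>BM\<close> over the boundary circle of the disk,
  since modulus one means that the copy of \<open>S\<close> carries no weight.\<close>

lemma T_homeomorphic: "B_space T_cat homeomorphic_space T2_space"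
proof -
  let ?f = "\<lambda>p. MC.solid (to_M p)"
  interpret L: cat_functor T_cat MC.C cyl_left by (rule MC.cyl_left_functor)
  have to_M: "continuous_map (B_space T_cat) (B_space MC.C) to_M" by (rule L.continuous_B_map)
  have T2: "T2_space = top_of_set (sphere 0 1 \<times> sphere 0 1)"
    by (simp add: T2_space_def S1_space_def prod_topology_subtopology_eu)
  have boundary: "norm (disk (B_map D_cat MC.H (to_M p))) = 1" if "p \<in> topspace (B_space T_cat)" for p
    using MC.norm_disk_H[OF MC.cyl_left_in[OF that]] by (simp add: MC.mass_cyl_left[OF that])
  have im: "?f ` topspace (B_space T_cat) = sphere 0 1 \<times> sphere 0 1"
  proof (intro equalityI subsetI)
    fix z assume "z \<in> ?f ` topspace (B_space T_cat)"
    then obtain p where p: "p \<in> topspace (B_space T_cat)" "z = ?f p" by blast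
    have "?f p \<in> sphere 0 1 \<times> cball 0 1" using MC.image_solid MC.cyl_left_in[OF p(1)] by blast
    then show "z \<in> sphere 0 1 \<times> sphere 0 1" using boundary[OF p(1)] by (simp add: p(2) MC.solid_def)
  next
    fix z :: "complex \<times> complex" assume z: "z \<in> sphere 0 1 \<times> sphere 0 1"
    then have "z \<in> sphere 0 1 \<times> cball 0 1" by auto
    then obtain q where q: "q \<in> topspace (B_space MC.C)" "z = MC.solid q" using MC.image_solid by blast
    then have "norm (disk (B_map D_cat MC.H q)) = 1" using z by (simp add: MC.solid_def)
    then show "z \<in> ?f ` topspace (B_space T_cat)" using MC.boundary_point[OF q(1)] q(2) by blast
  qed
  have "homeomorphic_map (B_space T_cat) T2_space ?f"
  proof (rule continuous_imp_homeomorphic_map)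
    show "compact_space (B_space T_cat)" by (rule T.compact_B_space[OF finite_T])
    show "Hausdorff_space T2_space" by (simp add: T2 Hausdorff_space_subtopology)
    have "continuous_map (B_space T_cat) euclidean ?f"
      using continuous_map_compose[OF to_M MC.continuous_solid]
      by (simp add: solid_space_eq continuous_map_in_subtopology o_def)
    then show "continuous_map (B_space T_cat) T2_space ?f"
      using im by (auto simp: T2 continuous_map_in_subtopology)
    show "?f ` topspace (B_space T_cat) = topspace T2_space" using im by (simp add: T2)
    have "inj_on to_M (topspace (B_space T_cat))"
      by (rule B_map_inj[OF MC.cyl_left_functor T_loop_free finite_T(1) MC.C.loop_free_axioms])
        (auto simp: cyl_left_def inj_on_def)
    then show "inj_on ?f (topspace (B_space T_cat))"
      using comp_inj_on[OF _ inj_on_subset[OF MC.inj_solid], of to_M] MC.cyl_left_in by (auto simp: o_def)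
  qed
  then show ?thesis by (rule homeomorphic_map_imp_homeomorphic_space)
qed

section \<open>Assembling the two spheres and the map between them\<close>

lemma P_sieve_square: "sieve_square T_cat MC.C NC.C P_cat cyl_left cyl_left M_to_P N_to_P"
  using sieve_square_pushout[OF cyl_left_sieve[OF F_M_functor] cyl_left_sieve[OF F_N_functor]]
  by (simp add: P_cat_def M_to_P_def N_to_P_def M_cat_cylinder N_cat_cylinder)

lemma Q_sieve_square: "sieve_square S_cat D_cat D_cat Q_cat S_incl S_incl D_to_Q1 D_to_Q2"
  using sieve_square_pushout[OF S_incl_sieve S_incl_sieve]
  by (simp add: Q_cat_def D_to_Q1_def D_to_Q2_def)

lemma disk_norm_le: "q \<in> topspace (B_space D_cat) \<Longrightarrow> norm (disk q) \<le> 1"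
  using image_disk by (metis image_eqI mem_cball_0)

lemma (in torus_cylinder) solid_norms:
  assumes "p \<in> topspace (B_space C)"
  shows "norm (twist p) = 1" "norm (disk (B_map D_cat H p)) \<le> 1"
  using imageI[OF assms, of solid] unfolding image_solid by (simp_all add: solid_def)

text \<open>The hemispheres meet only in the equator, because a height that is both nonpositive and
  nonnegative is zero.\<close>

lemma hemi_meet:
  assumes "norm w \<le> 1" "norm w' \<le> 1" "hemi (-1) w = hemi 1 w'"
  shows "w = w'" "norm w = 1"
proof -
  have w: "w = w'" "-1 * sqrt (1 - (norm w)\<^sup>2) = 1 * sqrt (1 - (norm w')\<^sup>2)"
    using assms(3) unfolding hemi_def vec3_eq_iff by blast+
  from w(2) have "sqrt (1 - (norm w)\<^sup>2) = 0" unfolding w(1)[symmetric] by linarith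
  then have "(norm w)\<^sup>2 = 1\<^sup>2" by simp
  then show "norm w = 1" by (rule power2_eq_imp_eq) simp_all
  show "w = w'" by fact
qed

lemma hemi_eq_iff: "hemi \<epsilon> w = hemi \<epsilon> w' \<longleftrightarrow> w = w'"
  by (auto simp: hemi_def)

text \<open>The maps agree on \<open>BT\<close> by \<open>torus_relation\<close> and
  \<open>torus_overlap\<close>. For injectivity on a solid torus, \<open>hopf_formula\<close>
  recovers the disk coordinate, and then the parametrization recovers the circle coordinate. A
  common value of the two solid tori has its Hopf image in both hemispheres, hence on the equator,
  so its preimages lie over the boundary circle.\<close>

lemma P_map:
  obtains \<phi> where "homeomorphic_map (B_space P_cat) S3_space \<phi>"
    "\<And>p. p \<in> topspace (B_space MC.C) \<Longrightarrow> \<phi> (B_map P_cat M_to_P p) = torus1 (MC.solid p)"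
    "\<And>p. p \<in> topspace (B_space NC.C) \<Longrightarrow> \<phi> (B_map P_cat N_to_P p) = torus2 (NC.solid p)"
proof -
  interpret P: sieve_square T_cat MC.C NC.C P_cat cyl_left cyl_left M_to_P N_to_P by (rule P_sieve_square)
  have h1: "hopf_formula (torus1 (MC.solid p)) = hemi (-1) (disk (B_map D_cat MC.H p))"
    if "p \<in> topspace (B_space MC.C)" for p
    unfolding MC.solid_def using torus_props(2) MC.solid_norms[OF that] by blast
  have h2: "hopf_formula (torus2 (NC.solid p)) = hemi 1 (disk (B_map D_cat NC.H p))"
    if "p \<in> topspace (B_space NC.C)" for p
    unfolding NC.solid_def using torus_props(4) NC.solid_norms[OF that] by blast
  show thesis
  proof (rule P.B_glue_homeomorphic_map[OF MC.compact_C NC.compact_C S3_Hausdorff, of "\<lambda>p. torus1 (MC.solid p)" "\<lambda>p. torus2 (NC.solid p)"])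
    show "continuous_map (B_space MC.C) S3_space (\<lambda>p. torus1 (MC.solid p))"
      using continuous_map_compose[OF MC.continuous_solid continuous_torus(1)] by (simp add: o_def)
    show "continuous_map (B_space NC.C) S3_space (\<lambda>p. torus2 (NC.solid p))"
      using continuous_map_compose[OF NC.continuous_solid continuous_torus(2)] by (simp add: o_def)
  next
    fix p assume p: "p \<in> topspace (B_space T_cat)"
    show "torus1 (MC.solid (to_M p)) = torus2 (NC.solid (to_N p))"
      unfolding MC.solid_def NC.solid_def MC.disk_cyl_left[OF p] NC.disk_cyl_left[OF p]
      using MC.solid_norms(1)[OF MC.cyl_left_in[OF p]] NC.solid_norms(1)[OF NC.cyl_left_in[OF p]]
      by (rule torus_overlap) (simp add: torus_relation[OF p])
  next
    show "inj_on (\<lambda>p. torus1 (MC.solid p)) (topspace (B_space MC.C))"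
    proof (rule inj_onI)
      fix p q assume pq: "p \<in> topspace (B_space MC.C)" "q \<in> topspace (B_space MC.C)"
        and e: "torus1 (MC.solid p) = torus1 (MC.solid q)"
      have d: "disk (B_map D_cat MC.H p) = disk (B_map D_cat MC.H q)"
        using h1[OF pq(1)] h1[OF pq(2)] by (simp add: e hemi_eq_iff)
      then have "MC.solid p = MC.solid q"
        using torus1_inj[OF MC.solid_norms(2)[OF pq(2)]] e by (simp add: MC.solid_def)
      then show "p = q" using MC.inj_solid pq by (simp add: inj_on_eq_iff)
    qed
    show "inj_on (\<lambda>p. torus2 (NC.solid p)) (topspace (B_space NC.C))"
    proof (rule inj_onI)
      fix p q assume pq: "p \<in> topspace (B_space NC.C)" "q \<in> topspace (B_space NC.C)"
        and e: "torus2 (NC.solid p) = torus2 (NC.solid q)"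
      have d: "disk (B_map D_cat NC.H p) = disk (B_map D_cat NC.H q)"
        using h2[OF pq(1)] h2[OF pq(2)] by (simp add: e hemi_eq_iff)
      then have "NC.solid p = NC.solid q"
        using torus2_inj[OF NC.solid_norms(2)[OF pq(2)]] e by (simp add: NC.solid_def)
      then show "p = q" using NC.inj_solid pq by (simp add: inj_on_eq_iff)
    qed
  next
    fix p q assume p: "p \<in> topspace (B_space MC.C)" and q: "q \<in> topspace (B_space NC.C)"
      and e: "torus1 (MC.solid p) = torus2 (NC.solid q)"
    have "hemi (-1) (disk (B_map D_cat MC.H p)) = hemi 1 (disk (B_map D_cat NC.H q))"
      using h1[OF p] h2[OF q] e by simp
    then have "norm (disk (B_map D_cat MC.H p)) = 1"
      by (rule hemi_meet(2)[OF MC.solid_norms(2)[OF p] NC.solid_norms(2)[OF q]])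
    then show "p \<in> to_M ` topspace (B_space T_cat)" by (rule MC.boundary_point[OF p])
  next
    show "topspace S3_space \<subseteq> (\<lambda>p. torus1 (MC.solid p)) ` topspace (B_space MC.C) \<union>
        (\<lambda>p. torus2 (NC.solid p)) ` topspace (B_space NC.C)"
    proof
      fix z assume "z \<in> topspace S3_space"
      then obtain v w where vw: "norm v = 1" "norm w \<le> 1" "z = torus1 (v, w) \<or> z = torus2 (v, w)"
        using torus_cover[of "fst z" "snd z"] by (auto simp only: prod.collapse)
      then have "(v, w) \<in> MC.solid ` topspace (B_space MC.C)" "(v, w) \<in> NC.solid ` topspace (B_space NC.C)"
        by (simp_all add: MC.image_solid NC.image_solid)
      then show "z \<in> (\<lambda>p. torus1 (MC.solid p)) ` topspace (B_space MC.C) \<union>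
          (\<lambda>p. torus2 (NC.solid p)) ` topspace (B_space NC.C)"
        using vw(3) by (metis (no_types, lifting) UnCI image_iff)
    qed
  qed (rule that)
qed

text \<open>Each copy of \<open>BD\<close> becomes a hemisphere, and the common circle
  \<open>BS\<close> becomes the equator.\<close>

lemma Q_map:
  obtains \<psi> where "homeomorphic_map (B_space Q_cat) S2_space \<psi>"
    "\<And>q. q \<in> topspace (B_space D_cat) \<Longrightarrow> \<psi> (B_map Q_cat D_to_Q1 q) = hemi (-1) (disk q)"
    "\<And>q. q \<in> topspace (B_space D_cat) \<Longrightarrow> \<psi> (B_map Q_cat D_to_Q2 q) = hemi 1 (disk q)"
proof -
  interpret Q: sieve_square S_cat D_cat D_cat Q_cat S_incl S_incl D_to_Q1 D_to_Q2 by (rule Q_sieve_square)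
  have disk: "continuous_map (B_space D_cat) D2_space disk"
    using disk_homeomorphic by (rule homeomorphic_imp_continuous_map)
  have cont: "continuous_map (B_space D_cat) S2_space (\<lambda>q. hemi \<epsilon> (disk q))" if "\<epsilon>\<^sup>2 = 1" for \<epsilon>
    using continuous_map_compose[OF disk continuous_hemi[OF that]] by (simp add: o_def)
  have inj: "inj_on (\<lambda>q. hemi \<epsilon> (disk q)) (topspace (B_space D_cat))" for \<epsilon>
    using inj_disk by (simp add: inj_on_def hemi_eq_iff)
  show thesis
  proof (rule Q.B_glue_homeomorphic_map[OF D_compact D_compact S2_Hausdorff, of "\<lambda>q. hemi (-1) (disk q)" "\<lambda>q. hemi 1 (disk q)"])
    fix p assume p: "p \<in> topspace (B_space S_cat)"
    have "norm (circ p) = 1" by (simp add: circ_eq[OF p])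
    then show "hemi (-1) (disk (B_map D_cat S_incl p)) = hemi 1 (disk (B_map D_cat S_incl p))"
      unfolding circ_def by (simp add: hemi_def)
  next
    fix p q assume p: "p \<in> topspace (B_space D_cat)" and q: "q \<in> topspace (B_space D_cat)"
      and e: "hemi (-1) (disk p) = hemi 1 (disk q)"
    show "p \<in> B_map D_cat S_incl ` topspace (B_space S_cat)"
      by (rule S_point_of_disk[OF p hemi_meet(2)[OF disk_norm_le[OF p] disk_norm_le[OF q] e]])
  next
    show "topspace S2_space \<subseteq> (\<lambda>q. hemi (-1) (disk q)) ` topspace (B_space D_cat) \<union>
        (\<lambda>q. hemi 1 (disk q)) ` topspace (B_space D_cat)"
    proof
      fix x assume "x \<in> topspace S2_space"
      then obtain w where w: "norm w \<le> 1" "x = hemi (-1) w \<or> x = hemi 1 w" using hemi_cover by blast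
      then have "w \<in> disk ` topspace (B_space D_cat)" by (simp add: image_disk)
      then show "x \<in> (\<lambda>q. hemi (-1) (disk q)) ` topspace (B_space D_cat) \<union>
          (\<lambda>q. hemi 1 (disk q)) ` topspace (B_space D_cat)"
        using w(2) by (auto simp: image_iff)
    qed
  qed (use cont inj that in auto)
qed

lemma square_commutes:
  "func_eq T_cat (S_incl \<circ>\<^sub>F G_fun) (H_M \<circ>\<^sub>F T_incl)" "func_eq T_cat (S_incl \<circ>\<^sub>F G_fun) (H_N \<circ>\<^sub>F T_incl)"
  by (simp_all only: M_cat_cylinder N_cat_cylinder MC.H_cyl_left NC.H_cyl_left func_eq_refl)

lemma T_incl_functor: "cat_functor T_cat M_cat T_incl" "cat_functor T_cat N_cat T_incl"
  using MC.cyl_left_functor NC.cyl_left_functor by (simp_all add: M_cat_cylinder N_cat_cylinder)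

lemmas H_pushout = cat_arrow_pushout[OF T_incl_functor S_incl_functor S_incl_functor G_functor H_M_functor H_N_functor
    square_commutes, folded P_cat_def Q_cat_def M_to_P_def N_to_P_def D_to_Q1_def D_to_Q2_def, folded H_fun_def]

text \<open>It suffices to check the two legs of \<open>P\<close>. There \<open>H_fun\<close> is
  \<open>H_M\<close> or \<open>H_N\<close> followed by an inclusion into \<open>Q\<close>, and both
  sides become the point of the hemisphere given by the disk coordinate.\<close>

lemma hopf_square:
  assumes \<phi>: "\<And>p. p \<in> topspace (B_space MC.C) \<Longrightarrow> \<phi> (B_map P_cat M_to_P p) = torus1 (MC.solid p)"
    "\<And>p. p \<in> topspace (B_space NC.C) \<Longrightarrow> \<phi> (B_map P_cat N_to_P p) = torus2 (NC.solid p)"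
    and \<psi>: "\<And>q. q \<in> topspace (B_space D_cat) \<Longrightarrow> \<psi> (B_map Q_cat D_to_Q1 q) = hemi (-1) (disk q)"
    "\<And>q. q \<in> topspace (B_space D_cat) \<Longrightarrow> \<psi> (B_map Q_cat D_to_Q2 q) = hemi 1 (disk q)"
    and c: "c \<in> topspace (B_space P_cat)"
  shows "\<psi> (B_map Q_cat H_fun c) = hopf_formula (\<phi> c)"
proof -
  interpret P: sieve_square T_cat MC.C NC.C P_cat cyl_left cyl_left M_to_P N_to_P by (rule P_sieve_square)
  interpret Q: sieve_square S_cat D_cat D_cat Q_cat S_incl S_incl D_to_Q1 D_to_Q2 by (rule Q_sieve_square)
  have H: "cat_functor P_cat Q_cat H_fun" "func_eq MC.C (H_fun \<circ>\<^sub>F M_to_P) (D_to_Q1 \<circ>\<^sub>F MC.H)"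
    "func_eq NC.C (H_fun \<circ>\<^sub>F N_to_P) (D_to_Q2 \<circ>\<^sub>F NC.H)"
    using H_pushout(1-3) by (simp_all add: M_cat_cylinder N_cat_cylinder)
  consider p where "p \<in> topspace (B_space MC.C)" "c = B_map P_cat M_to_P p"
    | p where "p \<in> topspace (B_space NC.C)" "c = B_map P_cat N_to_P p"
    using c P.B_cover by blast
  then show ?thesis
  proof cases
    case 1
    have "B_map Q_cat H_fun c = B_map Q_cat D_to_Q1 (B_map D_cat MC.H p)"
      using B_map_comp[OF P.J1.cat_functor_axioms H(1) 1(1)] B_map_comp[OF MC.H.cat_functor_axioms Q.J1.cat_functor_axioms 1(1)]
        B_map_cong[OF cat_functor_comp[OF P.J1.cat_functor_axioms H(1)] H(2) 1(1)] 1(2) by simp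
    then show ?thesis
      using torus_props(2)[OF MC.solid_norms(2,1)[OF 1(1)]]
      by (simp add: \<psi>(1)[OF MC.BH_in[OF 1(1)]] 1(2) \<phi>(1)[OF 1(1)] MC.solid_def)
  next
    case 2
    have "B_map Q_cat H_fun c = B_map Q_cat D_to_Q2 (B_map D_cat NC.H p)"
      using B_map_comp[OF P.J2.cat_functor_axioms H(1) 2(1)] B_map_comp[OF NC.H.cat_functor_axioms Q.J2.cat_functor_axioms 2(1)]
        B_map_cong[OF cat_functor_comp[OF P.J2.cat_functor_axioms H(1)] H(3) 2(1)] 2(2) by simp
    then show ?thesis
      using torus_props(4)[OF NC.solid_norms(2,1)[OF 2(1)]]
      by (simp add: \<psi>(2)[OF NC.BH_in[OF 2(1)]] 2(2) \<phi>(2)[OF 2(1)] NC.solid_def)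
  qed
qed

theorem theorem3:
  shows
    "is_cat_arrow_pushout TYPE(('w, 'x) category) TYPE(('y, 'z) category)
       (T_cat, S_cat, G_fun) (M_cat, D_cat, H_M) (N_cat, D_cat, H_N) (P_cat, Q_cat, H_fun)
       (T_incl, S_incl) (T_incl, S_incl) (M_to_P, D_to_Q1) (N_to_P, D_to_Q2) \<and>
     is_top_arrow_pushout TYPE('u) TYPE('v)
       (B_arrow (T_cat, S_cat, G_fun)) (B_arrow (M_cat, D_cat, H_M))
       (B_arrow (N_cat, D_cat, H_N)) (B_arrow (P_cat, Q_cat, H_fun))
       (B_square (M_cat, D_cat, H_M) (T_incl, S_incl))
       (B_square (N_cat, D_cat, H_N) (T_incl, S_incl))
       (B_square (P_cat, Q_cat, H_fun) (M_to_P, D_to_Q1))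
       (B_square (P_cat, Q_cat, H_fun) (N_to_P, D_to_Q2)) \<and>
     B_space T_cat homeomorphic_space T2_space \<and>
     B_space M_cat homeomorphic_space prod_topology S1_space D2_space \<and>
     B_space N_cat homeomorphic_space prod_topology S1_space D2_space \<and>
     B_space P_cat homeomorphic_space S3_space \<and>
     B_space S_cat homeomorphic_space S1_space \<and>
     B_space D_cat homeomorphic_space D2_space \<and>
     B_space Q_cat homeomorphic_space S2_space \<and>
     S3_mod_U1 homeomorphic_space S2_space \<and>
     (\<forall>k. homeomorphic_map S3_mod_U1 S2_space k \<longrightarrow>
       (\<exists>\<phi> \<psi>. homeomorphic_map (B_space P_cat) S3_space \<phi> \<and>
              homeomorphic_map (B_space Q_cat) S2_space \<psi> \<and>
              (\<forall>c\<in>topspace (B_space P_cat).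
                 \<psi> (B_map Q_cat H_fun c) = hopf_map k (\<phi> c))))"
proof (intro conjI allI impI)
  show "is_cat_arrow_pushout TYPE(('w, 'x) category) TYPE(('y, 'z) category)
       (T_cat, S_cat, G_fun) (M_cat, D_cat, H_M) (N_cat, D_cat, H_N) (P_cat, Q_cat, H_fun)
       (T_incl, S_incl) (T_incl, S_incl) (M_to_P, D_to_Q1) (N_to_P, D_to_Q2)"
    by (rule H_pushout(4))
  show "is_top_arrow_pushout TYPE('u) TYPE('v)
       (B_arrow (T_cat, S_cat, G_fun)) (B_arrow (M_cat, D_cat, H_M))
       (B_arrow (N_cat, D_cat, H_N)) (B_arrow (P_cat, Q_cat, H_fun))
       (B_square (M_cat, D_cat, H_M) (T_incl, S_incl))
       (B_square (N_cat, D_cat, H_N) (T_incl, S_incl))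
       (B_square (P_cat, Q_cat, H_fun) (M_to_P, D_to_Q1))
       (B_square (P_cat, Q_cat, H_fun) (N_to_P, D_to_Q2))"
    by (rule B_arrow_pushout[OF P_sieve_square[folded M_cat_cylinder N_cat_cylinder] Q_sieve_square G_functor
          H_M_functor H_N_functor H_pushout(1) square_commutes H_pushout(2,3)])
  show "B_space T_cat homeomorphic_space T2_space" by (rule T_homeomorphic)
  show "B_space M_cat homeomorphic_space prod_topology S1_space D2_space"
    unfolding M_cat_cylinder by (rule homeomorphic_map_imp_homeomorphic_space[OF MC.solid_homeomorphic])
  show "B_space N_cat homeomorphic_space prod_topology S1_space D2_space"
    unfolding N_cat_cylinder by (rule homeomorphic_map_imp_homeomorphic_space[OF NC.solid_homeomorphic])
  show "B_space S_cat homeomorphic_space S1_space"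
    by (rule homeomorphic_map_imp_homeomorphic_space[OF circ_homeomorphic])
  show "B_space D_cat homeomorphic_space D2_space"
    by (rule homeomorphic_map_imp_homeomorphic_space[OF disk_homeomorphic])
  obtain \<phi> where \<phi>: "homeomorphic_map (B_space P_cat) S3_space \<phi>"
    "\<And>p. p \<in> topspace (B_space MC.C) \<Longrightarrow> \<phi> (B_map P_cat M_to_P p) = torus1 (MC.solid p)"
    "\<And>p. p \<in> topspace (B_space NC.C) \<Longrightarrow> \<phi> (B_map P_cat N_to_P p) = torus2 (NC.solid p)"
    using P_map by blast
  obtain \<psi> where \<psi>: "homeomorphic_map (B_space Q_cat) S2_space \<psi>"
    "\<And>q. q \<in> topspace (B_space D_cat) \<Longrightarrow> \<psi> (B_map Q_cat D_to_Q1 q) = hemi (-1) (disk q)"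
    "\<And>q. q \<in> topspace (B_space D_cat) \<Longrightarrow> \<psi> (B_map Q_cat D_to_Q2 q) = hemi 1 (disk q)"
    using Q_map by blast
  obtain h where h: "homeomorphic_map S3_mod_U1 S2_space h"
    "\<And>z. z \<in> topspace S3_space \<Longrightarrow> h (U1_rel `` {z}) = hopf_formula z"
    using orbit_space_homeomorphism by blast
  show "B_space P_cat homeomorphic_space S3_space" by (rule homeomorphic_map_imp_homeomorphic_space[OF \<phi>(1)])
  show "B_space Q_cat homeomorphic_space S2_space" by (rule homeomorphic_map_imp_homeomorphic_space[OF \<psi>(1)])
  show "S3_mod_U1 homeomorphic_space S2_space" by (rule homeomorphic_map_imp_homeomorphic_space[OF h(1)])
  fix k assume k: "homeomorphic_map S3_mod_U1 S2_space k"
  \<comment> \<open>With \<open>h\<close> the square commutes for \<open>hopf_formula\<close>. For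
    an arbitrary identification \<open>k\<close> only the coordinate on \<open>BQ\<close> has to
    change, by \<open>k\<close> after the inverse of \<open>h\<close>.\<close>
  obtain h' where h': "homeomorphic_maps S3_mod_U1 S2_space h h'"
    using h(1) homeomorphic_map_maps by blast
  then have "homeomorphic_map S2_space S3_mod_U1 h'"
    using homeomorphic_maps_map[of S3_mod_U1 S2_space h h'] by blast
  then have "homeomorphic_map (B_space Q_cat) S2_space (k \<circ> (h' \<circ> \<psi>))"
    using \<psi>(1) k by (intro homeomorphic_map_compose)
  moreover have "(k \<circ> (h' \<circ> \<psi>)) (B_map Q_cat H_fun c) = hopf_map k (\<phi> c)" if c: "c \<in> topspace (B_space P_cat)" for c
  proof -
    have z: "\<phi> c \<in> topspace S3_space"
      using \<phi>(1) c by (metis homeomorphic_imp_surjective_map image_eqI)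
    have "U1_rel `` {\<phi> c} \<in> topspace S3_mod_U1"
      using z by (auto simp: S3_mod_U1_def topspace_quotient_topology quotient_def)
    then have "h' (hopf_formula (\<phi> c)) = U1_rel `` {\<phi> c}"
      using h' h(2)[OF z] by (metis homeomorphic_maps_def)
    then show ?thesis using hopf_square[OF \<phi>(2,3) \<psi>(2,3) c] by (simp add: hopf_map_def)
  qed
  ultimately show "\<exists>\<phi> \<psi>. homeomorphic_map (B_space P_cat) S3_space \<phi> \<and> homeomorphic_map (B_space Q_cat) S2_space \<psi> \<and>
      (\<forall>c\<in>topspace (B_space P_cat). \<psi> (B_map Q_cat H_fun c) = hopf_map k (\<phi> c))"
    using \<phi>(1) by blast
qed

end
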